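(* Let $M_1$, $M_2$ and $N$ be $C^r_{\mathbb K}$-manifolds modelled on locally convex topological $\mathbb K$-vector spaces and let $f\colon M_1\to N$ and $g\colon M_2\to N$ be $C^r_{\mathbb K}$-maps. If $f$ (resp., $g$) is a $C^r_{\mathbb K}$-submersion, then the fibre product \[ S:=\{(x,y)\in M_1\times M_2\colon f(x)=g(y)\} \] is a (not necessarily pure) split $C^r_{\mathbb K}$-submanifold of $M_1\times M_2$, and the projection $\mathrm{pr}_2\colon M_1\times M_2\to M_2$ restricts to a $C^r_{\mathbb K}$-submersion $\mathrm{pr}_2|_S\colon S\to M_2$ (resp., $\mathrm{pr}_1\colon M_1\times M_2\to M_1$ restricts to a $C^r_{\mathbb K}$-submersion $\mathrm{pr}_1|_S\colon S\to M_1$).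
   Context: Conventions: $\mathbb K\in\{\mathbb R,\mathbb C\}$. If $\mathbb K=\mathbb R$, then $r\in\{1,2,\ldots\}\cup\{\infty,\omega\}$; if $\mathbb K=\mathbb C$, then $r=\omega$. All topological spaces and topological vector spaces are Hausdorff. For open subsets of locally convex spaces, $C^r_{\mathbb R}$ with $r\in\mathbb N\cup\{\infty\}$ means: continuous, with iterated directional derivatives $d^{k}f(x;y_1,\ldots,y_k)$ existing for all $k\le r$ and continuous in $(x,y_1,\ldots,y_k)$; $C^\omega_{\mathbb C}$ means complex analytic (continuous and locally given by a convergent series of continuous homogeneous polynomials); $C^\omega_{\mathbb R}$ means real analytic (locally extends to a complex analytic map between the complexifications). A $C^r_{\mathbb K}$-manifold modelled on a locally convex space $E$ is a Hausdorff space with a maximal atlas of charts $\phi\colon U_\phi\to V_\phi$ (homeomorphisms from open subsets of the manifold onto open subsets of $E$) with $C^r_{\mathbb K}$ transition maps; such a manifold is called pure. A not necessarily pure $C^r_{\mathbb K}$-manifold is a topological space with open connected components, each component $C$ being given a $C^r_{\mathbb K}$-manifold structure modelled on some locally convex space $F_C$. Submersions: let $M$, $N$ be modelled on $E$, $F$. A $C^r_{\mathbb K}$-map $f\colon M\to N$ is a $C^r_{\mathbb K}$-submersion if for each $x\in M$ there are charts $\phi\colon U_\phi\to V_\phi\subseteq E$ of $M$ with $x\in U_\phi$ and $\psi\colon U_\psi\to V_\psi\subseteq F$ of $N$ with $f(x)\in U_\psi$ such that $f(U_\phi)\subseteq U_\psi$ and $\psi\circ f\circ\phi^{-1}=\pi|_{V_\phi}$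 for a continuous linear map $\pi\colon E\to F$ having a continuous linear right inverse. If the manifolds are not necessarily pure, the same local definition is used, with the modelling spaces of the components in question. Submanifolds: let $M$ be a $C^r_{\mathbb K}$-manifold modelled on $E$ and $F\subseteq E$ a closed vector subspace. A subset $N\subseteq M$ is a $C^r_{\mathbb K}$-submanifold modelled on $F$ if each $x\in N$ is in the domain of a chart $\phi\colon U_\phi\to V_\phi\subseteq E$ of $M$ with $\phi(U_\phi\cap N)=V_\phi\cap F$; then $N$ is a $C^r_{\mathbb K}$-manifold with the restricted charts. It is split if $F$ is complemented in $E$ as a topological vector space (i.e. there is a vector subspace $C\subseteq E$ such that addition $F\times C\to E$ is an isomorphism of topological vector spaces). A subset $N\subseteq M$ is a not necessarily pure (split) $C^r_{\mathbb K}$-submanifold if all connected components $C$ of $N$ are open in $N$ and each is a (split) $C^r_{\mathbb K}$-submanifold of $M$ modelled on some closed vector subspace $F_C\subseteq E$. *)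

theory Defs
  imports "HOL-Analysis.Analysis"
begin

section \<open>The ground field\<close>

text \<open>Up to isomorphism of normed fields, the only instances are \<open>real\<close> and \<open>complex\<close>. The ground field
  is real exactly if \<open>\<real> = UNIV\<close>.\<close>

class real_or_complex_field = real_normed_field +
  assumes real_or_complex:
    "(\<forall>z. \<exists>a. z = a *\<^sub>R 1) \<or>
     (\<exists>i. i * i = - 1 \<and> (\<forall>z. \<exists>a b. z = a *\<^sub>R 1 + b *\<^sub>R i))"

instance real :: real_or_complex_field
  by standard simp

instance complex :: real_or_complex_field
proof
  have "\<i> * \<i> = - 1 \<and> (\<forall>z. \<exists>a b. z = a *\<^sub>R 1 + b *\<^sub>R \<i>)"
    by (auto simp: complex_eq_iff)
  then show "(\<forall>z::complex. \<exists>a. z = a *\<^sub>R 1) \<or>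
      (\<exists>i::complex. i * i = - 1 \<and> (\<forall>z. \<exists>a b. z = a *\<^sub>R 1 + b *\<^sub>R i))"
    by blast
qed


section \<open>Locally convex spaces\<close>

text \<open>The underlying vector space is the linear subspace \<open>topspace (top_of E)\<close> of an ambient vector
  space, so that a vector subspace with its induced topology is again of the same type.\<close>

record ('k, 'e) tvs =
  top_of :: "'e topology"
  scale_of :: "'k \<Rightarrow> 'e \<Rightarrow> 'e"

abbreviation carrier_of :: "('k, 'e, 'z) tvs_scheme \<Rightarrow> 'e set"
  where "carrier_of E \<equiv> topspace (top_of E)"

definition locally_convex_space :: "('k::real_normed_field, 'e::ab_group_add) tvs \<Rightarrow> bool"
  where "locally_convex_space E \<longleftrightarrow>
    vector_space (scale_of E) \<and>
    module.subspace (scale_of E) (carrier_of E) \<and>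
    Hausdorff_space (top_of E) \<and>
    continuous_map (prod_topology (top_of E) (top_of E)) (top_of E) (\<lambda>(x, y). x + y) \<and>
    continuous_map (prod_topology euclidean (top_of E)) (top_of E) (\<lambda>(c, x). scale_of E c x) \<and>
    (\<forall>U. openin (top_of E) U \<and> 0 \<in> U \<longrightarrow>
      (\<exists>C. openin (top_of E) C \<and> 0 \<in> C \<and> C \<subseteq> U \<and>
        (\<forall>x\<in>C. \<forall>y\<in>C. \<forall>t. 0 \<le> t \<and> t \<le> 1 \<longrightarrow>
          scale_of E (of_real (1 - t)) x + scale_of E (of_real t) y \<in> C)))"

definition sub_tvs :: "('k, 'e) tvs \<Rightarrow> 'e set \<Rightarrow> ('k, 'e) tvs"
  where "sub_tvs E F = \<lparr>top_of = subtopology (top_of E) F, scale_of = scale_of E\<rparr>"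

definition prod_tvs :: "('k, 'e) tvs \<Rightarrow> ('k, 'f) tvs \<Rightarrow> ('k, 'e \<times> 'f) tvs"
  where "prod_tvs E F =
    \<lparr>top_of = prod_topology (top_of E) (top_of F),
     scale_of = (\<lambda>c (x, y). (scale_of E c x, scale_of F c y))\<rparr>"

text \<open>The complexification of a real space; \<open>(x, y)\<close> stands for \<open>x + \<i> y\<close>.\<close>

definition complexification :: "('k::real_normed_field, 'e::ab_group_add) tvs \<Rightarrow> (complex, 'e \<times> 'e) tvs"
  where "complexification E =
    \<lparr>top_of = prod_topology (top_of E) (top_of E),
     scale_of = (\<lambda>z (x, y).
       (scale_of E (of_real (Re z)) x - scale_of E (of_real (Im z)) y,
        scale_of E (of_real (Im z)) x + scale_of E (of_real (Re z)) y))\<rparr>"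

definition continuous_linear ::
    "('k, 'e::ab_group_add) tvs \<Rightarrow> ('k, 'f::ab_group_add) tvs \<Rightarrow> ('e \<Rightarrow> 'f) \<Rightarrow> bool"
  where "continuous_linear E F h \<longleftrightarrow>
    continuous_map (top_of E) (top_of F) h \<and>
    (\<forall>x\<in>carrier_of E. \<forall>y\<in>carrier_of E. h (x + y) = h x + h y) \<and>
    (\<forall>c. \<forall>x\<in>carrier_of E. h (scale_of E c x) = scale_of F c (h x))"

definition closed_vector_subspace ::
    "('k::field, 'e::ab_group_add) tvs \<Rightarrow> 'e set \<Rightarrow> bool"
  where "closed_vector_subspace E F \<longleftrightarrow>
    module.subspace (scale_of E) F \<and> closedin (top_of E) F"

definition complemented :: "('k::field, 'e::ab_group_add) tvs \<Rightarrow> 'e set \<Rightarrow> bool"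
  where "complemented E F \<longleftrightarrow>
    (\<exists>C. module.subspace (scale_of E) C \<and> C \<subseteq> carrier_of E \<and>
      homeomorphic_map
        (prod_topology (subtopology (top_of E) F) (subtopology (top_of E) C))
        (top_of E) (\<lambda>(x, y). x + y))"


section \<open>Differentiable and analytic maps\<close>

datatype smoothness = Order nat | Smooth | Analytic

definition admissible_smoothness :: "'k::real_or_complex_field itself \<Rightarrow> smoothness \<Rightarrow> bool"
  where "admissible_smoothness K r \<longleftrightarrow>
    r \<noteq> Order 0 \<and> ((\<real> :: 'k set) \<noteq> UNIV \<longrightarrow> r = Analytic)"

definition has_directional_derivative ::
    "('k::real_normed_field, 'e::ab_group_add) tvs \<Rightarrow> ('k, 'f::ab_group_add) tvs \<Rightarrow>
      ('e \<Rightarrow> 'f) \<Rightarrow> 'e \<Rightarrow> 'e \<Rightarrow> 'f \<Rightarrow> bool"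
  where "has_directional_derivative E F f x v l \<longleftrightarrow>
    limitin (top_of F) (\<lambda>t. scale_of F (inverse t) (f (x + scale_of E t v) - f x)) l (at 0)"

text \<open>The iterated derivative written \<open>d\<^sup>k f (x; y\<^sub>1, \<dots>, y\<^sub>k)\<close>, with the directions numbered from \<open>0\<close>;
  only \<open>y 0, \<dots>, y (k - 1)\<close> matter.\<close>

primrec iterated_derivative ::
    "('k::real_normed_field, 'e::ab_group_add) tvs \<Rightarrow> ('k, 'f::ab_group_add) tvs \<Rightarrow>
      ('e \<Rightarrow> 'f) \<Rightarrow> nat \<Rightarrow> 'e \<Rightarrow> (nat \<Rightarrow> 'e) \<Rightarrow> 'f"
  where
    "iterated_derivative E F f 0 x y = f x"
  | "iterated_derivative E F f (Suc k) x y =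
      (THE l. has_directional_derivative E F (\<lambda>u. iterated_derivative E F f k u y) x (y k) l)"

definition Ck_on ::
    "nat \<Rightarrow> ('k::real_normed_field, 'e::ab_group_add) tvs \<Rightarrow> ('k, 'f::ab_group_add) tvs \<Rightarrow>
      'e set \<Rightarrow> ('e \<Rightarrow> 'f) \<Rightarrow> bool"
  where "Ck_on k E F U f \<longleftrightarrow>
    (\<forall>j<k. \<forall>x\<in>U. \<forall>y\<in>Pi\<^sub>E {..<Suc j} (\<lambda>_. carrier_of E).
      \<exists>l. has_directional_derivative E F (\<lambda>u. iterated_derivative E F f j u y) x (y j) l) \<and>
    (\<forall>j\<le>k. continuous_map
      (prod_topology (subtopology (top_of E) U) (product_topology (\<lambda>_. top_of E) {..<j}))
      (top_of F) (\<lambda>(x, y). iterated_derivative E F f j x y))"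

definition multilinear ::
    "nat \<Rightarrow> ('k, 'e::ab_group_add) tvs \<Rightarrow> ('k, 'f::ab_group_add) tvs \<Rightarrow> ((nat \<Rightarrow> 'e) \<Rightarrow> 'f) \<Rightarrow> bool"
  where "multilinear n E F \<beta> \<longleftrightarrow>
    (\<forall>y\<in>Pi\<^sub>E {..<n} (\<lambda>_. carrier_of E). \<forall>i<n.
      (\<forall>u\<in>carrier_of E. \<forall>v\<in>carrier_of E. \<beta> (y(i := u + v)) = \<beta> (y(i := u)) + \<beta> (y(i := v))) \<and>
      (\<forall>c. \<forall>u\<in>carrier_of E. \<beta> (y(i := scale_of E c u)) = scale_of F c (\<beta> (y(i := u)))))"

definition continuous_homogeneous_polynomial ::
    "nat \<Rightarrow> ('k, 'e::ab_group_add) tvs \<Rightarrow> ('k, 'f::ab_group_add) tvs \<Rightarrow> ('e \<Rightarrow> 'f) \<Rightarrow> bool"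
  where "continuous_homogeneous_polynomial n E F p \<longleftrightarrow>
    (\<exists>\<beta>. multilinear n E F \<beta> \<and>
      continuous_map (product_topology (\<lambda>_. top_of E) {..<n}) (top_of F) \<beta> \<and>
      (\<forall>x\<in>carrier_of E. p x = \<beta> (\<lambda>i\<in>{..<n}. x)))"

text \<open>The following notion is used over fields isomorphic to \<open>complex\<close> only; convergence of the series
  is pointwise.\<close>

definition complex_analytic_on ::
    "('k, 'e::ab_group_add) tvs \<Rightarrow> ('k, 'f::ab_group_add) tvs \<Rightarrow> 'e set \<Rightarrow> ('e \<Rightarrow> 'f) \<Rightarrow> bool"
  where "complex_analytic_on E F U f \<longleftrightarrow>
    continuous_map (subtopology (top_of E) U) (top_of F) f \<and>
    (\<forall>x\<in>U. \<exists>W p. openin (top_of E) W \<and> 0 \<in> W \<and>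
      (\<forall>n. continuous_homogeneous_polynomial n E F (p n)) \<and>
      (\<forall>w\<in>W. x + w \<in> U \<and>
        limitin (top_of F) (\<lambda>m. \<Sum>n<m. p n w) (f (x + w)) sequentially))"

definition real_analytic_on ::
    "('k::real_normed_field, 'e::ab_group_add) tvs \<Rightarrow> ('k, 'f::ab_group_add) tvs \<Rightarrow>
      'e set \<Rightarrow> ('e \<Rightarrow> 'f) \<Rightarrow> bool"
  where "real_analytic_on E F U f \<longleftrightarrow>
    (\<forall>x\<in>U. \<exists>W g. openin (top_of (complexification E)) W \<and> (x, 0) \<in> W \<and>
      complex_analytic_on (complexification E) (complexification F) W g \<and>
      (\<forall>u\<in>U. (u, 0) \<in> W \<longrightarrow> g (u, 0) = (f u, 0)))"

definition Cr_on ::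
    "smoothness \<Rightarrow> ('k::real_or_complex_field, 'e::ab_group_add) tvs \<Rightarrow> ('k, 'f::ab_group_add) tvs \<Rightarrow>
      'e set \<Rightarrow> ('e \<Rightarrow> 'f) \<Rightarrow> bool"
  where "Cr_on r E F U f \<longleftrightarrow>
    openin (top_of E) U \<and> f ` U \<subseteq> carrier_of F \<and>
    (case r of
      Order k \<Rightarrow> Ck_on k E F U f
    | Smooth \<Rightarrow> (\<forall>k. Ck_on k E F U f)
    | Analytic \<Rightarrow>
        if (\<real> :: 'k set) = UNIV then real_analytic_on E F U f else complex_analytic_on E F U f)"


section \<open>Manifolds\<close>

text \<open>A chart \<open>(U, \<phi>)\<close> has domain \<open>U\<close>; the values of \<open>\<phi>\<close> outside \<open>U\<close> are irrelevant.\<close>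

type_synonym ('a, 'e) chart = "'a set \<times> ('a \<Rightarrow> 'e)"

record ('a, 'k, 'e) mfd =
  space_of :: "'a topology"
  model_of :: "('k, 'e) tvs"
  charts_of :: "('a, 'e) chart set"

definition is_chart :: "'a topology \<Rightarrow> ('k, 'e) tvs \<Rightarrow> ('a, 'e) chart \<Rightarrow> bool"
  where "is_chart X E = (\<lambda>(U, \<phi>).
    openin X U \<and> openin (top_of E) (\<phi> ` U) \<and>
    homeomorphic_map (subtopology X U) (subtopology (top_of E) (\<phi> ` U)) \<phi>)"

definition compatible ::
    "smoothness \<Rightarrow> ('k::real_or_complex_field, 'e::ab_group_add) tvs \<Rightarrow>
      ('a, 'e) chart \<Rightarrow> ('a, 'e) chart \<Rightarrow> bool"
  where "compatible r E = (\<lambda>(U, \<phi>) (V, \<psi>).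
    Cr_on r E E (\<phi> ` (U \<inter> V)) (\<psi> \<circ> inv_into U \<phi>) \<and>
    Cr_on r E E (\<psi> ` (U \<inter> V)) (\<phi> \<circ> inv_into V \<psi>))"

definition Cr_manifold ::
    "smoothness \<Rightarrow> ('a, 'k::real_or_complex_field, 'e::ab_group_add) mfd \<Rightarrow> bool"
  where "Cr_manifold r M \<longleftrightarrow>
    locally_convex_space (model_of M) \<and>
    Hausdorff_space (space_of M) \<and>
    (\<forall>c\<in>charts_of M. is_chart (space_of M) (model_of M) c) \<and>
    (\<Union>c\<in>charts_of M. fst c) = topspace (space_of M) \<and>
    (\<forall>c\<in>charts_of M. \<forall>d\<in>charts_of M. compatible r (model_of M) c d) \<and>
    (\<forall>c. is_chart (space_of M) (model_of M) c \<and>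
      (\<forall>d\<in>charts_of M. compatible r (model_of M) c d) \<longrightarrow> c \<in> charts_of M)"

text \<open>The maximal atlas containing a given atlas.\<close>

definition maximal_atlas ::
    "smoothness \<Rightarrow> 'a topology \<Rightarrow> ('k::real_or_complex_field, 'e::ab_group_add) tvs \<Rightarrow>
      ('a, 'e) chart set \<Rightarrow> ('a, 'e) chart set"
  where "maximal_atlas r X E A = {c. is_chart X E c \<and> (\<forall>d\<in>A. compatible r E c d)}"

definition prod_mfd ::
    "smoothness \<Rightarrow> ('a, 'k::real_or_complex_field, 'e::ab_group_add) mfd \<Rightarrow>
      ('b, 'k, 'f::ab_group_add) mfd \<Rightarrow> ('a \<times> 'b, 'k, 'e \<times> 'f) mfd"
  where "prod_mfd r M N =
    (let X = prod_topology (space_of M) (space_of N); E = prod_tvs (model_of M) (model_of N) in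
     \<lparr>space_of = X, model_of = E,
      charts_of = maximal_atlas r X E
        {(U \<times> V, map_prod \<phi> \<psi>) | U \<phi> V \<psi>. (U, \<phi>) \<in> charts_of M \<and> (V, \<psi>) \<in> charts_of N}\<rparr>)"

definition Cr_map ::
    "smoothness \<Rightarrow> ('a, 'k::real_or_complex_field, 'e::ab_group_add) mfd \<Rightarrow>
      ('b, 'k, 'f::ab_group_add) mfd \<Rightarrow> ('a \<Rightarrow> 'b) \<Rightarrow> bool"
  where "Cr_map r M N f \<longleftrightarrow>
    continuous_map (space_of M) (space_of N) f \<and>
    (\<forall>(U, \<phi>)\<in>charts_of M. \<forall>(V, \<psi>)\<in>charts_of N.
      Cr_on r (model_of M) (model_of N) (\<phi> ` (U \<inter> f -` V)) (\<psi> \<circ> f \<circ> inv_into U \<phi>))"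

definition Cr_submersion ::
    "smoothness \<Rightarrow> ('a, 'k::real_or_complex_field, 'e::ab_group_add) mfd \<Rightarrow>
      ('b, 'k, 'f::ab_group_add) mfd \<Rightarrow> ('a \<Rightarrow> 'b) \<Rightarrow> bool"
  where "Cr_submersion r M N f \<longleftrightarrow>
    Cr_map r M N f \<and>
    (\<forall>x\<in>topspace (space_of M).
      \<exists>(U, \<phi>)\<in>charts_of M. \<exists>(V, \<psi>)\<in>charts_of N. \<exists>\<pi> \<sigma>.
        x \<in> U \<and> f x \<in> V \<and> f ` U \<subseteq> V \<and>
        continuous_linear (model_of M) (model_of N) \<pi> \<and>
        continuous_linear (model_of N) (model_of M) \<sigma> \<and>
        (\<forall>y\<in>carrier_of (model_of N). \<pi> (\<sigma> y) = y) \<and>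
        (\<forall>v\<in>\<phi> ` U. (\<psi> \<circ> f \<circ> inv_into U \<phi>) v = \<pi> v))"


section \<open>Submanifolds\<close>

definition is_submanifold ::
    "('a, 'k::field, 'e::ab_group_add) mfd \<Rightarrow> 'a set \<Rightarrow> 'e set \<Rightarrow> bool"
  where "is_submanifold M S F \<longleftrightarrow>
    closed_vector_subspace (model_of M) F \<and> S \<subseteq> topspace (space_of M) \<and>
    (\<forall>x\<in>S. \<exists>(U, \<phi>)\<in>charts_of M. x \<in> U \<and> \<phi> ` (U \<inter> S) = \<phi> ` U \<inter> F)"

definition is_split_submanifold ::
    "('a, 'k::field, 'e::ab_group_add) mfd \<Rightarrow> 'a set \<Rightarrow> 'e set \<Rightarrow> bool"
  where "is_split_submanifold M S F \<longleftrightarrow> is_submanifold M S F \<and> complemented (model_of M) F"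

text \<open>The manifold structure on a submanifold, given by the restricted charts.\<close>

definition sub_mfd ::
    "smoothness \<Rightarrow> ('a, 'k::real_or_complex_field, 'e::ab_group_add) mfd \<Rightarrow> 'a set \<Rightarrow> 'e set \<Rightarrow>
      ('a, 'k, 'e) mfd"
  where "sub_mfd r M S F =
    (let X = subtopology (space_of M) S; E = sub_tvs (model_of M) F in
     \<lparr>space_of = X, model_of = E,
      charts_of = maximal_atlas r X E
        {(U \<inter> S, \<phi>) | U \<phi>. (U, \<phi>) \<in> charts_of M \<and> \<phi> ` (U \<inter> S) = \<phi> ` U \<inter> F}\<rparr>)"

text \<open>A not necessarily pure manifold is a topological space \<open>X\<close> together with a manifold structure
  \<open>P C\<close> on each connected component \<open>C\<close>. All its modelling spaces are carried by the same type \<open>'e\<close>,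
  which suffices for submanifolds. A not necessarily pure submanifold \<open>S\<close> comes with a family of
  modelling subspaces \<open>F C\<close>.\<close>

definition nonpure_Cr_manifold ::
    "smoothness \<Rightarrow> 'a topology \<Rightarrow> ('a set \<Rightarrow> ('a, 'k::real_or_complex_field, 'e::ab_group_add) mfd) \<Rightarrow>
      bool"
  where "nonpure_Cr_manifold r X P \<longleftrightarrow>
    (\<forall>C\<in>connected_components_of X.
      openin X C \<and> space_of (P C) = subtopology X C \<and> Cr_manifold r (P C))"

definition nonpure_Cr_submersion ::
    "smoothness \<Rightarrow> 'a topology \<Rightarrow> ('a set \<Rightarrow> ('a, 'k::real_or_complex_field, 'e::ab_group_add) mfd) \<Rightarrow>
      ('b, 'k, 'f::ab_group_add) mfd \<Rightarrow> ('a \<Rightarrow> 'b) \<Rightarrow> bool"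
  where "nonpure_Cr_submersion r X P N f \<longleftrightarrow>
    nonpure_Cr_manifold r X P \<and>
    (\<forall>C\<in>connected_components_of X. Cr_submersion r (P C) N f)"

definition is_nonpure_split_submanifold ::
    "('a, 'k::field, 'e::ab_group_add) mfd \<Rightarrow> 'a set \<Rightarrow> ('a set \<Rightarrow> 'e set) \<Rightarrow> bool"
  where "is_nonpure_split_submanifold M S F \<longleftrightarrow>
    S \<subseteq> topspace (space_of M) \<and>
    (\<forall>C\<in>connected_components_of (subtopology (space_of M) S).
      openin (subtopology (space_of M) S) C \<and> is_split_submanifold M C (F C))"

definition fibre_product ::
    "('a, 'k, 'e) mfd \<Rightarrow> ('b, 'k, 'f) mfd \<Rightarrow> ('a \<Rightarrow> 'c) \<Rightarrow> ('b \<Rightarrow> 'c) \<Rightarrow> ('a \<times> 'b) set"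
  where "fibre_product M\<^sub>1 M\<^sub>2 f g =
    {(x, y). x \<in> topspace (space_of M\<^sub>1) \<and> y \<in> topspace (space_of M\<^sub>2) \<and> f x = g y}"

end

theory Submission
  imports Defs "HOL-Complex_Analysis.Complex_Analysis"
begin

text \<open>
  Near a point of \<open>S\<close> choose charts in which \<open>f\<close> is a linear map \<open>\<pi>\<close> with a right inverse \<open>\<sigma>\<close>. There \<open>S\<close>
  is given by \<open>\<pi> u = k w\<close>, where \<open>k\<close> is \<open>g\<close> read in charts, and the shear \<open>(u, w) \<mapsto> (u - \<sigma> (k w), w)\<close>
  flattens \<open>S\<close> to the kernel of \<open>(u, w) \<mapsto> \<pi> u\<close>, on which the second projection is linear and split.

  The model space depends on the point. If two charts around a point of \<open>S\<close> flatten \<open>S\<close> to \<open>F\<close> and \<open>F'\<close>,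
  then the tangent map of the transition map is an automorphism of the ambient space taking \<open>F\<close> onto
  \<open>F'\<close>, and composing with it turns every chart flattening \<open>S\<close> to \<open>F\<close> into one flattening it to \<open>F'\<close>.
  Hence the points with a chart of model \<open>F\<close> form an open and closed subset of \<open>S\<close>, and each connected
  component, being open by local convexity, has a single model.

  The calculus this needs (chain rule, tangent maps) is proved for \<open>C\<^sup>k\<close> by means of continuous
  seminorms and Hahn--Banach. The analytic classes are reduced to it: by Cauchy estimates a map is complex
  analytic exactly if it is \<open>C\<^sup>k\<close> over the complex numbers for all \<open>k\<close>, and real analytic maps are the
  restrictions of such maps to the real part of the complexification.
\<close>

section \<open>Locally convex spaces and their seminorms\<close>

text \<open>General locally convex spaces admit no inverse function theorem. The argument goes
  through because a submersion comes, by definition, with charts in which it is linear, and because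
  the shear leaves \<open>w\<close> fixed and is therefore inverted by
  \<open>(u, w) \<mapsto> (u + \<sigma> (k w), w)\<close>. A component must be modelled on one fixed
  subspace of the ambient model space; isomorphic kernels at different points do not suffice. This
  is why the tangent map of a transition map is wanted as an automorphism of the whole space. The
  submersion property is claimed for every family of models that makes \<open>S\<close> a split
  submanifold, not just for the kernels found, so it has to be carried along the same automorphisms.
  On the analytic side, power series converge pointwise and the target spaces may be incomplete, so
  vector-valued Cauchy integrals may fail to exist. Functionals dominated by one continuous seminorm
  reduce the estimates to holomorphic functions of one variable, with bounds that do not depend on
  the functional.\<close>

lemma prod_nbhd:
  assumes "openin (prod_topology X Y) W" "(a, b) \<in> W"
  obtains U V where "openin X U" "openin Y V" "a \<in> U" "b \<in> V" "U \<times> V \<subseteq> W"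
proof -
  have "\<exists>U V. openin X U \<and> openin Y V \<and> a \<in> U \<and> b \<in> V \<and> U \<times> V \<subseteq> W"
    using assms unfolding openin_prod_topology_alt by simp
  then show ?thesis
    using that by auto
qed

lemma continuous_map_in: "continuous_map X Y f \<Longrightarrow> x \<in> topspace X \<Longrightarrow> f x \<in> topspace Y"
  using continuous_map_image_subset_topspace by blast

lemma continuous_map_local:
  assumes "\<And>z. z \<in> topspace X \<Longrightarrow> \<exists>W. openin X W \<and> z \<in> W \<and> continuous_map (subtopology X W) Y f"
  shows "continuous_map X Y f"
  unfolding continuous_map
proof (intro conjI allI impI)
  show "f ` topspace X \<subseteq> topspace Y"
  proof
    fix y assume "y \<in> f ` topspace X"
    then obtain z where z: "z \<in> topspace X" "y = f z" by blast
    obtain W where "z \<in> W" "continuous_map (subtopology X W) Y f"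
      using assms[OF z(1)] by blast
    then show "y \<in> topspace Y"
      using continuous_map_in[of "subtopology X W" Y f z] z by simp
  qed
  fix V assume V: "openin Y V"
  show "openin X {x \<in> topspace X. f x \<in> V}"
  proof (subst openin_subopen, intro ballI)
    fix z assume z: "z \<in> {x \<in> topspace X. f x \<in> V}"
    then obtain W where W: "openin X W" "z \<in> W" "continuous_map (subtopology X W) Y f"
      using assms by blast
    have "openin (subtopology X W) {x \<in> topspace (subtopology X W). f x \<in> V}"
      using openin_continuous_map_preimage[OF W(3) V] .
    then have "openin X {x \<in> topspace (subtopology X W). f x \<in> V}"
      by (simp add: openin_open_subtopology[OF W(1)])
    then show "\<exists>T. openin X T \<and> z \<in> T \<and> T \<subseteq> {x \<in> topspace X. f x \<in> V}"
      using z W by (intro exI[of _ "{x \<in> topspace (subtopology X W). f x \<in> V}"]) auto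
  qed
qed

lemma subtopology_prod_left:
  "subtopology (prod_topology X Y) (A \<times> topspace Y) = prod_topology (subtopology X A) Y"
  by (simp only: subtopology_Times subtopology_topspace)

lemma continuous_map_fst_comp:
  "continuous_map X (prod_topology Y Z) f \<Longrightarrow> continuous_map X Y (\<lambda>x. fst (f x))"
  using continuous_map_compose[OF _ continuous_map_fst, unfolded o_def] .

lemma continuous_map_snd_comp:
  "continuous_map X (prod_topology Y Z) f \<Longrightarrow> continuous_map X Z (\<lambda>x. snd (f x))"
  using continuous_map_compose[OF _ continuous_map_snd, unfolded o_def] .

lemmas continuous_map_projections = continuous_map_fst continuous_map_snd
  continuous_map_fst_comp[OF continuous_map_fst] continuous_map_fst_comp[OF continuous_map_snd]
  continuous_map_snd_comp[OF continuous_map_fst] continuous_map_snd_comp[OF continuous_map_snd]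

lemma limitin_compose:
  assumes f: "continuous_map X Y f" and g: "limitin X g a F"
  shows "limitin Y (\<lambda>x. f (g x)) (f a) F"
  using continuous_map_limit[OF f g] by (simp add: o_def)

locale lcs =
  fixes E :: "('k::real_normed_field, 'e::ab_group_add) tvs"
  assumes lcs: "locally_convex_space E"
begin

sublocale vector_space "scale_of E"
  using lcs unfolding locally_convex_space_def by blast

lemma subspace_carrier: "subspace (carrier_of E)"
  using lcs unfolding locally_convex_space_def by blast

lemmas zero_in [simp] = subspace_0[OF subspace_carrier]
  and add_in [simp] = subspace_add[OF subspace_carrier]
  and diff_in [simp] = subspace_diff[OF subspace_carrier]
  and neg_in [simp] = subspace_neg[OF subspace_carrier]
  and scale_in [simp] = subspace_scale[OF subspace_carrier]
  and sum_in = subspace_sum[OF subspace_carrier]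

lemma hausdorff: "Hausdorff_space (top_of E)"
  using lcs unfolding locally_convex_space_def by blast

lemma convex_nbhd:
  assumes "openin (top_of E) U" "0 \<in> U"
  obtains C where "openin (top_of E) C" "0 \<in> C" "C \<subseteq> U"
    "\<forall>x\<in>C. \<forall>y\<in>C. \<forall>t. 0 \<le> t \<and> t \<le> 1 \<longrightarrow>
        scale_of E (of_real (1 - t)) x + scale_of E (of_real t) y \<in> C"
proof -
  have "\<exists>C. openin (top_of E) C \<and> 0 \<in> C \<and> C \<subseteq> U \<and>
      (\<forall>x\<in>C. \<forall>y\<in>C. \<forall>t. 0 \<le> t \<and> t \<le> 1 \<longrightarrow>
        scale_of E (of_real (1 - t)) x + scale_of E (of_real t) y \<in> C)"
    using lcs assms unfolding locally_convex_space_def by simp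
  then show ?thesis
    using that by auto
qed

lemma continuous_add:
  assumes "continuous_map X (top_of E) f" "continuous_map X (top_of E) g"
  shows "continuous_map X (top_of E) (\<lambda>x. f x + g x)"
proof -
  have "continuous_map (prod_topology (top_of E) (top_of E)) (top_of E) (\<lambda>(x, y). x + y)"
    using lcs unfolding locally_convex_space_def by blast
  from continuous_map_compose[OF continuous_map_pairedI[OF assms] this] show ?thesis
    by (simp add: o_def)
qed

lemma continuous_scale:
  assumes "continuous_map X euclidean c" "continuous_map X (top_of E) f"
  shows "continuous_map X (top_of E) (\<lambda>x. scale_of E (c x) (f x))"
proof -
  have "continuous_map (prod_topology euclidean (top_of E)) (top_of E) (\<lambda>(c, x). scale_of E c x)"
    using lcs unfolding locally_convex_space_def by blast
  from continuous_map_compose[OF continuous_map_pairedI[OF assms] this] show ?thesis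
    by (simp add: o_def)
qed

lemma continuous_scale_const:
  assumes "continuous_map X (top_of E) f"
  shows "continuous_map X (top_of E) (\<lambda>x. scale_of E c (f x))"
  by (rule continuous_scale) (use assms in auto)

lemma continuous_neg:
  assumes "continuous_map X (top_of E) f"
  shows "continuous_map X (top_of E) (\<lambda>x. - f x)"
  using continuous_scale_const[OF assms, of "-1"] by simp

lemma continuous_diff:
  assumes "continuous_map X (top_of E) f" "continuous_map X (top_of E) g"
  shows "continuous_map X (top_of E) (\<lambda>x. f x - g x)"
  using continuous_add[OF assms(1) continuous_neg[OF assms(2)]] by simp

lemma continuous_sum:
  assumes "\<And>i. i \<in> I \<Longrightarrow> continuous_map X (top_of E) (f i)"
  shows "continuous_map X (top_of E) (\<lambda>x. \<Sum>i\<in>I. f i x)"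
proof (cases "finite I")
  case True
  then show ?thesis using assms
    by (induction I) (auto intro!: continuous_add)
qed auto

lemma scale_nbhd_zero:
  assumes "openin (top_of E) C" "0 \<in> C"
  obtains \<delta> V where "\<delta> > 0" "openin (top_of E) V" "0 \<in> V"
    "\<forall>c. \<forall>x\<in>V. norm c < \<delta> \<longrightarrow> scale_of E c x \<in> C"
proof -
  let ?P = "prod_topology euclidean (top_of E)"
  have cont: "continuous_map ?P (top_of E) (\<lambda>z. scale_of E (fst z) (snd z))"
    by (rule continuous_scale) (auto simp: continuous_map_fst continuous_map_snd)
  let ?W = "{z \<in> topspace ?P. scale_of E (fst z) (snd z) \<in> C}"
  have "openin ?P ?W"
    using openin_continuous_map_preimage[OF cont assms(1)] .
  moreover have "(0, 0) \<in> ?W"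
    using assms by (auto simp: topspace_prod_topology)
  ultimately obtain A V where AV: "openin euclidean A" "openin (top_of E) V" "0 \<in> A" "0 \<in> V" "A \<times> V \<subseteq> ?W"
    by (rule prod_nbhd)
  then obtain \<delta> where \<delta>: "\<delta> > 0" "ball 0 \<delta> \<subseteq> A"
    unfolding open_openin[symmetric] open_contains_ball by auto
  have "\<forall>c. \<forall>x\<in>V. norm c < \<delta> \<longrightarrow> scale_of E c x \<in> C"
    using AV(5) \<delta>(2) by (auto simp: subset_iff)
  with \<delta>(1) AV(2,4) show ?thesis
    by (rule that)
qed

end

section \<open>Continuous seminorms and Minkowski gauges\<close>

definition seminorm_on :: "('k::real_normed_field, 'e::ab_group_add) tvs \<Rightarrow> ('e \<Rightarrow> real) \<Rightarrow> bool"
  where "seminorm_on E q \<longleftrightarrow>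
    continuous_map (top_of E) euclideanreal q \<and>
    (\<forall>x\<in>carrier_of E. \<forall>y\<in>carrier_of E. q (x + y) \<le> q x + q y) \<and>
    (\<forall>c. \<forall>x\<in>carrier_of E. q (scale_of E c x) = norm c * q x)"

context lcs
begin

text \<open>The seminorm is the Minkowski gauge of \<open>D\<close>. Convexity yields the triangle
  inequality, balancedness the homogeneity for arbitrary scalars, and the neighbourhood
  \<open>V\<close> inside \<open>D\<close> both finiteness and continuity.\<close>

lemma gauge_of_balanced_convex:
  assumes D: "\<And>x. x \<in> D \<Longrightarrow> x \<in> carrier_of E"
    and bal: "\<And>c x. norm c \<le> 1 \<Longrightarrow> x \<in> D \<Longrightarrow> scale_of E c x \<in> D"
    and conv: "\<And>x y t. x \<in> D \<Longrightarrow> y \<in> D \<Longrightarrow> 0 \<le> t \<Longrightarrow> t \<le> 1 \<Longrightarrow>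
        scale_of E (of_real (1 - t)) x + scale_of E (of_real t) y \<in> D"
    and nbhd: "openin (top_of E) V" "0 \<in> V" "V \<subseteq> D"
  shows "\<exists>q. seminorm_on E q \<and> (\<forall>x\<in>carrier_of E. q x < 1 \<longrightarrow> x \<in> D)"
proof -
  define S where "S x = {r::real. r > 0 \<and> scale_of E (of_real (inverse r)) x \<in> D}" for x
  define q where "q x = Inf (S x)" for x
  have ne: "S x \<noteq> {}" if x: "x \<in> carrier_of E" for x
  proof -
    have "continuous_map euclideanreal (top_of E) (\<lambda>c. scale_of E (of_real c) x)"
      by (rule continuous_scale) (use x in \<open>auto intro: continuous_intros\<close>)
    from openin_continuous_map_preimage[OF this nbhd(1)]
    have "open {c. scale_of E (of_real c) x \<in> V}"
      by simp
    moreover have "0 \<in> {c. scale_of E (of_real c) x \<in> V}"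
      using nbhd by simp
    ultimately obtain \<delta> where "\<delta> > 0" "ball 0 \<delta> \<subseteq> {c. scale_of E (of_real c) x \<in> V}"
      using open_contains_ball by blast
    then have "\<delta>/2 \<in> {c. scale_of E (of_real c) x \<in> V}"
      using \<open>\<delta> > 0\<close> by (auto simp: subset_iff simp del: mem_Collect_eq)
    then have "scale_of E (of_real (\<delta>/2)) x \<in> D"
      using nbhd by blast
    then have "2 / \<delta> \<in> S x"
      using \<open>\<delta> > 0\<close> by (simp add: S_def)
    then show ?thesis by blast
  qed
  have bdd: "bdd_below (S x)" for x
    unfolding S_def by (rule bdd_belowI[of _ 0]) auto
  have q_le: "q x \<le> r" if "r \<in> S x" for x r
    unfolding q_def using that bdd by (rule cInf_lower)
  have q_ge: "c \<le> q x" if "x \<in> carrier_of E" "\<And>r. r \<in> S x \<Longrightarrow> c \<le> r" for x c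
    unfolding q_def using ne[OF that(1)] that(2) by (rule cInf_greatest)
  have q_nonneg: "0 \<le> q x" if "x \<in> carrier_of E" for x
    using that by (rule q_ge) (auto simp: S_def)
  \<comment> \<open>Upward closedness comes from balancedness; at the end it puts \<open>1\<close>
    into \<open>S x\<close> as soon as \<open>q x < 1\<close>.\<close>
  have up: "r' \<in> S x" if "r \<in> S x" "r \<le> r'" for r r' x
  proof -
    have "scale_of E (of_real (r / r')) (scale_of E (of_real (inverse r)) x) \<in> D"
      by (rule bal) (use that in \<open>auto simp: S_def norm_divide simp del: of_real_inverse\<close>)
    moreover have "of_real (r / r') * of_real (inverse r) = (of_real (inverse r') :: 'k)"
      using that by (simp add: S_def field_simps)
    ultimately show ?thesis
      using that by (simp add: S_def del: of_real_inverse of_real_divide)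
  qed
  have ex: "\<exists>r\<in>S x. r < c" if "x \<in> carrier_of E" "q x < c" for x c
    using that cInf_less_iff[OF ne[OF that(1)] bdd] unfolding q_def by blast
  have sub: "q (x + y) \<le> q x + q y" if xy: "x \<in> carrier_of E" "y \<in> carrier_of E" for x y
  proof (rule field_le_epsilon)
    fix e :: real assume "e > 0"
    then obtain r r' where r: "r \<in> S x" "r < q x + e/2" and r': "r' \<in> S y" "r' < q y + e/2"
      using ex[of x "q x + e/2"] ex[of y "q y + e/2"] xy by auto
    have pos: "r > 0" "r' > 0"
      using r r' by (auto simp: S_def)
    \<comment> \<open>With this weight the convex combination of \<open>x / r\<close> and
      \<open>y / r'\<close> is \<open>(x + y) / (r + r')\<close>.\<close>
    define t where "t = r' / (r + r')"
    have t: "0 \<le> t" "t \<le> 1" "1 - t = r / (r + r')"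
      using pos by (auto simp: t_def field_simps)
    have "scale_of E (of_real (1 - t)) (scale_of E (of_real (inverse r)) x)
        + scale_of E (of_real t) (scale_of E (of_real (inverse r')) y) \<in> D"
      using r r' t by (intro conv) (auto simp: S_def)
    moreover have "(1 - t) * inverse r = inverse (r + r')" "t * inverse r' = inverse (r + r')"
      using pos unfolding t(3) by (auto simp: t_def field_simps)
    ultimately have "scale_of E (of_real (inverse (r + r'))) (x + y) \<in> D"
      by (metis of_real_mult scale_right_distrib scale_scale)
    then have "r + r' \<in> S (x + y)"
      using pos by (simp add: S_def)
    then show "q (x + y) \<le> q x + q y + e"
      using q_le[of "r + r'" "x + y"] r r' by linarith
  qed
  have scale_le: "q (scale_of E c x) \<le> norm c * q x" if "c \<noteq> 0" "x \<in> carrier_of E" for c x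
  proof -
    have "q (scale_of E c x) / norm c \<le> q x"
    proof (rule q_ge)
      fix r assume r: "r \<in> S x"
      have "scale_of E (c / of_real (norm c)) (scale_of E (of_real (inverse r)) x) \<in> D"
        by (rule bal) (use that r in \<open>auto simp: S_def norm_divide simp del: of_real_inverse\<close>)
      moreover have "c / of_real (norm c) * of_real (inverse r) = of_real (inverse (norm c * r)) * c"
        by (simp add: field_simps)
      ultimately have "norm c * r \<in> S (scale_of E c x)"
        using r that by (simp add: S_def)
      from q_le[OF this] show "q (scale_of E c x) / norm c \<le> r"
        using that by (simp add: field_simps)
    qed (use that in auto)
    then show ?thesis
      using that by (simp add: field_simps)
  qed
  have zero_D: "0 \<in> D"
    using nbhd by auto
  have q0: "q 0 = 0"
  proof -
    have "q 0 \<le> e" if "e > 0" for e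
      using that zero_D by (intro q_le) (auto simp: S_def)
    then show ?thesis
      using q_nonneg[of 0] field_le_epsilon[of "q 0" 0] by fastforce
  qed
  have hom: "q (scale_of E c x) = norm c * q x" if x: "x \<in> carrier_of E" for c x
  proof (cases "c = 0")
    case False
    \<comment> \<open>The missing inequality is the one already shown, applied to the inverse
      scalar.\<close>
    have "q (scale_of E (inverse c) (scale_of E c x)) \<le> norm (inverse c) * q (scale_of E c x)"
      by (rule scale_le) (use False x in auto)
    moreover have "scale_of E (inverse c) (scale_of E c x) = x"
      using False by simp
    ultimately have "q x \<le> inverse (norm c) * q (scale_of E c x)"
      by (metis norm_inverse)
    then have "norm c * q x \<le> q (scale_of E c x)"
      using False by (simp add: field_simps)
    then show ?thesis
      using scale_le[OF False x] by linarith
  qed (use q0 in simp)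
  have small: "q x \<le> e" if "scale_of E (of_real (inverse e)) x \<in> V" "e > 0" for x e
    using that nbhd by (intro q_le) (auto simp: S_def)
  have cont: "continuous_map (top_of E) euclideanreal q"
    unfolding continuous_map_atin
  proof
    fix a assume a: "a \<in> carrier_of E"
    show "limitin euclideanreal q (q a) (atin (top_of E) a)"
      unfolding limitin_canonical_iff
    proof (rule tendstoI)
      fix e :: real assume e: "e > 0"
      let ?g = "\<lambda>y. scale_of E (of_real (inverse (e/2))) (y - a)"
      have "continuous_map (top_of E) (top_of E) ?g"
        using a by (intro continuous_scale_const continuous_diff) auto
      from openin_continuous_map_preimage[OF this nbhd(1)]
      have o: "openin (top_of E) {y \<in> carrier_of E. ?g y \<in> V}" .
      have "dist (q y) (q a) < e" if y: "y \<in> carrier_of E" "?g y \<in> V" for y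
      proof -
        have 1: "q (y - a) \<le> e/2"
          using y e by (intro small) auto
        have "q (a - y) = q (y - a)"
          using hom[of "y - a" "-1"] y a by simp
        moreover have "q y \<le> q (y - a) + q a" "q a \<le> q (a - y) + q y"
          using sub[of "y - a" a] sub[of "a - y" y] y a by auto
        ultimately show ?thesis
          using 1 e by (auto simp: dist_real_def)
      qed
      then show "\<forall>\<^sub>F y in atin (top_of E) a. dist (q y) (q a) < e"
        unfolding eventually_atin
        by (intro disjI2 exI[of _ "{y \<in> carrier_of E. ?g y \<in> V}"]) (use o a nbhd in auto)
    qed
  qed
  have "seminorm_on E q"
    using cont sub hom unfolding seminorm_on_def by blast
  moreover have "x \<in> D" if x: "x \<in> carrier_of E" and "q x < 1" for x
  proof -
    from ex[OF that] obtain r where "r \<in> S x" "r < 1" by blast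
    then have "1 \<in> S x" using up[of r x 1] by simp
    then show ?thesis by (simp add: S_def)
  qed
  ultimately show ?thesis
    by auto
qed

text \<open>Local convexity provides convex neighbourhoods \<open>C\<close> that need not be
  balanced, so the gauge is taken of the balanced core \<open>D\<close> of \<open>C\<close>. Joint
  continuity of scaling at zero ensures that \<open>D\<close> is still a neighbourhood of
  \<open>0\<close>. By this lemma limits and continuity can be tested with seminorms.\<close>

lemma exists_seminorm:
  assumes U: "openin (top_of E) U" and a: "a \<in> U"
  obtains q where "seminorm_on E q" "\<forall>x\<in>carrier_of E. q (x - a) < 1 \<longrightarrow> x \<in> U"
proof -
  have aE: "a \<in> carrier_of E"
    using assms openin_subset by blast
  define U0 where "U0 = {x \<in> carrier_of E. x + a \<in> U}"
  have "continuous_map (top_of E) (top_of E) (\<lambda>x. x + a)"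
    using aE by (intro continuous_add) auto
  then have "openin (top_of E) U0"
    unfolding U0_def by (rule openin_continuous_map_preimage[OF _ U])
  moreover have "0 \<in> U0"
    using a by (simp add: U0_def)
  ultimately obtain C where C: "openin (top_of E) C" "0 \<in> C" "C \<subseteq> U0"
    and conv: "\<forall>x\<in>C. \<forall>y\<in>C. \<forall>t. 0 \<le> t \<and> t \<le> 1 \<longrightarrow>
        scale_of E (of_real (1 - t)) x + scale_of E (of_real t) y \<in> C"
    by (rule convex_nbhd)
  define D where "D = {x \<in> carrier_of E. \<forall>c. norm c \<le> 1 \<longrightarrow> scale_of E c x \<in> C}"
  obtain \<delta> V where V: "\<delta> > 0" "openin (top_of E) V" "0 \<in> V"
    "\<forall>c. \<forall>x\<in>V. norm c < \<delta> \<longrightarrow> scale_of E c x \<in> C"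
    by (rule scale_nbhd_zero[OF C(1,2)])
  \<comment> \<open>After this scaling, a factor \<open>c\<close> of norm at most \<open>1\<close>
    acts as \<open>c * (\<delta>/2)\<close>, whose norm is below \<open>\<delta>\<close>.\<close>
  let ?g = "\<lambda>x. scale_of E (of_real (2/\<delta>)) x"
  have "continuous_map (top_of E) (top_of E) ?g"
    by (rule continuous_scale_const) simp
  from openin_continuous_map_preimage[OF this V(2)]
  have o: "openin (top_of E) {x \<in> carrier_of E. ?g x \<in> V}" .
  have sub: "{x \<in> carrier_of E. ?g x \<in> V} \<subseteq> D"
  proof -
    have "scale_of E c x \<in> C" if "?g x \<in> V" "norm c \<le> 1" for c x
    proof -
      have "\<delta> * norm c < \<delta> * 2" using V(1) that by simp
      then have "scale_of E (c * of_real (\<delta>/2)) (?g x) \<in> C"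
        using V(1) that by (intro V(4)[rule_format]) (auto simp: norm_mult)
      then show ?thesis using V(1) by simp
    qed
    then show ?thesis unfolding D_def by blast
  qed
  have "\<exists>q. seminorm_on E q \<and> (\<forall>x\<in>carrier_of E. q x < 1 \<longrightarrow> x \<in> D)"
  proof (rule gauge_of_balanced_convex[of D "{x \<in> carrier_of E. ?g x \<in> V}"])
    show "scale_of E c x \<in> D" if "norm c \<le> 1" "x \<in> D" for c x
      using that by (auto simp: D_def norm_mult mult_le_one)
    show "scale_of E (of_real (1 - t)) x + scale_of E (of_real t) y \<in> D"
      if "x \<in> D" "y \<in> D" "0 \<le> t" "t \<le> 1" for x y t
    proof -
      have "scale_of E c (scale_of E (of_real (1 - t)) x + scale_of E (of_real t) y) \<in> C"
        if "norm c \<le> 1" for c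
      proof -
        have "scale_of E (of_real (1 - t)) (scale_of E c x) + scale_of E (of_real t) (scale_of E c y) \<in> C"
          using that \<open>x \<in> D\<close> \<open>y \<in> D\<close> \<open>0 \<le> t\<close> \<open>t \<le> 1\<close> by (intro conv[rule_format]) (auto simp: D_def)
        then show ?thesis
          by (simp add: scale_right_distrib mult.commute)
      qed
      then show ?thesis
        using that by (simp add: D_def)
    qed
    show "x \<in> carrier_of E" if "x \<in> D" for x
      using that by (simp add: D_def)
    show "0 \<in> {x \<in> carrier_of E. ?g x \<in> V}"
      using V(3) by simp
  qed (fact o sub)+
  then obtain q where q: "seminorm_on E q" "\<forall>x\<in>carrier_of E. q x < 1 \<longrightarrow> x \<in> D"
    by auto
  have "\<forall>x\<in>carrier_of E. q (x - a) < 1 \<longrightarrow> x \<in> U"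
  proof (intro ballI impI)
    fix x assume x: "x \<in> carrier_of E" "q (x - a) < 1"
    then have "x - a \<in> D" using q(2) aE by simp
    then have "\<forall>c. norm c \<le> 1 \<longrightarrow> scale_of E c (x - a) \<in> C"
      by (simp add: D_def)
    from this[rule_format, of 1] have "x - a \<in> C"
      by simp
    then show "x \<in> U" using C by (auto simp: U0_def)
  qed
  with q(1) show ?thesis
    by (rule that)
qed

context
  fixes q assumes q: "seminorm_on E q"
begin

lemma seminorm_add: "x \<in> carrier_of E \<Longrightarrow> y \<in> carrier_of E \<Longrightarrow> q (x + y) \<le> q x + q y"
  using q by (simp add: seminorm_on_def)

lemma seminorm_scale: "x \<in> carrier_of E \<Longrightarrow> q (scale_of E c x) = norm c * q x"
  using q by (simp add: seminorm_on_def)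

lemma seminorm_zero: "q 0 = 0"
  using seminorm_scale[of 0 0] by simp

lemma seminorm_neg: "x \<in> carrier_of E \<Longrightarrow> q (- x) = q x"
  using seminorm_scale[of x "-1"] by simp

lemma seminorm_nonneg: "x \<in> carrier_of E \<Longrightarrow> 0 \<le> q x"
  using seminorm_add[of x "- x"] seminorm_neg[of x] by (simp add: seminorm_zero)

lemma seminorm_commute: "x \<in> carrier_of E \<Longrightarrow> y \<in> carrier_of E \<Longrightarrow> q (x - y) = q (y - x)"
  using seminorm_neg[of "x - y"] by simp

lemma seminorm_triangle:
  "x \<in> carrier_of E \<Longrightarrow> y \<in> carrier_of E \<Longrightarrow> z \<in> carrier_of E \<Longrightarrow>
    q (x - z) \<le> q (x - y) + q (y - z)"
  using seminorm_add[of "x - y" "y - z"] by simp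

lemma seminorm_diff: "x \<in> carrier_of E \<Longrightarrow> y \<in> carrier_of E \<Longrightarrow> q (x - y) \<le> q x + q y"
  using seminorm_add[of x "- y"] seminorm_neg[of y] by simp

lemma seminorm_sum:
  "(\<And>i. i \<in> I \<Longrightarrow> f i \<in> carrier_of E) \<Longrightarrow> q (\<Sum>i\<in>I. f i) \<le> (\<Sum>i\<in>I. q (f i))"
proof (induction I rule: infinite_finite_induct)
  case (insert i I)
  then have "q (f i + (\<Sum>i\<in>I. f i)) \<le> q (f i) + q (\<Sum>i\<in>I. f i)"
    by (intro seminorm_add sum_in) auto
  then show ?case using insert by fastforce
qed (simp_all add: seminorm_zero)

lemma continuous_seminorm:
  assumes "continuous_map X (top_of E) f"
  shows "continuous_map X euclideanreal (\<lambda>x. q (f x))"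
  using continuous_map_compose[OF assms, of euclideanreal q] q by (simp add: seminorm_on_def o_def)

lemma seminorm_open:
  assumes "a \<in> carrier_of E"
  shows "openin (top_of E) {x \<in> carrier_of E. q (x - a) < e}"
proof -
  have "continuous_map (top_of E) euclideanreal (\<lambda>x. q (x - a))"
    using assms by (intro continuous_seminorm continuous_diff) auto
  from openin_continuous_map_preimage[OF this, of "{..<e}"] show ?thesis
    by simp
qed

end

text \<open>Balls of continuous seminorms are open and form neighbourhood bases, so a limit is
  tested with one seminorm at a time, in the way a norm would be used. Membership in the carrier has
  to be recorded separately because the ambient type may be larger than the space.\<close>

lemma limitin_iff:
  "limitin (top_of E) f l F \<longleftrightarrow> l \<in> carrier_of E \<and> (\<forall>\<^sub>F x in F. f x \<in> carrier_of E) \<and>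
    (\<forall>q. seminorm_on E q \<longrightarrow> (\<forall>e>0. \<forall>\<^sub>F x in F. q (f x - l) < e))"
  (is "?L \<longleftrightarrow> ?R")
proof
  assume L: ?L
  then have l: "l \<in> carrier_of E"
    by (simp add: limitin_def)
  have "\<forall>\<^sub>F x in F. q (f x - l) < e" if q: "seminorm_on E q" and "e > 0" for q e
  proof -
    have "l \<in> {x \<in> carrier_of E. q (x - l) < e}"
      using l \<open>e > 0\<close> by (simp add: seminorm_zero[OF q])
    with L seminorm_open[OF q l] have "\<forall>\<^sub>F x in F. f x \<in> {x \<in> carrier_of E. q (x - l) < e}"
      unfolding limitin_def by blast
    then show ?thesis
      by (rule eventually_mono) simp
  qed
  moreover have "\<forall>\<^sub>F x in F. f x \<in> carrier_of E"
    using L l by (auto simp: limitin_def)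
  ultimately show ?R
    using l by simp
next
  assume R: ?R
  show ?L
    unfolding limitin_def
  proof (intro conjI allI impI)
    fix U assume U: "openin (top_of E) U \<and> l \<in> U"
    then obtain q where q: "seminorm_on E q" "\<forall>x\<in>carrier_of E. q (x - l) < 1 \<longrightarrow> x \<in> U"
      using exists_seminorm by metis
    have "\<forall>\<^sub>F x in F. q (f x - l) < 1" "\<forall>\<^sub>F x in F. f x \<in> carrier_of E"
      using R q(1) by auto
    then show "\<forall>\<^sub>F x in F. f x \<in> U"
      by eventually_elim (use q(2) in auto)
  qed (use R in auto)
qed

lemma limitin_seminorm:
  "limitin (top_of E) f l F \<Longrightarrow> seminorm_on E q \<Longrightarrow> e > 0 \<Longrightarrow> \<forall>\<^sub>F x in F. q (f x - l) < e"
  by (simp add: limitin_iff)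

lemma continuous_mapD:
  assumes "continuous_map X (top_of E) f" "seminorm_on E q" "a \<in> topspace X" "e > 0"
  obtains W where "openin X W" "a \<in> W" "\<forall>x\<in>W. f x \<in> carrier_of E \<and> q (f x - f a) < e"
proof -
  have fa: "f a \<in> carrier_of E"
    using assms continuous_map_image_subset_topspace by blast
  let ?W = "{x \<in> topspace X. f x \<in> {y \<in> carrier_of E. q (y - f a) < e}}"
  have "openin X ?W"
    by (rule openin_continuous_map_preimage[OF assms(1) seminorm_open[OF assms(2) fa]])
  moreover have "a \<in> ?W"
    using fa assms by (simp add: seminorm_zero[OF assms(2)])
  moreover have "\<forall>x\<in>?W. f x \<in> carrier_of E \<and> q (f x - f a) < e"
    by blast
  ultimately show ?thesis
    by (rule that)
qed

lemma continuous_mapI: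
  assumes "\<And>x. x \<in> topspace X \<Longrightarrow> f x \<in> carrier_of E"
    and "\<And>q a e. seminorm_on E q \<Longrightarrow> a \<in> topspace X \<Longrightarrow> e > 0 \<Longrightarrow>
      \<exists>W. openin X W \<and> a \<in> W \<and> (\<forall>x\<in>W. q (f x - f a) < e)"
  shows "continuous_map X (top_of E) f"
  unfolding continuous_map_atin
proof
  fix a assume a: "a \<in> topspace X"
  show "limitin (top_of E) f (f a) (atin X a)"
    unfolding limitin_iff eventually_atin
  proof (intro conjI allI impI)
    show "a \<notin> topspace X \<or> (\<exists>U. openin X U \<and> a \<in> U \<and> (\<forall>x\<in>U - {a}. f x \<in> carrier_of E))"
      using assms(1) a by (intro disjI2 exI[of _ "topspace X"]) auto
    show "a \<notin> topspace X \<or> (\<exists>U. openin X U \<and> a \<in> U \<and> (\<forall>x\<in>U - {a}. q (f x - f a) < e))"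
      if "seminorm_on E q" "0 < e" for q e
      using assms(2)[OF that(1) a that(2)] by auto
  qed (use assms(1) a in auto)
qed

lemma limitin_unique:
  assumes "limitin (top_of E) f l F" "limitin (top_of E) f l' F" "F \<noteq> bot"
  shows "l = l'"
  using limitin_Hausdorff_unique[OF assms hausdorff] .

lemma limitin_add:
  assumes "limitin (top_of E) f a F" "limitin (top_of E) g b F"
  shows "limitin (top_of E) (\<lambda>x. f x + g x) (a + b) F"
proof -
  have c: "continuous_map (prod_topology (top_of E) (top_of E)) (top_of E) (\<lambda>z. fst z + snd z)"
    by (intro continuous_add) (auto simp: continuous_map_fst continuous_map_snd)
  have "limitin (prod_topology (top_of E) (top_of E)) (\<lambda>x. (f x, g x)) (a, b) F"
    using assms by (simp add: limitin_pairwise o_def)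
  from limitin_compose[OF c this] show ?thesis
    by (simp add: o_def)
qed

lemma limitin_scale:
  assumes "(c \<longlongrightarrow> c0) F" "limitin (top_of E) f a F"
  shows "limitin (top_of E) (\<lambda>x. scale_of E (c x) (f x)) (scale_of E c0 a) F"
proof -
  have c: "continuous_map (prod_topology euclidean (top_of E)) (top_of E) (\<lambda>z. scale_of E (fst z) (snd z))"
    by (intro continuous_scale) (auto simp: continuous_map_fst continuous_map_snd)
  have "limitin (prod_topology euclidean (top_of E)) (\<lambda>x. (c x, f x)) (c0, a) F"
    using assms by (simp add: limitin_pairwise o_def)
  from limitin_compose[OF c this] show ?thesis
    by (simp add: o_def)
qed

end

section \<open>Products, subspaces and complexifications\<close>

lemma lcs_prod_tvs:
  assumes "lcs E" "lcs F"
  shows "lcs (prod_tvs E F)"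
proof -
  interpret E: lcs E by fact
  interpret F: lcs F by fact
  let ?P = "prod_tvs E F"
  have vs: "vector_space (scale_of ?P)"
    by standard
      (auto simp: prod_tvs_def E.scale_right_distrib F.scale_right_distrib E.scale_left_distrib F.scale_left_distrib)
  interpret P: vector_space "scale_of ?P" by fact
  have top: "top_of ?P = prod_topology (top_of E) (top_of F)"
    by (simp add: prod_tvs_def)
  have sc: "scale_of ?P c z = (scale_of E c (fst z), scale_of F c (snd z))" for c z
    by (cases z) (simp add: prod_tvs_def)
  have sub: "P.subspace (carrier_of ?P)"
    unfolding P.subspace_def by (auto simp: top sc zero_prod_def)
  have add: "continuous_map (prod_topology (top_of ?P) (top_of ?P)) (top_of ?P) (\<lambda>(x, y). x + y)"
    unfolding top case_prod_unfold plus_prod_def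
    by (intro continuous_map_pairedI E.continuous_add F.continuous_add)
      (intro continuous_map_projections)+
  have mult: "continuous_map (prod_topology euclidean (top_of ?P)) (top_of ?P) (\<lambda>(c, x). scale_of ?P c x)"
    unfolding top case_prod_unfold sc
    by (intro continuous_map_pairedI E.continuous_scale F.continuous_scale)
      (intro continuous_map_projections)+
  have conv: "\<exists>C. openin (top_of ?P) C \<and> 0 \<in> C \<and> C \<subseteq> U \<and>
        (\<forall>x\<in>C. \<forall>y\<in>C. \<forall>t. 0 \<le> t \<and> t \<le> 1 \<longrightarrow>
          scale_of ?P (of_real (1 - t)) x + scale_of ?P (of_real t) y \<in> C)"
    if U: "openin (top_of ?P) U" "0 \<in> U" for U
  proof -
    obtain A B where AB: "openin (top_of E) A" "openin (top_of F) B" "0 \<in> A" "0 \<in> B" "A \<times> B \<subseteq> U"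
      using U unfolding top zero_prod_def by (rule prod_nbhd)
    obtain A' where A': "openin (top_of E) A'" "0 \<in> A'" "A' \<subseteq> A"
      "\<forall>x\<in>A'. \<forall>y\<in>A'. \<forall>t. 0 \<le> t \<and> t \<le> 1 \<longrightarrow>
        scale_of E (of_real (1 - t)) x + scale_of E (of_real t) y \<in> A'"
      using AB(1,3) by (rule E.convex_nbhd)
    obtain B' where B': "openin (top_of F) B'" "0 \<in> B'" "B' \<subseteq> B"
      "\<forall>x\<in>B'. \<forall>y\<in>B'. \<forall>t. 0 \<le> t \<and> t \<le> 1 \<longrightarrow>
        scale_of F (of_real (1 - t)) x + scale_of F (of_real t) y \<in> B'"
      using AB(2,4) by (rule F.convex_nbhd)
    show ?thesis
    proof (intro exI[of _ "A' \<times> B'"] conjI ballI allI impI)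
      show "openin (top_of ?P) (A' \<times> B')"
        using A'(1) B'(1) by (simp add: top openin_prod_Times_iff)
      show "A' \<times> B' \<subseteq> U"
        using AB(5) A'(3) B'(3) by blast
      show "scale_of ?P (of_real (1 - t)) x + scale_of ?P (of_real t) y \<in> A' \<times> B'"
        if "x \<in> A' \<times> B'" "y \<in> A' \<times> B'" "0 \<le> t \<and> t \<le> 1" for x y t
        using that A'(4) B'(4) unfolding sc mem_Times_iff by auto
    qed (use A'(2) B'(2) in \<open>auto simp: zero_prod_def\<close>)
  qed
  have "Hausdorff_space (top_of ?P)"
    unfolding top by (simp add: Hausdorff_space_prod_topology E.hausdorff F.hausdorff)
  then show ?thesis
    unfolding lcs_def locally_convex_space_def using vs sub add mult conv by blast
qed

lemma lcs_sub_tvs: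
  assumes "lcs E" and A: "module.subspace (scale_of E) A"
  shows "lcs (sub_tvs E A)"
proof -
  interpret E: lcs E by fact
  let ?P = "sub_tvs E A"
  have top: "top_of ?P = subtopology (top_of E) A" and sc: "scale_of ?P = scale_of E"
    by (simp_all add: sub_tvs_def)
  have sub: "E.subspace (carrier_of ?P)"
    unfolding top using E.subspace_inter[OF E.subspace_carrier A] by simp
  have cE: "continuous_map X (top_of E) f" if "continuous_map X (top_of ?P) f" for X :: "'x topology" and f
    using that unfolding top continuous_map_in_subtopology by blast
  have add: "continuous_map (prod_topology (top_of ?P) (top_of ?P)) (top_of ?P) (\<lambda>(x, y). x + y)"
    unfolding case_prod_unfold
  proof (subst (3) top, rule continuous_map_into_subtopology)
    show "continuous_map (prod_topology (top_of ?P) (top_of ?P)) (top_of E) (\<lambda>p. fst p + snd p)"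
      by (intro E.continuous_add cE continuous_map_projections)
    show "(\<lambda>p. fst p + snd p) \<in> topspace (prod_topology (top_of ?P) (top_of ?P)) \<rightarrow> A"
      using E.subspace_add[OF A] by (auto simp: top)
  qed
  have mult: "continuous_map (prod_topology euclidean (top_of ?P)) (top_of ?P) (\<lambda>(c, x). scale_of ?P c x)"
    unfolding case_prod_unfold
  proof (subst (2) top, rule continuous_map_into_subtopology, unfold sc)
    show "continuous_map (prod_topology euclidean (top_of ?P)) (top_of E) (\<lambda>p. scale_of E (fst p) (snd p))"
      by (intro E.continuous_scale cE continuous_map_projections)
    show "(\<lambda>p. scale_of E (fst p) (snd p)) \<in> topspace (prod_topology euclidean (top_of ?P)) \<rightarrow> A"
      using E.subspace_scale[OF A] by (auto simp: top)
  qed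
  have conv: "\<exists>C. openin (top_of ?P) C \<and> 0 \<in> C \<and> C \<subseteq> U \<and>
        (\<forall>x\<in>C. \<forall>y\<in>C. \<forall>t. 0 \<le> t \<and> t \<le> 1 \<longrightarrow>
          scale_of ?P (of_real (1 - t)) x + scale_of ?P (of_real t) y \<in> C)"
    if U: "openin (top_of ?P) U" "0 \<in> U" for U
  proof -
    obtain T where T: "openin (top_of E) T" "U = T \<inter> A"
      using U unfolding top openin_subtopology by blast
    then have "0 \<in> T"
      using U by blast
    with T(1) obtain C where C: "openin (top_of E) C" "0 \<in> C" "C \<subseteq> T"
      "\<forall>x\<in>C. \<forall>y\<in>C. \<forall>t. 0 \<le> t \<and> t \<le> 1 \<longrightarrow>
        scale_of E (of_real (1 - t)) x + scale_of E (of_real t) y \<in> C"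
      by (rule E.convex_nbhd)
    show ?thesis
    proof (intro exI[of _ "C \<inter> A"] conjI ballI allI impI)
      show "openin (top_of ?P) (C \<inter> A)"
        using C(1) by (auto simp: top openin_subtopology)
      show "scale_of ?P (of_real (1 - t)) x + scale_of ?P (of_real t) y \<in> C \<inter> A"
        if "x \<in> C \<inter> A" "y \<in> C \<inter> A" "0 \<le> t \<and> t \<le> 1" for x y t
        using that C(4) A unfolding sc by (auto intro!: E.subspace_add E.subspace_scale)
    qed (use C T E.subspace_0[OF A] in auto)
  qed
  have "Hausdorff_space (top_of ?P)"
    unfolding top by (simp add: Hausdorff_space_subtopology E.hausdorff)
  then show ?thesis
    unfolding lcs_def locally_convex_space_def sc
    using E.vector_space_axioms sub add mult conv unfolding sc by blast
qed

lemma lcs_complexification: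
  fixes E :: "('k::real_normed_field, 'e::ab_group_add) tvs"
  assumes "lcs E"
  shows "lcs (complexification E)"
proof -
  interpret E: lcs E by fact
  let ?P = "complexification E"
  have sc: "scale_of ?P c z = (scale_of E (of_real (Re c)) (fst z) - scale_of E (of_real (Im c)) (snd z),
      scale_of E (of_real (Im c)) (fst z) + scale_of E (of_real (Re c)) (snd z))" for c z
    by (cases z) (simp add: complexification_def)
  have top: "top_of ?P = prod_topology (top_of E) (top_of E)"
    by (simp add: complexification_def)
  have vs: "vector_space (scale_of ?P)"
    by standard
      (auto simp: sc E.scale_right_distrib E.scale_left_distrib E.scale_right_diff_distrib
        E.scale_left_diff_distrib algebra_simps)
  interpret P: vector_space "scale_of ?P" by fact
  have sub: "P.subspace (carrier_of ?P)"
    unfolding P.subspace_def by (auto simp: top sc zero_prod_def)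
  have add: "continuous_map (prod_topology (top_of ?P) (top_of ?P)) (top_of ?P) (\<lambda>(x, y). x + y)"
    unfolding top case_prod_unfold plus_prod_def
    by (intro continuous_map_pairedI E.continuous_add)
      (intro continuous_map_projections)+
  have re: "continuous_map (prod_topology euclidean Y) euclidean (\<lambda>x. of_real (Re (fst x)) :: 'k)"
    and im: "continuous_map (prod_topology euclidean Y) euclidean (\<lambda>x. of_real (Im (fst x)) :: 'k)"
    for Y :: "'z topology"
  proof -
    have "continuous_map euclidean euclidean (\<lambda>x. of_real (Re x) :: 'k)"
      "continuous_map euclidean euclidean (\<lambda>x. of_real (Im x) :: 'k)"
      unfolding continuous_map_iff_continuous2
      by (intro linear_continuous_on bounded_linear_compose[OF bounded_linear_of_real]
        bounded_linear_Re bounded_linear_Im)+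
    from this[THEN continuous_map_compose[OF continuous_map_fst]]
    show "continuous_map (prod_topology euclidean Y) euclidean (\<lambda>x. of_real (Re (fst x)) :: 'k)"
      "continuous_map (prod_topology euclidean Y) euclidean (\<lambda>x. of_real (Im (fst x)) :: 'k)"
      by (simp_all add: o_def)
  qed
  have mult: "continuous_map (prod_topology euclidean (top_of ?P)) (top_of ?P) (\<lambda>(c, x). scale_of ?P c x)"
    unfolding top case_prod_unfold sc
    by (intro continuous_map_pairedI E.continuous_add E.continuous_diff E.continuous_scale re im)
      (intro continuous_map_projections)+
  have conv: "\<exists>C. openin (top_of ?P) C \<and> 0 \<in> C \<and> C \<subseteq> U \<and>
        (\<forall>x\<in>C. \<forall>y\<in>C. \<forall>t. 0 \<le> t \<and> t \<le> 1 \<longrightarrow>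
          scale_of ?P (of_real (1 - t)) x + scale_of ?P (of_real t) y \<in> C)"
    if U: "openin (top_of ?P) U" "0 \<in> U" for U
  proof -
    obtain A B where AB: "openin (top_of E) A" "openin (top_of E) B" "0 \<in> A" "0 \<in> B" "A \<times> B \<subseteq> U"
      using U unfolding top zero_prod_def by (rule prod_nbhd)
    obtain A' where A': "openin (top_of E) A'" "0 \<in> A'" "A' \<subseteq> A"
      "\<forall>x\<in>A'. \<forall>y\<in>A'. \<forall>t. 0 \<le> t \<and> t \<le> 1 \<longrightarrow>
        scale_of E (of_real (1 - t)) x + scale_of E (of_real t) y \<in> A'"
      using AB(1,3) by (rule E.convex_nbhd)
    obtain B' where B': "openin (top_of E) B'" "0 \<in> B'" "B' \<subseteq> B"
      "\<forall>x\<in>B'. \<forall>y\<in>B'. \<forall>t. 0 \<le> t \<and> t \<le> 1 \<longrightarrow>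
        scale_of E (of_real (1 - t)) x + scale_of E (of_real t) y \<in> B'"
      using AB(2,4) by (rule E.convex_nbhd)
    show ?thesis
    proof (intro exI[of _ "A' \<times> B'"] conjI ballI allI impI)
      show "openin (top_of ?P) (A' \<times> B')"
        using A'(1) B'(1) by (simp add: top openin_prod_Times_iff)
      show "A' \<times> B' \<subseteq> U"
        using AB(5) A'(3) B'(3) by blast
      show "scale_of ?P (of_real (1 - t)) x + scale_of ?P (of_real t) y \<in> A' \<times> B'"
        if "x \<in> A' \<times> B'" "y \<in> A' \<times> B'" "0 \<le> t \<and> t \<le> 1" for x y t
        using that A'(4) B'(4) unfolding sc mem_Times_iff by auto
    qed (use A'(2) B'(2) in \<open>auto simp: zero_prod_def\<close>)
  qed
  have "Hausdorff_space (top_of ?P)"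
    unfolding top by (simp add: Hausdorff_space_prod_topology E.hausdorff)
  then show ?thesis
    unfolding lcs_def locally_convex_space_def using vs sub add mult conv by blast
qed

section \<open>The mean value inequality and strong differentiability\<close>

text \<open>With a slack \<open>e\<close> added to \<open>c\<close>, the bound holds on all short
  intervals around a point, by differentiability there, and the bounds on adjacent intervals add up;
  bisection then gives it on the unit interval. The parameter is real for either ground field, and
  \<open>l\<close> is an arbitrary vector from which the derivative deviates by at most
  \<open>c\<close>.\<close>

lemma (in lcs) mean_value_inequality:
  fixes \<gamma> :: "real \<Rightarrow> 'e"
  assumes q: "seminorm_on E q"
    and in_carrier: "\<And>s. 0 \<le> s \<Longrightarrow> s \<le> 1 \<Longrightarrow> \<gamma> s \<in> carrier_of E"
      "\<And>s. 0 \<le> s \<Longrightarrow> s \<le> 1 \<Longrightarrow> \<gamma>' s \<in> carrier_of E" "l \<in> carrier_of E"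
    and der: "\<And>s e. 0 \<le> s \<Longrightarrow> s \<le> 1 \<Longrightarrow> e > 0 \<Longrightarrow>
      \<exists>d>0. \<forall>u. 0 \<le> u \<and> u \<le> 1 \<and> \<bar>u - s\<bar> < d \<longrightarrow>
        q (\<gamma> u - \<gamma> s - scale_of E (of_real (u - s)) (\<gamma>' s)) \<le> e * \<bar>u - s\<bar>"
    and bound: "\<And>s. 0 \<le> s \<Longrightarrow> s \<le> 1 \<Longrightarrow> q (\<gamma>' s - l) \<le> c"
  shows "q (\<gamma> 1 - \<gamma> 0 - l) \<le> c"
proof (rule field_le_epsilon)
  fix e :: real assume e: "e > 0"
  define r where "r a b = \<gamma> b - \<gamma> a - scale_of E (of_real (b - a)) l" for a b
  define P where "P a b \<longleftrightarrow> (0 \<le> a \<and> a \<le> b \<and> b \<le> 1 \<longrightarrow> q (r a b) \<le> (c + e) * (b - a))" for a b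
  have r_in: "r a b \<in> carrier_of E" if "0 \<le> a" "a \<le> 1" "0 \<le> b" "b \<le> 1" for a b
    using that in_carrier unfolding r_def by (intro diff_in scale_in) auto
  have r_add: "r a b + r b d = r a d" for a b d
    by (simp add: r_def scale_left_diff_distrib)
  have join: "q (r a d) \<le> (c + e) * (d - a)"
    if "0 \<le> a" "a \<le> b" "b \<le> d" "d \<le> 1" "q (r a b) \<le> (c + e) * (b - a)" "q (r b d) \<le> (c + e) * (d - b)"
    for a b d
  proof -
    have "q (r a d) \<le> q (r a b) + q (r b d)"
      using seminorm_add[OF q r_in[of a b] r_in[of b d]] that by (simp add: r_add)
    also have "\<dots> \<le> (c + e) * (b - a) + (c + e) * (d - b)"
      using that by (intro add_mono)
    finally show ?thesis by (simp add: algebra_simps)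
  qed
  have "P 0 1"
  \<comment> \<open>Bisection leaves short intervals that contain a given point \<open>x\<close>;
    such an interval is cut at \<open>x\<close> and both halves are compared with the derivative
    there.\<close>
  proof (rule Bolzano)
    show "P a d" if "P a b" "P b d" "a \<le> b" "b \<le> d" for a b d
      using that join[of a b d] unfolding P_def by auto
    fix x :: real assume x: "0 \<le> x" "x \<le> 1"
    obtain \<delta> where \<delta>: "\<delta> > 0" "\<forall>u. 0 \<le> u \<and> u \<le> 1 \<and> \<bar>u - x\<bar> < \<delta> \<longrightarrow>
        q (\<gamma> u - \<gamma> x - scale_of E (of_real (u - x)) (\<gamma>' x)) \<le> e * \<bar>u - x\<bar>"
      using der[OF x e] by auto
    have main: "q (r x u) \<le> (c + e) * \<bar>u - x\<bar>" if u: "0 \<le> u" "u \<le> 1" "\<bar>u - x\<bar> < \<delta>" for u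
    proof -
      let ?a = "\<gamma> u - \<gamma> x - scale_of E (of_real (u - x)) (\<gamma>' x)"
      let ?b = "scale_of E (of_real (u - x)) (\<gamma>' x - l)"
      have "r x u = ?a + ?b"
        by (simp add: r_def scale_right_diff_distrib)
      moreover have "?a \<in> carrier_of E" "?b \<in> carrier_of E"
        using x u in_carrier by auto
      ultimately have "q (r x u) \<le> q ?a + q ?b"
        using seminorm_add[OF q] by metis
      also have "q ?b = \<bar>u - x\<bar> * q (\<gamma>' x - l)"
        using x in_carrier seminorm_scale[OF q, of "\<gamma>' x - l" "of_real (u - x)"] by (simp del: of_real_diff)
      also have "\<dots> \<le> \<bar>u - x\<bar> * c"
        using bound[OF x] by (intro mult_left_mono) auto
      finally show ?thesis
        using \<delta>(2) u by (simp add: algebra_simps) (smt (verit, best))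
    qed
    have "P a b" if "a \<le> x" "x \<le> b" "b - a < \<delta>" for a b
      unfolding P_def
    proof
      assume ab: "0 \<le> a \<and> a \<le> b \<and> b \<le> 1"
      have "r a x = - r x a"
        by (simp add: r_def scale_left_diff_distrib)
      then have "q (r a x) = q (r x a)"
        using seminorm_neg[OF q r_in[of x a]] ab that x by simp
      then have "q (r a x) \<le> (c + e) * (x - a)"
        using main[of a] ab that x by simp
      moreover have "q (r x b) \<le> (c + e) * (b - x)"
        using main[of b] ab that x by simp
      ultimately show "q (r a b) \<le> (c + e) * (b - a)"
        using ab that by (intro join[of a x b]) auto
    qed
    then show "\<exists>d>0. \<forall>a b. a \<le> x \<and> x \<le> b \<and> b - a < d \<longrightarrow> P a b"
      using \<delta>(1) by blast
  qed simp
  then show "q (\<gamma> 1 - \<gamma> 0 - l) \<le> c + e"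
    by (simp add: P_def r_def)
qed

lemma (in lcs) limitin_at_zeroD:
  assumes "limitin (top_of E) f l (at (0::'a::real_normed_vector))" "seminorm_on E q" "e > 0"
  obtains d where "d > 0" "\<forall>t. t \<noteq> 0 \<and> norm t < d \<longrightarrow> f t \<in> carrier_of E \<and> q (f t - l) < e"
proof -
  have "\<forall>\<^sub>F t in at 0. f t \<in> carrier_of E \<and> q (f t - l) < e"
    using assms unfolding limitin_iff by (simp add: eventually_conj)
  then obtain d where "d > 0" "\<forall>t. t \<noteq> 0 \<and> norm t < d \<longrightarrow> f t \<in> carrier_of E \<and> q (f t - l) < e"
    unfolding eventually_at by (auto simp: dist_norm)
  then show ?thesis
    by (rule that)
qed

text \<open>Multiplied out by \<open>t\<close>, the estimate of the difference quotient makes sense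
  at \<open>t = 0\<close> as well, which is the form that the mean value inequality asks
  for.\<close>

lemma has_directional_derivativeD:
  fixes E :: "('k::real_normed_field, 'e::ab_group_add) tvs"
  assumes "lcs E" "lcs F" "has_directional_derivative E F f x v l" "seminorm_on F q" "e > 0"
    and f: "\<forall>u\<in>U. f u \<in> carrier_of F" "x \<in> U"
  shows "\<exists>d>0. \<forall>t. norm t < d \<and> x + scale_of E t v \<in> U \<longrightarrow> q (f (x + scale_of E t v) - f x - scale_of F t l) \<le> e * norm t"
proof -
  interpret E: lcs E by fact
  interpret F: lcs F by fact
  have l: "l \<in> carrier_of F"
    using assms(3) by (simp add: has_directional_derivative_def limitin_def)
  obtain d where d: "d > 0" "\<forall>t. t \<noteq> 0 \<and> norm t < d \<longrightarrow>
      scale_of F (inverse t) (f (x + scale_of E t v) - f x) \<in> carrier_of F \<and>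
      q (scale_of F (inverse t) (f (x + scale_of E t v) - f x) - l) < e"
    using assms(3) unfolding has_directional_derivative_def
    by (rule F.limitin_at_zeroD[OF _ assms(4,5)])
  have "q (f (x + scale_of E t v) - f x - scale_of F t l) \<le> e * norm t"
    if t: "norm t < d" "x + scale_of E t v \<in> U" for t
  proof (cases "t = 0")
    case False
    let ?w = "scale_of F (inverse t) (f (x + scale_of E t v) - f x) - l"
    have "f (x + scale_of E t v) - f x - scale_of F t l = scale_of F t ?w"
      using False by (simp add: F.scale_right_diff_distrib)
    also have "q \<dots> = norm t * q ?w"
      using f t l by (intro F.seminorm_scale[OF assms(4)]) auto
    also have "\<dots> \<le> norm t * e"
      using d t False by (intro mult_left_mono) (auto intro: less_imp_le)
    finally show ?thesis by (simp add: mult.commute)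
  next
    case True
    then show ?thesis
      using F.seminorm_zero[OF assms(4)] by simp
  qed
  with d(1) show ?thesis
    by blast
qed

section \<open>Directional derivatives and strong differentiability\<close>

locale lcs_pair = E: lcs E + F: lcs F
  for E :: "('k::real_normed_field, 'e::ab_group_add) tvs" and F :: "('k, 'f::ab_group_add) tvs"
begin

abbreviation "has_dd \<equiv> has_directional_derivative E F"

lemma has_dd_unique: "has_dd f x v l \<Longrightarrow> has_dd f x v l' \<Longrightarrow> l = l'"
  unfolding has_directional_derivative_def by (rule F.limitin_unique) auto

lemma has_dd_in: "has_dd f x v l \<Longrightarrow> l \<in> carrier_of F"
  by (simp add: has_directional_derivative_def limitin_def)

lemma eventually_line:
  assumes "openin (top_of E) U" "x \<in> U" "v \<in> carrier_of E"
  shows "\<forall>\<^sub>F t in at 0. x + scale_of E t v \<in> U"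
proof -
  have x: "x \<in> carrier_of E"
    using assms openin_subset by blast
  have "limitin (top_of E) (\<lambda>t. x + scale_of E t v) (x + scale_of E 0 v) (at 0)"
    by (intro E.limitin_add E.limitin_scale tendsto_ident_at) (use x assms in auto)
  then show ?thesis
    using assms(1,2) unfolding limitin_def by simp
qed

lemma has_dd_cong:
  assumes "openin (top_of E) U" "x \<in> U" "v \<in> carrier_of E" "\<And>u. u \<in> U \<Longrightarrow> f u = g u"
    and "has_dd f x v l"
  shows "has_dd g x v l"
  unfolding has_directional_derivative_def
proof (rule limitin_transform_eventually)
  show "limitin (top_of F) (\<lambda>t. scale_of F (inverse t) (f (x + scale_of E t v) - f x)) l (at 0)"
    using assms by (simp add: has_directional_derivative_def)
  show "\<forall>\<^sub>F t in at 0. scale_of F (inverse t) (f (x + scale_of E t v) - f x) =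
      scale_of F (inverse t) (g (x + scale_of E t v) - g x)"
    using eventually_line[OF assms(1-3)] by eventually_elim (use assms in simp)
qed

lemma has_dd_add:
  assumes "has_dd f x v l" "has_dd g x v m"
  shows "has_dd (\<lambda>u. f u + g u) x v (l + m)"
  using F.limitin_add[OF assms[unfolded has_directional_derivative_def]]
  unfolding has_directional_derivative_def
  by (simp add: add_diff_add F.scale_right_distrib)

lemma has_dd_scale:
  assumes "has_dd f x v l"
  shows "has_dd (\<lambda>u. scale_of F c (f u)) x v (scale_of F c l)"
  using F.limitin_scale[OF tendsto_const[of c] assms[unfolded has_directional_derivative_def]]
  unfolding has_directional_derivative_def
  by (simp add: F.scale_right_diff_distrib mult.commute)

lemma has_dd_const: "has_dd (\<lambda>u. a) x v 0"
  unfolding has_directional_derivative_def by simp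

lemma has_dd_sum_list:
  assumes "\<And>i. i \<in> set I \<Longrightarrow> has_dd (f i) x v (l i)"
  shows "has_dd (\<lambda>u. \<Sum>i\<leftarrow>I. f i u) x v (\<Sum>i\<leftarrow>I. l i)"
  using assms by (induction I) (auto intro: has_dd_add has_dd_const)

lemma seminorm_quotient:
  assumes q: "seminorm_on F q" and "a \<in> carrier_of F" "l \<in> carrier_of F" "t \<noteq> 0"
  shows "q (scale_of F (inverse t) a - l) = q (a - scale_of F t l) / norm t"
proof -
  have "scale_of F (inverse t) a - l = scale_of F (inverse t) (a - scale_of F t l)"
    using assms(4) by (simp add: F.scale_right_diff_distrib)
  then show ?thesis
    using assms by (simp add: F.seminorm_scale[OF q] norm_inverse divide_inverse del: F.scale_scale)
qed

text \<open>By the mean value inequality on the segment from \<open>x\<close> to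
  \<open>x + t v\<close>, the quotient deviates from \<open>D x0 v0 p0\<close> by no more than
  \<open>D\<close> oscillates near that point, so joint continuity of \<open>D\<close> makes the
  limit uniform in point, direction and parameter. The parameter \<open>p\<close> will hold the
  other directions of an iterated derivative. Additivity of derivatives and the chain rule rest on
  this uniformity.\<close>

lemma strong_differentiability:
  fixes H :: "'e \<Rightarrow> 'p \<Rightarrow> 'f" and P :: "'p topology"
  assumes U: "openin (top_of E) U" and q: "seminorm_on F q"
    and dd: "\<And>x v p. x \<in> U \<Longrightarrow> v \<in> carrier_of E \<Longrightarrow> p \<in> topspace P \<Longrightarrow> has_dd (\<lambda>u. H u p) x v (D x v p)"
    and H: "\<And>x p. x \<in> U \<Longrightarrow> p \<in> topspace P \<Longrightarrow> H x p \<in> carrier_of F"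
    and cont: "continuous_map (prod_topology (subtopology (top_of E) U) (prod_topology (top_of E) P)) (top_of F)
      (\<lambda>z. D (fst z) (fst (snd z)) (snd (snd z)))"
    and x0: "x0 \<in> U" and v0: "v0 \<in> carrier_of E" and p0: "p0 \<in> topspace P" and e: "e > 0"
  shows "\<exists>A V Q \<delta>. openin (top_of E) A \<and> x0 \<in> A \<and> openin (top_of E) V \<and> v0 \<in> V \<and>
    openin P Q \<and> p0 \<in> Q \<and> \<delta> > 0 \<and> A \<subseteq> U \<and>
    (\<forall>x\<in>A. \<forall>v\<in>V. \<forall>p\<in>Q. \<forall>t. norm t < \<delta> \<longrightarrow> x + scale_of E t v \<in> U \<and>
      (t \<noteq> 0 \<longrightarrow> q (scale_of F (inverse t) (H (x + scale_of E t v) p - H x p) - D x0 v0 p0) < e))"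
proof -
  let ?Y = "prod_topology (prod_topology (top_of E) euclidean) (prod_topology (top_of E) P)"
  let ?line = "\<lambda>z. fst (fst z) + scale_of E (snd (fst z)) (fst (snd z))"
  define W where "W = {z \<in> topspace ?Y. ?line z \<in> U}"
  have line: "continuous_map ?Y (top_of E) ?line"
    by (intro E.continuous_add E.continuous_scale continuous_map_projections)
  have W: "openin ?Y W"
    unfolding W_def by (rule openin_continuous_map_preimage[OF line U])
  have "continuous_map (subtopology ?Y W) (prod_topology (subtopology (top_of E) U) (prod_topology (top_of E) P))
      (\<lambda>z. (?line z, snd z))"
    by (intro continuous_map_pairedI continuous_map_into_subtopology
        continuous_map_from_subtopology line continuous_map_snd) (auto simp: W_def)
  from continuous_map_compose[OF this cont]
  have c: "continuous_map (subtopology ?Y W) (top_of F) (\<lambda>z. D (?line z) (fst (snd z)) (snd (snd z)))"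
    by (simp add: o_def)
  have mem: "((x0, 0), (v0, p0)) \<in> topspace (subtopology ?Y W)"
    using x0 v0 p0 openin_subset[OF U] by (auto simp: W_def)
  let ?z0 = "((x0, 0::'k), (v0, p0))"
  \<comment> \<open>The mean value inequality yields only a weak inequality; the factor
    \<open>1/2\<close> makes the final one strict.\<close>
  have "e / 2 > 0"
    using e by simp
  then obtain O' where O': "openin (subtopology ?Y W) O'" "?z0 \<in> O'"
    and close0: "\<forall>z\<in>O'. D (?line z) (fst (snd z)) (snd (snd z)) \<in> carrier_of F \<and>
      q (D (?line z) (fst (snd z)) (snd (snd z)) - D (?line ?z0) (fst (snd ?z0)) (snd (snd ?z0))) < e / 2"
    by (rule F.continuous_mapD[OF c q mem])
  have close: "D (?line z) (fst (snd z)) (snd (snd z)) \<in> carrier_of F \<and>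
      q (D (?line z) (fst (snd z)) (snd (snd z)) - D x0 v0 p0) < e / 2" if "z \<in> O'" for z
    using bspec[OF close0 that] by simp
  have O'_sub: "O' \<subseteq> W" and O'_open: "openin ?Y O'"
    using O'(1) by (simp_all add: openin_open_subtopology[OF W])
  obtain AT VQ where box1: "openin (prod_topology (top_of E) euclidean) AT" "openin (prod_topology (top_of E) P) VQ"
    "(x0, 0) \<in> AT" "(v0, p0) \<in> VQ" "AT \<times> VQ \<subseteq> O'"
    using O'_open O'(2) by (rule prod_nbhd)
  obtain A T where A: "openin (top_of E) A" "openin euclidean T" "x0 \<in> A" "0 \<in> T" "A \<times> T \<subseteq> AT"
    using box1(1,3) by (rule prod_nbhd)
  obtain V Q where V: "openin (top_of E) V" "openin P Q" "v0 \<in> V" "p0 \<in> Q" "V \<times> Q \<subseteq> VQ"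
    using box1(2,4) by (rule prod_nbhd)
  obtain \<delta> where \<delta>: "\<delta> > 0" "ball 0 \<delta> \<subseteq> T"
    using A(2,4) unfolding open_openin[symmetric] open_contains_ball by auto
  have box: "((x, t), (v, p)) \<in> O'" if "x \<in> A" "norm t < \<delta>" "v \<in> V" "p \<in> Q" for x t v p
    using that A(5) V(5) box1(5) \<delta>(2) by (auto simp: subset_iff)
  have inU: "x + scale_of E t v \<in> U" if "x \<in> A" "norm t < \<delta>" "v \<in> V" "p \<in> Q" for x t v p
    using box[OF that] O'_sub by (auto simp: W_def)
  have D0: "D x0 v0 p0 \<in> carrier_of F"
    using has_dd_in[OF dd[OF x0 v0 p0]] .
  have main: "q (scale_of F (inverse t) (H (x + scale_of E t v) p - H x p) - D x0 v0 p0) < e"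
    if x: "x \<in> A" and t: "norm t < \<delta>" "t \<noteq> 0" and v: "v \<in> V" and p: "p \<in> Q" for x t v p
  proof -
    have vE: "v \<in> carrier_of E" and pP: "p \<in> topspace P"
      using v p openin_subset V by blast+
    \<comment> \<open>The segment is run through by a real \<open>s\<close> even when
      \<open>t\<close> is a complex scalar, so that the real mean value inequality applies.\<close>
    define y where "y s = x + scale_of E (of_real s * t) v" for s :: real
    have small: "norm (of_real s * t) < \<delta>" if "0 \<le> s" "s \<le> 1" for s :: real
      using that t(1) mult_right_mono[of s 1 "norm t"] by (simp add: norm_mult)
    have yU: "y s \<in> U" if "0 \<le> s" "s \<le> 1" for s
      unfolding y_def using inU[OF x small[OF that] v p] .
    have close': "q (D (y s) v p - D x0 v0 p0) < e / 2" "D (y s) v p \<in> carrier_of F" if "0 \<le> s" "s \<le> 1" for s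
      using close[OF box[OF x small[OF that] v p]] by (auto simp: y_def)
    have "q (H (y 1) p - H (y 0) p - scale_of F t (D x0 v0 p0)) \<le> norm t * (e / 2)"
    proof (rule F.mean_value_inequality[OF q, of "\<lambda>s. H (y s) p" "\<lambda>s. scale_of F t (D (y s) v p)"])
      fix s :: real assume s: "0 \<le> s" "s \<le> 1"
      show "H (y s) p \<in> carrier_of F"
        using H yU[OF s] pP by blast
      show "scale_of F t (D (y s) v p) \<in> carrier_of F"
        using close'(2)[OF s] by simp
      have "q (scale_of F t (D (y s) v p - D x0 v0 p0)) \<le> norm t * (e / 2)"
        using close'[OF s] D0 by (subst F.seminorm_scale[OF q]) (auto intro!: mult_left_mono simp del: times_divide_eq_right)
      then show "q (scale_of F t (D (y s) v p) - scale_of F t (D x0 v0 p0)) \<le> norm t * (e / 2)"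
        by (simp add: F.scale_right_diff_distrib)
      fix e' :: real assume e': "e' > 0"
      have lcsE: "lcs E" "lcs F" by unfold_locales
      have "e' / norm t > 0" "\<forall>u\<in>U. H u p \<in> carrier_of F"
        using e' t(2) H pP by auto
      from has_directional_derivativeD[where U = U, OF lcsE dd[OF yU[OF s] vE pP] q this yU[OF s]]
      obtain d where d: "d > 0"
        "\<forall>r. norm r < d \<and> y s + scale_of E r v \<in> U \<longrightarrow>
          q (H (y s + scale_of E r v) p - H (y s) p - scale_of F r (D (y s) v p)) \<le> e' / norm t * norm r"
        by (elim exE conjE)
      show "\<exists>d>0. \<forall>u. 0 \<le> u \<and> u \<le> 1 \<and> \<bar>u - s\<bar> < d \<longrightarrow>
        q (H (y u) p - H (y s) p - scale_of F (of_real (u - s)) (scale_of F t (D (y s) v p))) \<le> e' * \<bar>u - s\<bar>"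
      proof (intro exI[of _ "d / norm t"] conjI allI impI)
        show "0 < d / norm t" using d t(2) by simp
        fix u assume u: "0 \<le> u \<and> u \<le> 1 \<and> \<bar>u - s\<bar> < d / norm t"
        let ?r = "of_real (u - s) * t"
        have yu: "y s + scale_of E ?r v = y u"
          by (simp add: y_def algebra_simps)
        have r: "norm ?r = \<bar>u - s\<bar> * norm t"
          by (simp add: norm_mult del: of_real_diff)
        then have "norm ?r < d"
          using u t(2) by (simp add: field_simps)
        then have "q (H (y u) p - H (y s) p - scale_of F ?r (D (y s) v p)) \<le> e' / norm t * norm ?r"
          using d(2)[rule_format, of ?r] yU[of u] u unfolding yu by blast
        then show "q (H (y u) p - H (y s) p - scale_of F (of_real (u - s)) (scale_of F t (D (y s) v p))) \<le> e' * \<bar>u - s\<bar>"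
          using t(2) unfolding r by simp
      qed
    qed (use D0 in auto)
    then have "q (H (x + scale_of E t v) p - H x p - scale_of F t (D x0 v0 p0)) \<le> norm t * (e / 2)"
      by (simp add: y_def)
    moreover have "x + scale_of E t v \<in> U" "x \<in> U"
      using yU[of 1] yU[of 0] by (auto simp: y_def)
    moreover have "norm t * (e / 2) < norm t * e"
      using t(2) e by simp
    ultimately show ?thesis
      using t(2) D0 pP H by (subst seminorm_quotient[OF q]) (auto simp: divide_less_eq mult.commute intro: F.diff_in)
  qed
  have "A \<subseteq> U"
    using inU[of _ 0 v0 p0] \<delta>(1) V(3,4) by auto
  moreover have "\<forall>x\<in>A. \<forall>v\<in>V. \<forall>p\<in>Q. \<forall>t. norm t < \<delta> \<longrightarrow> x + scale_of E t v \<in> U \<and>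
      (t \<noteq> 0 \<longrightarrow> q (scale_of F (inverse t) (H (x + scale_of E t v) p - H x p) - D x0 v0 p0) < e)"
    using inU main by auto
  ultimately show ?thesis
    using A(1,3) V(1-4) \<delta>(1) by (intro exI[of _ A] exI[of _ V] exI[of _ Q] exI[of _ \<delta>] conjI)
qed

end

section \<open>Iterated derivatives\<close>

declare iterated_derivative.simps(2) [simp del]

lemma limitin_filterlim:
  assumes "limitin X f l G" "filterlim h G F"
  shows "limitin X (\<lambda>t. f (h t)) l F"
  using assms unfolding limitin_def by (auto intro: eventually_compose_filterlim)

text \<open>The parameters in \<open>P\<close> are held fixed during differentiation. In the main
  instance \<open>P\<close> consists of the first \<open>j\<close> directions, \<open>H\<close> is
  the derivative of order \<open>j\<close>, and \<open>D\<close> is the one of order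
  \<open>j + 1\<close>.\<close>

definition (in lcs_pair) C1_family ::
    "'e set \<Rightarrow> 'p topology \<Rightarrow> ('e \<Rightarrow> 'p \<Rightarrow> 'f) \<Rightarrow> ('e \<Rightarrow> 'e \<Rightarrow> 'p \<Rightarrow> 'f) \<Rightarrow> bool"
  where "C1_family U P H D \<longleftrightarrow> openin (top_of E) U \<and>
    (\<forall>x\<in>U. \<forall>v\<in>carrier_of E. \<forall>p\<in>topspace P. has_dd (\<lambda>u. H u p) x v (D x v p)) \<and>
    (\<forall>x\<in>U. \<forall>p\<in>topspace P. H x p \<in> carrier_of F) \<and>
    continuous_map (prod_topology (subtopology (top_of E) U) (prod_topology (top_of E) P)) (top_of F)
      (\<lambda>z. D (fst z) (fst (snd z)) (snd (snd z)))"

context lcs_pair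
begin

text \<open>With this seminorm, \<open>C1_family_eventually\<close> can be invoked for its
  membership statements alone.\<close>

lemma zero_seminorm: "seminorm_on F (\<lambda>x. 0)"
  by (simp add: seminorm_on_def)

context
  fixes U :: "'e set" and P :: "'p topology" and H D
  assumes C1: "C1_family U P H D"
begin

lemma C1_family_dd: "x \<in> U \<Longrightarrow> v \<in> carrier_of E \<Longrightarrow> p \<in> topspace P \<Longrightarrow> has_dd (\<lambda>u. H u p) x v (D x v p)"
  using C1 by (simp add: C1_family_def)

lemma C1_family_eventually:
  assumes "seminorm_on F q" "e > 0" and x0: "x0 \<in> U" "v \<in> carrier_of E" "p0 \<in> topspace P"
    and x: "limitin (top_of E) x x0 (at (0::'k))" and w: "limitin (top_of E) w v (at 0)"
    and p: "limitin P p p0 (at 0)"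
  shows "\<forall>\<^sub>F t in at 0. x t \<in> U \<and> x t + scale_of E t (w t) \<in> U \<and> p t \<in> topspace P \<and>
    q (scale_of F (inverse t) (H (x t + scale_of E t (w t)) (p t) - H (x t) (p t)) - D x0 v p0) < e"
proof -
  have "\<exists>A V Q \<delta>. openin (top_of E) A \<and> x0 \<in> A \<and> openin (top_of E) V \<and> v \<in> V \<and>
    openin P Q \<and> p0 \<in> Q \<and> \<delta> > 0 \<and> A \<subseteq> U \<and>
    (\<forall>x\<in>A. \<forall>v'\<in>V. \<forall>p\<in>Q. \<forall>t. norm t < \<delta> \<longrightarrow> x + scale_of E t v' \<in> U \<and>
      (t \<noteq> 0 \<longrightarrow> q (scale_of F (inverse t) (H (x + scale_of E t v') p - H x p) - D x0 v p0) < e))"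
  proof (rule strong_differentiability[where U = U and H = H and D = D and P = P and q = q
        and ?x0.0 = x0 and ?v0.0 = v and ?p0.0 = p0 and e = e])
    show "openin (top_of E) U"
      using C1 by (simp add: C1_family_def)
    show "continuous_map (prod_topology (subtopology (top_of E) U) (prod_topology (top_of E) P)) (top_of F)
      (\<lambda>z. D (fst z) (fst (snd z)) (snd (snd z)))"
      using C1 by (simp add: C1_family_def)
    show "has_dd (\<lambda>u. H u p) x v (D x v p)" if "x \<in> U" "v \<in> carrier_of E" "p \<in> topspace P" for x v p
      using C1_family_dd that .
    show "H x p \<in> carrier_of F" if "x \<in> U" "p \<in> topspace P" for x p
      using C1 that by (simp add: C1_family_def)
  qed (fact assms)+
  then obtain A V Q \<delta> where *: "openin (top_of E) A" "x0 \<in> A" "openin (top_of E) V" "v \<in> V"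
    "openin P Q" "p0 \<in> Q" "\<delta> > 0" "A \<subseteq> U"
    "\<forall>x\<in>A. \<forall>v'\<in>V. \<forall>p\<in>Q. \<forall>t. norm t < \<delta> \<longrightarrow> x + scale_of E t v' \<in> U \<and>
      (t \<noteq> 0 \<longrightarrow> q (scale_of F (inverse t) (H (x + scale_of E t v') p - H x p) - D x0 v p0) < e)"
    by (elim exE conjE)
  have 1: "\<forall>\<^sub>F t in at 0. x t \<in> A"
    using x *(1,2) by (simp add: limitin_def)
  have 2: "\<forall>\<^sub>F t in at 0. w t \<in> V"
    using w *(3,4) by (simp add: limitin_def)
  have 3: "\<forall>\<^sub>F t in at 0. p t \<in> Q"
    using p *(5,6) by (simp add: limitin_def)
  have 4: "\<forall>\<^sub>F t in at (0::'k). t \<noteq> 0 \<and> norm t < \<delta>"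
    using *(7) unfolding eventually_at by (auto simp: dist_norm)
  have Q: "Q \<subseteq> topspace P"
    using *(5) by (rule openin_subset)
  from 1 2 3 4 show ?thesis
    by eventually_elim (use *(8,9) Q in blast)
qed

text \<open>Strong differentiability lets the point, the direction and the parameter all move with
  \<open>t\<close>, as they do in the proofs of additivity and of the chain rule.\<close>

lemma C1_family_limit:
  assumes x0: "x0 \<in> U" "v \<in> carrier_of E" "p0 \<in> topspace P"
    and x: "limitin (top_of E) x x0 (at (0::'k))" and w: "limitin (top_of E) w v (at 0)"
    and p: "limitin P p p0 (at 0)"
  shows "limitin (top_of F)
    (\<lambda>t. scale_of F (inverse t) (H (x t + scale_of E t (w t)) (p t) - H (x t) (p t))) (D x0 v p0) (at 0)"
  unfolding F.limitin_iff
proof (intro conjI allI impI)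
  show "D x0 v p0 \<in> carrier_of F"
    using has_dd_in[OF C1_family_dd[OF x0]] .
  show "\<forall>\<^sub>F t in at 0. q (scale_of F (inverse t) (H (x t + scale_of E t (w t)) (p t) - H (x t) (p t)) - D x0 v p0) < e"
    if "seminorm_on F q" "0 < e" for q e
    using C1_family_eventually[OF that assms] by eventually_elim simp
  have H: "\<forall>x\<in>U. \<forall>p\<in>topspace P. H x p \<in> carrier_of F"
    using C1 by (simp add: C1_family_def)
  show "\<forall>\<^sub>F t in at 0. scale_of F (inverse t) (H (x t + scale_of E t (w t)) (p t) - H (x t) (p t)) \<in> carrier_of F"
    using C1_family_eventually[OF zero_seminorm zero_less_one assms]
    by eventually_elim (use H in simp)
qed

text \<open>To move by \<open>t (v + w)\<close> is to move by \<open>t v\<close> and then by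
  \<open>t w\<close>. The second difference quotient has the moving base point
  \<open>x + t v\<close>; that it still tends to \<open>D x w p\<close> is strong
  differentiability.\<close>

lemma C1_family_additive:
  assumes x: "x \<in> U" and v: "v \<in> carrier_of E" and w: "w \<in> carrier_of E" and p: "p \<in> topspace P"
  shows "D x (v + w) p = D x v p + D x w p"
proof (rule has_dd_unique[OF C1_family_dd[OF x E.add_in[OF v w] p]])
  have xE: "x \<in> carrier_of E"
    using x C1 openin_subset unfolding C1_family_def by blast
  have lim: "limitin (top_of E) (\<lambda>t. x + scale_of E t v) x (at 0)"
    using E.limitin_add[OF _ E.limitin_scale[OF tendsto_ident_at], of "\<lambda>_. x" x 0 UNIV "\<lambda>_. v" v] xE v
    by simp
  have "limitin (top_of F) (\<lambda>t. scale_of F (inverse t) (H (x + scale_of E t v + scale_of E t w) p - H (x + scale_of E t v) p))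
      (D x w p) (at 0)"
    using C1_family_limit[OF x w p lim, of "\<lambda>_. w" "\<lambda>_. p"] w p by simp
  from F.limitin_add[OF C1_family_dd[OF x v p, unfolded has_directional_derivative_def] this]
  show "has_dd (\<lambda>u. H u p) x (v + w) (D x v p + D x w p)"
    unfolding has_directional_derivative_def
    by (simp add: F.scale_right_distrib[symmetric] E.scale_right_distrib add.assoc del: F.scale_right_diff_distrib)
qed

end

lemma has_dd_scale_direction:
  assumes "has_dd f x v l"
  shows "has_dd f x (scale_of E c v) (scale_of F c l)"
proof (cases "c = 0")
  case True
  then show ?thesis
    by (simp add: has_directional_derivative_def)
next
  case False
  have "filterlim (\<lambda>t. t * c) (at 0) (at 0)"
    using False by (auto simp: filterlim_at eventually_at_filter intro!: tendsto_eq_intros)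
  from F.limitin_scale[OF tendsto_const limitin_filterlim[OF assms[unfolded has_directional_derivative_def] this], of c]
  moreover have "c * (inverse t * inverse c) = inverse t" for t
    using False by simp
  ultimately show ?thesis
    using False unfolding has_directional_derivative_def by simp
qed

abbreviation it :: "('e \<Rightarrow> 'f) \<Rightarrow> nat \<Rightarrow> 'e \<Rightarrow> (nat \<Rightarrow> 'e) \<Rightarrow> 'f" where
  "it \<equiv> iterated_derivative E F"

lemma it_cong: "(\<And>i. i < j \<Longrightarrow> y i = y' i) \<Longrightarrow> it f j x y = it f j x y'"
proof (induction j arbitrary: x)
  case (Suc j)
  then have "it f j u y = it f j u y'" for u
    by simp
  then show ?case
    using Suc.prems by (simp add: iterated_derivative.simps)
qed simp

lemma Ck_has_dd:
  assumes "Ck_on k E F U f" "j < k" "x \<in> U" "\<forall>i\<le>j. y i \<in> carrier_of E"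
  shows "has_dd (\<lambda>u. it f j u y) x (y j) (it f (Suc j) x y)"
proof -
  \<comment> \<open>\<open>Ck_on\<close> quantifies over families that are \<open>undefined\<close>
    from index \<open>Suc j\<close> on; \<open>it_cong\<close> then removes the restriction
    again.\<close>
  let ?y = "restrict y {..<Suc j}"
  have "?y \<in> Pi\<^sub>E {..<Suc j} (\<lambda>_. carrier_of E)"
    using assms(4) by auto
  then obtain l where "has_dd (\<lambda>u. it f j u ?y) x (?y j) l"
    using assms(1-3) unfolding Ck_on_def by blast
  moreover have "it f j u ?y = it f j u y" for u
    by (rule it_cong) simp
  ultimately have l: "has_dd (\<lambda>u. it f j u y) x (y j) l"
    by simp
  then have "it f (Suc j) x y = l"
    using has_dd_unique by (auto simp: iterated_derivative.simps)
  then show ?thesis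
    using l by simp
qed

lemma Ck_continuous:
  "Ck_on k E F U f \<Longrightarrow> j \<le> k \<Longrightarrow> continuous_map
      (prod_topology (subtopology (top_of E) U) (product_topology (\<lambda>_. top_of E) {..<j}))
      (top_of F) (\<lambda>z. it f j (fst z) (snd z))"
  by (simp add: Ck_on_def case_prod_unfold)

lemma Ck_continuous_map:
  assumes "Ck_on k E F U f"
  shows "continuous_map (subtopology (top_of E) U) (top_of F) f"
proof -
  \<comment> \<open>For order zero the space of directions is a product over the empty index set,
    whose only point is the function with constant value \<open>undefined\<close>.\<close>
  have "continuous_map (subtopology (top_of E) U)
      (prod_topology (subtopology (top_of E) U) (product_topology (\<lambda>_. top_of E) {..<0::nat})) (\<lambda>x. (x, \<lambda>i. undefined))"
    by (intro continuous_map_pairedI) simp_all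
  from continuous_map_compose[OF this Ck_continuous[OF assms le0]] show ?thesis
    by (simp add: o_def)
qed

lemma it_in:
  assumes "Ck_on k E F U f" "j \<le> k" "x \<in> U" "x \<in> carrier_of E" "\<forall>i<j. y i \<in> carrier_of E"
  shows "it f j x y \<in> carrier_of F"
proof -
  have "(x, restrict y {..<j}) \<in> topspace (prod_topology (subtopology (top_of E) U) (product_topology (\<lambda>_. top_of E) {..<j}))"
    using assms by auto
  from continuous_map_in[OF Ck_continuous[OF assms(1,2)] this]
  have "it f j x (restrict y {..<j}) \<in> carrier_of F"
    by simp
  also have "it f j x (restrict y {..<j}) = it f j x y"
    by (rule it_cong) simp
  finally show ?thesis .
qed

text \<open>Directions are numbered in the order of differentiation, so the new one enters at index
  \<open>j\<close>, behind those that serve as parameters.\<close>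

lemma Ck_C1_family:
  assumes "Ck_on k E F U f" "j < k" "openin (top_of E) U"
  shows "C1_family U (product_topology (\<lambda>_. top_of E) {..<j}) (it f j) (\<lambda>x v p. it f (Suc j) x (p(j := v)))"
  unfolding C1_family_def
proof (intro conjI ballI)
  let ?P = "product_topology (\<lambda>_. top_of E) {..<j}"
  let ?X = "prod_topology (subtopology (top_of E) U) (prod_topology (top_of E) ?P)"
  fix x p assume x: "x \<in> U" and p: "p \<in> topspace ?P"
  have xE: "x \<in> carrier_of E" and pE: "\<And>i. i < j \<Longrightarrow> p i \<in> carrier_of E"
    using x p openin_subset[OF assms(3)] by (auto simp: PiE_iff)
  then show "it f j x p \<in> carrier_of F"
    using it_in[OF assms(1) _ x xE, of j p] assms(2) by simp
  fix v assume v: "v \<in> carrier_of E"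
  have "has_dd (\<lambda>u. it f j u (p(j := v))) x ((p(j := v)) j) (it f (Suc j) x (p(j := v)))"
    using v pE by (intro Ck_has_dd[OF assms(1,2) x]) auto
  moreover have "it f j u (p(j := v)) = it f j u p" for u
    by (rule it_cong) simp
  ultimately show "has_dd (\<lambda>u. it f j u p) x v (it f (Suc j) x (p(j := v)))"
    by simp
next
  let ?P = "product_topology (\<lambda>_. top_of E) {..<j}"
  let ?X = "prod_topology (subtopology (top_of E) U) (prod_topology (top_of E) ?P)"
  have comp: "continuous_map ?X (top_of E) (\<lambda>z. ((snd (snd z))(j := fst (snd z))) i)" if "i < Suc j" for i
  proof (cases "i = j")
    case False
    have "continuous_map ?X ?P (\<lambda>z. snd (snd z))"
      by (rule continuous_map_projections)
    from continuous_map_compose[OF this continuous_map_product_projection[of i "{..<j}" "\<lambda>_. top_of E"]]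
    show ?thesis
      using that False by (simp add: o_def)
  qed (use continuous_map_projections in simp)
  have "continuous_map ?X (product_topology (\<lambda>_. top_of E) {..<Suc j}) (\<lambda>z. (snd (snd z))(j := fst (snd z)))"
    unfolding continuous_map_componentwise
    using comp by (auto simp: extensional_def PiE_iff)
  from continuous_map_compose[OF continuous_map_pairedI[OF continuous_map_fst this] Ck_continuous[OF assms(1)]] assms(2)
  show "continuous_map ?X (top_of F) (\<lambda>z. it f (Suc j) (fst z) ((snd (snd z))(j := fst (snd z))))"
    by (simp add: o_def)
qed (fact assms)

text \<open>In the last slot, where the newest derivative acts, linearity is that of the derivative
  of a \<open>C1_family\<close>. In an earlier slot it is the identity of the previous order,
  differentiated once more.\<close>

lemma it_multilinear_upd:
  assumes f: "Ck_on k E F U f" and U: "openin (top_of E) U"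
    and "j \<le> k" "x \<in> U" "i < j" "u \<in> carrier_of E" "v \<in> carrier_of E" "\<And>l. l < j \<Longrightarrow> y l \<in> carrier_of E"
  shows "it f j x (y(i := u + v)) = it f j x (y(i := u)) + it f j x (y(i := v))"
    and "it f j x (y(i := scale_of E c u)) = scale_of F c (it f j x (y(i := u)))"
proof -
  have "it f j x (y(i := u + v)) = it f j x (y(i := u)) + it f j x (y(i := v)) \<and>
      it f j x (y(i := scale_of E c u)) = scale_of F c (it f j x (y(i := u)))"
    using assms(3-)
  proof (induction j arbitrary: x)
    case (Suc j)
    have jk: "j < k" and j: "j \<le> k"
      using Suc.prems by auto
    have dd: "has_dd (\<lambda>u. it f j u y') x (y' j) (it f (Suc j) x y')"
      if "\<And>l. l < Suc j \<Longrightarrow> y' l \<in> carrier_of E" for y'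
      using that by (intro Ck_has_dd[OF f jk \<open>x \<in> U\<close>]) auto
    show ?case
    proof (cases "i = j")
      case True
      let ?p = "restrict y {..<j}"
      have p: "?p \<in> topspace (product_topology (\<lambda>_. top_of E) {..<j})"
        using Suc.prems by auto
      have eq: "it f (Suc j) x (?p(j := w)) = it f (Suc j) x (y(i := w))" for w
        by (rule it_cong) (use True in auto)
      have add: "it f (Suc j) x (y(i := u + v)) = it f (Suc j) x (y(i := u)) + it f (Suc j) x (y(i := v))"
        using C1_family_additive[OF Ck_C1_family[OF f jk U] Suc.prems(2,4,5) p] unfolding eq .
      have "has_dd (\<lambda>w. it f j w ?p) x u (it f (Suc j) x (y(i := u)))"
        "has_dd (\<lambda>w. it f j w ?p) x (scale_of E c u) (it f (Suc j) x (y(i := scale_of E c u)))"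
        using C1_family_dd[OF Ck_C1_family[OF f jk U] Suc.prems(2) _ p] Suc.prems(4) unfolding eq by auto
      then have "it f (Suc j) x (y(i := scale_of E c u)) = scale_of F c (it f (Suc j) x (y(i := u)))"
        using has_dd_unique has_dd_scale_direction by blast
      with add show ?thesis ..
    next
      case False
      then have ij: "i < j"
        using Suc.prems by simp
      have IH_both: "it f j w (y(i := u + v)) = it f j w (y(i := u)) + it f j w (y(i := v)) \<and>
          it f j w (y(i := scale_of E c u)) = scale_of F c (it f j w (y(i := u)))" if "w \<in> U" for w
        by (rule Suc.IH[OF j that ij]) (use Suc.prems in simp_all)
      note IH = conjunct1[OF IH_both] conjunct2[OF IH_both]
      have dd': "has_dd (\<lambda>w. it f j w (y(i := a))) x (y j) (it f (Suc j) x (y(i := a)))" if "a \<in> carrier_of E" for a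
      proof -
        have "\<And>l. l < Suc j \<Longrightarrow> (y(i := a)) l \<in> carrier_of E"
          using Suc.prems that by simp
        from dd[of "y(i := a)", OF this] show ?thesis
          using False by simp
      qed
      have yj: "y j \<in> carrier_of E"
        using Suc.prems by simp
      have "it f (Suc j) x (y(i := u + v)) = it f (Suc j) x (y(i := u)) + it f (Suc j) x (y(i := v))"
        by (rule has_dd_unique[OF dd' has_dd_cong[OF U \<open>x \<in> U\<close> yj _ has_dd_add[OF dd' dd']]])
          (use IH(1) Suc.prems in simp_all)
      moreover have "it f (Suc j) x (y(i := scale_of E c u)) = scale_of F c (it f (Suc j) x (y(i := u)))"
        by (rule has_dd_unique[OF dd' has_dd_cong[OF U \<open>x \<in> U\<close> yj _ has_dd_scale[OF dd']]])
          (use IH(2) Suc.prems in simp_all)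
      ultimately show ?thesis ..
    qed
  qed simp
  then show "it f j x (y(i := u + v)) = it f j x (y(i := u)) + it f j x (y(i := v))"
    "it f j x (y(i := scale_of E c u)) = scale_of F c (it f j x (y(i := u)))"
    by auto
qed

lemma it_multilinear:
  assumes "Ck_on k E F U f" "openin (top_of E) U" "j \<le> k" "x \<in> U"
  shows "multilinear j E F (it f j x)"
  unfolding multilinear_def
  using it_multilinear_upd[OF assms(1-4)] by (auto simp: PiE_iff)

lemma it_continuous_at:
  assumes "Ck_on k E F U f" "openin (top_of E) U" "j \<le> k" "x \<in> U"
  shows "continuous_map (product_topology (\<lambda>_. top_of E) {..<j}) (top_of F) (it f j x)"
proof -
  have "continuous_map (product_topology (\<lambda>_. top_of E) {..<j})
      (prod_topology (subtopology (top_of E) U) (product_topology (\<lambda>_. top_of E) {..<j})) (\<lambda>y. (x, y))"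
    using assms(4) openin_subset[OF assms(2)] by (intro continuous_map_pairedI) auto
  from continuous_map_compose[OF this Ck_continuous[OF assms(1,3)]] show ?thesis
    by (simp add: o_def)
qed

text \<open>Iterated derivatives are definite descriptions. To avoid working with them, one guesses
  a family \<open>D\<close>, checks its derivatives and its continuity, and uniqueness of limits
  identifies it with the iterated derivatives.\<close>

lemma CkI:
  assumes U: "openin (top_of E) U"
    and zero: "\<And>x y. x \<in> U \<Longrightarrow> D 0 x y = f x"
    and dd: "\<And>j x y. j < k \<Longrightarrow> x \<in> U \<Longrightarrow> \<forall>i\<le>j. y i \<in> carrier_of E \<Longrightarrow>
      has_dd (\<lambda>u. D j u y) x (y j) (D (Suc j) x y)"
    and cont: "\<And>j. j \<le> k \<Longrightarrow> continuous_map
      (prod_topology (subtopology (top_of E) U) (product_topology (\<lambda>_. top_of E) {..<j}))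
      (top_of F) (\<lambda>z. D j (fst z) (snd z))"
  shows "Ck_on k E F U f"
    and "\<And>j x y. j \<le> k \<Longrightarrow> x \<in> U \<Longrightarrow> \<forall>i<j. y i \<in> carrier_of E \<Longrightarrow> it f j x y = D j x y"
proof -
  have dd': "has_dd (\<lambda>u. it f j u y) x (y j) (D (Suc j) x y)"
    if "\<And>x. x \<in> U \<Longrightarrow> it f j x y = D j x y" "j < k" "x \<in> U" "\<forall>i\<le>j. y i \<in> carrier_of E" for j x y
  proof (rule has_dd_cong[OF U \<open>x \<in> U\<close>])
    show "has_dd (\<lambda>u. D j u y) x (y j) (D (Suc j) x y)"
      using dd that(2-4) .
    show "D j u y = it f j u y" if "u \<in> U" for u
      using \<open>\<And>x. x \<in> U \<Longrightarrow> it f j x y = D j x y\<close> that by simp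
  qed (use that(4) in simp)
  have eq: "it f j x y = D j x y" if "j \<le> k" "x \<in> U" "\<forall>i<j. y i \<in> carrier_of E" for j x y
    using that
  proof (induction j arbitrary: x)
    case (Suc j)
    have "has_dd (\<lambda>u. it f j u y) x (y j) (D (Suc j) x y)"
      using Suc by (intro dd') auto
    then show ?case
      using has_dd_unique by (auto simp: iterated_derivative.simps)
  qed (use zero in simp)
  show "it f j x y = D j x y" if "j \<le> k" "x \<in> U" "\<forall>i<j. y i \<in> carrier_of E" for j x y
    using that by (rule eq)
  show "Ck_on k E F U f"
    unfolding Ck_on_def case_prod_unfold
  proof (intro conjI allI impI ballI)
    fix j x y assume *: "j < k" "x \<in> U" "y \<in> Pi\<^sub>E {..<Suc j} (\<lambda>_. carrier_of E)"
    from *(3) have y: "\<forall>i\<le>j. y i \<in> carrier_of E"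
      by (simp add: PiE_iff less_Suc_eq_le)
    then have eqj: "it f j x y = D j x y" if "x \<in> U" for x
      using eq[of j x y] that *(1) by simp
    from dd'[OF eqj *(1,2) y] show "\<exists>l. has_dd (\<lambda>u. it f j u y) x (y j) l"
      by blast
  next
    show "continuous_map (prod_topology (subtopology (top_of E) U) (product_topology (\<lambda>_. top_of E) {..<j}))
       (top_of F) (\<lambda>z. it f j (fst z) (snd z))" if "j \<le> k" for j
      by (rule continuous_map_eq[OF cont[OF that]]) (use eq[OF that] in \<open>simp add: PiE_iff mem_Times_iff\<close>)
  qed
qed

lemma Ck_cong:
  assumes "openin (top_of E) U" "Ck_on k E F U f" "\<And>x. x \<in> U \<Longrightarrow> f x = g x"
  shows "Ck_on k E F U g"
proof (rule CkI(1)[where D = "it f", OF assms(1)])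
  show "continuous_map (prod_topology (subtopology (top_of E) U) (product_topology (\<lambda>_. top_of E) {..<j}))
       (top_of F) (\<lambda>z. it f j (fst z) (snd z))" if "j \<le> k" for j
    using Ck_continuous assms(2) that .
  show "has_dd (\<lambda>u. it f j u y) x (y j) (it f (Suc j) x y)"
    if "j < k" "x \<in> U" "\<forall>i\<le>j. y i \<in> carrier_of E" for j x y
    using Ck_has_dd[OF assms(2) that] .
qed (use assms(3) in simp)

lemma Ck_local:
  assumes "openin (top_of E) U"
    and loc: "\<And>x. x \<in> U \<Longrightarrow> \<exists>V. openin (top_of E) V \<and> x \<in> V \<and> Ck_on k E F V f"
  shows "Ck_on k E F U f"
proof (rule CkI(1)[where D = "it f", OF assms(1)])
  show "has_dd (\<lambda>u. it f j u y) x (y j) (it f (Suc j) x y)"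
    if "j < k" "x \<in> U" "\<forall>i\<le>j. y i \<in> carrier_of E" for j x y
    using loc[OF that(2)] Ck_has_dd[OF _ that(1) _ that(3)] by blast
  fix j assume "j \<le> k"
  let ?P = "product_topology (\<lambda>_. top_of E) {..<j}"
  let ?X = "prod_topology (subtopology (top_of E) U) ?P"
  show "continuous_map ?X (top_of F) (\<lambda>z. it f j (fst z) (snd z))"
  proof (rule continuous_map_local)
    fix z assume z: "z \<in> topspace ?X"
    then obtain V where V: "openin (top_of E) V" "fst z \<in> V" "Ck_on k E F V f"
      using loc[of "fst z"] by auto
    have "continuous_map (prod_topology (subtopology (top_of E) (V \<inter> U)) ?P) (top_of F) (\<lambda>z. it f j (fst z) (snd z))"
      using continuous_map_from_subtopology[OF Ck_continuous[OF V(3) \<open>j \<le> k\<close>], of "U \<times> topspace ?P"]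
      unfolding subtopology_prod_left subtopology_subtopology .
    moreover have "subtopology ?X ((V \<inter> U) \<times> topspace ?P) = prod_topology (subtopology (top_of E) (V \<inter> U)) ?P"
      unfolding subtopology_prod_left subtopology_subtopology by (metis inf_left_idem inf_commute)
    moreover have "openin ?X ((V \<inter> U) \<times> topspace ?P)"
      unfolding openin_prod_Times_iff using openin_subtopology_Int[OF V(1), of U] openin_topspace[of ?P] by blast
    ultimately show "\<exists>W. openin ?X W \<and> z \<in> W \<and> continuous_map (subtopology ?X W) (top_of F) (\<lambda>z. it f j (fst z) (snd z))"
      using z V(2) by (intro exI[of _ "(V \<inter> U) \<times> topspace ?P"]) (simp add: mem_Times_iff)
  qed
qed simp

end

section \<open>Derivatives along curves\<close>

lemma (in lcs) limitin_of_quotient: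
  assumes b: "limitin (top_of E) (\<lambda>t. scale_of E (inverse t) (a t - a0)) b (at 0)" and a0: "a0 \<in> carrier_of E"
  shows "limitin (top_of E) a a0 (at 0)"
proof -
  have "limitin (top_of E) (\<lambda>t. a0 + scale_of E t (scale_of E (inverse t) (a t - a0)))
      (a0 + scale_of E 0 b) (at 0)"
    using a0 by (intro limitin_add limitin_scale b tendsto_ident_at) simp
  moreover have "\<forall>\<^sub>F t in at 0. a0 + scale_of E t (scale_of E (inverse t) (a t - a0)) = a t"
    by (auto simp: eventually_at_filter)
  ultimately show ?thesis
    using limitin_transform_eventually[of _ a] by simp
qed

context lcs_pair
begin

text \<open>The product rule for multilinear maps: the arguments are exchanged one at a time and the
  differences telescope. In step \<open>n\<close> the slots before \<open>n\<close> already hold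
  \<open>a j t\<close> and the later ones still \<open>a0 j\<close>; all of them tend to
  \<open>a0 j\<close>, while slot \<open>n\<close> carries the difference quotient with limit
  \<open>b n\<close>.\<close>

lemma multilinear_quotient:
  assumes ml: "multilinear m E F \<beta>"
    and cont: "continuous_map (product_topology (\<lambda>_. top_of E) {..<m}) (top_of F) \<beta>"
    and a0: "\<And>i. i < m \<Longrightarrow> a0 i \<in> carrier_of E"
    and a: "\<And>i. i < m \<Longrightarrow> \<forall>\<^sub>F t in at 0. a i t \<in> carrier_of E"
    and b: "\<And>i. i < m \<Longrightarrow> limitin (top_of E) (\<lambda>t. scale_of E (inverse t) (a i t - a0 i)) (b i) (at 0)"
  shows "limitin (top_of F) (\<lambda>t. scale_of F (inverse t) (\<beta> (\<lambda>i\<in>{..<m}. a i t) - \<beta> (\<lambda>i\<in>{..<m}. a0 i)))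
    (\<Sum>i<m. \<beta> (\<lambda>j\<in>{..<m}. if j = i then b i else a0 j)) (at 0)"
proof -
  define c where "c n t = (\<lambda>j\<in>{..<m}. if j < n then a j t else a0 j)" for n t
  have a_lim: "limitin (top_of E) (a i) (a0 i) (at 0)" if "i < m" for i
    using E.limitin_of_quotient[OF b a0] that by blast
  have ev: "\<forall>\<^sub>F t in at 0. \<forall>i\<in>{..<m}. a i t \<in> carrier_of E"
    using a by (intro eventually_ball_finite) auto
  have main: "limitin (top_of F) (\<lambda>t. scale_of F (inverse t) (\<beta> (c n t) - \<beta> (c 0 t)))
    (\<Sum>i<n. \<beta> (\<lambda>j\<in>{..<m}. if j = i then b i else a0 j)) (at 0)" if "n \<le> m" for n
    using that
  proof (induction n)
    case (Suc n)
    then have n: "n < m" by simp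
    define w where "w t = (c n t)(n := scale_of E (inverse t) (a n t - a0 n))" for t
    let ?w0 = "\<lambda>j\<in>{..<m}. if j = n then b n else a0 j"
    have "limitin (product_topology (\<lambda>_. top_of E) {..<m}) w ?w0 (at 0)"
      unfolding limitin_componentwise
    proof (intro conjI ballI)
      show "\<forall>\<^sub>F t in at 0. w t \<in> topspace (product_topology (\<lambda>_. top_of E) {..<m})"
        using ev by eventually_elim (use n a0 in \<open>simp add: c_def w_def PiE_iff extensional_def\<close>)
      fix i assume "i \<in> {..<m}"
      then show "limitin (top_of E) (\<lambda>t. w t i) (?w0 i) (at 0)"
        using b[of i] a_lim[of i] a0[of i] n by (cases "i = n"; cases "i < n") (simp_all add: c_def w_def)
    qed simp
    from limitin_compose[OF cont this]
    have "limitin (top_of F) (\<lambda>t. \<beta> (w t)) (\<beta> ?w0) (at 0)" .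
    moreover have "\<forall>\<^sub>F t in at 0. \<beta> (w t) = scale_of F (inverse t) (\<beta> (c (Suc n) t) - \<beta> (c n t))"
      using ev
    proof eventually_elim
      fix t assume at: "\<forall>i\<in>{..<m}. a i t \<in> carrier_of E"
      have cP: "c n t \<in> Pi\<^sub>E {..<m} (\<lambda>_. carrier_of E)"
        using at a0 by (simp add: c_def w_def PiE_iff)
      have an: "a n t \<in> carrier_of E" "a0 n \<in> carrier_of E"
        using at a0 n by auto
      have 1: "c (Suc n) t = (c n t)(n := a n t)" "c n t = (c n t)(n := a0 n)"
        using n by (auto simp: c_def fun_eq_iff)
      have "\<beta> ((c n t)(n := (a n t - a0 n) + a0 n)) = \<beta> ((c n t)(n := a n t - a0 n)) + \<beta> ((c n t)(n := a0 n))"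
        using ml cP n an unfolding multilinear_def by (meson E.diff_in)
      then have "\<beta> (c (Suc n) t) = \<beta> ((c n t)(n := a n t - a0 n)) + \<beta> (c n t)"
        using 1 by simp
      moreover have "\<beta> (w t) = scale_of F (inverse t) (\<beta> ((c n t)(n := a n t - a0 n)))"
        using ml cP n an unfolding w_def multilinear_def by (meson E.diff_in)
      ultimately show "\<beta> (w t) = scale_of F (inverse t) (\<beta> (c (Suc n) t) - \<beta> (c n t))"
        by simp
    qed
    ultimately have lim: "limitin (top_of F) (\<lambda>t. scale_of F (inverse t) (\<beta> (c (Suc n) t) - \<beta> (c n t))) (\<beta> ?w0) (at 0)"
      by (rule limitin_transform_eventually[rotated])
    have telescope: "scale_of F r (x - y) + scale_of F r (z - x) = scale_of F r (z - y)" for r x y z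
      by (simp add: F.scale_right_distrib[symmetric])
    have "n \<le> m"
      using n by simp
    from F.limitin_add[OF Suc.IH[OF this] lim] show ?case
      by (simp only: telescope sum.lessThan_Suc)
  qed simp
  have "c m t = (\<lambda>i\<in>{..<m}. a i t)" "c 0 t = (\<lambda>i\<in>{..<m}. a0 i)" for t
    by (auto simp: c_def fun_eq_iff)
  with main[OF order_refl] show ?thesis
    by (simp only:)
qed

text \<open>Point and directions move together. The difference is split by first moving the point,
  with the current directions as parameters of a \<open>C1_family\<close>, and then moving the
  directions at the fixed point \<open>x0\<close>, where the derivative is multilinear. The curves
  enter only through their quotients at \<open>0\<close>, since in the chain rule they are values of
  \<open>f\<close> and of its derivatives.\<close>

lemma it_along_curve:
  assumes f: "Ck_on k E F U f" and U: "openin (top_of E) U" and m: "m < k" and x0: "x0 \<in> U"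
    and z: "limitin (top_of E) (\<lambda>t. scale_of E (inverse t) (z t - x0)) v (at 0)"
    and a0: "\<And>i. i < m \<Longrightarrow> a0 i \<in> carrier_of E"
    and a: "\<And>i. i < m \<Longrightarrow> \<forall>\<^sub>F t in at 0. a i t \<in> carrier_of E"
    and b: "\<And>i. i < m \<Longrightarrow> limitin (top_of E) (\<lambda>t. scale_of E (inverse t) (a i t - a0 i)) (b i) (at 0)"
  shows "limitin (top_of F) (\<lambda>t. scale_of F (inverse t) (it f m (z t) (\<lambda>i. a i t) - it f m x0 a0))
    (it f (Suc m) x0 (a0(m := v)) + (\<Sum>i<m. it f m x0 (a0(i := b i)))) (at 0)"
proof -
  let ?P = "product_topology (\<lambda>_. top_of E) {..<m}"
  have x0E: "x0 \<in> carrier_of E"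
    using x0 openin_subset[OF U] by blast
  have vE: "v \<in> carrier_of E"
    using z by (simp add: limitin_def)
  have a_lim: "limitin (top_of E) (a i) (a0 i) (at 0)" if "i < m" for i
    using E.limitin_of_quotient[OF b a0] that by blast
  have ev: "\<forall>\<^sub>F t in at 0. \<forall>i\<in>{..<m}. a i t \<in> carrier_of E"
    using a by (intro eventually_ball_finite) auto
  define p where "p t = (\<lambda>i\<in>{..<m}. a i t)" for t
  let ?p0 = "\<lambda>i\<in>{..<m}. a0 i"
  have p0: "?p0 \<in> topspace ?P"
    using a0 by (simp add: PiE_iff)
  have p_lim: "limitin ?P p ?p0 (at 0)"
    unfolding limitin_componentwise
  proof (intro conjI ballI)
    show "\<forall>\<^sub>F t in at 0. p t \<in> topspace ?P"
      using ev by eventually_elim (simp add: p_def PiE_iff)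
  qed (use a_lim in \<open>simp_all add: p_def\<close>)
  \<comment> \<open>The curve is written as \<open>z t = x0 + t w\<close> with its own difference
    quotient as the direction \<open>w\<close>, which tends to \<open>v\<close>.\<close>
  have "limitin (top_of F) (\<lambda>t. scale_of F (inverse t)
      (it f m (x0 + scale_of E t (scale_of E (inverse t) (z t - x0))) (p t) - it f m x0 (p t)))
      (it f (Suc m) x0 (?p0(m := v))) (at 0)"
    using x0E by (intro C1_family_limit[OF Ck_C1_family[OF f m U] x0 vE p0 _ z p_lim]) simp
  moreover have "\<forall>\<^sub>F t in at 0. scale_of F (inverse t)
      (it f m (x0 + scale_of E t (scale_of E (inverse t) (z t - x0))) (p t) - it f m x0 (p t)) =
      scale_of F (inverse t) (it f m (z t) (p t) - it f m x0 (p t))"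
    by (auto simp: eventually_at_filter)
  ultimately have 1: "limitin (top_of F) (\<lambda>t. scale_of F (inverse t) (it f m (z t) (p t) - it f m x0 (p t)))
      (it f (Suc m) x0 (?p0(m := v))) (at 0)"
    by (rule limitin_transform_eventually[rotated])
  have 2: "limitin (top_of F) (\<lambda>t. scale_of F (inverse t) (it f m x0 (p t) - it f m x0 ?p0))
    (\<Sum>i<m. it f m x0 (\<lambda>j\<in>{..<m}. if j = i then b i else a0 j)) (at 0)"
    unfolding p_def
  proof (rule multilinear_quotient)
    show "multilinear m E F (it f m x0)"
      by (rule it_multilinear[OF f U _ x0]) (use m in simp)
    show "continuous_map (product_topology (\<lambda>_. top_of E) {..<m}) (top_of F) (it f m x0)"
      by (rule it_continuous_at[OF f U _ x0]) (use m in simp)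
  qed (fact a0 a b)+
  have eqs: "it f m (z t) (p t) = it f m (z t) (\<lambda>i. a i t)" "it f m x0 ?p0 = it f m x0 a0"
    "it f (Suc m) x0 (?p0(m := v)) = it f (Suc m) x0 (a0(m := v))" for t
    by (rule it_cong, simp add: p_def)+
  have eq: "it f m x0 (\<lambda>j\<in>{..<m}. if j = i then b i else a0 j) = it f m x0 (a0(i := b i))" for i
    by (rule it_cong) simp
  show ?thesis
    using F.limitin_add[OF 1 2] unfolding eqs eq by (simp add: F.scale_right_distrib[symmetric])
qed

end

section \<open>The chain rule\<close>

text \<open>The \<open>k\<close>-th derivative of \<open>g \<circ> f\<close> is a sum of terms
  \<open>d\<^sup>m g (f x; d\<^sup>|\<^sup>B\<^sup>1\<^sup>| f (x; y\<^sub>B\<^sub>1), \<dots>)\<close>, each encoded by its list of blocks of direction indices.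
  Differentiating in direction \<open>k\<close> opens a new block \<open>[k]\<close> or appends \<open>k\<close> to an existing block.\<close>

fun chain_terms :: "nat \<Rightarrow> nat list list list" where
  "chain_terms 0 = [[]]"
| "chain_terms (Suc k) =
    concat (map (\<lambda>Bs. (Bs @ [[k]]) # map (\<lambda>i. Bs[i := Bs ! i @ [k]]) [0..<length Bs]) (chain_terms k))"

text \<open>The bounds keep each derivative in a term within the order up to which \<open>f\<close>
  and \<open>g\<close> are known to be differentiable.\<close>

lemma chain_terms_bounds:
  assumes "Bs \<in> set (chain_terms k)"
  shows "length Bs \<le> k \<and> (\<forall>B\<in>set Bs. length B \<le> k \<and> set B \<subseteq> {..<k})"
  using assms
proof (induction k arbitrary: Bs)
  case (Suc k)
  let ?F = "\<lambda>Cs. (Cs @ [[k]]) # map (\<lambda>i. Cs[i := Cs ! i @ [k]]) [0..<length Cs]"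
  have "\<exists>Cs\<in>set (chain_terms k). Bs \<in> set (?F Cs)"
    using Suc.prems by (auto simp only: chain_terms.simps set_concat set_map)
  then obtain Cs where Cs: "Cs \<in> set (chain_terms k)" and "Bs \<in> set (?F Cs)"
    by blast
  then have "Bs = Cs @ [[k]] \<or> (\<exists>i<length Cs. Bs = Cs[i := Cs ! i @ [k]])"
    by auto
  moreover have IH: "length Cs \<le> k" "\<And>B. B \<in> set Cs \<Longrightarrow> length B \<le> k \<and> set B \<subseteq> {..<k}"
    using Suc.IH[OF Cs] by auto
  ultimately consider "Bs = Cs @ [[k]]" | i where "i < length Cs" "Bs = Cs[i := Cs ! i @ [k]]"
    by blast
  then show ?case
  proof cases
    case 1
    then show ?thesis using IH by fastforce
  next
    case 2
    have "length B \<le> Suc k \<and> set B \<subseteq> {..<Suc k}" if "B \<in> set Bs" for B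
    proof -
      have "B \<in> insert (Cs ! i @ [k]) (set Cs)"
        using that 2 set_update_subset_insert by fast
      then show ?thesis
        using IH(2)[of B] IH(2)[of "Cs ! i"] 2(1) by fastforce
    qed
    then show ?thesis
      using IH(1) 2(2) by simp
  qed
qed simp

lemma sum_list_upt: "(\<Sum>i\<leftarrow>[0..<m]. h i) = (\<Sum>i<m. (h i :: 'a::comm_monoid_add))"
  by (induction m) (auto simp: add.commute)

lemma sum_list_concat_eq: "sum_list (concat xss) = (\<Sum>xs\<leftarrow>xss. sum_list xs :: 'a::comm_monoid_add)"
  by (induction xss) auto

lemma (in lcs) continuous_sum_list:
  assumes "\<And>b. b \<in> set bs \<Longrightarrow> continuous_map X (top_of E) (h b)"
  shows "continuous_map X (top_of E) (\<lambda>z. \<Sum>b\<leftarrow>bs. h b z)"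
  using assms by (induction bs) (auto intro: continuous_add)

locale lcs_triple = EF: lcs_pair E F + FG: lcs_pair F G
  for E :: "('k::real_normed_field, 'e::ab_group_add) tvs" and F :: "('k, 'f::ab_group_add) tvs"
    and G :: "('k, 'g::ab_group_add) tvs"
begin

sublocale EG: lcs_pair E G
  by unfold_locales

definition chain_term :: "('e \<Rightarrow> 'f) \<Rightarrow> ('f \<Rightarrow> 'g) \<Rightarrow> nat list list \<Rightarrow> 'e \<Rightarrow> (nat \<Rightarrow> 'e) \<Rightarrow> 'g"
  where "chain_term f g Bs x y =
    FG.it g (length Bs) (f x) (\<lambda>i. EF.it f (length (Bs ! i)) x (\<lambda>l. y (Bs ! i ! l)))"

context
  fixes f g U V n
  assumes f: "Ck_on n E F U f" and g: "Ck_on n F G V g"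
    and U: "openin (top_of E) U" and V: "openin (top_of F) V" and fUV: "f ` U \<subseteq> V"
begin

text \<open>This is \<open>it_along_curve\<close> for the curve \<open>f (x + t y k)\<close>. Moving
  the point at which \<open>g\<close> is differentiated creates the new block \<open>[k]\<close>;
  moving the argument in slot \<open>i\<close> lengthens block \<open>i\<close>.\<close>

lemma chain_term_dd:
  assumes Bs: "length Bs \<le> k" "\<forall>B\<in>set Bs. length B \<le> k \<and> set B \<subseteq> {..<k}"
    and k: "k < n" and x: "x \<in> U" and y: "\<forall>i\<le>k. y i \<in> carrier_of E"
  shows "EG.has_dd (\<lambda>u. chain_term f g Bs u y) x (y k)
    (chain_term f g (Bs @ [[k]]) x y + (\<Sum>i<length Bs. chain_term f g (Bs[i := Bs ! i @ [k]]) x y))"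
proof -
  let ?m = "length Bs"
  define a where "a i u = EF.it f (length (Bs ! i)) u (\<lambda>l. y (Bs ! i ! l))" for i u
  define b where "b i = EF.it f (Suc (length (Bs ! i))) x (\<lambda>l. y ((Bs ! i @ [k]) ! l))" for i
  define v where "v = EF.it f (Suc 0) x (\<lambda>l. y ([k] ! l))"
  have xE: "x \<in> carrier_of E"
    using x openin_subset[OF U] by blast
  have line: "\<forall>\<^sub>F t in at 0. x + scale_of E t (y k) \<in> U"
    using EF.eventually_line[OF U x] y by simp
  have yB: "y (Bs ! i ! l) \<in> carrier_of E" "length (Bs ! i) \<le> k" if "i < ?m" "l < length (Bs ! i)" for i l
  proof -
    have "Bs ! i \<in> set Bs"
      using that by simp
    then have "Bs ! i ! l < k" "length (Bs ! i) \<le> k"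
      using Bs(2) that(2) nth_mem[of l "Bs ! i"] by blast+
    then show "y (Bs ! i ! l) \<in> carrier_of E" "length (Bs ! i) \<le> k"
      using y by auto
  qed
  have len: "length (Bs ! i) \<le> k" if "i < ?m" for i
    using Bs(2) that nth_mem by blast
  have a_in: "a i u \<in> carrier_of F" if "i < ?m" "u \<in> U" for i u
    unfolding a_def using yB(1)[OF that(1)] len[OF that(1)] k that(2) openin_subset[OF U]
    by (intro EF.it_in[OF f]) auto
  have fx: "f x \<in> V"
    using x fUV by blast
  have "EF.has_dd (\<lambda>u. EF.it f 0 u (\<lambda>_. y k)) x (y k) (EF.it f (Suc 0) x (\<lambda>_. y k))"
    using EF.Ck_has_dd[OF f _ x, of 0 "\<lambda>_. y k"] k y by simp
  moreover have "EF.it f (Suc 0) x (\<lambda>_. y k) = v"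
    unfolding v_def by (rule EF.it_cong) simp
  ultimately have z: "limitin (top_of F) (\<lambda>t. scale_of F (inverse t) (f (x + scale_of E t (y k)) - f x)) v (at 0)"
    by (simp add: has_directional_derivative_def)
  have quot: "limitin (top_of F) (\<lambda>t. scale_of F (inverse t) (a i (x + scale_of E t (y k)) - a i x)) (b i) (at 0)"
    if i: "i < ?m" for i
  proof -
    let ?y = "\<lambda>l. y ((Bs ! i @ [k]) ! l)"
    have "EF.has_dd (\<lambda>u. EF.it f (length (Bs ! i)) u ?y) x (?y (length (Bs ! i))) (b i)"
      unfolding b_def using len[OF i] k yB(1)[OF i] y
      by (intro EF.Ck_has_dd[OF f _ x]) (auto simp: nth_append)
    moreover have "EF.it f (length (Bs ! i)) u ?y = a i u" for u
      unfolding a_def by (rule EF.it_cong) (simp add: nth_append)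
    ultimately show ?thesis
      by (simp add: has_directional_derivative_def)
  qed
  have "limitin (top_of G) (\<lambda>t. scale_of G (inverse t)
      (FG.it g ?m (f (x + scale_of E t (y k))) (\<lambda>i. a i (x + scale_of E t (y k))) - FG.it g ?m (f x) (\<lambda>i. a i x)))
    (FG.it g (Suc ?m) (f x) ((\<lambda>i. a i x)(?m := v)) + (\<Sum>i<?m. FG.it g ?m (f x) ((\<lambda>i. a i x)(i := b i)))) (at 0)"
  proof (rule FG.it_along_curve[OF g V _ fx z])
    show "?m < n"
      using Bs(1) k by simp
    show "\<forall>\<^sub>F t in at 0. a i (x + scale_of E t (y k)) \<in> carrier_of F" if "i < ?m" for i
      using line by eventually_elim (rule a_in[OF that])
  qed (use a_in x quot in auto)
  moreover have "FG.it g (Suc ?m) (f x) ((\<lambda>i. a i x)(?m := v)) = chain_term f g (Bs @ [[k]]) x y"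
    unfolding chain_term_def length_append
    by (simp, rule FG.it_cong) (auto simp: nth_append a_def v_def less_Suc_eq)
  moreover have "FG.it g ?m (f x) ((\<lambda>i. a i x)(i := b i)) = chain_term f g (Bs[i := Bs ! i @ [k]]) x y"
    if "i < ?m" for i
    unfolding chain_term_def length_list_update
    by (rule FG.it_cong) (use that in \<open>auto simp: nth_list_update a_def b_def\<close>)
  ultimately show ?thesis
    unfolding has_directional_derivative_def chain_term_def[of f g Bs] a_def by simp
qed

lemma chain_term_continuous:
  assumes Bs: "length Bs \<le> k" "\<forall>B\<in>set Bs. length B \<le> k \<and> set B \<subseteq> {..<k}" and k: "k \<le> n"
  shows "continuous_map (prod_topology (subtopology (top_of E) U) (product_topology (\<lambda>_. top_of E) {..<k}))
      (top_of G) (\<lambda>z. chain_term f g Bs (fst z) (snd z))"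
proof -
  let ?X = "prod_topology (subtopology (top_of E) U) (product_topology (\<lambda>_. top_of E) {..<k})"
  let ?m = "length Bs"
  have inner: "continuous_map ?X (top_of F) (\<lambda>z. EF.it f (length (Bs ! i)) (fst z) (\<lambda>l. snd z (Bs ! i ! l)))"
    if i: "i < ?m" for i
  proof -
    let ?B = "Bs ! i"
    let ?r = "\<lambda>z. (fst z, \<lambda>l\<in>{..<length ?B}. snd z (?B ! l))"
    have "?B \<in> set Bs"
      using i by simp
    then have B: "length ?B \<le> n" "\<And>l. l < length ?B \<Longrightarrow> ?B ! l < k"
      using Bs(2) k nth_mem by fastforce+
    have proj: "continuous_map ?X (top_of E) (\<lambda>z. snd z (?B ! l))" if "l < length ?B" for l
      using continuous_map_compose[OF continuous_map_snd
        continuous_map_product_projection[of "?B ! l" "{..<k}" "\<lambda>_. top_of E"]] B(2)[OF that]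
      by (simp add: o_def)
    have "continuous_map ?X (product_topology (\<lambda>_. top_of E) {..<length ?B}) (\<lambda>z. \<lambda>l\<in>{..<length ?B}. snd z (?B ! l))"
      unfolding continuous_map_componentwise using proj by auto
    from continuous_map_compose[OF continuous_map_pairedI[OF continuous_map_fst this] EF.Ck_continuous[OF f B(1)]]
    have "continuous_map ?X (top_of F) (\<lambda>z. EF.it f (length ?B) (fst z) (\<lambda>l\<in>{..<length ?B}. snd z (?B ! l)))"
      by (simp add: o_def)
    moreover have "EF.it f (length ?B) u (\<lambda>l\<in>{..<length ?B}. y (?B ! l)) = EF.it f (length ?B) u (\<lambda>l. y (?B ! l))" for u y
      by (rule EF.it_cong) simp
    ultimately show ?thesis
      by simp
  qed
  let ?a = "\<lambda>z i. EF.it f (length (Bs ! i)) (fst z) (\<lambda>l. snd z (Bs ! i ! l))"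
  have "continuous_map ?X (product_topology (\<lambda>_. top_of F) {..<?m}) (\<lambda>z. \<lambda>i\<in>{..<?m}. ?a z i)"
    unfolding continuous_map_componentwise using inner by auto
  moreover have "continuous_map ?X (subtopology (top_of F) V) (\<lambda>z. f (fst z))"
  proof -
    have "continuous_map ?X (top_of F) (\<lambda>z. f (fst z))"
      using continuous_map_compose[OF continuous_map_fst EF.Ck_continuous_map[OF f]] by (simp add: o_def)
    then show ?thesis
      by (rule continuous_map_into_subtopology) (use fUV in auto)
  qed
  ultimately have pair: "continuous_map ?X (prod_topology (subtopology (top_of F) V) (product_topology (\<lambda>_. top_of F) {..<?m}))
      (\<lambda>z. (f (fst z), \<lambda>i\<in>{..<?m}. ?a z i))"
    by (intro continuous_map_pairedI)
  have "?m \<le> n"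
    using Bs(1) k by simp
  from continuous_map_compose[OF pair FG.Ck_continuous[OF g this]]
  have "continuous_map ?X (top_of G) (\<lambda>z. FG.it g ?m (f (fst z)) (\<lambda>i\<in>{..<?m}. ?a z i))"
    by (simp add: o_def)
  moreover have "FG.it g ?m (f (fst z)) (\<lambda>i\<in>{..<?m}. ?a z i) = chain_term f g Bs (fst z) (snd z)" for z
    unfolding chain_term_def by (rule FG.it_cong) simp
  ultimately show ?thesis
    by simp
qed

text \<open>The formula of Faa di Bruno is the candidate family for \<open>CkI\<close>: the
  recursion of \<open>chain_terms\<close> was made to match \<open>chain_term_dd\<close>.\<close>

theorem Ck_compose: "Ck_on n E G U (\<lambda>x. g (f x))"
proof (rule EG.CkI(1)[where D = "\<lambda>k x y. \<Sum>Bs\<leftarrow>chain_terms k. chain_term f g Bs x y", OF U])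
  show "(\<Sum>Bs\<leftarrow>chain_terms 0. chain_term f g Bs x y) = g (f x)" for x y
    by (simp add: chain_term_def)
  show "EG.has_dd (\<lambda>u. \<Sum>Bs\<leftarrow>chain_terms k. chain_term f g Bs u y) x (y k)
      (\<Sum>Bs\<leftarrow>chain_terms (Suc k). chain_term f g Bs x y)"
    if "k < n" "x \<in> U" "\<forall>i\<le>k. y i \<in> carrier_of E" for k x y
  proof -
    have "(\<Sum>Bs\<leftarrow>chain_terms (Suc k). chain_term f g Bs x y) = (\<Sum>Bs\<leftarrow>chain_terms k.
      chain_term f g (Bs @ [[k]]) x y + (\<Sum>i<length Bs. chain_term f g (Bs[i := Bs ! i @ [k]]) x y))"
      by (simp add: map_concat sum_list_concat_eq o_def sum_list_upt)
    then show ?thesis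
      using chain_terms_bounds that by (auto intro!: EG.has_dd_sum_list chain_term_dd)
  qed
  show "continuous_map (prod_topology (subtopology (top_of E) U) (product_topology (\<lambda>_. top_of E) {..<k}))
      (top_of G) (\<lambda>z. \<Sum>Bs\<leftarrow>chain_terms k. chain_term f g Bs (fst z) (snd z))" if "k \<le> n" for k
  proof -
    have "continuous_map (prod_topology (subtopology (top_of E) U) (product_topology (\<lambda>_. top_of E) {..<k}))
      (top_of G) (\<lambda>z. chain_term f g Bs (fst z) (snd z))" if "Bs \<in> set (chain_terms k)" for Bs
      using chain_terms_bounds[OF that] chain_term_continuous[OF _ _ \<open>k \<le> n\<close>] by simp
    then show ?thesis
      by (rule FG.F.continuous_sum_list)
  qed
qed

end

end

section \<open>Continuous linear maps and pairs\<close>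

lemma (in lcs_pair) continuous_linear_Ck:
  assumes "continuous_linear E F h" and U: "openin (top_of E) U"
  shows "Ck_on k E F U h"
proof -
  define D where "D j x y = (if j = 0 then h x else if j = 1 then h (y 0) else 0)" for j :: nat and x :: 'e and y :: "nat \<Rightarrow> 'e"
  have h: "continuous_map (top_of E) (top_of F) h" "\<And>x y. x \<in> carrier_of E \<Longrightarrow> y \<in> carrier_of E \<Longrightarrow> h (x + y) = h x + h y"
    "\<And>c x. x \<in> carrier_of E \<Longrightarrow> h (scale_of E c x) = scale_of F c (h x)"
    using assms(1) by (auto simp: continuous_linear_def)
  show ?thesis
  proof (rule CkI(1)[where D = D, OF U])
    fix j x and y :: "nat \<Rightarrow> 'e" assume x: "x \<in> U" and y: "\<forall>i\<le>j. y i \<in> carrier_of E"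
    have xE: "x \<in> carrier_of E"
      using x openin_subset[OF U] by blast
    show "has_dd (\<lambda>u. D j u y) x (y j) (D (Suc j) x y)"
    proof (cases j)
      case 0
      have "h (y 0) \<in> carrier_of F"
        using continuous_map_in[OF h(1)] y by simp
      moreover have "\<forall>\<^sub>F t in at 0. scale_of F (inverse t) (h (x + scale_of E t (y 0)) - h x) = h (y 0)"
        using xE y by (simp add: h eventually_at_filter)
      ultimately show ?thesis
        unfolding has_directional_derivative_def using 0 by (simp add: D_def limitin_eventually)
    next
      case (Suc i)
      then show ?thesis
        using has_dd_const by (simp add: D_def)
    qed
  next
    fix j :: nat
    let ?X = "prod_topology (subtopology (top_of E) U) (product_topology (\<lambda>_. top_of E) {..<j})"
    have 1: "continuous_map ?X (top_of E) fst"
      using continuous_map_into_fulltopology[OF continuous_map_fst] .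
    have 2: "continuous_map ?X (top_of E) (\<lambda>z. snd z 0)" if "j = 1"
      using continuous_map_compose[OF continuous_map_snd continuous_map_product_projection[of 0 "{..<j}" "\<lambda>_. top_of E"]] that
      by (simp add: o_def)
    show "continuous_map ?X (top_of F) (\<lambda>z. D j (fst z) (snd z))"
      using continuous_map_compose[OF 1 h(1)] continuous_map_compose[OF 2 h(1)]
      by (cases "j = 0"; cases "j = 1") (auto simp: D_def o_def)
  qed (simp add: D_def)
qed

lemma prod_tvs_sel [simp]:
  "top_of (prod_tvs E F) = prod_topology (top_of E) (top_of F)"
  "scale_of (prod_tvs E F) c z = (scale_of E c (fst z), scale_of F c (snd z))"
  by (simp_all add: prod_tvs_def case_prod_unfold)

lemma sub_tvs_sel [simp]:
  "top_of (sub_tvs E A) = subtopology (top_of E) A"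
  "scale_of (sub_tvs E A) = scale_of E"
  by (simp_all add: sub_tvs_def)

lemma Ck_pair:
  assumes "lcs E" "lcs F" "lcs G" and U: "openin (top_of E) U"
    and f: "Ck_on k E F U f" and g: "Ck_on k E G U g"
  shows "Ck_on k E (prod_tvs F G) U (\<lambda>x. (f x, g x))"
proof -
  interpret EF: lcs_pair E F
    using assms by (simp add: lcs_pair_def)
  interpret EG: lcs_pair E G
    using assms by (simp add: lcs_pair_def)
  interpret EP: lcs_pair E "prod_tvs F G"
    using assms by (simp add: lcs_pair_def lcs_prod_tvs)
  show ?thesis
  proof (rule EP.CkI(1)[where D = "\<lambda>j x y. (EF.it f j x y, EG.it g j x y)", OF U])
    fix j x and y :: "nat \<Rightarrow> 'b" assume *: "j < k" "x \<in> U" "\<forall>i\<le>j. y i \<in> carrier_of E"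
    show "EP.has_dd (\<lambda>u. (EF.it f j u y, EG.it g j u y)) x (y j) (EF.it f (Suc j) x y, EG.it g (Suc j) x y)"
      using EF.Ck_has_dd[OF f *] EG.Ck_has_dd[OF g *]
      by (simp add: has_directional_derivative_def limitin_pairwise o_def)
  next
    fix j assume "j \<le> k"
    then show "continuous_map (prod_topology (subtopology (top_of E) U) (product_topology (\<lambda>_. top_of E) {..<j}))
      (top_of (prod_tvs F G)) (\<lambda>z. (EF.it f j (fst z) (snd z), EG.it g j (fst z) (snd z)))"
      using EF.Ck_continuous[OF f] EG.Ck_continuous[OF g] by (simp add: continuous_map_paired)
  qed simp
qed

lemma continuous_linear_in: "continuous_linear E F h \<Longrightarrow> x \<in> carrier_of E \<Longrightarrow> h x \<in> carrier_of F"
  unfolding continuous_linear_def by (blast intro: continuous_map_in)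

lemma continuous_linear_id: "continuous_linear E E (\<lambda>x. x)"
  by (simp add: continuous_linear_def)

lemma continuous_linear_compose:
  assumes "continuous_linear E F f" "continuous_linear F G g"
  shows "continuous_linear E G (\<lambda>x. g (f x))"
  using assms continuous_map_compose[of "top_of E" "top_of F" f "top_of G" g] continuous_linear_in[OF assms(1)]
  unfolding continuous_linear_def by (simp add: o_def)

lemma continuous_linear_fst: "continuous_linear (prod_tvs E F) E fst"
  and continuous_linear_snd: "continuous_linear (prod_tvs E F) F snd"
  by (simp_all add: continuous_linear_def continuous_map_fst continuous_map_snd)

lemma continuous_linear_pair:
  "continuous_linear E F f \<Longrightarrow> continuous_linear E G g \<Longrightarrow> continuous_linear E (prod_tvs F G) (\<lambda>x. (f x, g x))"
  by (simp add: continuous_linear_def continuous_map_paired)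

lemma continuous_linear_zero: "lcs F \<Longrightarrow> continuous_linear E F (\<lambda>x. 0)"
proof -
  assume "lcs F"
  then interpret F: lcs F .
  show ?thesis
    by (simp add: continuous_linear_def)
qed

lemma continuous_linear_add:
  assumes "lcs F" "continuous_linear E F f" "continuous_linear E F g"
  shows "continuous_linear E F (\<lambda>x. f x + g x)"
proof -
  interpret F: lcs F by fact
  show ?thesis
    using assms unfolding continuous_linear_def
    by (simp add: F.continuous_add F.scale_right_distrib)
qed

lemma continuous_linear_diff:
  assumes "lcs F" "continuous_linear E F f" "continuous_linear E F g"
  shows "continuous_linear E F (\<lambda>x. f x - g x)"
proof -
  interpret F: lcs F by fact
  show ?thesis
    using assms unfolding continuous_linear_def
    by (simp add: F.continuous_diff F.scale_right_diff_distrib)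
qed

lemma continuous_linear_into_sub:
  assumes "continuous_linear E F h" "h ` carrier_of E \<subseteq> A"
  shows "continuous_linear E (sub_tvs F A) h"
  using assms by (auto simp: continuous_linear_def continuous_map_in_subtopology)

lemma continuous_linear_from_sub:
  "continuous_linear E F h \<Longrightarrow> continuous_linear (sub_tvs E A) F h"
  by (auto simp: continuous_linear_def continuous_map_from_subtopology)

section \<open>The Hahn--Banach theorem for continuous seminorms\<close>

text \<open>Domination by \<open>q\<close> stands in for continuity: the estimates below use the
  functional through this bound.\<close>

definition dominated_functional ::
    "(complex, 'e::ab_group_add) tvs \<Rightarrow> ('e \<Rightarrow> real) \<Rightarrow> ('e \<Rightarrow> complex) \<Rightarrow> bool"
  where "dominated_functional E q \<phi> \<longleftrightarrow>
    (\<forall>x\<in>carrier_of E. \<forall>y\<in>carrier_of E. \<phi> (x + y) = \<phi> x + \<phi> y) \<and>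
    (\<forall>c. \<forall>x\<in>carrier_of E. \<phi> (scale_of E c x) = c * \<phi> x) \<and>
    (\<forall>x\<in>carrier_of E. cmod (\<phi> x) \<le> q x)"

locale complex_lcs = lcs E for E :: "(complex, 'e::ab_group_add) tvs"
begin

text \<open>Partial functionals are encoded by their graphs, real subspaces of pairs
  \<open>(x, r)\<close> ordered by inclusion, so that a chain has its union as upper bound in Zorn's
  lemma. The condition \<open>r \<le> q x\<close> alone makes such a subspace single-valued: if
  \<open>(0, r)\<close> belongs to it then so does \<open>(0, -r)\<close>, and both values are at
  most \<open>q 0 = 0\<close>.\<close>

lemma real_hahn_banach:
  assumes q: "seminorm_on E q" and x0: "x0 \<in> carrier_of E"
  obtains u :: "'e \<Rightarrow> real" where
    "\<forall>x\<in>carrier_of E. \<forall>y\<in>carrier_of E. u (x + y) = u x + u y"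
    "\<forall>a. \<forall>x\<in>carrier_of E. u (scale_of E (of_real a) x) = a * u x"
    "\<forall>x\<in>carrier_of E. u x \<le> q x" "u x0 = q x0"
proof -
  let ?rs = "\<lambda>a::real. scale_of E (of_real a)"
  define \<G> where "\<G> = {G :: ('e \<times> real) set. (x0, q x0) \<in> G \<and> G \<subseteq> carrier_of E \<times> UNIV \<and>
    (\<forall>x r y s. (x, r) \<in> G \<longrightarrow> (y, s) \<in> G \<longrightarrow> (x + y, r + s) \<in> G) \<and>
    (\<forall>a x r. (x, r) \<in> G \<longrightarrow> (?rs a x, a * r) \<in> G) \<and>
    (\<forall>x r. (x, r) \<in> G \<longrightarrow> r \<le> q x)}"
  have q_rs: "q (?rs a x) = \<bar>a\<bar> * q x" if "x \<in> carrier_of E" for a x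
    using seminorm_scale[OF q that, of "of_real a"] by simp
  have "{(?rs a x0, a * q x0) | a. True} \<in> \<G>"
  proof -
    have "\<exists>a. x0 = ?rs a x0 \<and> q x0 = a * q x0"
      by (intro exI[of _ 1]) simp
    moreover have "\<exists>c. ?rs a x0 + ?rs b x0 = ?rs c x0 \<and> a * q x0 + b * q x0 = c * q x0" for a b
      by (intro exI[of _ "a + b"]) (simp add: scale_left_distrib distrib_right)
    moreover have "\<exists>c. ?rs a (?rs b x0) = ?rs c x0 \<and> a * (b * q x0) = c * q x0" for a b
      by (intro exI[of _ "a * b"]) simp
    moreover have "a * q x0 \<le> q (?rs a x0)" for a
      using x0 seminorm_nonneg[OF q x0] by (simp add: q_rs mult_right_mono)
    ultimately show ?thesis
      using x0 unfolding \<G>_def by (auto simp del: scale_scale)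
  qed
  then have ne: "\<G> \<noteq> {}"
    by blast
  have "\<exists>M\<in>\<G>. \<forall>X\<in>\<G>. M \<subseteq> X \<longrightarrow> X = M"
  proof (rule subset_Zorn_nonempty[OF ne])
    fix \<C> assume \<C>: "\<C> \<noteq> {}" "subset.chain \<G> \<C>"
    then have sub: "\<C> \<subseteq> \<G>"
      by (simp add: subset.chain_def)
    have two: "\<exists>G\<in>\<C>. a \<in> G \<and> b \<in> G" if "a \<in> \<Union>\<C>" "b \<in> \<Union>\<C>" for a b
      using that \<C>(2) unfolding subset.chain_def by blast
    have "(x + y, r + s) \<in> \<Union>\<C>" if "(x, r) \<in> \<Union>\<C>" "(y, s) \<in> \<Union>\<C>" for x r y s
      using two[OF that] sub unfolding \<G>_def by blast
    moreover have "(?rs a x, a * r) \<in> \<Union>\<C>" if "(x, r) \<in> \<Union>\<C>" for a x r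
      using that sub unfolding \<G>_def by blast
    moreover have "r \<le> q x" if "(x, r) \<in> \<Union>\<C>" for x r
      using that sub unfolding \<G>_def by blast
    moreover have "(x0, q x0) \<in> \<Union>\<C>" "\<Union>\<C> \<subseteq> carrier_of E \<times> UNIV"
      using \<C>(1) sub unfolding \<G>_def by blast+
    ultimately show "\<Union>\<C> \<in> \<G>"
      unfolding \<G>_def by blast
  qed
  then obtain M where M: "M \<in> \<G>" "\<And>X. X \<in> \<G> \<Longrightarrow> M \<subseteq> X \<Longrightarrow> X = M"
    by metis
  have x0M: "(x0, q x0) \<in> M" and MU: "M \<subseteq> carrier_of E \<times> UNIV"
    and M_add: "\<And>x r y s. (x, r) \<in> M \<Longrightarrow> (y, s) \<in> M \<Longrightarrow> (x + y, r + s) \<in> M"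
    and M_rs: "\<And>a x r. (x, r) \<in> M \<Longrightarrow> (?rs a x, a * r) \<in> M"
    and M_le: "\<And>x r. (x, r) \<in> M \<Longrightarrow> r \<le> q x"
    using M(1) unfolding \<G>_def by blast+
  have inE: "x \<in> carrier_of E" if "(x, r) \<in> M" for x r
    using that MU by blast
  have M0: "(0, 0) \<in> M"
    using M_rs[OF x0M, of 0] by simp
  have total: "\<exists>r. (x1, r) \<in> M" if x1: "x1 \<in> carrier_of E" for x1
  proof -
    \<comment> \<open>The inequality behind extension by one dimension: a number that separates the
      two sides may be taken as the value at \<open>x1\<close>.\<close>
    have sep: "s - q (y - x1) \<le> q (z + x1) - t" if yz: "(y, s) \<in> M" "(z, t) \<in> M" for y s z t
    proof -
      have "s + t \<le> q (y + z)"
        using M_le[OF M_add[OF yz]] .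
      also have "y + z = (y - x1) + (z + x1)"
        by simp
      also have "q \<dots> \<le> q (y - x1) + q (z + x1)"
        using yz inE x1 by (intro seminorm_add[OF q]) auto
      finally show ?thesis by simp
    qed
    let ?L = "{s - q (y - x1) | y s. (y, s) \<in> M}"
    define c where "c = Sup ?L"
    have L_ne: "?L \<noteq> {}"
      using M0 by blast
    have L_bdd: "bdd_above ?L"
      using sep[OF _ M0] by (intro bdd_aboveI[of _ "q (0 + x1) - 0"]) blast
    have lower: "s - q (y - x1) \<le> c" if "(y, s) \<in> M" for y s
      unfolding c_def using that L_bdd by (intro cSup_upper) blast+
    have upper: "c \<le> q (z + x1) - t" if "(z, t) \<in> M" for z t
      unfolding c_def using sep[OF _ that] L_ne by (intro cSup_least) blast+
    define X where "X = {(y + ?rs a x1, s + a * c) | y s a. (y, s) \<in> M}"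
    have X_I: "(y + ?rs a x1, s + a * c) \<in> X" if "(y, s) \<in> M" for y s a
      using that unfolding X_def by blast
    \<comment> \<open>Dividing by the absolute value of \<open>a\<close> reduces the claim to
      \<open>upper\<close> for positive and to \<open>lower\<close> for negative
      \<open>a\<close>.\<close>
    have X_le: "s + a * c \<le> q (y + ?rs a x1)" if ys: "(y, s) \<in> M" for y s a
    proof (cases a "0::real" rule: linorder_cases)
      case equal
      then show ?thesis using M_le[OF ys] by simp
    next
      case greater
      have y': "?rs (inverse a) y \<in> carrier_of E"
        using inE[OF ys] by simp
      have "y + ?rs a x1 = ?rs a (?rs (inverse a) y + x1)"
        using greater by (simp add: scale_right_distrib)
      then have "q (y + ?rs a x1) = a * q (?rs (inverse a) y + x1)"
        using q_rs[of "?rs (inverse a) y + x1" a] y' x1 greater by simp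
      moreover have "a * c \<le> a * (q (?rs (inverse a) y + x1) - inverse a * s)"
        using upper[OF M_rs[OF ys, of "inverse a"]] greater by (intro mult_left_mono) auto
      moreover have "a * (q (?rs (inverse a) y + x1) - inverse a * s) = a * q (?rs (inverse a) y + x1) - s"
        using greater by (simp add: right_diff_distrib mult.assoc[symmetric] del: of_real_inverse)
      ultimately show ?thesis
        by linarith
    next
      case less
      let ?b = "- a"
      have y': "?rs (inverse ?b) y \<in> carrier_of E"
        using inE[OF ys] by simp
      have "y + ?rs a x1 = ?rs ?b (?rs (inverse ?b) y - x1)"
        using less by (simp add: scale_right_diff_distrib)
      then have "q (y + ?rs a x1) = ?b * q (?rs (inverse ?b) y - x1)"
        using q_rs[of "?rs (inverse ?b) y - x1" ?b] y' x1 less by simp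
      moreover have "?b * (inverse ?b * s - q (?rs (inverse ?b) y - x1)) \<le> ?b * c"
        using lower[OF M_rs[OF ys, of "inverse ?b"]] less by (intro mult_left_mono) auto
      moreover have "?b * (inverse ?b * s - q (?rs (inverse ?b) y - x1)) = s - ?b * q (?rs (inverse ?b) y - x1)"
        using less by (simp add: right_diff_distrib mult.assoc[symmetric] del: of_real_inverse of_real_minus)
      ultimately show ?thesis
        by linarith
    qed
    have "X \<in> \<G>"
      unfolding \<G>_def
    proof (intro CollectI conjI allI impI)
      show "(x0, q x0) \<in> X"
        using X_I[OF x0M, of 0] by simp
      show "X \<subseteq> carrier_of E \<times> UNIV"
        using inE x1 unfolding X_def by auto
      show "(x + y, r + s) \<in> X" if xy: "(x, r) \<in> X" "(y, s) \<in> X" for x r y s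
      proof -
        obtain x' r' a where x': "x = x' + ?rs a x1" "r = r' + a * c" "(x', r') \<in> M"
          using xy(1) unfolding X_def by blast
        obtain y' s' b where y': "y = y' + ?rs b x1" "s = s' + b * c" "(y', s') \<in> M"
          using xy(2) unfolding X_def by blast
        have "x + y = (x' + y') + ?rs (a + b) x1" "r + s = (r' + s') + (a + b) * c"
          using x' y' by (simp_all add: algebra_simps)
        then show ?thesis
          using X_I[OF M_add[OF x'(3) y'(3)], of "a + b"] by simp
      qed
      show "(?rs b x, b * r) \<in> X" if x: "(x, r) \<in> X" for b x r
      proof -
        obtain x' r' a where x': "x = x' + ?rs a x1" "r = r' + a * c" "(x', r') \<in> M"
          using x unfolding X_def by blast
        have "?rs b x = ?rs b x' + ?rs (b * a) x1" "b * r = b * r' + (b * a) * c"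
          using x' by (simp_all add: algebra_simps)
        then show ?thesis
          using X_I[OF M_rs[OF x'(3), of b], of "b * a"] by simp
      qed
      show "r \<le> q x" if "(x, r) \<in> X" for x r
        using that X_le unfolding X_def by blast
    qed
    moreover have "M \<subseteq> X"
      using X_I[of _ _ 0] by auto
    ultimately have "X = M"
      by (rule M(2))
    then show ?thesis
      using X_I[OF M0, of 1] by auto
  qed
  have unique: "r = s" if "(x, r) \<in> M" "(x, s) \<in> M" for x r s
  proof -
    have "(x + ?rs (-1) x, r + (-1) * s) \<in> M" "(x + ?rs (-1) x, s + (-1) * r) \<in> M"
      using M_add M_rs that by blast+
    then show ?thesis
      using M_le[of 0 "r - s"] M_le[of 0 "s - r"] by (simp add: seminorm_zero[OF q])
  qed
  define u where "u x = (SOME r. (x, r) \<in> M)" for x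
  have u: "(x, u x) \<in> M" if "x \<in> carrier_of E" for x
    unfolding u_def using total[OF that] by (rule someI_ex)
  show ?thesis
  proof (rule that)
    show "\<forall>x\<in>carrier_of E. \<forall>y\<in>carrier_of E. u (x + y) = u x + u y"
      using unique[OF u M_add[OF u u]] by simp
    show "\<forall>a. \<forall>x\<in>carrier_of E. u (?rs a x) = a * u x"
      using unique[OF u M_rs[OF u]] by simp
    show "\<forall>x\<in>carrier_of E. u x \<le> q x"
      using M_le u by blast
    show "u x0 = q x0"
      using unique[OF u[OF x0] x0M] .
  qed
qed

text \<open>A complex functional is determined by its real part \<open>u\<close>, as
  \<open>u x - \<i> u (\<i> x)\<close>. Turning \<open>\<phi> x\<close> onto the positive real axis
  by a unit scalar makes it equal to a value of \<open>u\<close>, so the bound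
  \<open>u \<le> q\<close> extends to the modulus.\<close>

lemma hahn_banach:
  assumes q: "seminorm_on E q" and x0: "x0 \<in> carrier_of E"
  obtains \<phi> where "dominated_functional E q \<phi>" "cmod (\<phi> x0) = q x0"
proof -
  obtain u :: "'e \<Rightarrow> real" where
    add: "\<forall>x\<in>carrier_of E. \<forall>y\<in>carrier_of E. u (x + y) = u x + u y"
    and real: "\<forall>a. \<forall>x\<in>carrier_of E. u (scale_of E (of_real a) x) = a * u x"
    and le: "\<forall>x\<in>carrier_of E. u x \<le> q x" and ux0: "u x0 = q x0"
    using q x0 by (rule real_hahn_banach)
  define \<phi> where "\<phi> x = Complex (u x) (- u (scale_of E \<i> x))" for x
  have minus: "u (- x) = - u x" if "x \<in> carrier_of E" for x
    using real[rule_format, OF that, of "-1"] by simp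
  have \<phi>_add: "\<phi> (x + y) = \<phi> x + \<phi> y" if "x \<in> carrier_of E" "y \<in> carrier_of E" for x y
    using that add by (simp add: \<phi>_def complex_eq_iff scale_right_distrib)
  have \<phi>_real: "\<phi> (scale_of E (of_real a) x) = of_real a * \<phi> x" if x: "x \<in> carrier_of E" for a x
  proof -
    have "scale_of E \<i> (scale_of E (of_real a) x) = scale_of E (of_real a) (scale_of E \<i> x)"
      by (simp add: mult.commute)
    then show ?thesis
      using real x by (simp add: \<phi>_def complex_eq_iff del: scale_scale)
  qed
  have \<phi>_i: "\<phi> (scale_of E \<i> x) = \<i> * \<phi> x" if x: "x \<in> carrier_of E" for x
    using minus[OF x] by (simp add: \<phi>_def complex_eq_iff)
  have \<phi>_scale: "\<phi> (scale_of E c x) = c * \<phi> x" if x: "x \<in> carrier_of E" for c x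
  proof -
    have "scale_of E c x = scale_of E (of_real (Re c)) x + scale_of E (of_real (Im c)) (scale_of E \<i> x)"
      by (simp add: scale_left_distrib[symmetric] mult.commute complex_eq[symmetric])
    then have "\<phi> (scale_of E c x) = of_real (Re c) * \<phi> x + of_real (Im c) * (\<i> * \<phi> x)"
      using \<phi>_add \<phi>_real \<phi>_i x by (simp del: scale_scale)
    also have "\<dots> = (of_real (Re c) + \<i> * of_real (Im c)) * \<phi> x"
      by (simp add: distrib_right)
    finally show ?thesis
      by (simp add: complex_eq[symmetric])
  qed
  have bound: "cmod (\<phi> x) \<le> q x" if x: "x \<in> carrier_of E" for x
  proof (cases "\<phi> x = 0")
    case True
    then show ?thesis using seminorm_nonneg[OF q x] by simp
  next
    case False
    define c where "c = cnj (\<phi> x) / cmod (\<phi> x)"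
    have c: "cmod c = 1"
      using False by (simp add: c_def norm_divide)
    have "c * \<phi> x = cmod (\<phi> x)"
      using False by (simp add: c_def complex_norm_square[symmetric] power2_eq_square mult.commute)
    then have "\<phi> (scale_of E c x) = cmod (\<phi> x)"
      using \<phi>_scale[OF x] by simp
    then have "cmod (\<phi> x) = u (scale_of E c x)"
      by (simp add: \<phi>_def complex_eq_iff)
    also have "\<dots> \<le> q (scale_of E c x)"
      using le x by simp
    also have "\<dots> = q x"
      using seminorm_scale[OF q x] c by simp
    finally show ?thesis .
  qed
  have "q x0 \<le> cmod (\<phi> x0)"
    using complex_Re_le_cmod[of "\<phi> x0"] ux0 by (simp add: \<phi>_def)
  with bound[OF x0] have "cmod (\<phi> x0) = q x0"
    by simp
  moreover have "dominated_functional E q \<phi>"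
    unfolding dominated_functional_def using \<phi>_add \<phi>_scale bound by blast
  ultimately show ?thesis
    using that by blast
qed

text \<open>Through this lemma an estimate in \<open>E\<close> becomes a scalar one with the same
  bound for all dominated functionals.\<close>

lemma seminorm_le_by_functionals:
  assumes "seminorm_on E q" "x \<in> carrier_of E"
    and "\<And>\<phi>. dominated_functional E q \<phi> \<Longrightarrow> cmod (\<phi> x) \<le> B"
  shows "q x \<le> B"
  using hahn_banach[OF assms(1,2)] assms(3) by metis

context
  fixes q \<phi> assumes \<phi>: "dominated_functional E q \<phi>"
begin

lemma functional_add: "x \<in> carrier_of E \<Longrightarrow> y \<in> carrier_of E \<Longrightarrow> \<phi> (x + y) = \<phi> x + \<phi> y"
  and functional_scale: "x \<in> carrier_of E \<Longrightarrow> \<phi> (scale_of E c x) = c * \<phi> x"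
  and functional_le: "x \<in> carrier_of E \<Longrightarrow> cmod (\<phi> x) \<le> q x"
  using \<phi> by (simp_all add: dominated_functional_def)

lemma functional_diff: "x \<in> carrier_of E \<Longrightarrow> y \<in> carrier_of E \<Longrightarrow> \<phi> (x - y) = \<phi> x - \<phi> y"
  using functional_add[of x "scale_of E (-1) y"] functional_scale[of y "-1"] by simp

lemma functional_zero: "\<phi> 0 = 0"
  using functional_scale[of 0 0] by simp

lemma functional_sum:
  "(\<And>i. i \<in> I \<Longrightarrow> f i \<in> carrier_of E) \<Longrightarrow> \<phi> (\<Sum>i\<in>I. f i) = (\<Sum>i\<in>I. \<phi> (f i))"
proof (induction I rule: infinite_finite_induct)
  case (insert i I)
  then show ?case by (simp add: functional_add sum_in)
qed (simp_all add: functional_zero)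

end

text \<open>Cauchy's inequality on the circle of radius \<open>3/2\<close> bounds the scalar
  coefficients by \<open>B (2/3)^n\<close>, the same for all functionals dominated by
  \<open>q\<close>. Summing the tail at the point \<open>1\<close> gives \<open>3 B (2/3)^N\<close>,
  which is therefore a bound for the seminorm itself. Radius \<open>2\<close> leaves room for the
  closed disc of radius \<open>3/2\<close>, which has \<open>1\<close> in its interior.\<close>

lemma taylor_series_converges:
  assumes q: "seminorm_on E q"
    and h: "\<And>t. cmod t < 2 \<Longrightarrow> h t \<in> carrier_of E" and a: "\<And>n. a n \<in> carrier_of E"
    and B: "\<And>t. cmod t \<le> 3/2 \<Longrightarrow> q (h t) \<le> B"
    and hol: "\<And>\<phi>. dominated_functional E q \<phi> \<Longrightarrow> (\<lambda>t. \<phi> (h t)) holomorphic_on ball 0 2"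
    and deriv: "\<And>\<phi> n. dominated_functional E q \<phi> \<Longrightarrow> (deriv ^^ n) (\<lambda>t. \<phi> (h t)) 0 = fact n * \<phi> (a n)"
  shows "(\<lambda>N. q ((\<Sum>n<N. a n) - h 1)) \<longlonglongrightarrow> 0"
proof -
  have B0: "0 \<le> B"
    using B[of 0] seminorm_nonneg[OF q h[of 0]] by simp
  have main: "q ((\<Sum>n<N. a n) - h 1) \<le> 3 * B * (2/3)^N" for N
  proof (rule seminorm_le_by_functionals[OF q])
    show "(\<Sum>n<N. a n) - h 1 \<in> carrier_of E"
      using a h[of 1] by (intro diff_in sum_in) auto
    fix \<phi> assume \<phi>: "dominated_functional E q \<phi>"
    let ?g = "\<lambda>t. \<phi> (h t)"
    have coeff: "cmod (\<phi> (a n)) \<le> B * (2/3)^n" for n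
    proof -
      have "cmod ((deriv ^^ n) ?g 0) \<le> fact n * B / (3/2)^n"
      proof (rule Cauchy_inequality)
        show "?g holomorphic_on ball 0 (3/2)"
          using hol[OF \<phi>] by (rule holomorphic_on_subset) auto
        show "continuous_on (cball 0 (3/2)) ?g"
          using holomorphic_on_imp_continuous_on[OF hol[OF \<phi>]] by (rule continuous_on_subset) auto
        show "cmod (?g x) \<le> B" if "cmod (0 - x) = 3/2" for x
          using that B[of x] functional_le[OF \<phi> h[of x]] by simp
      qed simp
      then have "fact n * cmod (\<phi> (a n)) \<le> fact n * (B * (2/3)^n)"
        by (simp add: deriv[OF \<phi>] norm_mult power_divide field_simps)
      then show ?thesis
        by (simp only: mult_le_cancel_left_pos fact_gt_zero)
    qed
    have "(\<lambda>n. (deriv ^^ n) ?g 0 / fact n * (1 - 0)^n) sums ?g 1"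
      by (rule holomorphic_power_series[OF hol[OF \<phi>]]) simp
    then have sums: "(\<lambda>n. \<phi> (a n)) sums ?g 1"
      by (simp add: deriv[OF \<phi>])
    have tail: "(\<lambda>n. \<phi> (a (n + N))) sums (?g 1 - (\<Sum>n<N. \<phi> (a n)))"
      using sums by (rule sums_split_initial_segment)
    have geo: "(\<lambda>n. B * (2/3)^N * (2/3)^n) sums (B * (2/3)^N * (1 / (1 - 2/3)))"
      by (intro sums_mult geometric_sums) simp
    have "cmod (\<phi> (a (n + N))) \<le> B * (2/3)^N * (2/3)^n" for n
      using coeff[of "n + N"] by (simp add: power_add mult_ac)
    then have "cmod (\<Sum>n. \<phi> (a (n + N))) \<le> (\<Sum>n. B * (2/3)^N * (2/3)^n)"
      using sums_summable[OF geo] by (rule norm_suminf_le)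
    then have "cmod (?g 1 - (\<Sum>n<N. \<phi> (a n))) \<le> 3 * B * (2/3)^N"
      using sums_unique[OF tail] sums_unique[OF geo] by (simp add: mult_ac)
    moreover have "\<phi> ((\<Sum>n<N. a n) - h 1) = (\<Sum>n<N. \<phi> (a n)) - ?g 1"
      using a h[of 1] by (simp add: functional_diff[OF \<phi>] functional_sum[OF \<phi>] sum_in)
    ultimately show "cmod (\<phi> ((\<Sum>n<N. a n) - h 1)) \<le> 3 * B * (2/3)^N"
      by (simp add: norm_minus_commute)
  qed
  have "(\<lambda>N. 3 * B * (2/3::real)^N) \<longlonglongrightarrow> 3 * B * 0"
    by (intro tendsto_intros LIMSEQ_power_zero) simp
  then have lim: "(\<lambda>N. 3 * B * (2/3::real)^N) \<longlonglongrightarrow> 0"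
    by simp
  have nonneg: "0 \<le> q ((\<Sum>n<N. a n) - h 1)" for N
    using a h[of 1] by (intro seminorm_nonneg[OF q] diff_in sum_in) auto
  show ?thesis
    by (rule tendsto_sandwich[OF _ _ tendsto_const lim]) (use main nonneg in auto)
qed

end

section \<open>Holomorphic maps and complex analytic maps\<close>

text \<open>A seminorm ball of radius \<open>1 / R\<close> does it. The lemma supplies the discs of
  radius \<open>R\<close> in complex lines on which Cauchy estimates take place.\<close>

lemma (in lcs) balanced_nbhd:
  assumes "openin (top_of E) U" "x \<in> U" "R > 0"
  obtains W where "openin (top_of E) W" "0 \<in> W"
    "\<forall>w\<in>W. \<forall>t. norm t < R \<longrightarrow> x + scale_of E t w \<in> U"
proof -
  have x: "x \<in> carrier_of E"
    using assms openin_subset by blast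
  obtain q where q: "seminorm_on E q" "\<forall>u\<in>carrier_of E. q (u - x) < 1 \<longrightarrow> u \<in> U"
    using assms(1,2) by (rule exists_seminorm)
  let ?W = "{w \<in> carrier_of E. q (w - 0) < inverse R}"
  have "x + scale_of E t w \<in> U" if "w \<in> ?W" "norm t < R" for w t
  proof -
    have "q (scale_of E t w) = norm t * q w"
      using that seminorm_scale[OF q(1)] by simp
    also have "\<dots> \<le> norm t * inverse R"
      using that by (intro mult_left_mono) auto
    also have "\<dots> < R * inverse R"
      using that(2) \<open>R > 0\<close> by (intro mult_strict_right_mono) auto
    finally show ?thesis
      using q(2) x that(1) \<open>R > 0\<close> by simp
  qed
  moreover have "0 \<in> ?W"
    using \<open>R > 0\<close> by (simp add: seminorm_zero[OF q(1)])
  moreover have "openin (top_of E) ?W"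
    by (rule seminorm_open[OF q(1)]) simp
  ultimately show ?thesis
    using that[of ?W] by blast
qed

locale complex_pair = lcs_pair E F
  for E :: "(complex, 'e::ab_group_add) tvs" and F :: "(complex, 'f::ab_group_add) tvs"
begin

sublocale CF: complex_lcs F
  by unfold_locales

text \<open>Being bounded by \<open>q\<close>, the functional may be applied under the limit of the
  difference quotients. Complex differentiability along lines thus becomes holomorphy of scalar
  functions.\<close>

lemma functional_line_derivative:
  assumes q: "seminorm_on F q" and \<phi>: "dominated_functional F q \<phi>"
    and U: "openin (top_of E) U" and f: "\<forall>u\<in>U. f u \<in> carrier_of F"
    and w: "w \<in> carrier_of E" and t0: "x + scale_of E t0 w \<in> U"
    and dd: "has_dd f (x + scale_of E t0 w) w l"
  shows "((\<lambda>t. \<phi> (f (x + scale_of E t w))) has_field_derivative \<phi> l) (at t0)"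
  unfolding DERIV_def
proof (rule tendstoI)
  fix e :: real assume e: "e > 0"
  let ?x = "x + scale_of E t0 w"
  have eq: "x + scale_of E (t0 + h) w = ?x + scale_of E h w" for h
    by (simp add: E.scale_left_distrib)
  have l: "l \<in> carrier_of F"
    using has_dd_in[OF dd] .
  have "\<forall>\<^sub>F h in at 0. q (scale_of F (inverse h) (f (?x + scale_of E h w) - f ?x) - l) < e"
    using dd q e unfolding has_directional_derivative_def F.limitin_iff by blast
  moreover have "\<forall>\<^sub>F h in at 0. ?x + scale_of E h w \<in> U"
    by (rule eventually_line[OF U t0 w])
  ultimately show "\<forall>\<^sub>F h in at 0. dist ((\<phi> (f (x + scale_of E (t0 + h) w)) - \<phi> (f ?x)) / h) (\<phi> l) < e"
  proof eventually_elim
    case (elim h)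
    let ?y = "f (?x + scale_of E h w)"
    have y: "?y \<in> carrier_of F" "f ?x \<in> carrier_of F"
      using f t0 elim by auto
    have "(\<phi> ?y - \<phi> (f ?x)) / h - \<phi> l = \<phi> (scale_of F (inverse h) (?y - f ?x) - l)"
      using y l by (simp add: CF.functional_diff[OF \<phi>] CF.functional_scale[OF \<phi>] divide_inverse mult.commute
          del: F.scale_right_diff_distrib)
    then have "cmod ((\<phi> ?y - \<phi> (f ?x)) / h - \<phi> l) \<le> q (scale_of F (inverse h) (?y - f ?x) - l)"
      using y l CF.functional_le[OF \<phi>] by simp
    then show ?case
      using elim unfolding eq dist_norm by linarith
  qed
qed

lemma seminorm_line_continuous:
  assumes f: "continuous_map (subtopology (top_of E) U) (top_of F) f" and q: "seminorm_on F q"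
    and "x \<in> carrier_of E" "w \<in> carrier_of E" and K: "\<forall>t\<in>K. x + scale_of E t w \<in> U"
  shows "continuous_on K (\<lambda>t. q (f (x + scale_of E t w)))"
proof -
  have "continuous_map (top_of_set K) (subtopology (top_of E) U) (\<lambda>t. x + scale_of E t w)"
    using assms by (intro continuous_map_into_subtopology E.continuous_add E.continuous_scale) auto
  from F.continuous_seminorm[OF q continuous_map_compose[OF this f]] show ?thesis
    by (simp add: o_def)
qed

context
  fixes U f
  assumes U: "openin (top_of E) U" and f: "\<And>k. Ck_on k E F U f"
begin

lemma it_f_in: "x \<in> U \<Longrightarrow> \<forall>i<j. y i \<in> carrier_of E \<Longrightarrow> it f j x y \<in> carrier_of F"
  using it_in[OF f order_refl] openin_subset[OF U] by blast

text \<open>On the line all directions equal \<open>w\<close>, so each complex derivative in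
  \<open>t\<close> raises the order by one and adds one more copy of \<open>w\<close>.\<close>

lemma functional_line_higher_deriv:
  assumes q: "seminorm_on F q" and \<phi>: "dominated_functional F q \<phi>" and w: "w \<in> carrier_of E"
    and T: "open T" "\<forall>t\<in>T. x + scale_of E t w \<in> U" and t: "t \<in> T"
  shows "(deriv ^^ n) (\<lambda>t. \<phi> (f (x + scale_of E t w))) t = \<phi> (it f n (x + scale_of E t w) (\<lambda>_. w))"
    and "((deriv ^^ n) (\<lambda>t. \<phi> (f (x + scale_of E t w))) has_field_derivative
      \<phi> (it f (Suc n) (x + scale_of E t w) (\<lambda>_. w))) (at t)"
proof -
  let ?h = "\<lambda>n t. \<phi> (it f n (x + scale_of E t w) (\<lambda>_. w))"
  have d: "(?h n has_field_derivative ?h (Suc n) t) (at t)" if "t \<in> T" for n t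
  proof (rule functional_line_derivative[OF q \<phi> U _ w])
    show "\<forall>u\<in>U. it f n u (\<lambda>_. w) \<in> carrier_of F"
      using it_f_in w by simp
    show "x + scale_of E t w \<in> U"
      using T(2) that by blast
    then show "has_dd (\<lambda>u. it f n u (\<lambda>_. w)) (x + scale_of E t w) w (it f (Suc n) (x + scale_of E t w) (\<lambda>_. w))"
      using Ck_has_dd[OF f lessI, of _ n "\<lambda>_. w"] w by simp
  qed
  have eq: "\<forall>t\<in>T. (deriv ^^ n) (?h 0) t = ?h n t" for n
  proof (induction n)
    case (Suc n)
    show ?case
    proof
      fix t assume t: "t \<in> T"
      have "((deriv ^^ n) (?h 0) has_field_derivative ?h (Suc n) t) (at t)"
        by (rule has_field_derivative_transform_within_open[OF d[OF t] T(1) t]) (use Suc.IH in simp)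
      then show "(deriv ^^ Suc n) (?h 0) t = ?h (Suc n) t"
        by (simp add: DERIV_imp_deriv)
    qed
  qed simp
  show "(deriv ^^ n) (\<lambda>t. \<phi> (f (x + scale_of E t w))) t = ?h n t"
    using eq t by simp
  show "((deriv ^^ n) (\<lambda>t. \<phi> (f (x + scale_of E t w))) has_field_derivative ?h (Suc n) t) (at t)"
    by (rule has_field_derivative_transform_within_open[OF d[OF t] T(1) t]) (use eq in simp)
qed

text \<open>The Taylor series in one variable of \<open>f (x + t w)\<close>, evaluated at
  \<open>t = 1\<close>. Its coefficients already exist as vectors of \<open>F\<close>, so only the
  convergence has to be tested, and functionals do that.\<close>

lemma Ck_taylor_series:
  assumes x: "x \<in> carrier_of E" and w: "w \<in> carrier_of E"
    and line: "\<forall>t. cmod t < 2 \<longrightarrow> x + scale_of E t w \<in> U"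
  shows "limitin (top_of F) (\<lambda>N. \<Sum>n<N. scale_of F (inverse (fact n)) (it f n x (\<lambda>_. w))) (f (x + w)) sequentially"
proof -
  have xU: "x \<in> U"
    using line[rule_format, of 0] by simp
  have xw: "x + w \<in> U"
    using line[rule_format, of 1] by simp
  have a_in: "scale_of F (inverse (fact n)) (it f n x (\<lambda>_. w)) \<in> carrier_of F" for n
    using it_f_in[OF xU] w by simp
  have h_in: "f (x + scale_of E t w) \<in> carrier_of F" if "cmod t < 2" for t
    using it_f_in[of _ 0] line that by simp
  have lim: "(\<lambda>N. q ((\<Sum>n<N. scale_of F (inverse (fact n)) (it f n x (\<lambda>_. w))) - f (x + scale_of E 1 w))) \<longlonglongrightarrow> 0"
    if q: "seminorm_on F q" for q
  proof -
    have "continuous_on (cball 0 (3/2)) (\<lambda>t. q (f (x + scale_of E t w)))"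
      by (rule seminorm_line_continuous[OF Ck_continuous_map[OF f] q x w]) (use line in auto)
    then have "bounded ((\<lambda>t. q (f (x + scale_of E t w))) ` cball 0 (3/2))"
      by (intro compact_imp_bounded compact_continuous_image) auto
    then obtain B where B: "\<forall>y\<in>(\<lambda>t. q (f (x + scale_of E t w))) ` cball 0 (3/2). norm y \<le> B"
      unfolding bounded_iff by blast
    show ?thesis
    proof (rule CF.taylor_series_converges[OF q h_in a_in, where B = B])
      show "q (f (x + scale_of E t w)) \<le> B" if "cmod t \<le> 3 / 2" for t
        using bspec[OF B imageI[of t]] that by simp
      fix \<phi> assume \<phi>: "dominated_functional F q \<phi>"
      have T: "open (ball 0 2)" "\<forall>t\<in>ball 0 2. x + scale_of E t w \<in> U"
        using line by auto
      show "(\<lambda>t. \<phi> (f (x + scale_of E t w))) holomorphic_on ball 0 2"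
        unfolding holomorphic_on_open[OF T(1)]
        using functional_line_higher_deriv(2)[OF q \<phi> w T, of _ 0] unfolding funpow_0 by blast
      show "(deriv ^^ n) (\<lambda>t. \<phi> (f (x + scale_of E t w))) 0 =
          fact n * \<phi> (scale_of F (inverse (fact n)) (it f n x (\<lambda>_. w)))" for n
        using functional_line_higher_deriv(1)[OF q \<phi> w T, of 0 n] it_f_in[OF xU, of n "\<lambda>_. w"] w
        by (simp add: CF.functional_scale[OF \<phi>])
    qed auto
  qed
  show ?thesis
    unfolding F.limitin_iff
  proof (intro conjI allI impI)
    show "f (x + w) \<in> carrier_of F"
      using h_in[of 1] by simp
    show "\<forall>\<^sub>F N in sequentially. (\<Sum>n<N. scale_of F (inverse (fact n)) (it f n x (\<lambda>_. w))) \<in> carrier_of F"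
      using a_in by (intro always_eventually allI F.sum_in)
    show "\<forall>\<^sub>F N in sequentially. q ((\<Sum>n<N. scale_of F (inverse (fact n)) (it f n x (\<lambda>_. w))) - f (x + w)) < e"
      if "seminorm_on F q" "0 < e" for q e
      using order_tendstoD(2)[OF lim[OF that(1)] that(2)] by simp
  qed
qed

theorem Ck_imp_complex_analytic: "complex_analytic_on E F U f"
  unfolding complex_analytic_on_def
proof (intro conjI ballI)
  show "continuous_map (subtopology (top_of E) U) (top_of F) f"
    using Ck_continuous_map[OF f] .
  fix x assume x: "x \<in> U"
  have xE: "x \<in> carrier_of E"
    using x openin_subset[OF U] by blast
  have "(2::real) > 0"
    by simp
  with U x obtain W where W: "openin (top_of E) W" "0 \<in> W"
    "\<forall>w\<in>W. \<forall>t. norm t < 2 \<longrightarrow> x + scale_of E t w \<in> U"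
    by (rule E.balanced_nbhd)
  let ?p = "\<lambda>n w. scale_of F (inverse (fact n)) (it f n x (\<lambda>_. w))"
  have poly: "continuous_homogeneous_polynomial n E F (?p n)" for n
    unfolding continuous_homogeneous_polynomial_def
  proof (intro exI[of _ "\<lambda>y. scale_of F (inverse (fact n)) (it f n x y)"] conjI ballI)
    have "multilinear n E F (it f n x)"
      by (rule it_multilinear[OF f U order_refl x])
    then show "multilinear n E F (\<lambda>y. scale_of F (inverse (fact n)) (it f n x y))"
      unfolding multilinear_def by (simp add: F.scale_right_distrib mult.commute)
    show "continuous_map (product_topology (\<lambda>_. top_of E) {..<n}) (top_of F) (\<lambda>y. scale_of F (inverse (fact n)) (it f n x y))"
      by (intro F.continuous_scale_const it_continuous_at[OF f U order_refl x])
    show "?p n w = scale_of F (inverse (fact n)) (it f n x (\<lambda>i\<in>{..<n}. w))" for w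
      using it_cong[of n "\<lambda>_. w" "\<lambda>i\<in>{..<n}. w"] by simp
  qed
  have "x + w \<in> U \<and> limitin (top_of F) (\<lambda>m. \<Sum>n<m. ?p n w) (f (x + w)) sequentially" if "w \<in> W" for w
    using Ck_taylor_series[OF xE, of w] W(3)[rule_format, OF that, of 1] W(3) that openin_subset[OF W(1)] by auto
  then show "\<exists>W p. openin (top_of E) W \<and> 0 \<in> W \<and> (\<forall>n. continuous_homogeneous_polynomial n E F (p n)) \<and>
      (\<forall>w\<in>W. x + w \<in> U \<and> limitin (top_of F) (\<lambda>m. \<Sum>n<m. p n w) (f (x + w)) sequentially)"
    using W(1,2) poly by (intro exI[of _ W] exI[of _ ?p]) auto
qed

end

end

text \<open>The tube lemma: finitely many of the local sets \<open>T t\<close> cover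
  \<open>K\<close>, and the corresponding \<open>N t\<close> are intersected. It converts estimates
  near each parameter of a closed disc into one that is uniform over the disc.\<close>

lemma compact_tube:
  assumes K: "compact K"
    and loc: "\<And>t. t \<in> K \<Longrightarrow> \<exists>N T. openin X N \<and> x0 \<in> N \<and> open T \<and> t \<in> T \<and> (\<forall>x\<in>N. \<forall>s\<in>T \<inter> K. P x s)"
    and x0: "x0 \<in> topspace X"
  shows "\<exists>N. openin X N \<and> x0 \<in> N \<and> (\<forall>x\<in>N. \<forall>s\<in>K. P x s)"
proof -
  obtain N T where NT: "\<forall>t\<in>K. openin X (N t) \<and> x0 \<in> N t \<and> open (T t) \<and> t \<in> T t \<and> (\<forall>x\<in>N t. \<forall>s\<in>T t \<inter> K. P x s)"
    using bchoice[of K] loc by metis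
  obtain C where C: "C \<subseteq> K" "finite C" "K \<subseteq> (\<Union>t\<in>C. T t)"
    by (rule compactE_image[OF K, of K T]) (use NT in auto)
  let ?N = "\<Inter>(insert (topspace X) (N ` C))"
  have "openin X ?N"
    by (rule openin_Inter) (use C NT in auto)
  moreover have "x0 \<in> ?N"
    using x0 C NT by auto
  moreover have "P x s" if "x \<in> ?N" "s \<in> K" for x s
  proof -
    obtain t where "t \<in> C" "s \<in> T t"
      using C(3) \<open>s \<in> K\<close> by blast
    then show ?thesis
      using NT C(1) that by blast
  qed
  ultimately show ?thesis
    by blast
qed

lemma (in lcs_pair) multilinear_scale_all:
  assumes ml: "multilinear n E F \<beta>" and v: "v \<in> carrier_of E"
  shows "\<beta> (\<lambda>i\<in>{..<n}. scale_of E c v) = scale_of F (c ^ n) (\<beta> (\<lambda>i\<in>{..<n}. v))"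
proof -
  have "\<beta> (\<lambda>i\<in>{..<n}. if i < m then scale_of E c v else v) = scale_of F (c ^ m) (\<beta> (\<lambda>i\<in>{..<n}. v))"
    if "m \<le> n" for m
    using that
  proof (induction m)
    case (Suc m)
    let ?y = "\<lambda>i\<in>{..<n}. if i < m then scale_of E c v else v"
    have y: "?y \<in> Pi\<^sub>E {..<n} (\<lambda>_. carrier_of E)"
      using v by auto
    have m: "m < n"
      using Suc.prems by simp
    have upd: "(\<lambda>i\<in>{..<n}. if i < Suc m then scale_of E c v else v) = ?y(m := scale_of E c v)" "?y(m := v) = ?y"
      using m by (auto simp: fun_eq_iff)
    have hom: "\<beta> (?y(m := scale_of E c v)) = scale_of F c (\<beta> (?y(m := v)))"
      using bspec[OF ml[unfolded multilinear_def] y, rule_format, OF m] v by blast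
    have "m \<le> n"
      using m by simp
    from Suc.IH[OF this] show ?case
      by (simp only: upd(1) hom) (simp only: upd(2) F.scale_scale power_Suc)
  qed simp
  moreover have "(\<lambda>i\<in>{..<n}. if i < n then scale_of E c v else v) = (\<lambda>i\<in>{..<n}. scale_of E c v)"
    by (auto simp: fun_eq_iff)
  ultimately show ?thesis
    by (metis order_refl)
qed

section \<open>Cauchy estimates and differentiability of complex analytic maps\<close>

context complex_pair
begin

text \<open>Locally uniform Cauchy estimates turn pointwise complex differentiability along lines, together
  with joint continuity, into joint continuity of the derivative.\<close>

lemma gateaux_derivative_continuous:
  fixes H :: "'e \<Rightarrow> 'p \<Rightarrow> 'f" and P :: "'p topology"
  assumes U: "openin (top_of E) U"
    and cont: "continuous_map (prod_topology (subtopology (top_of E) U) P) (top_of F) (\<lambda>z. H (fst z) (snd z))"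
    and dd: "\<And>x v p. x \<in> U \<Longrightarrow> v \<in> carrier_of E \<Longrightarrow> p \<in> topspace P \<Longrightarrow> has_dd (\<lambda>u. H u p) x v (D x v p)"
  shows "continuous_map (prod_topology (subtopology (top_of E) U) (prod_topology (top_of E) P)) (top_of F)
      (\<lambda>z. D (fst z) (fst (snd z)) (snd (snd z)))"
proof (rule F.continuous_mapI)
  let ?X = "prod_topology (subtopology (top_of E) U) (prod_topology (top_of E) P)"
  have UE: "U \<subseteq> carrier_of E"
    using openin_subset[OF U] .
  show "D (fst z) (fst (snd z)) (snd (snd z)) \<in> carrier_of F" if "z \<in> topspace ?X" for z
    using that by (intro has_dd_in[OF dd]) auto
  have H_in: "H x p \<in> carrier_of F" if "x \<in> U" "p \<in> topspace P" for x p
    using continuous_map_in[OF cont, of "(x, p)"] that UE by auto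
  fix q z0 and e :: real assume q: "seminorm_on F q" and z0: "z0 \<in> topspace ?X" and e: "e > 0"
  obtain x0 v0 p0 where z0_eq: "z0 = (x0, v0, p0)"
    by (cases z0) auto
  have x0: "x0 \<in> U" and v0: "v0 \<in> carrier_of E" and p0: "p0 \<in> topspace P"
    using z0 by (auto simp: z0_eq)
  have "\<forall>\<^sub>F t in at 0. x0 + scale_of E t v0 \<in> U"
    by (rule eventually_line[OF U x0 v0])
  then obtain d where d: "d > 0" "\<forall>t. t \<noteq> 0 \<and> cmod t < d \<longrightarrow> x0 + scale_of E t v0 \<in> U"
    unfolding eventually_at by (auto simp: dist_norm)
  \<comment> \<open>Half of \<open>d\<close> keeps the closed disc of radius \<open>r\<close> inside
    the open disc on which the line through \<open>x0\<close> stays in \<open>U\<close>.\<close>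
  define r where "r = d / 2"
  have r: "r > 0"
    using d(1) by (simp add: r_def)
  have line0: "x0 + scale_of E t v0 \<in> U" if "cmod t \<le> r" for t
    using d that x0 by (cases "t = 0") (auto simp: r_def)
  let ?Y = "prod_topology ?X euclidean"
  let ?line = "\<lambda>y. fst (fst y) + scale_of E (snd y) (fst (snd (fst y)))"
  let ?W = "{y \<in> topspace ?Y. ?line y \<in> U}"
  have c1: "continuous_map ?Y (top_of E) (\<lambda>y. fst (fst y))"
    using continuous_map_into_fulltopology[OF continuous_map_compose[OF continuous_map_fst continuous_map_fst]]
    by (simp add: o_def)
  have c2: "continuous_map ?Y (top_of E) (\<lambda>y. fst (snd (fst y)))"
    by (rule continuous_map_fst_comp[OF continuous_map_snd_comp[OF continuous_map_fst]])
  have c3: "continuous_map ?Y P (\<lambda>y. snd (snd (fst y)))"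
    by (rule continuous_map_snd_comp[OF continuous_map_snd_comp[OF continuous_map_fst]])
  have line: "continuous_map ?Y (top_of E) ?line"
    by (intro E.continuous_add E.continuous_scale c1 c2 continuous_map_snd)
  have W: "openin ?Y ?W"
    by (rule openin_continuous_map_preimage[OF line U])
  have "continuous_map (subtopology ?Y ?W) (prod_topology (subtopology (top_of E) U) P) (\<lambda>y. (?line y, snd (snd (fst y))))"
    by (intro continuous_map_pairedI continuous_map_into_subtopology continuous_map_from_subtopology line c3) auto
  from continuous_map_compose[OF this cont]
  have HY: "continuous_map (subtopology ?Y ?W) (top_of F) (\<lambda>y. H (?line y) (snd (snd (fst y))))"
    by (simp add: o_def)
  \<comment> \<open>By Cauchy's inequality a bound \<open>e * r / 2\<close> on the circle of radius
    \<open>r\<close> becomes \<open>e / 2\<close> for the derivative at the centre.\<close>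
  define Q where "Q z t \<longleftrightarrow> fst z + scale_of E t (fst (snd z)) \<in> U \<and>
    q (H (fst z + scale_of E t (fst (snd z))) (snd (snd z)) - H (x0 + scale_of E t v0) p0) < e * r / 2" for z t
  have er: "e * r / 4 > 0"
    using e r by simp
  have "\<exists>N. openin ?X N \<and> z0 \<in> N \<and> (\<forall>z\<in>N. \<forall>t\<in>cball 0 r. Q z t)"
  proof (rule compact_tube[OF compact_cball _ z0])
    fix t1 :: complex assume t1: "t1 \<in> cball 0 r"
    have mem: "(z0, t1) \<in> topspace (subtopology ?Y ?W)"
      using z0 line0[of t1] t1 by (auto simp: z0_eq)
    obtain O' where O': "openin (subtopology ?Y ?W) O'" "(z0, t1) \<in> O'"
      "\<forall>y\<in>O'. H (?line y) (snd (snd (fst y))) \<in> carrier_of F \<and>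
        q (H (?line y) (snd (snd (fst y))) - H (?line (z0, t1)) (snd (snd (fst (z0, t1))))) < e * r / 4"
      by (rule F.continuous_mapD[OF HY q mem er])
    have O'Y: "openin ?Y O'" "O' \<subseteq> ?W"
      using iffD1[OF openin_open_subtopology[OF W] O'(1)] by blast+
    obtain N T where NT: "openin ?X N" "openin euclidean T" "z0 \<in> N" "t1 \<in> T" "N \<times> T \<subseteq> O'"
      using O'Y(1) O'(2) by (rule prod_nbhd)
    have "Q z s" if "z \<in> N" "s \<in> T \<inter> cball 0 r" for z s
    proof -
      let ?a = "H (?line (z, s)) (snd (snd z))" and ?b = "H (x0 + scale_of E s v0) p0"
      let ?c = "H (?line (z0, t1)) (snd (snd z0))"
      have zs: "(z, s) \<in> O'" "(z0, s) \<in> O'"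
        using NT(3,5) that by blast+
      then have 1: "?a \<in> carrier_of F" "q (?a - ?c) < e * r / 4" and 2: "?b \<in> carrier_of F" "q (?b - ?c) < e * r / 4"
        using O'(3)[rule_format, OF zs(1)] O'(3)[rule_format, OF zs(2)] by (auto simp: z0_eq)
      have c: "?c \<in> carrier_of F"
        using O'(3)[rule_format, OF O'(2)] by simp
      have "q (?a - ?b) \<le> q (?a - ?c) + q (?c - ?b)"
        using 1(1) c 2(1) by (rule F.seminorm_triangle[OF q])
      then have "q (?a - ?b) < e * r / 2"
        using 1(2) 2(2) F.seminorm_commute[OF q c 2(1)] by linarith
      moreover have "fst z + scale_of E s (fst (snd z)) \<in> U"
        using zs(1) O'Y(2) by auto
      ultimately show ?thesis
        by (simp add: Q_def)
    qed
    moreover have "open T"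
      using NT(2) by simp
    ultimately show "\<exists>N T. openin ?X N \<and> z0 \<in> N \<and> open T \<and> t1 \<in> T \<and> (\<forall>z\<in>N. \<forall>s\<in>T \<inter> cball 0 r. Q z s)"
      using NT(1,3,4) by blast
  qed
  then obtain N where N: "openin ?X N" "z0 \<in> N" "\<forall>z\<in>N. \<forall>t\<in>cball 0 r. Q z t"
    by blast
  have "q (D (fst z) (fst (snd z)) (snd (snd z)) - D x0 v0 p0) < e" if z: "z \<in> N" for z
  proof -
    obtain x v p where z_eq: "z = (x, v, p)"
      by (cases z) auto
    have xvp: "x \<in> U" "v \<in> carrier_of E" "p \<in> topspace P"
      using openin_subset[OF N(1)] z by (auto simp: z_eq)
    have Qz: "x + scale_of E t v \<in> U" "q (H (x + scale_of E t v) p - H (x0 + scale_of E t v0) p0) < e * r / 2"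
      if "cmod t \<le> r" for t
      using N(3)[rule_format, OF z, of t] that by (auto simp: Q_def z_eq)
    have Dz: "D x v p \<in> carrier_of F" "D x0 v0 p0 \<in> carrier_of F"
      using has_dd_in dd xvp x0 v0 p0 by blast+
    have "q (D x v p - D x0 v0 p0) \<le> e / 2"
    proof (rule CF.seminorm_le_by_functionals[OF q])
      fix \<phi> assume \<phi>: "dominated_functional F q \<phi>"
      let ?g = "\<lambda>t. \<phi> (H (x + scale_of E t v) p) - \<phi> (H (x0 + scale_of E t v0) p0)"
      have der: "((\<lambda>t. \<phi> (H (x' + scale_of E t v') p')) has_field_derivative \<phi> (D (x' + scale_of E t v') v' p')) (at t)"
        if "x' + scale_of E t v' \<in> U" "v' \<in> carrier_of E" "p' \<in> topspace P" for x' v' p' t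
        using H_in that by (intro functional_line_derivative[OF q \<phi> U _ _ _ dd]) auto
      have derg: "(?g has_field_derivative (\<phi> (D (x + scale_of E t v) v p) - \<phi> (D (x0 + scale_of E t v0) v0 p0))) (at t)"
        if "cmod t \<le> r" for t
        using Qz[OF that] line0[OF that] xvp v0 p0 by (intro DERIV_diff der)
      have "cmod ((deriv ^^ 1) ?g 0) \<le> fact 1 * (e * r / 2) / r ^ 1"
      proof (rule Cauchy_inequality)
        show "?g holomorphic_on ball 0 r"
          unfolding holomorphic_on_open[OF open_ball]
        proof
          fix t :: complex assume "t \<in> ball 0 r"
          then show "\<exists>f'. (?g has_field_derivative f') (at t)"
            using derg[of t] by (intro exI) auto
        qed
        show "continuous_on (cball 0 r) ?g"
        proof (intro continuous_at_imp_continuous_on ballI)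
          fix t :: complex assume "t \<in> cball 0 r"
          then show "isCont ?g t"
            using DERIV_isCont[OF derg[of t]] by simp
        qed
        show "cmod (?g t) \<le> e * r / 2" if "cmod (0 - t) = r" for t
        proof -
          have t: "cmod t \<le> r"
            using that by simp
          have "?g t = \<phi> (H (x + scale_of E t v) p - H (x0 + scale_of E t v0) p0)"
            using H_in Qz[OF t] line0[OF t] xvp p0 by (simp add: CF.functional_diff[OF \<phi>])
          also have "cmod \<dots> \<le> q (H (x + scale_of E t v) p - H (x0 + scale_of E t v0) p0)"
            using H_in Qz[OF t] line0[OF t] xvp p0 by (intro CF.functional_le[OF \<phi>]) simp
          finally show ?thesis
            using Qz(2)[OF t] by simp
        qed
      qed (fact r)
      moreover have "(deriv ^^ 1) ?g 0 = \<phi> (D x v p - D x0 v0 p0)"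
        using DERIV_imp_deriv[OF derg[of 0]] r Dz by (simp add: CF.functional_diff[OF \<phi>])
      ultimately show "cmod (\<phi> (D x v p - D x0 v0 p0)) \<le> e / 2"
        using r by simp
    qed (use Dz in simp)
    then show ?thesis
      using e by (simp add: z_eq)
  qed
  then show "\<exists>W. openin ?X W \<and> z0 \<in> W \<and>
      (\<forall>z\<in>W. q (D (fst z) (fst (snd z)) (snd (snd z)) - D (fst z0) (fst (snd z0)) (snd (snd z0))) < e)"
    using N(1,2) by (intro exI[of _ N]) (simp add: z0_eq)
qed

lemma analytic_expansion:
  assumes f: "complex_analytic_on E F U f" and x: "x \<in> U"
  obtains \<beta> W where "openin (top_of E) W" "0 \<in> W" "\<forall>n. multilinear n E F (\<beta> n)"
    "\<forall>n. continuous_map (product_topology (\<lambda>_. top_of E) {..<n}) (top_of F) (\<beta> n)"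
    "\<forall>w\<in>W. x + w \<in> U \<and> limitin (top_of F) (\<lambda>m. \<Sum>n<m. \<beta> n (\<lambda>i\<in>{..<n}. w)) (f (x + w)) sequentially"
proof -
  obtain W p where W: "openin (top_of E) W" "0 \<in> W" "\<forall>n. continuous_homogeneous_polynomial n E F (p n)"
    "\<forall>w\<in>W. x + w \<in> U \<and> limitin (top_of F) (\<lambda>m. \<Sum>n<m. p n w) (f (x + w)) sequentially"
    using f x unfolding complex_analytic_on_def by blast
  obtain \<beta> where \<beta>: "\<forall>n. multilinear n E F (\<beta> n) \<and>
      continuous_map (product_topology (\<lambda>_. top_of E) {..<n}) (top_of F) (\<beta> n) \<and>
      (\<forall>x\<in>carrier_of E. p n x = \<beta> n (\<lambda>i\<in>{..<n}. x))"
    using choice[OF W(3)[unfolded continuous_homogeneous_polynomial_def]] by blast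
  have "w \<in> carrier_of E" if "w \<in> W" for w
    using that openin_subset[OF W(1)] by blast
  then show ?thesis
    using W(1,2,4) \<beta> by (intro that[of W \<beta>]) auto
qed

text \<open>The derivative is the linear coefficient \<open>P 1\<close>. Convergence at the one
  point \<open>s v\<close> bounds the numbers \<open>s^n q (P n)\<close> by a constant
  \<open>M\<close>. For \<open>cmod t \<le> s / 2\<close> the terms of order two and higher are then
  dominated by a geometric series and are of size \<open>cmod t\<close> squared, so the difference
  quotient differs from \<open>P 1\<close> by a multiple of \<open>cmod t\<close>.\<close>

lemma analytic_has_dd:
  assumes f: "complex_analytic_on E F U f" and x: "x \<in> U" and v: "v \<in> carrier_of E"
  shows "\<exists>l. has_dd f x v l"
proof -
  obtain \<beta> W where W: "openin (top_of E) W" "0 \<in> W" and ml: "\<forall>n. multilinear n E F (\<beta> n)"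
    and \<beta>: "\<forall>n. continuous_map (product_topology (\<lambda>_. top_of E) {..<n}) (top_of F) (\<beta> n)"
    and lim: "\<forall>w\<in>W. x + w \<in> U \<and> limitin (top_of F) (\<lambda>m. \<Sum>n<m. \<beta> n (\<lambda>i\<in>{..<n}. w)) (f (x + w)) sequentially"
    using f x by (rule analytic_expansion)
  define P where "P n = \<beta> n (\<lambda>i\<in>{..<n}. v)" for n
  have P: "P n \<in> carrier_of F" for n
    unfolding P_def using v by (intro continuous_map_in[OF \<beta>[rule_format]]) auto
  obtain d where d: "d > 0" "\<forall>t. t \<noteq> 0 \<and> cmod t < d \<longrightarrow> scale_of E t v \<in> W"
    using eventually_line[OF W v] unfolding eventually_at by (auto simp: dist_norm)
  have S: "limitin (top_of F) (\<lambda>m. \<Sum>n<m. scale_of F (t ^ n) (P n)) (f (x + scale_of E t v)) sequentially"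
    if "cmod t < d" for t
  proof -
    have "scale_of E t v \<in> W"
      using d that W(2) by (cases "t = 0") auto
    from lim[rule_format, OF this] show ?thesis
      using multilinear_scale_all[OF ml[rule_format] v] by (simp add: P_def)
  qed
  have f_in: "f (x + scale_of E t v) \<in> carrier_of F" if "cmod t < d" for t
    using S[OF that] by (simp add: limitin_def)
  \<comment> \<open>The expansion at \<open>t = 0\<close>, where \<open>0 ^ 0 = 1\<close> leaves
    just the constant term.\<close>
  have fx: "f x = P 0"
  proof (rule F.limitin_unique)
    show "limitin (top_of F) (\<lambda>m. \<Sum>n<m. scale_of F (0 ^ n) (P n)) (f x) sequentially"
      using S[of 0] d(1) by simp
    have "(\<Sum>n<m. scale_of F (0 ^ n) (P n)) = P 0" if "m \<ge> 1" for m
    proof -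
      have "(\<Sum>n<m. scale_of F (0 ^ n) (P n)) = (\<Sum>n\<in>{0}. scale_of F (0 ^ n) (P n))"
        using that by (intro sum.mono_neutral_right) auto
      then show ?thesis by simp
    qed
    then show "limitin (top_of F) (\<lambda>m. \<Sum>n<m. scale_of F (0 ^ n) (P n)) (P 0) sequentially"
      using P by (intro limitin_eventually) (auto simp: eventually_sequentially)
  qed simp
  define s where "s = d / 2"
  have s: "0 < s" "s < d"
    using d(1) by (auto simp: s_def)
  have quad: "\<exists>M\<ge>0. \<forall>t. t \<noteq> 0 \<and> cmod t \<le> s / 2 \<longrightarrow>
      q (scale_of F (inverse t) (f (x + scale_of E t v) - f x) - P 1) \<le> M * cmod t" if q: "seminorm_on F q" for q
  proof -
    have "\<forall>\<^sub>F m in sequentially. q ((\<Sum>n<m. scale_of F (of_real s ^ n) (P n)) - f (x + scale_of E (of_real s) v)) < 1"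
      using S[of "of_real s"] s q unfolding F.limitin_iff by simp
    then obtain N0 where N0: "\<forall>m\<ge>N0. q ((\<Sum>n<m. scale_of F (of_real s ^ n) (P n)) - f (x + scale_of E (of_real s) v)) < 1"
      unfolding eventually_sequentially by blast
    \<comment> \<open>The summand \<open>2\<close> takes care of \<open>n \<ge> N0\<close>: such a
      term is the difference of two partial sums, each within distance \<open>1\<close> of the
      limit.\<close>
    define M where "M = 2 + (\<Sum>n<N0. s ^ n * q (P n))"
    have qP: "0 \<le> q (P n)" for n
      using F.seminorm_nonneg[OF q P] .
    have sum_nonneg': "0 \<le> (\<Sum>n<N0. s ^ n * q (P n))"
      using s qP by (intro sum_nonneg) auto
    then have M: "0 \<le> M"
      by (simp add: M_def)
    have term_le: "s ^ n * q (P n) \<le> M" for n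
    proof (cases "n < N0")
      case True
      then have "s ^ n * q (P n) \<le> (\<Sum>n<N0. s ^ n * q (P n))"
        using s qP by (intro member_le_sum) auto
      then show ?thesis by (simp add: M_def)
    next
      case False
      let ?S = "\<lambda>m. \<Sum>n<m. scale_of F (of_real s ^ n) (P n)" and ?L = "f (x + scale_of E (of_real s) v)"
      have in_F: "?S m \<in> carrier_of F" "?L \<in> carrier_of F" for m
        using P f_in s by (auto intro!: F.sum_in)
      have eq: "(?S (Suc n) - ?L) - (?S n - ?L) = scale_of F (of_real s ^ n) (P n)"
        by simp
      have "q ((?S (Suc n) - ?L) - (?S n - ?L)) \<le> q (?S (Suc n) - ?L) + q (?S n - ?L)"
        by (rule F.seminorm_diff[OF q]) (rule F.diff_in; fact in_F)+
      then have "q (scale_of F (of_real s ^ n) (P n)) \<le> q (?S (Suc n) - ?L) + q (?S n - ?L)"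
        unfolding eq .
      moreover have "q (?S (Suc n) - ?L) < 1" "q (?S n - ?L) < 1"
        using N0[rule_format, of "Suc n"] N0[rule_format, of n] False by (simp_all del: sum.lessThan_Suc)
      moreover have "q (scale_of F (of_real s ^ n) (P n)) = s ^ n * q (P n)"
        using F.seminorm_scale[OF q P] s by (simp add: norm_power)
      ultimately show ?thesis
        using sum_nonneg' by (simp add: M_def)
    qed
    have "q (scale_of F (inverse t) (f (x + scale_of E t v) - f x) - P 1) \<le> 2 * M / s^2 * cmod t"
      if t: "t \<noteq> 0" "cmod t \<le> s / 2" for t
    proof -
      let ?S = "\<lambda>m. \<Sum>n<m. scale_of F (t ^ n) (P n)" and ?L = "f (x + scale_of E t v)"
      have td: "cmod t < d"
        using t s by simp
      \<comment> \<open>The factor \<open>2\<close> bounds the geometric series of ratio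
        \<open>1/2\<close>, since \<open>cmod t / s\<close> is at most \<open>1/2\<close>.\<close>
      have tail: "q (?S m - P 0 - scale_of F t (P 1)) \<le> 2 * M * (cmod t / s)^2" if m: "m \<ge> 2" for m :: nat
      proof -
        define k where "k = m - 2"
        have m_eq: "m = Suc (Suc k)"
          using m by (simp add: k_def)
        have "?S m - P 0 - scale_of F t (P 1) = (\<Sum>n<k. scale_of F (t ^ (n + 2)) (P (n + 2)))"
          unfolding m_eq sum.lessThan_Suc_shift by (simp add: mult.assoc power2_eq_square)
        also have "q \<dots> \<le> (\<Sum>n<k. q (scale_of F (t ^ (n + 2)) (P (n + 2))))"
          using P by (intro F.seminorm_sum[OF q]) simp
        also have "\<dots> \<le> (\<Sum>n<k. M * (cmod t / s)^2 * (1/2)^n)"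
        proof (rule sum_mono)
          fix n
          have "q (scale_of F (t ^ (n + 2)) (P (n + 2))) = (cmod t / s) ^ (n + 2) * (s ^ (n + 2) * q (P (n + 2)))"
            using F.seminorm_scale[OF q P] s by (simp add: norm_power norm_mult power_divide)
          also have "\<dots> \<le> (cmod t / s) ^ (n + 2) * M"
            by (rule mult_left_mono[OF term_le]) (use s in simp)
          also have "\<dots> = M * (cmod t / s)^2 * (cmod t / s) ^ n"
            by (simp only: power_add mult_ac)
          also have "\<dots> \<le> M * (cmod t / s)^2 * (1/2) ^ n"
            using t s M by (intro mult_left_mono power_mono) (auto simp: field_simps)
          finally show "q (scale_of F (t ^ (n + 2)) (P (n + 2))) \<le> M * (cmod t / s)^2 * (1/2) ^ n" .
        qed
        also have "\<dots> = M * (cmod t / s)^2 * (\<Sum>n<k. (1/2) ^ n)"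
          by (simp add: sum_distrib_left)
        also have "\<dots> \<le> M * (cmod t / s)^2 * 2"
        proof (rule mult_left_mono)
          have "(\<Sum>n<k. (1/2::real) ^ n) = 2 - 2 * (1/2) ^ k"
            by (induction k) auto
          then show "(\<Sum>n<k. (1/2::real) ^ n) \<le> 2"
            by simp
        qed (use M in simp)
        finally show ?thesis
          by (simp add: mult_ac)
      qed
      have in_F: "?S m \<in> carrier_of F" "?L \<in> carrier_of F" for m
        using P f_in td by (auto intro!: F.sum_in)
      have "q (?L - f x - scale_of F t (P 1)) \<le> 2 * M * (cmod t / s)^2"
      proof (rule field_le_epsilon)
        fix e :: real assume "e > 0"
        then have "\<forall>\<^sub>F m in sequentially. q (?S m - ?L) < e"
          by (rule F.limitin_seminorm[OF S[OF td] q])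
        moreover have "\<forall>\<^sub>F m in sequentially. m \<ge> (2::nat)"
          by (rule eventually_ge_at_top)
        ultimately have "\<forall>\<^sub>F m in sequentially. q (?S m - ?L) < e \<and> m \<ge> 2"
          by (rule eventually_conj)
        then obtain m where m: "q (?S m - ?L) < e" "m \<ge> 2"
          unfolding eventually_sequentially by blast
        have eq: "(?S m - P 0 - scale_of F t (P 1)) - (?S m - ?L) = ?L - f x - scale_of F t (P 1)"
          by (simp add: fx)
        have "q ((?S m - P 0 - scale_of F t (P 1)) - (?S m - ?L)) \<le> q (?S m - P 0 - scale_of F t (P 1)) + q (?S m - ?L)"
          using in_F P by (intro F.seminorm_diff[OF q]) simp_all
        then show "q (?L - f x - scale_of F t (P 1)) \<le> 2 * M * (cmod t / s)^2 + e"
          using tail[OF m(2)] m(1) unfolding eq by linarith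
      qed
      then have "q (?L - f x - scale_of F t (P 1)) / cmod t \<le> 2 * M * (cmod t / s)^2 / cmod t"
        by (intro divide_right_mono) simp_all
      also have "\<dots> = 2 * M / s^2 * cmod t"
        using t(1) by (simp add: power2_eq_square)
      also have "q (?L - f x - scale_of F t (P 1)) / cmod t = q (scale_of F (inverse t) (?L - f x) - P 1)"
        using in_F(2) P t(1) fx by (intro seminorm_quotient[OF q, symmetric]) simp_all
      finally show ?thesis .
    qed
    then show ?thesis
      using M by (intro exI[of _ "2 * M / s^2"]) auto
  qed
  have "has_dd f x v (P 1)"
    unfolding has_directional_derivative_def F.limitin_iff
  proof (intro conjI allI impI)
    show "\<forall>\<^sub>F t in at 0. scale_of F (inverse t) (f (x + scale_of E t v) - f x) \<in> carrier_of F"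
      unfolding eventually_at using d(1) f_in P fx
      by (intro exI[of _ d]) (auto simp: dist_norm)
    fix q and e :: real assume q: "seminorm_on F q" and e: "0 < e"
    obtain M where M: "M \<ge> 0" "\<forall>t. t \<noteq> 0 \<and> cmod t \<le> s / 2 \<longrightarrow>
        q (scale_of F (inverse t) (f (x + scale_of E t v) - f x) - P 1) \<le> M * cmod t"
      using quad[OF q] by blast
    show "\<forall>\<^sub>F t in at 0. q (scale_of F (inverse t) (f (x + scale_of E t v) - f x) - P 1) < e"
      unfolding eventually_at
    proof (intro exI[of _ "min (s/2) (e / (M + 1))"] conjI ballI impI)
      show "0 < min (s / 2) (e / (M + 1))"
        using s e M(1) by simp
      fix t :: complex assume t: "t \<noteq> 0 \<and> dist t 0 < min (s / 2) (e / (M + 1))"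
      then have "M * cmod t \<le> (M + 1) * cmod t"
        by (intro mult_right_mono) auto
      also have "\<dots> < e"
        using t M(1) by (simp add: dist_norm field_simps)
      finally show "q (scale_of F (inverse t) (f (x + scale_of E t v) - f x) - P 1) < e"
        using M(2)[rule_format, of t] t by (simp add: dist_norm)
    qed
  qed (use P in simp)
  then show ?thesis
    by blast
qed

end

section \<open>Directional derivatives of complex analytic maps\<close>

context complex_pair
begin

text \<open>This is the derivative in direction \<open>v\<close> of the polynomial given by
  \<open>\<beta>\<close> on the diagonal, of degree one less. To exhibit an underlying multilinear
  map, \<open>Y i\<close> inserts \<open>v\<close> at position \<open>i\<close> into a list of
  \<open>n\<close> arguments.\<close>

lemma polynomial_directional_derivative:
  assumes ml: "multilinear (Suc n) E F \<beta>"
    and cont: "continuous_map (product_topology (\<lambda>_. top_of E) {..<Suc n}) (top_of F) \<beta>"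
    and v: "v \<in> carrier_of E"
  shows "continuous_homogeneous_polynomial n E F (\<lambda>w. \<Sum>i<Suc n. \<beta> (\<lambda>j\<in>{..<Suc n}. if j = i then v else w))"
proof -
  define Y where "Y i y = (\<lambda>j\<in>{..<Suc n}. if j = i then v else if j < i then y j else y (j - 1))"
    for i and y :: "nat \<Rightarrow> 'e"
  let ?P = "product_topology (\<lambda>_. top_of E) {..<n}" and ?Q = "product_topology (\<lambda>_. top_of E) {..<Suc n}"
  have Y_cont: "continuous_map ?P ?Q (Y i)" if i: "i < Suc n" for i
    unfolding continuous_map_componentwise
  proof (intro conjI ballI)
    fix j assume j: "j \<in> {..<Suc n}"
    have proj: "continuous_map ?P (top_of E) (\<lambda>y. y k)" if "k < n" for k
      using continuous_map_product_projection[of k "{..<n}" "\<lambda>_. top_of E"] that by simp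
    consider "j = i" | "j < i" | "j > i" by linarith
    then show "continuous_map ?P (top_of E) (\<lambda>y. Y i y j)"
      by cases (use j i v proj[of j] proj[of "j - 1"] in \<open>auto simp: Y_def\<close>)
  qed (auto simp: Y_def)
  \<comment> \<open>Slots before \<open>i\<close> keep their number; those from \<open>i\<close> on
    are pushed up by one by the inserted \<open>v\<close>.\<close>
  have Y_upd: "Y i (y(l := u)) = (Y i y)((if l < i then l else Suc l) := u)" if "l < n" "i < Suc n" for i l u y
    using that by (auto simp: Y_def fun_eq_iff)
  have Y_in: "Y i y \<in> Pi\<^sub>E {..<Suc n} (\<lambda>_. carrier_of E)" if "i < Suc n" "y \<in> Pi\<^sub>E {..<n} (\<lambda>_. carrier_of E)" for i y
    using continuous_map_in[OF Y_cont[OF that(1)], of y] that(2) by simp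
  show ?thesis
    unfolding continuous_homogeneous_polynomial_def
  proof (intro exI[of _ "\<lambda>y. \<Sum>i<Suc n. \<beta> (Y i y)"] conjI ballI)
    show "multilinear n E F (\<lambda>y. \<Sum>i<Suc n. \<beta> (Y i y))"
      unfolding multilinear_def
    proof (intro ballI allI impI conjI)
      fix y l assume y: "y \<in> Pi\<^sub>E {..<n} (\<lambda>_. carrier_of E)" and l: "l < n"
      have ml': "\<beta> ((Y i y)(k := u + u')) = \<beta> ((Y i y)(k := u)) + \<beta> ((Y i y)(k := u'))"
        "\<beta> ((Y i y)(k := scale_of E c u)) = scale_of F c (\<beta> ((Y i y)(k := u)))"
        if "i < Suc n" "k < Suc n" "u \<in> carrier_of E" "u' \<in> carrier_of E" for i k u u' c
        using bspec[OF ml[unfolded multilinear_def] Y_in[OF that(1) y], rule_format, OF that(2)] that(3,4) by blast+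
      have k: "(if l < i then l else Suc l) < Suc n" for i
        using l by simp
      show "(\<Sum>i<Suc n. \<beta> (Y i (y(l := u + u')))) = (\<Sum>i<Suc n. \<beta> (Y i (y(l := u)))) + (\<Sum>i<Suc n. \<beta> (Y i (y(l := u'))))"
        if "u \<in> carrier_of E" "u' \<in> carrier_of E" for u u'
        unfolding sum.distrib[symmetric]
        by (intro sum.cong refl) (use Y_upd[OF l] ml'(1)[OF _ k that] in simp)
      show "(\<Sum>i<Suc n. \<beta> (Y i (y(l := scale_of E c u)))) = scale_of F c (\<Sum>i<Suc n. \<beta> (Y i (y(l := u))))"
        if "u \<in> carrier_of E" for c u
        unfolding F.scale_sum_right
        by (intro sum.cong refl) (use Y_upd[OF l] ml'(2)[OF _ k that that] in simp)
    qed
    have "continuous_map ?P (top_of F) (\<lambda>y. \<beta> (Y i y))" if "i < Suc n" for i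
      using continuous_map_compose[OF Y_cont[OF that] cont] by (simp add: o_def)
    then show "continuous_map ?P (top_of F) (\<lambda>y. \<Sum>i<Suc n. \<beta> (Y i y))"
      by (intro F.continuous_sum) simp
    fix w
    have "(\<lambda>j\<in>{..<Suc n}. if j = i then v else w) = Y i (\<lambda>i\<in>{..<n}. w)" if "i < Suc n" for i
      using that by (auto simp: Y_def fun_eq_iff)
    then show "(\<Sum>i<Suc n. \<beta> (\<lambda>j\<in>{..<Suc n}. if j = i then v else w)) = (\<Sum>i<Suc n. \<beta> (Y i (\<lambda>i\<in>{..<n}. w)))"
      by (intro sum.cong) auto
  qed
qed

lemma functional_limit:
  assumes q: "seminorm_on F q" and \<phi>: "dominated_functional F q \<phi>" and lim: "limitin (top_of F) g l G"
  shows "((\<lambda>t. \<phi> (g t)) \<longlongrightarrow> \<phi> l) G"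
proof (rule tendstoI)
  fix e :: real assume "e > 0"
  then have 1: "\<forall>\<^sub>F t in G. q (g t - l) < e"
    by (rule F.limitin_seminorm[OF lim q])
  have l: "l \<in> carrier_of F" and 2: "\<forall>\<^sub>F t in G. g t \<in> carrier_of F"
    using lim by (simp_all add: F.limitin_iff)
  from 1 2 show "\<forall>\<^sub>F t in G. dist (\<phi> (g t)) (\<phi> l) < e"
  proof eventually_elim
    case (elim t)
    then show ?case
      using CF.functional_le[OF \<phi>, of "g t - l"] l by (simp add: dist_norm CF.functional_diff[OF \<phi>])
  qed
qed

context
  fixes U f D
  assumes U: "openin (top_of E) U" and f: "complex_analytic_on E F U f"
    and D: "\<And>x v. x \<in> U \<Longrightarrow> v \<in> carrier_of E \<Longrightarrow> has_dd f x v (D x v)"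
begin

lemma U_in: "x \<in> U \<Longrightarrow> x \<in> carrier_of E"
  using openin_subset[OF U] by blast

lemma f_cont: "continuous_map (subtopology (top_of E) U) (top_of F) f"
  using f by (simp add: complex_analytic_on_def)

lemma f_in: "x \<in> U \<Longrightarrow> f x \<in> carrier_of F"
  using continuous_map_in[OF f_cont] U_in by simp

lemma D_in: "x \<in> U \<Longrightarrow> v \<in> carrier_of E \<Longrightarrow> D x v \<in> carrier_of F"
  using has_dd_in[OF D] .

text \<open>The one-point parameter space turns the single map \<open>f\<close> into a family, the
  form in which \<open>gateaux_derivative_continuous\<close> and
  \<open>strong_differentiability\<close> are stated.\<close>

lemma D_cont: "continuous_map (prod_topology (subtopology (top_of E) U) (prod_topology (top_of E) (discrete_topology UNIV :: unit topology)))
    (top_of F) (\<lambda>z. D (fst z) (fst (snd z)))"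
proof -
  have "continuous_map (prod_topology (subtopology (top_of E) U) (discrete_topology UNIV :: unit topology)) (top_of F) (\<lambda>z. f (fst z))"
    using continuous_map_compose[OF continuous_map_fst f_cont] by (simp add: o_def)
  from gateaux_derivative_continuous[OF U this, of "\<lambda>x v _. D x v"] D show ?thesis
    by simp
qed

lemma D_scale: "x \<in> U \<Longrightarrow> v \<in> carrier_of E \<Longrightarrow> D x (scale_of E c v) = scale_of F c (D x v)"
  using has_dd_unique[OF D has_dd_scale_direction[OF D]] by simp

lemma D_fixed_cont:
  assumes v: "v \<in> carrier_of E"
  shows "continuous_map (subtopology (top_of E) U) (top_of F) (\<lambda>x. D x v)"
proof -
  have "continuous_map (subtopology (top_of E) U)
      (prod_topology (subtopology (top_of E) U) (prod_topology (top_of E) (discrete_topology UNIV :: unit topology))) (\<lambda>x. (x, (v, ())))"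
    using v by (intro continuous_map_pairedI) auto
  from continuous_map_compose[OF this D_cont] show ?thesis
    by (simp add: o_def)
qed

lemma line_holomorphic:
  assumes q: "seminorm_on F q" and \<phi>: "dominated_functional F q \<phi>" and w: "w \<in> carrier_of E"
    and T: "open T" "\<forall>t\<in>T. x + scale_of E t w \<in> U"
  shows "(\<lambda>t. \<phi> (f (x + scale_of E t w))) holomorphic_on T"
  unfolding holomorphic_on_open[OF T(1)]
proof
  fix t assume t: "t \<in> T"
  have "((\<lambda>t. \<phi> (f (x + scale_of E t w))) has_field_derivative \<phi> (D (x + scale_of E t w) w)) (at t)"
    using T(2) t f_in D w by (intro functional_line_derivative[OF q \<phi> U _ w]) auto
  then show "\<exists>f'. ((\<lambda>t. \<phi> (f (x + scale_of E t w))) has_field_derivative f') (at t)"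
    by blast
qed

text \<open>The direction is rescaled to \<open>t v\<close> so that both \<open>f\<close>-terms lie on lines through \<open>x0\<close>.\<close>

lemma quotient_uniform:
  assumes q: "seminorm_on F q" and x0: "x0 \<in> carrier_of E" and w: "w \<in> carrier_of E" and v: "v \<in> carrier_of E"
    and line: "\<forall>t. cmod t < 3 \<longrightarrow> x0 + scale_of E t w \<in> U" and e: "e > 0"
  shows "\<forall>\<^sub>F \<tau> in at 0. \<forall>t\<in>cball 0 2. x0 + scale_of E t (w + scale_of E \<tau> v) \<in> U \<and>
    q (scale_of F (inverse \<tau>) (f (x0 + scale_of E t (w + scale_of E \<tau> v)) - f (x0 + scale_of E t w)) -
      scale_of F t (D (x0 + scale_of E t w) v)) < e"
proof -
  \<comment> \<open>At \<open>\<tau> = 0\<close> the condition is vacuous, so it can be proved on a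
    full neighbourhood of \<open>0\<close>, as \<open>compact_tube\<close> demands.\<close>
  define P where "P \<tau> t \<longleftrightarrow> \<tau> \<noteq> 0 \<longrightarrow> x0 + scale_of E t (w + scale_of E \<tau> v) \<in> U \<and>
    q (scale_of F (inverse \<tau>) (f (x0 + scale_of E t (w + scale_of E \<tau> v)) - f (x0 + scale_of E t w)) -
      scale_of F t (D (x0 + scale_of E t w) v)) < e" for \<tau> t
  have line_cont: "continuous_map euclidean (top_of E) (\<lambda>t. x0 + scale_of E t w)"
    and v_cont: "continuous_map euclidean (top_of E) (\<lambda>t. scale_of E t v)"
    using x0 w v by (auto intro!: E.continuous_add E.continuous_scale)
  let ?T0 = "{t. x0 + scale_of E t w \<in> U}"
  have T0: "open ?T0"
    using openin_continuous_map_preimage[OF line_cont U] by simp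
  have tD_cont: "continuous_map (top_of_set ?T0) (top_of F) (\<lambda>t. scale_of F t (D (x0 + scale_of E t w) v))"
  proof (intro F.continuous_scale)
    have "continuous_map (top_of_set ?T0) (subtopology (top_of E) U) (\<lambda>t. x0 + scale_of E t w)"
      using line_cont by (intro continuous_map_into_subtopology continuous_map_from_subtopology) auto
    from continuous_map_compose[OF this D_fixed_cont[OF v]]
    show "continuous_map (top_of_set ?T0) (top_of F) (\<lambda>t. D (x0 + scale_of E t w) v)"
      by (simp add: o_def)
  qed simp
  have "\<exists>N. openin euclidean N \<and> 0 \<in> N \<and> (\<forall>\<tau>\<in>N. \<forall>t\<in>cball 0 2. P \<tau> t)"
  proof (rule compact_tube[OF compact_cball])
    fix t1 :: complex assume t1: "t1 \<in> cball 0 2"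
    then have x1: "x0 + scale_of E t1 w \<in> U"
      using line by simp
    have v1: "scale_of E t1 v \<in> carrier_of E"
      using v by simp
    have e2: "e / 2 > 0"
      using e by simp
    have "\<exists>A V Q \<delta>. openin (top_of E) A \<and> x0 + scale_of E t1 w \<in> A \<and> openin (top_of E) V \<and> scale_of E t1 v \<in> V \<and>
      openin (discrete_topology (UNIV :: unit set)) Q \<and> () \<in> Q \<and> \<delta> > 0 \<and> A \<subseteq> U \<and>
      (\<forall>x\<in>A. \<forall>v'\<in>V. \<forall>p\<in>Q. \<forall>t. norm t < \<delta> \<longrightarrow> x + scale_of E t v' \<in> U \<and>
        (t \<noteq> 0 \<longrightarrow> q (scale_of F (inverse t) (f (x + scale_of E t v') - f x) - D (x0 + scale_of E t1 w) (scale_of E t1 v)) < e / 2))"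
    proof (rule strong_differentiability[where H = "\<lambda>x _. f x" and D = "\<lambda>x v _. D x v", OF U q])
      show "continuous_map (prod_topology (subtopology (top_of E) U) (prod_topology (top_of E) (discrete_topology UNIV :: unit topology)))
        (top_of F) (\<lambda>z. D (fst z) (fst (snd z)))"
        by (rule D_cont)
      show "has_dd (\<lambda>u. f u) x v (D x v)" if "x \<in> U" "v \<in> carrier_of E" for x v
        using D[OF that] .
      show "f x \<in> carrier_of F" if "x \<in> U" for x
        using f_in[OF that] .
      show "() \<in> topspace (discrete_topology UNIV)"
        by simp
    qed (fact x1 v1 e2)+
    then obtain A V Q \<delta> where A: "openin (top_of E) A" "x0 + scale_of E t1 w \<in> A"
      and V: "openin (top_of E) V" "scale_of E t1 v \<in> V" and Q: "() \<in> Q" and \<delta>: "\<delta> > 0" and AU: "A \<subseteq> U"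
      and strong: "\<forall>x\<in>A. \<forall>v'\<in>V. \<forall>p\<in>Q. \<forall>\<tau>. norm \<tau> < \<delta> \<longrightarrow> x + scale_of E \<tau> v' \<in> U \<and>
        (\<tau> \<noteq> 0 \<longrightarrow> q (scale_of F (inverse \<tau>) (f (x + scale_of E \<tau> v') - f x) - D (x0 + scale_of E t1 w) (scale_of E t1 v)) < e / 2)"
      by (elim exE conjE)
    have "t1 \<in> topspace (top_of_set ?T0)"
      using x1 by simp
    then obtain T1 where T1: "openin (top_of_set ?T0) T1" "t1 \<in> T1"
      "\<forall>t\<in>T1. scale_of F t (D (x0 + scale_of E t w) v) \<in> carrier_of F \<and>
        q (scale_of F t (D (x0 + scale_of E t w) v) - scale_of F t1 (D (x0 + scale_of E t1 w) v)) < e / 2"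
      using e2 by (rule F.continuous_mapD[OF tD_cont q])
    define T where "T = T1 \<inter> {t. x0 + scale_of E t w \<in> A} \<inter> {t. scale_of E t v \<in> V}"
    have "open T1"
      using T1(1) T0 openin_open_trans by blast
    moreover have "open {t. x0 + scale_of E t w \<in> A}"
      using openin_continuous_map_preimage[OF line_cont A(1)] by simp
    moreover have "open {t. scale_of E t v \<in> V}"
      using openin_continuous_map_preimage[OF v_cont V(1)] by simp
    ultimately have T: "open T"
      unfolding T_def by (intro open_Int)
    have "P \<tau> t" if "\<tau> \<in> ball 0 \<delta>" "t \<in> T" for \<tau> t
      unfolding P_def
    proof
      assume \<tau>: "\<tau> \<noteq> 0"
      let ?x = "x0 + scale_of E t w"
      have shift: "x0 + scale_of E t (w + scale_of E \<tau> v) = ?x + scale_of E \<tau> (scale_of E t v)"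
        by (simp add: E.scale_right_distrib mult.commute add.assoc)
      have mem: "?x \<in> A" "scale_of E t v \<in> V" "t \<in> T1" "norm \<tau> < \<delta>"
        using that by (auto simp: T_def)
      let ?a = "scale_of F (inverse \<tau>) (f (?x + scale_of E \<tau> (scale_of E t v)) - f ?x)"
      let ?b = "scale_of F t1 (D (x0 + scale_of E t1 w) v)" and ?c = "scale_of F t (D ?x v)"
      have 1: "?x + scale_of E \<tau> (scale_of E t v) \<in> U" "q (?a - ?b) < e / 2"
        using strong[rule_format, OF mem(1,2) Q mem(4)] \<tau> D_scale[OF x1 v] by auto
      have 2: "?c \<in> carrier_of F" "q (?c - ?b) < e / 2"
        using T1(3) mem(3) by auto
      have 3: "?b \<in> carrier_of F" "?a \<in> carrier_of F"
        using T1(2,3) f_in 1(1) mem(1) AU by auto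
      have "q (?a - ?c) \<le> q (?a - ?b) + q (?b - ?c)"
        using 3(2,1) 2(1) by (rule F.seminorm_triangle[OF q])
      then have "q (?a - ?c) < e"
        using 1(2) 2(2) F.seminorm_commute[OF q 3(1) 2(1)] by linarith
      with 1(1) show "x0 + scale_of E t (w + scale_of E \<tau> v) \<in> U \<and>
        q (scale_of F (inverse \<tau>) (f (x0 + scale_of E t (w + scale_of E \<tau> v)) - f ?x) - ?c) < e"
        unfolding shift by blast
    qed
    moreover have "t1 \<in> T"
      using T1(2) A(2) V(2) by (simp add: T_def)
    ultimately show "\<exists>N T. openin euclidean N \<and> 0 \<in> N \<and> open T \<and> t1 \<in> T \<and> (\<forall>\<tau>\<in>N. \<forall>t\<in>T \<inter> cball 0 2. P \<tau> t)"
      using T \<delta> by (intro exI[of _ "ball 0 \<delta>"] exI[of _ T]) auto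
  qed simp
  then obtain N where N: "open N" "0 \<in> N" "\<forall>\<tau>\<in>N. \<forall>t\<in>cball 0 2. P \<tau> t"
    by auto
  have "\<forall>\<^sub>F \<tau> in at 0. \<tau> \<in> N"
    using N(1,2) by (simp add: eventually_at_topological) blast
  moreover have "\<forall>\<^sub>F \<tau> in at (0::complex). \<tau> \<noteq> 0"
    by (simp add: eventually_at_filter)
  ultimately show ?thesis
    by eventually_elim (use N(3) in \<open>auto simp: P_def\<close>)
qed

text \<open>On a small disc the expansion of \<open>f\<close> along a line is, under
  \<open>\<phi>\<close>, a scalar power series in \<open>t\<close>, and the coefficients of such a
  series are determined by the derivatives of its sum at \<open>0\<close>.\<close>

lemma taylor_coefficient:
  assumes q: "seminorm_on F q" and \<phi>: "dominated_functional F q \<phi>" and z: "z \<in> carrier_of E"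
    and W: "openin (top_of E) W" "0 \<in> W" and ml: "\<forall>n. multilinear n E F (\<beta> n)"
    and cont: "\<forall>n. continuous_map (product_topology (\<lambda>_. top_of E) {..<n}) (top_of F) (\<beta> n)"
    and lim: "\<forall>w\<in>W. x0 + w \<in> U \<and> limitin (top_of F) (\<lambda>m. \<Sum>n<m. \<beta> n (\<lambda>i\<in>{..<n}. w)) (f (x0 + w)) sequentially"
  shows "(deriv ^^ n) (\<lambda>t. \<phi> (f (x0 + scale_of E t z))) 0 = fact n * \<phi> (\<beta> n (\<lambda>i\<in>{..<n}. z))"
proof -
  let ?c = "\<lambda>n. \<phi> (\<beta> n (\<lambda>i\<in>{..<n}. z))"
  have \<beta>_in: "\<beta> n (\<lambda>i\<in>{..<n}. z) \<in> carrier_of F" for n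
    using z by (intro continuous_map_in[OF cont[rule_format]]) auto
  obtain d where d: "d > 0" "\<forall>t. t \<noteq> 0 \<and> cmod t < d \<longrightarrow> scale_of E t z \<in> W"
    using eventually_line[OF W z] unfolding eventually_at by (auto simp: dist_norm)
  have sums: "(\<lambda>n. ?c n * t ^ n) sums \<phi> (f (x0 + scale_of E t z))" if "cmod t < d" for t
  proof -
    have "scale_of E t z \<in> W"
      using d that W(2) by (cases "t = 0") auto
    from bspec[OF lim this, THEN conjunct2]
    have "limitin (top_of F) (\<lambda>m. \<Sum>n<m. scale_of F (t ^ n) (\<beta> n (\<lambda>i\<in>{..<n}. z))) (f (x0 + scale_of E t z)) sequentially"
      unfolding multilinear_scale_all[OF ml[rule_format] z] .
    from functional_limit[OF q \<phi> this]
    show ?thesis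
      using \<beta>_in by (simp add: sums_def CF.functional_sum[OF \<phi>] CF.functional_scale[OF \<phi>] mult.commute)
  qed
  have "(\<lambda>t. \<phi> (f (x0 + scale_of E t z))) has_fps_expansion Abs_fps ?c"
    unfolding has_fps_expansion_def
  proof
    \<comment> \<open>Convergence at the point \<open>d / 2\<close> already bounds the radius of
      convergence from below.\<close>
    have "summable (\<lambda>n. ?c n * of_real (d / 2) ^ n)"
      using sums[of "of_real (d / 2)"] d(1) by (simp add: sums_iff norm_divide)
    from conv_radius_geI[OF this] have "ereal (d / 2) \<le> fps_conv_radius (Abs_fps ?c)"
      using d(1) by (simp add: fps_conv_radius_def norm_divide)
    moreover have "0 < ereal (d / 2)"
      using d(1) by simp
    ultimately show "0 < fps_conv_radius (Abs_fps ?c)"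
      by (rule less_le_trans[rotated])
    have "\<forall>\<^sub>F t in nhds 0. t \<in> ball (0::complex) d"
      using d(1) by (intro eventually_nhds_in_open) auto
    then show "\<forall>\<^sub>F t in nhds 0. eval_fps (Abs_fps ?c) t = \<phi> (f (x0 + scale_of E t z))"
      by eventually_elim (use sums in \<open>simp add: eval_fps_def sums_iff\<close>)
  qed
  from fps_nth_fps_expansion[OF this, of n] show ?thesis
    by (simp add: field_simps)
qed

text \<open>The expansion of \<open>f\<close> converges only pointwise, so it cannot be
  differentiated term by term. Instead, under each functional, \<open>t\<close> times the derivative
  at \<open>x0 + t w\<close> is a uniform limit, on a disc in \<open>t\<close>, of holomorphic
  difference quotients formed from the lines with directions \<open>w + \<tau> v\<close> and
  \<open>w\<close>. Taylor coefficients at \<open>0\<close> pass to the limit and come out as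
  derivatives of the homogeneous terms of \<open>f\<close> in direction \<open>v\<close>. Hence
  \<open>taylor_series_converges\<close>, read at \<open>t = 1\<close>, gives the expansion.\<close>

lemma directional_derivative_analytic:
  assumes v: "v \<in> carrier_of E"
  shows "complex_analytic_on E F U (\<lambda>x. D x v)"
  unfolding complex_analytic_on_def
proof (intro conjI ballI)
  show "continuous_map (subtopology (top_of E) U) (top_of F) (\<lambda>x. D x v)"
    by (rule D_fixed_cont[OF v])
  fix x0 assume x0: "x0 \<in> U"
  obtain \<beta> W where W: "openin (top_of E) W" "0 \<in> W" and ml: "\<forall>n. multilinear n E F (\<beta> n)"
    and \<beta>: "\<forall>n. continuous_map (product_topology (\<lambda>_. top_of E) {..<n}) (top_of F) (\<beta> n)"
    and lim: "\<forall>w\<in>W. x0 + w \<in> U \<and> limitin (top_of F) (\<lambda>m. \<Sum>n<m. \<beta> n (\<lambda>i\<in>{..<n}. w)) (f (x0 + w)) sequentially"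
    using f x0 by (rule analytic_expansion)
  \<comment> \<open>Radius \<open>3\<close> contains the closed disc of radius \<open>2\<close> on
    which the quotients converge uniformly; radius \<open>2\<close> is what
    \<open>taylor_series_converges\<close> asks for.\<close>
  have "(3::real) > 0"
    by simp
  with U x0 obtain W3 where W3: "openin (top_of E) W3" "0 \<in> W3"
    "\<forall>w\<in>W3. \<forall>t. norm t < 3 \<longrightarrow> x0 + scale_of E t w \<in> U"
    by (rule E.balanced_nbhd)
  \<comment> \<open>The derivative in direction \<open>v\<close> of the homogeneous term of degree
    \<open>n\<close>, thus of degree \<open>n - 1\<close> in \<open>w\<close>.\<close>
  define a where "a n w = (\<Sum>i<n. \<beta> n (\<lambda>j\<in>{..<n}. if j = i then v else w))" for n w
  have conv: "limitin (top_of F) (\<lambda>m. \<Sum>n<m. a (Suc n) w) (D (x0 + w) v) sequentially" if w3: "w \<in> W3" for w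
  proof -
    have w: "w \<in> carrier_of E"
      using openin_subset[OF W3(1)] w3 by blast
    have line: "\<forall>t. cmod t < 3 \<longrightarrow> x0 + scale_of E t w \<in> U"
      using W3(3) w3 by blast
    have a_in: "a n w \<in> carrier_of F" for n
      unfolding a_def using v w by (intro F.sum_in continuous_map_in[OF \<beta>[rule_format]]) auto
    \<comment> \<open>Changing \<open>w\<close> by \<open>\<tau> v\<close> moves the point
      \<open>x0 + t w\<close> by \<open>\<tau> t v\<close>, hence the factor \<open>t\<close>. It
      raises powers by one, so the coefficient of \<open>t^n\<close> is
      \<open>a n w\<close>.\<close>
    let ?h = "\<lambda>t. scale_of F t (D (x0 + scale_of E t w) v)"
    have h_in: "?h t \<in> carrier_of F" if "cmod t < 2" for t
      using line that D_in[OF _ v] by simp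
    have lim_q: "(\<lambda>N. q ((\<Sum>n<N. a n w) - ?h 1)) \<longlonglongrightarrow> 0" if q: "seminorm_on F q" for q
    proof -
      have "continuous_on (cball 0 (3/2)) (\<lambda>t. q (D (x0 + scale_of E t w) v))"
        by (rule seminorm_line_continuous[OF D_fixed_cont[OF v] q U_in[OF x0] w]) (use line in auto)
      then have "bounded ((\<lambda>t. q (D (x0 + scale_of E t w) v)) ` cball 0 (3/2))"
        by (intro compact_imp_bounded compact_continuous_image) auto
      then obtain B where B: "\<forall>y\<in>(\<lambda>t. q (D (x0 + scale_of E t w) v)) ` cball 0 (3/2). norm y \<le> B"
        unfolding bounded_iff by blast
      show ?thesis
      proof (rule CF.taylor_series_converges[OF q h_in a_in, where B = "3/2 * B"])
        show "q (?h t) \<le> 3/2 * B" if t: "cmod t \<le> 3 / 2" for t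
        proof -
          have 1: "q (D (x0 + scale_of E t w) v) \<le> B"
            using bspec[OF B imageI[of t]] t by simp
          have 2: "q (?h t) = cmod t * q (D (x0 + scale_of E t w) v)"
            using D_in[OF _ v] line t by (intro F.seminorm_scale[OF q]) simp
          have 3: "0 \<le> q (D (x0 + scale_of E t w) v)"
            using D_in[OF _ v] line t by (intro F.seminorm_nonneg[OF q]) simp
          show ?thesis
            unfolding 2 by (rule mult_mono[OF t 1]) (use 3 in auto)
        qed
        fix \<phi> assume \<phi>: "dominated_functional F q \<phi>"
        define g where "g z t = \<phi> (f (x0 + scale_of E t z))" for z t
        define K where "K \<tau> t = inverse \<tau> * (g (w + scale_of E \<tau> v) t - g w t)" for \<tau> t
        have in3: "\<forall>\<^sub>F \<tau> in at 0. w + scale_of E \<tau> v \<in> W3"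
          by (rule eventually_line[OF W3(1) w3 v])
        have g_hol: "g z holomorphic_on ball 0 3" if "z \<in> W3" for z
          unfolding g_def using W3(3) that openin_subset[OF W3(1)]
          by (intro line_holomorphic[OF q \<phi>]) auto
        have unif: "uniform_limit (cball 0 2) K (\<lambda>t. \<phi> (?h t)) (at 0)"
        proof (rule uniform_limitI)
          fix e :: real assume "e > 0"
          from quotient_uniform[OF q U_in[OF x0] w v line this]
          show "\<forall>\<^sub>F \<tau> in at 0. \<forall>t\<in>cball 0 2. dist (K \<tau> t) (\<phi> (?h t)) < e"
          proof (rule eventually_mono, intro ballI)
            fix \<tau> t :: complex
            assume *: "\<forall>t\<in>cball 0 2. x0 + scale_of E t (w + scale_of E \<tau> v) \<in> U \<and>
              q (scale_of F (inverse \<tau>) (f (x0 + scale_of E t (w + scale_of E \<tau> v)) - f (x0 + scale_of E t w)) - ?h t) < e"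
              and t: "t \<in> cball 0 2"
            let ?a = "f (x0 + scale_of E t (w + scale_of E \<tau> v))" and ?b = "f (x0 + scale_of E t w)"
            have in_F: "?a \<in> carrier_of F" "?b \<in> carrier_of F" "?h t \<in> carrier_of F"
              using * t line f_in D_in[OF _ v] by auto
            have "K \<tau> t - \<phi> (?h t) = \<phi> (scale_of F (inverse \<tau>) (?a - ?b) - ?h t)"
              using in_F by (simp add: K_def g_def CF.functional_diff[OF \<phi>] CF.functional_scale[OF \<phi>]
                  del: F.scale_right_diff_distrib)
            also have "cmod \<dots> \<le> q (scale_of F (inverse \<tau>) (?a - ?b) - ?h t)"
              using in_F by (intro CF.functional_le[OF \<phi>]) simp
            also have "\<dots> < e"
              using * t by blast
            finally show "dist (K \<tau> t) (\<phi> (?h t)) < e"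
              by (simp add: dist_norm)
          qed
        qed
        have K_hol: "\<forall>\<^sub>F \<tau> in at 0. K \<tau> holomorphic_on ball 0 3"
          using in3
        proof eventually_elim
          case (elim \<tau>)
          show ?case
            unfolding K_def by (intro holomorphic_intros g_hol elim w3)
        qed
        have K_hol2: "\<forall>\<^sub>F \<tau> in at 0. continuous_on (cball 0 2) (K \<tau>) \<and> K \<tau> holomorphic_on ball 0 2"
          using K_hol
        proof eventually_elim
          case (elim \<tau>)
          have "cball (0::complex) 2 \<subseteq> ball 0 3" "ball (0::complex) 2 \<subseteq> ball 0 3"
            by auto
          then show ?case
            using elim holomorphic_on_imp_continuous_on[OF elim] continuous_on_subset holomorphic_on_subset by blast
        qed
        have "\<not> trivial_limit (at (0::complex))"
          by simp
        with K_hol2 unif show "(\<lambda>t. \<phi> (?h t)) holomorphic_on ball 0 2"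
          by (rule holomorphic_uniform_limit)
        fix n
        have unif2: "uniform_limit (ball 0 2) K (\<lambda>t. \<phi> (?h t)) (at 0)"
          by (rule uniform_limit_on_subset[OF unif]) auto
        have K_hol3: "\<forall>\<^sub>F \<tau> in at 0. K \<tau> holomorphic_on ball 0 2"
          using K_hol2 by eventually_elim simp
        \<comment> \<open>By Weierstrass' theorem uniform limits of holomorphic functions carry
          their derivatives along. The same limit is computed below from the Taylor coefficients of
          \<open>f\<close>, and the two values are compared.\<close>
        have lim1: "((\<lambda>\<tau>. (deriv ^^ n) (K \<tau>) 0) \<longlongrightarrow> (deriv ^^ n) (\<lambda>t. \<phi> (?h t)) 0) (at 0)"
          by (rule higher_deriv_complex_uniform_limit[OF unif2 K_hol3]) auto
        let ?Pn = "\<lambda>z. \<beta> n (\<lambda>i\<in>{..<n}. z)"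
        have P_in: "?Pn z \<in> carrier_of F" if "z \<in> carrier_of E" for z
          using that by (intro continuous_map_in[OF \<beta>[rule_format]]) auto
        have coeff: "(deriv ^^ n) (g z) 0 = fact n * \<phi> (?Pn z)" if "z \<in> carrier_of E" for z
          unfolding g_def by (rule taylor_coefficient[OF q \<phi> that W ml \<beta> lim])
        have "\<forall>\<^sub>F \<tau> in at 0. (deriv ^^ n) (K \<tau>) 0 = fact n * \<phi> (scale_of F (inverse \<tau>) (?Pn (w + scale_of E \<tau> v) - ?Pn w))"
          using in3
        proof eventually_elim
          case (elim \<tau>)
          have "(deriv ^^ n) (K \<tau>) 0 = inverse \<tau> * (deriv ^^ n) (\<lambda>t. g (w + scale_of E \<tau> v) t - g w t) 0"
            unfolding K_def by (rule higher_deriv_cmult[where A = "ball 0 3"]) (auto intro!: holomorphic_intros g_hol elim w3)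
          also have "(deriv ^^ n) (\<lambda>t. g (w + scale_of E \<tau> v) t - g w t) 0 = (deriv ^^ n) (g (w + scale_of E \<tau> v)) 0 - (deriv ^^ n) (g w) 0"
            by (rule higher_deriv_diff[where S = "ball 0 3"]) (auto intro!: g_hol elim w3)
          also have "\<dots> = fact n * (\<phi> (?Pn (w + scale_of E \<tau> v)) - \<phi> (?Pn w))"
            using w v by (simp add: coeff right_diff_distrib)
          finally show ?case
            using P_in w v by (simp add: CF.functional_diff[OF \<phi>] CF.functional_scale[OF \<phi>] mult_ac del: F.scale_right_diff_distrib)
        qed
        moreover have "limitin (top_of F) (\<lambda>\<tau>. scale_of F (inverse \<tau>) (?Pn (w + scale_of E \<tau> v) - ?Pn w)) (a n w) (at 0)"
          unfolding a_def
        proof (rule multilinear_quotient[OF ml[rule_format] \<beta>[rule_format]])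
          have "\<forall>\<^sub>F \<tau> in at 0. v = scale_of E (inverse \<tau>) (w + scale_of E \<tau> v - w)"
            by (simp add: eventually_at_filter)
          then show "limitin (top_of E) (\<lambda>\<tau>. scale_of E (inverse \<tau>) (w + scale_of E \<tau> v - w)) v (at 0)"
            using v by (intro limitin_eventually) (auto elim: eventually_mono)
        qed (use w v in auto)
        then have "((\<lambda>\<tau>. fact n * \<phi> (scale_of F (inverse \<tau>) (?Pn (w + scale_of E \<tau> v) - ?Pn w))) \<longlongrightarrow> fact n * \<phi> (a n w)) (at 0)"
          by (intro tendsto_mult_left functional_limit[OF q \<phi>])
        ultimately have "((\<lambda>\<tau>. (deriv ^^ n) (K \<tau>) 0) \<longlongrightarrow> fact n * \<phi> (a n w)) (at 0)"
          by (simp add: tendsto_cong)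
        then show "(deriv ^^ n) (\<lambda>t. \<phi> (?h t)) 0 = fact n * \<phi> (a n w)"
          using tendsto_unique[OF _ lim1] by simp
      qed auto
    qed
    \<comment> \<open>\<open>a 0 w\<close> is an empty sum and may be dropped; afterwards the term
      with index \<open>n\<close> has degree \<open>n\<close>, as the definition of an expansion
      requires.\<close>
    have shift: "(\<Sum>n<N. a (Suc n) w) = (\<Sum>n<Suc N. a n w)" for N
      by (simp add: sum.lessThan_Suc_shift a_def del: sum.lessThan_Suc)
    show ?thesis
      unfolding F.limitin_iff
    proof (intro conjI allI impI)
      show "D (x0 + w) v \<in> carrier_of F"
        using h_in[of 1] by simp
      show "\<forall>\<^sub>F N in sequentially. (\<Sum>n<N. a (Suc n) w) \<in> carrier_of F"
        using a_in by (intro always_eventually allI F.sum_in)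
      fix q and e :: real assume q: "seminorm_on F q" and "0 < e"
      have "(\<lambda>N. q ((\<Sum>n<Suc N. a n w) - ?h 1)) \<longlonglongrightarrow> 0"
        using LIMSEQ_Suc[OF lim_q[OF q]] .
      from order_tendstoD(2)[OF this \<open>0 < e\<close>]
      show "\<forall>\<^sub>F N in sequentially. q ((\<Sum>n<N. a (Suc n) w) - D (x0 + w) v) < e"
        unfolding shift by simp
    qed
  qed
  have "x0 + w \<in> U" if "w \<in> W3" for w
    using W3(3)[rule_format, OF that, of 1] by simp
  moreover have "continuous_homogeneous_polynomial n E F (a (Suc n))" for n
    unfolding a_def by (rule polynomial_directional_derivative[OF ml[rule_format] \<beta>[rule_format] v])
  ultimately show "\<exists>W p. openin (top_of E) W \<and> 0 \<in> W \<and> (\<forall>n. continuous_homogeneous_polynomial n E F (p n)) \<and>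
      (\<forall>w\<in>W. x0 + w \<in> U \<and> limitin (top_of F) (\<lambda>m. \<Sum>n<m. p n w) (D (x0 + w) v) sequentially)"
    using W3(1,2) conv by (intro exI[of _ W3] exI[of _ "\<lambda>n. a (Suc n)"]) auto
qed

end

text \<open>With the directions frozen, analyticity passes from each derivative to the next by
  \<open>directional_derivative_analytic\<close>, which guarantees that they all exist. Joint
  continuity in point and directions is a separate induction, by
  \<open>gateaux_derivative_continuous\<close>.\<close>

theorem complex_analytic_imp_Ck:
  assumes U: "openin (top_of E) U" and f: "complex_analytic_on E F U f"
  shows "Ck_on k E F U f"
proof -
  have an: "complex_analytic_on E F U (\<lambda>x. it f j x y)" if "\<forall>i<j. y i \<in> carrier_of E" for j y
    using that
  proof (induction j)
    case (Suc j)
    then have IH: "complex_analytic_on E F U (\<lambda>x. it f j x y)"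
      by simp
    define D where "D x v = (THE l. has_dd (\<lambda>u. it f j u y) x v l)" for x v
    have D: "has_dd (\<lambda>u. it f j u y) x v (D x v)" if "x \<in> U" "v \<in> carrier_of E" for x v
      unfolding D_def using analytic_has_dd[OF IH that] has_dd_unique by (metis theI)
    have "complex_analytic_on E F U (\<lambda>x. D x (y j))"
      by (rule directional_derivative_analytic[OF U IH D]) (use Suc.prems in auto)
    then show ?case
      by (simp add: D_def iterated_derivative.simps)
  qed (use f in simp)
  have dd: "has_dd (\<lambda>u. it f j u y) x v (it f (Suc j) x (y(j := v)))"
    if x: "x \<in> U" and y: "\<forall>i<j. y i \<in> carrier_of E" and v: "v \<in> carrier_of E" for j x y v
  proof -
    have eq: "it f j u (y(j := v)) = it f j u y" for u
      by (rule it_cong) simp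
    obtain l where l: "has_dd (\<lambda>u. it f j u y) x v l"
      using analytic_has_dd[OF an[OF y] x v] by blast
    then have "it f (Suc j) x (y(j := v)) = l"
      using has_dd_unique by (auto simp: iterated_derivative.simps eq)
    with l show ?thesis by simp
  qed
  have cont: "continuous_map (prod_topology (subtopology (top_of E) U) (product_topology (\<lambda>_. top_of E) {..<j}))
      (top_of F) (\<lambda>z. it f j (fst z) (snd z))" for j
  proof (induction j)
    case 0
    have "continuous_map (subtopology (top_of E) U) (top_of F) f"
      using f by (simp add: complex_analytic_on_def)
    from continuous_map_compose[OF continuous_map_fst this] show ?case
      by (simp add: o_def)
  next
    case (Suc j)
    let ?P = "product_topology (\<lambda>_. top_of E) {..<j}" and ?P' = "product_topology (\<lambda>_. top_of E) {..<Suc j}"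
    let ?X = "prod_topology (subtopology (top_of E) U) ?P'"
    have D: "continuous_map (prod_topology (subtopology (top_of E) U) (prod_topology (top_of E) ?P)) (top_of F)
      (\<lambda>z. it f (Suc j) (fst z) ((snd (snd z))(j := fst (snd z))))"
      by (rule gateaux_derivative_continuous[OF U Suc.IH, of "\<lambda>x v p. it f (Suc j) x (p(j := v))"])
        (rule dd, auto simp: PiE_iff)
    have proj: "continuous_map ?X (top_of E) (\<lambda>z. snd z i)" if "i < Suc j" for i
      using continuous_map_compose[OF continuous_map_snd continuous_map_product_projection[of i "{..<Suc j}" "\<lambda>_. top_of E"]] that
      by (simp add: o_def)
    have "continuous_map ?X ?P (\<lambda>z. restrict (snd z) {..<j})"
      unfolding continuous_map_componentwise using proj by auto
    then have "continuous_map ?X (prod_topology (subtopology (top_of E) U) (prod_topology (top_of E) ?P))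
        (\<lambda>z. (fst z, (snd z j, restrict (snd z) {..<j})))"
      using proj[of j] by (intro continuous_map_pairedI continuous_map_fst) auto
    from continuous_map_compose[OF this D]
    have "continuous_map ?X (top_of F) (\<lambda>z. it f (Suc j) (fst z) ((restrict (snd z) {..<j})(j := snd z j)))"
      by (simp add: o_def)
    moreover have "it f (Suc j) x ((restrict y {..<j})(j := y j)) = it f (Suc j) x y" for x y
      by (rule it_cong) auto
    ultimately show ?case
      by simp
  qed
  show ?thesis
  proof (rule CkI(1)[where D = "it f", OF U])
    fix j x y assume *: "j < k" "x \<in> U" "\<forall>i\<le>j. y i \<in> carrier_of E"
    then show "has_dd (\<lambda>u. it f j u y) x (y j) (it f (Suc j) x y)"
      using dd[OF *(2), of j y "y j"] by (simp add: fun_upd_triv)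
  qed (use cont in simp_all)
qed

corollary complex_analytic_iff_Ck:
  "openin (top_of E) U \<Longrightarrow> complex_analytic_on E F U f \<longleftrightarrow> (\<forall>k. Ck_on k E F U f)"
  using complex_analytic_imp_Ck Ck_imp_complex_analytic by blast

end

section \<open>Calculus of \<open>C\<^sup>r\<close>-maps\<close>

text \<open>Transport along \<open>J\<close>: a space over a field isomorphic to
  \<open>complex\<close> becomes a complex space with the same vectors and the same
  topology.\<close>

definition rescale :: "('l \<Rightarrow> 'k) \<Rightarrow> ('k, 'e) tvs \<Rightarrow> ('l, 'e) tvs"
  where "rescale J E = \<lparr>top_of = top_of E, scale_of = \<lambda>c. scale_of E (J c)\<rparr>"

lemma rescale_sel [simp]: "top_of (rescale J E) = top_of E" "scale_of (rescale J E) c = scale_of E (J c)"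
  by (simp_all add: rescale_def)

locale scalar_isomorphism =
  fixes J :: "complex \<Rightarrow> 'k::real_or_complex_field"
  assumes add: "J (z + w) = J z + J w" and mult: "J (z * w) = J z * J w"
    and of_real: "J (of_real a) = of_real a" and cont: "continuous_on UNIV J" and surj: "surj J"
begin

lemma lcs_rescale:
  assumes "lcs E"
  shows "lcs (rescale J E)"
proof -
  interpret E: lcs E by fact
  have one: "J 1 = 1"
    using of_real[of 1] by simp
  have vs: "vector_space (scale_of (rescale J E))"
    by standard (simp_all add: E.scale_right_distrib E.scale_left_distrib add mult one)
  interpret V: vector_space "scale_of (rescale J E)" by fact
  have sub: "V.subspace (carrier_of (rescale J E))"
    unfolding V.subspace_def by auto
  have "continuous_map (prod_topology euclidean (top_of E)) euclidean (\<lambda>p. J (fst p))"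
    using continuous_map_compose[OF continuous_map_fst, of euclidean euclidean J] cont by (simp add: o_def)
  then have mult: "continuous_map (prod_topology euclidean (top_of E)) (top_of E) (\<lambda>p. scale_of E (J (fst p)) (snd p))"
    by (intro E.continuous_scale continuous_map_snd)
  show ?thesis
    using E.lcs vs sub mult
    unfolding lcs_def locally_convex_space_def by (simp add: case_prod_unfold of_real del: of_real_diff)
qed

lemma all_scalars: "(\<forall>c. P (J c)) \<longleftrightarrow> (\<forall>c. P c)"
  using surj by (metis surjD)

text \<open>Scalars enter the definition only through the homogeneity of multilinear maps, which is
  quantified over all of them; as \<open>J\<close> is onto, this does not change.\<close>

lemma complex_analytic_rescale:
  "complex_analytic_on (rescale J E) (rescale J F) U f \<longleftrightarrow> complex_analytic_on E F U f"
proof -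
  have "multilinear n (rescale J E) (rescale J F) \<beta> \<longleftrightarrow> multilinear n E F \<beta>" for n \<beta>
    unfolding multilinear_def rescale_sel
      all_scalars[of "\<lambda>c. \<forall>u\<in>carrier_of E. \<beta> (_(_ := scale_of E c u)) = scale_of F c (\<beta> (_(_ := u)))"] ..
  then show ?thesis
    unfolding complex_analytic_on_def continuous_homogeneous_polynomial_def by simp
qed

lemma continuous_linear_rescale:
  "continuous_linear (rescale J E) (rescale J F) h \<longleftrightarrow> continuous_linear E F h"
  unfolding continuous_linear_def rescale_sel
    all_scalars[of "\<lambda>c. \<forall>x\<in>carrier_of E. h (scale_of E c x) = scale_of F c (h x)"] ..

end

lemma exists_scalar_isomorphism:
  assumes "(\<real> :: 'k::real_or_complex_field set) \<noteq> UNIV"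
  shows "\<exists>J :: complex \<Rightarrow> 'k. scalar_isomorphism J"
proof -
  have "\<not> (\<forall>z::'k. \<exists>a. z = a *\<^sub>R 1)"
    using assms by (auto simp: Reals_def of_real_def image_def)
  then obtain i :: 'k where i: "i * i = - 1" "\<forall>z. \<exists>a b. z = a *\<^sub>R 1 + b *\<^sub>R i"
    using real_or_complex[where 'a = 'k] by auto
  define J where "J z = of_real (Re z) + of_real (Im z) * i" for z
  have "scalar_isomorphism J"
  proof
    fix z w and a :: real
    show "J (z + w) = J z + J w"
      by (simp add: J_def algebra_simps)
    have "J z * J w = of_real (Re z) * of_real (Re w) + of_real (Im z) * of_real (Im w) * (i * i)
        + (of_real (Re z) * of_real (Im w) + of_real (Im z) * of_real (Re w)) * i"
      by (simp add: J_def algebra_simps)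
    then show "J (z * w) = J z * J w"
      unfolding i(1) by (simp add: J_def algebra_simps)
    show "J (of_real a) = of_real a"
      by (simp add: J_def)
    have "bounded_linear J"
      unfolding J_def
      by (intro bounded_linear_add bounded_linear_mult_const bounded_linear_compose[OF bounded_linear_of_real]
          bounded_linear_Re bounded_linear_Im)
    then show "continuous_on UNIV J"
      by (rule linear_continuous_on)
    have "\<exists>z. y = J z" for y
    proof -
      obtain a b where "y = a *\<^sub>R 1 + b *\<^sub>R i"
        using i(2) by blast
      then have "y = J (Complex a b)"
        by (simp add: J_def of_real_def)
      then show ?thesis ..
    qed
    then show "surj J"
      by (simp add: surj_def)
  qed
  then show ?thesis
    by (intro exI[of _ J])
qed

section \<open>Real analytic maps through extensions to the complexification\<close>

lemma complexification_sel [simp]: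
  "top_of (complexification E) = prod_topology (top_of E) (top_of E)"
  "scale_of (complexification E) c z =
    (scale_of E (of_real (Re c)) (fst z) - scale_of E (of_real (Im c)) (snd z),
     scale_of E (of_real (Im c)) (fst z) + scale_of E (of_real (Re c)) (snd z))"
  by (simp_all add: complexification_def case_prod_unfold)

text \<open>The extension is required to be \<open>C^k\<close> over the complex numbers for all
  \<open>k\<close> instead of analytic, so that the rules for \<open>C^k\<close> maps apply to it
  directly. The points \<open>(u, 0)\<close> are the real ones.\<close>

definition analytic_extension ::
    "('k::real_normed_field, 'e::ab_group_add) tvs \<Rightarrow> ('k, 'f::ab_group_add) tvs \<Rightarrow> 'e set \<Rightarrow> ('e \<Rightarrow> 'f) \<Rightarrow>
      ('e \<times> 'e) set \<Rightarrow> ('e \<times> 'e \<Rightarrow> 'f \<times> 'f) \<Rightarrow> bool"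
  where "analytic_extension E F U f W g \<longleftrightarrow>
    openin (top_of (complexification E)) W \<and> (\<forall>k. Ck_on k (complexification E) (complexification F) W g) \<and>
    (\<forall>u\<in>U. (u, 0) \<in> W \<longrightarrow> g (u, 0) = (f u, 0))"

lemma real_analytic_iff_extension:
  assumes "lcs E" "lcs F"
  shows "real_analytic_on E F U f \<longleftrightarrow> (\<forall>x\<in>U. \<exists>W g. (x, 0) \<in> W \<and> analytic_extension E F U f W g)"
proof -
  interpret CC: complex_pair "complexification E" "complexification F"
    using assms by (simp add: complex_pair_def lcs_pair_def lcs_complexification)
  have "openin (top_of (complexification E)) W \<and> (x, 0) \<in> W \<and>
      complex_analytic_on (complexification E) (complexification F) W g \<and>
      (\<forall>u\<in>U. (u, 0) \<in> W \<longrightarrow> g (u, 0) = (f u, 0)) \<longleftrightarrow>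
    (x, 0) \<in> W \<and> analytic_extension E F U f W g" for x W g
    unfolding analytic_extension_def using CC.complex_analytic_iff_Ck[of W g] by blast
  then show ?thesis
    unfolding real_analytic_on_def by (simp only:)
qed

lemma Ck_subset:
  assumes "lcs E" "lcs F" "openin (top_of E) U" "openin (top_of E) V" "V \<subseteq> U" "Ck_on k E F U f"
  shows "Ck_on k E F V f"
proof -
  interpret lcs_pair E F
    using assms by (simp add: lcs_pair_def)
  show ?thesis
    by (rule Ck_local[OF assms(4)]) (use assms in blast)
qed

lemma continuous_linear_complexification:
  assumes "lcs E" "lcs F" "continuous_linear E F h"
  shows "continuous_linear (complexification E) (complexification F) (map_prod h h)"
proof -
  interpret E: lcs E by fact
  interpret F: lcs F by fact
  have h: "continuous_map (top_of E) (top_of F) h"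
    and add: "\<And>x y. x \<in> carrier_of E \<Longrightarrow> y \<in> carrier_of E \<Longrightarrow> h (x + y) = h x + h y"
    and sc: "\<And>c x. x \<in> carrier_of E \<Longrightarrow> h (scale_of E c x) = scale_of F c (h x)"
    using assms(3) by (auto simp: continuous_linear_def)
  have diff: "h (x - y) = h x - h y" if "x \<in> carrier_of E" "y \<in> carrier_of E" for x y
    using add[of "x - y" y] that by simp
  have "continuous_map (top_of (complexification E)) (top_of (complexification F)) (\<lambda>z. (h (fst z), h (snd z)))"
    using continuous_map_compose[OF continuous_map_fst[of "top_of E" "top_of E"] h]
      continuous_map_compose[OF continuous_map_snd[of "top_of E" "top_of E"] h]
    by (simp add: continuous_map_paired o_def)
  then show ?thesis
    unfolding continuous_linear_def by (auto simp: map_prod_def case_prod_unfold add sc diff)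
qed

lemma continuous_embed_real:
  assumes "lcs E"
  shows "continuous_map (top_of E) (top_of (complexification E)) (\<lambda>u. (u, 0))"
proof -
  interpret E: lcs E by fact
  show ?thesis
    by (simp add: continuous_map_paired)
qed

lemma real_analytic_continuous:
  assumes "lcs E" "lcs F" and U: "openin (top_of E) U" and f: "real_analytic_on E F U f"
  shows "continuous_map (subtopology (top_of E) U) (top_of F) f"
proof (rule continuous_map_local)
  interpret CC: lcs_pair "complexification E" "complexification F"
    using assms by (simp add: lcs_pair_def lcs_complexification)
  fix x assume "x \<in> topspace (subtopology (top_of E) U)"
  then have x: "x \<in> U" "x \<in> carrier_of E"
    by auto
  then obtain W g where W: "(x, 0) \<in> W" and ext: "analytic_extension E F U f W g"
    using f real_analytic_iff_extension[OF assms(1,2)] by blast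
  have Wo: "openin (top_of (complexification E)) W" and g: "Ck_on 0 (complexification E) (complexification F) W g"
    and gf: "\<forall>u\<in>U. (u, 0) \<in> W \<longrightarrow> g (u, 0) = (f u, 0)"
    using ext by (auto simp: analytic_extension_def)
  let ?V = "{u \<in> carrier_of E. (u, 0) \<in> W}"
  have V: "openin (top_of E) ?V"
    by (rule openin_continuous_map_preimage[OF continuous_embed_real[OF assms(1)] Wo])
  have "continuous_map (subtopology (top_of E) (U \<inter> ?V)) (subtopology (top_of (complexification E)) W) (\<lambda>u. (u, 0))"
    by (intro continuous_map_into_subtopology continuous_map_from_subtopology continuous_embed_real assms(1)) auto
  from continuous_map_compose[OF this CC.Ck_continuous_map[OF g]]
  have "continuous_map (subtopology (top_of E) (U \<inter> ?V)) (top_of F) (\<lambda>u. fst (g (u, 0)))"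
    by (intro continuous_map_fst_comp) (simp add: o_def)
  then have "continuous_map (subtopology (top_of E) (U \<inter> ?V)) (top_of F) f"
    by (rule continuous_map_eq) (use gf in auto)
  then have "continuous_map (subtopology (subtopology (top_of E) U) ?V) (top_of F) f"
    by (simp add: subtopology_subtopology)
  moreover have "openin (subtopology (top_of E) U) (U \<inter> ?V)"
    using openin_subtopology_Int2[OF V] .
  moreover have "subtopology (subtopology (top_of E) U) (U \<inter> ?V) = subtopology (subtopology (top_of E) U) ?V"
    by (simp add: subtopology_subtopology)
  ultimately show "\<exists>W. openin (subtopology (top_of E) U) W \<and> x \<in> W \<and>
      continuous_map (subtopology (subtopology (top_of E) U) W) (top_of F) f"
    using x W by (intro exI[of _ "U \<inter> ?V"]) auto
qed

lemma real_analytic_local: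
  assumes "lcs E" "lcs F" "openin (top_of E) U"
    and loc: "\<And>x. x \<in> U \<Longrightarrow> \<exists>V. openin (top_of E) V \<and> x \<in> V \<and> real_analytic_on E F V f"
  shows "real_analytic_on E F U f"
  unfolding real_analytic_iff_extension[OF assms(1,2)]
proof
  fix x assume x: "x \<in> U"
  interpret E: lcs E by fact
  have lcsC: "lcs (complexification E)" "lcs (complexification F)"
    using assms lcs_complexification by blast+
  obtain V where V: "openin (top_of E) V" "x \<in> V" "real_analytic_on E F V f"
    using loc[OF x] by blast
  obtain W g where W: "(x, 0) \<in> W" and ext: "analytic_extension E F V f W g"
    using V(2,3) real_analytic_iff_extension[OF assms(1,2)] by blast
  let ?W = "W \<inter> V \<times> carrier_of E"
  have "openin (top_of (complexification E)) ?W"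
    using ext V(1) by (intro openin_Int) (auto simp: analytic_extension_def openin_prod_Times_iff)
  moreover have "Ck_on k (complexification E) (complexification F) ?W g" for k
    by (rule Ck_subset[OF lcsC _ calculation, of W]) (use ext in \<open>auto simp: analytic_extension_def\<close>)
  moreover have "\<forall>u\<in>U. (u, 0) \<in> ?W \<longrightarrow> g (u, 0) = (f u, 0)"
    using ext by (auto simp: analytic_extension_def)
  ultimately show "\<exists>W g. (x, 0) \<in> W \<and> analytic_extension E F U f W g"
    using W V(2) by (intro exI[of _ ?W] exI[of _ g]) (auto simp: analytic_extension_def)
qed

lemma real_analytic_linear:
  assumes "lcs E" "lcs F" and U: "openin (top_of E) U" and h: "continuous_linear E F h"
  shows "real_analytic_on E F U h"
  unfolding real_analytic_iff_extension[OF assms(1,2)]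
proof (intro ballI exI conjI)
  fix x assume x: "x \<in> U"
  interpret E: lcs E by fact
  interpret F: lcs F by fact
  interpret CC: lcs_pair "complexification E" "complexification F"
    using assms by (simp add: lcs_pair_def lcs_complexification)
  show "(x, 0) \<in> carrier_of (complexification E)"
    using x openin_subset[OF U] by auto
  have "h 0 = 0"
    using h E.zero_in unfolding continuous_linear_def by (metis E.scale_zero_left F.scale_zero_left)
  moreover have "Ck_on k (complexification E) (complexification F) (carrier_of (complexification E)) (map_prod h h)" for k
    by (rule CC.continuous_linear_Ck[OF continuous_linear_complexification[OF assms(1,2) h] openin_topspace])
  ultimately show "analytic_extension E F U h (carrier_of (complexification E)) (map_prod h h)"
    unfolding analytic_extension_def using openin_topspace[of "top_of (complexification E)"]
    by (simp del: complexification_sel)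
qed

lemma real_analytic_pair:
  assumes "lcs E" "lcs F" "lcs G" and U: "openin (top_of E) U"
    and f: "real_analytic_on E F U f" and g: "real_analytic_on E G U g"
  shows "real_analytic_on E (prod_tvs F G) U (\<lambda>x. (f x, g x))"
  unfolding real_analytic_iff_extension[OF assms(1) lcs_prod_tvs[OF assms(2,3)]]
proof
  fix x assume x: "x \<in> U"
  let ?E = "complexification E" and ?F = "complexification F" and ?G = "complexification G"
    and ?P = "complexification (prod_tvs F G)"
  have lcsC: "lcs ?E" "lcs ?F" "lcs ?G" "lcs ?P"
    using assms lcs_complexification lcs_prod_tvs by blast+
  interpret C3: lcs_triple ?E "prod_tvs ?F ?G" ?P
    using lcsC by (simp add: lcs_triple_def lcs_pair_def lcs_prod_tvs)
  obtain W\<^sub>1 f' where f': "(x, 0) \<in> W\<^sub>1" "analytic_extension E F U f W\<^sub>1 f'"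
    using f x real_analytic_iff_extension[OF assms(1,2)] by blast
  obtain W\<^sub>2 g' where g': "(x, 0) \<in> W\<^sub>2" "analytic_extension E G U g W\<^sub>2 g'"
    using g x real_analytic_iff_extension[OF assms(1,3)] by blast
  let ?W = "W\<^sub>1 \<inter> W\<^sub>2"
  \<comment> \<open>The middle two of four coordinates are exchanged: a pair of complexified vectors
    becomes a complexified pair.\<close>
  let ?r = "\<lambda>z. ((fst (fst z), fst (snd z)), (snd (fst z), snd (snd z)))"
  have o: "openin (top_of ?E) W\<^sub>1" "openin (top_of ?E) W\<^sub>2" "openin (top_of ?E) ?W"
    using f' g' by (auto simp: analytic_extension_def)
  have "continuous_linear (prod_tvs ?F ?G) ?P ?r"
    unfolding continuous_linear_def
    by (auto simp: continuous_map_paired simp del: continuous_map_pairedI intro!: continuous_map_projections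
        continuous_map_fst_comp[OF continuous_map_fst] continuous_map_snd_comp[OF continuous_map_fst]
        continuous_map_fst_comp[OF continuous_map_snd] continuous_map_snd_comp[OF continuous_map_snd])
  then have r: "Ck_on k (prod_tvs ?F ?G) ?P (carrier_of (prod_tvs ?F ?G)) ?r" for k
    using C3.FG.continuous_linear_Ck openin_topspace by blast
  have pair: "Ck_on k ?E (prod_tvs ?F ?G) ?W (\<lambda>z. (f' z, g' z))" for k
    using f' g' by (intro Ck_pair lcsC o Ck_subset[OF lcsC(1,2) o(1,3)] Ck_subset[OF lcsC(1,3) o(2,3)])
      (auto simp: analytic_extension_def)
  have "(\<lambda>z. (f' z, g' z)) ` ?W \<subseteq> carrier_of (prod_tvs ?F ?G)"
    using continuous_map_image_subset_topspace[OF C3.EF.Ck_continuous_map[OF pair]] openin_subset[OF o(3)] by fastforce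
  from C3.Ck_compose[OF pair r o(3) openin_topspace this]
  have "Ck_on k ?E ?P ?W (\<lambda>z. ?r (f' z, g' z))" for k .
  then have "analytic_extension E (prod_tvs F G) U (\<lambda>x. (f x, g x)) ?W (\<lambda>z. ?r (f' z, g' z))"
    using f' g' o(3) by (auto simp: analytic_extension_def zero_prod_def simp del: complexification_sel)
  then show "\<exists>W h. (x, 0) \<in> W \<and> analytic_extension E (prod_tvs F G) U (\<lambda>x. (f x, g x)) W h"
    using f'(1) g'(1) by blast
qed

lemma real_analytic_compose:
  assumes "lcs E" "lcs F" "lcs G" and U: "openin (top_of E) U" and fUV: "f ` U \<subseteq> V"
    and f: "real_analytic_on E F U f" and g: "real_analytic_on F G V g"
  shows "real_analytic_on E G U (\<lambda>x. g (f x))"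
  unfolding real_analytic_iff_extension[OF assms(1,3)]
proof
  fix x assume x: "x \<in> U"
  let ?E = "complexification E" and ?F = "complexification F" and ?G = "complexification G"
  have lcsC: "lcs ?E" "lcs ?F" "lcs ?G"
    using assms lcs_complexification by blast+
  interpret C3: lcs_triple ?E ?F ?G
    using lcsC by (simp add: lcs_triple_def lcs_pair_def)
  obtain W\<^sub>1 f' where f': "(x, 0) \<in> W\<^sub>1" "analytic_extension E F U f W\<^sub>1 f'"
    using f x real_analytic_iff_extension[OF assms(1,2)] by blast
  have fx: "f x \<in> V"
    using x fUV by blast
  obtain W\<^sub>2 g' where g': "(f x, 0) \<in> W\<^sub>2" "analytic_extension F G V g W\<^sub>2 g'"
    using g fx real_analytic_iff_extension[OF assms(2,3)] by blast
  have o: "openin (top_of ?E) W\<^sub>1" "openin (top_of ?F) W\<^sub>2" and ck: "Ck_on k ?E ?F W\<^sub>1 f'" "Ck_on k ?F ?G W\<^sub>2 g'"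
    and f'f: "\<forall>u\<in>U. (u, 0) \<in> W\<^sub>1 \<longrightarrow> f' (u, 0) = (f u, 0)"
    and g'g: "\<forall>u\<in>V. (u, 0) \<in> W\<^sub>2 \<longrightarrow> g' (u, 0) = (g u, 0)" for k
    using f' g' by (simp_all add: analytic_extension_def del: complexification_sel)
  let ?W = "{z \<in> topspace (subtopology (top_of ?E) W\<^sub>1). f' z \<in> W\<^sub>2}"
  have "openin (subtopology (top_of ?E) W\<^sub>1) ?W"
    by (rule openin_continuous_map_preimage[OF C3.EF.Ck_continuous_map[OF ck(1)] o(2)])
  then have oW: "openin (top_of ?E) ?W" and sub: "?W \<subseteq> W\<^sub>1"
    using openin_open_subtopology[OF o(1)] by blast+
  have "Ck_on k ?E ?G ?W (\<lambda>z. g' (f' z))" for k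
    by (rule C3.Ck_compose[OF Ck_subset[OF lcsC(1,2) o(1) oW sub ck(1)] ck(2) oW o(2)]) blast
  moreover have "\<forall>u\<in>U. (u, 0) \<in> ?W \<longrightarrow> g' (f' (u, 0)) = (g (f u), 0)"
  proof (intro ballI impI)
    fix u assume u: "u \<in> U" "(u, 0) \<in> ?W"
    then have "f' (u, 0) = (f u, 0)" "f' (u, 0) \<in> W\<^sub>2"
      using f'f sub by blast+
    then show "g' (f' (u, 0)) = (g (f u), 0)"
      using g'g fUV u(1) by auto
  qed
  moreover have "(x, 0) \<in> ?W"
    using f'(1) g'(1) bspec[OF f'f x] openin_subset[OF o(1)] by (simp add: subsetD del: complexification_sel)
  ultimately have "(x, 0) \<in> ?W \<and> analytic_extension E G U (\<lambda>x. g (f x)) ?W (\<lambda>z. g' (f' z))"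
    unfolding analytic_extension_def using oW by (intro conjI allI)
  then show "\<exists>W h. (x, 0) \<in> W \<and> analytic_extension E G U (\<lambda>x. g (f x)) W h"
    by (intro exI)
qed

section \<open>Reduction of \<open>Cr_on\<close> to the three underlying calculi\<close>

definition smoothness_le :: "nat \<Rightarrow> smoothness \<Rightarrow> bool"
  where "smoothness_le k r \<longleftrightarrow> (case r of Order m \<Rightarrow> k \<le> m | _ \<Rightarrow> True)"

lemma Cr_on_Ck:
  assumes "r \<noteq> Analytic"
  shows "Cr_on r E F U f \<longleftrightarrow> openin (top_of E) U \<and> f ` U \<subseteq> carrier_of F \<and> (\<forall>k. smoothness_le k r \<longrightarrow> Ck_on k E F U f)"
  using assms by (cases r) (auto simp: Cr_on_def smoothness_le_def Ck_on_def)

lemma Cr_on_real_analytic: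
  fixes E :: "('k::real_or_complex_field, 'e::ab_group_add) tvs"
  assumes "(\<real> :: 'k set) = UNIV"
  shows "Cr_on Analytic E F U f \<longleftrightarrow> openin (top_of E) U \<and> f ` U \<subseteq> carrier_of F \<and> real_analytic_on E F U f"
  using assms by (simp add: Cr_on_def)

lemma (in scalar_isomorphism) Cr_on_complex:
  fixes E :: "('k, 'e::ab_group_add) tvs"
  assumes "lcs E" "lcs F" "(\<real> :: 'k set) \<noteq> UNIV"
  shows "Cr_on Analytic E F U f \<longleftrightarrow> openin (top_of E) U \<and> f ` U \<subseteq> carrier_of F \<and>
    (\<forall>k. Ck_on k (rescale J E) (rescale J F) U f)"
proof -
  interpret CC: complex_pair "rescale J E" "rescale J F"
    using assms by (simp add: complex_pair_def lcs_pair_def lcs_rescale)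
  show ?thesis
    using assms(3) CC.complex_analytic_iff_Ck[of U f]
    by (auto simp: Cr_on_def complex_analytic_rescale)
qed

lemma Cr_on_openin: "Cr_on r E F U f \<Longrightarrow> openin (top_of E) U"
  and Cr_on_in: "Cr_on r E F U f \<Longrightarrow> f ` U \<subseteq> carrier_of F"
  by (simp_all add: Cr_on_def)

text \<open>Finite or infinite order is treated by \<open>C^k\<close> calculus, the real analytic
  class by extensions, and the complex analytic class by \<open>C^k\<close> calculus after
  rescaling. The closure properties below reduce to these three cases.\<close>

lemma admissible_cases:
  fixes K :: "'k::real_or_complex_field itself"
  assumes "admissible_smoothness K r"
  obtains "r \<noteq> Analytic"
    | "r = Analytic" "(\<real> :: 'k set) = UNIV"
    | J :: "complex \<Rightarrow> 'k" where "r = Analytic" "(\<real> :: 'k set) \<noteq> UNIV" "scalar_isomorphism J"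
  using assms exists_scalar_isomorphism unfolding admissible_smoothness_def by blast

lemma prod_tvs_rescale: "prod_tvs (rescale J F) (rescale J G) = rescale J (prod_tvs F G)"
  by (simp add: prod_tvs_def rescale_def)

context
  fixes r :: smoothness and E :: "('k::real_or_complex_field, 'e::ab_group_add) tvs"
    and F :: "('k, 'f::ab_group_add) tvs"
  assumes adm: "admissible_smoothness TYPE('k) r" and E: "lcs E" and F: "lcs F"
begin

interpretation EF: lcs_pair E F
  using E F by (simp add: lcs_pair_def)

lemma Cr_local:
  assumes U: "openin (top_of E) U" and loc: "\<And>x. x \<in> U \<Longrightarrow> \<exists>V. x \<in> V \<and> Cr_on r E F V f"
  shows "Cr_on r E F U f"
proof -
  have im: "f ` U \<subseteq> carrier_of F"
    using loc Cr_on_in by blast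
  show ?thesis
  proof (cases rule: admissible_cases[OF adm])
    case 1
    have "Ck_on k E F U f" if "smoothness_le k r" for k
    proof (rule EF.Ck_local[OF U])
      fix x assume "x \<in> U"
      from loc[OF this, unfolded Cr_on_Ck[OF 1]] that
      show "\<exists>V. openin (top_of E) V \<and> x \<in> V \<and> Ck_on k E F V f"
        by blast
    qed
    then show ?thesis
      using U im by (simp add: Cr_on_Ck[OF 1])
  next
    case 2
    have "real_analytic_on E F U f"
    proof (rule real_analytic_local[OF E F U])
      fix x assume "x \<in> U"
      from loc[OF this, unfolded 2(1) Cr_on_real_analytic[OF 2(2)]]
      show "\<exists>V. openin (top_of E) V \<and> x \<in> V \<and> real_analytic_on E F V f"
        by blast
    qed
    then show ?thesis
      using U im by (simp add: 2(1) Cr_on_real_analytic[OF 2(2)])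
  next
    case (3 J)
    interpret scalar_isomorphism J by fact
    note C = Cr_on_complex[OF E F 3(2)]
    interpret CC: lcs_pair "rescale J E" "rescale J F"
      using E F by (simp add: lcs_pair_def lcs_rescale)
    have U': "openin (top_of (rescale J E)) U"
      using U by simp
    have "Ck_on k (rescale J E) (rescale J F) U f" for k
    proof (rule CC.Ck_local[OF U'])
      fix x assume "x \<in> U"
      from loc[OF this, unfolded 3(1) C]
      show "\<exists>V. openin (top_of (rescale J E)) V \<and> x \<in> V \<and> Ck_on k (rescale J E) (rescale J F) V f"
        by (simp only: rescale_sel) blast
    qed
    then show ?thesis
      using U im by (simp add: 3(1) C)
  qed
qed

lemma Cr_continuous:
  assumes "Cr_on r E F U f"
  shows "continuous_map (subtopology (top_of E) U) (top_of F) f"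
proof (cases rule: admissible_cases[OF adm])
  case 1
  have "smoothness_le 0 r"
    by (cases r) (auto simp: smoothness_le_def)
  then show ?thesis
    using assms EF.Ck_continuous_map by (auto simp: Cr_on_Ck[OF 1])
next
  case 2
  then show ?thesis
    using assms real_analytic_continuous[OF E F] by (simp add: Cr_on_def)
next
  case (3 J)
  then show ?thesis
    using assms by (simp add: Cr_on_def complex_analytic_on_def)
qed

lemma Cr_subset:
  assumes "Cr_on r E F U f" "openin (top_of E) V" "V \<subseteq> U"
  shows "Cr_on r E F V f"
  by (rule Cr_local[OF assms(2)]) (use assms in blast)

lemma Cr_cong:
  assumes f: "Cr_on r E F U f" and fg: "\<And>x. x \<in> U \<Longrightarrow> f x = g x"
  shows "Cr_on r E F U g"
proof -
  have U: "openin (top_of E) U" and im: "f ` U \<subseteq> carrier_of F"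
    using f Cr_on_openin Cr_on_in by blast+
  have im': "g ` U \<subseteq> carrier_of F"
    using im fg by fastforce
  show ?thesis
  proof (cases rule: admissible_cases[OF adm])
    case 1
    then show ?thesis
      using f fg im' U EF.Ck_cong[OF U] by (auto simp: Cr_on_Ck[OF 1])
  next
    case 2
    then show ?thesis
      using f fg im' by (simp add: Cr_on_real_analytic[OF 2(2)] real_analytic_on_def)
  next
    case (3 J)
    interpret scalar_isomorphism J by fact
    note C = Cr_on_complex[OF E F 3(2)]
    interpret CC: lcs_pair "rescale J E" "rescale J F"
      using E F by (simp add: lcs_pair_def lcs_rescale)
    have "openin (top_of (rescale J E)) U"
      using U by simp
    from CC.Ck_cong[OF this] show ?thesis
      using f fg im' U by (auto simp: 3(1) C)
  qed
qed

lemma Cr_linear: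
  assumes h: "continuous_linear E F h" and U: "openin (top_of E) U"
  shows "Cr_on r E F U h"
proof -
  have im: "h ` U \<subseteq> carrier_of F"
    using continuous_linear_in[OF h] openin_subset[OF U] by blast
  show ?thesis
  proof (cases rule: admissible_cases[OF adm])
    case 1
    then show ?thesis
      using U im EF.continuous_linear_Ck[OF h U] by (simp add: Cr_on_Ck[OF 1])
  next
    case 2
    then show ?thesis
      using U im real_analytic_linear[OF E F U h] by (simp add: Cr_on_real_analytic[OF 2(2)])
  next
    case (3 J)
    interpret scalar_isomorphism J by fact
    interpret CC: lcs_pair "rescale J E" "rescale J F"
      using E F by (simp add: lcs_pair_def lcs_rescale)
    have "openin (top_of (rescale J E)) U" "continuous_linear (rescale J E) (rescale J F) h"
      using U h by (simp_all add: continuous_linear_rescale)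
    from CC.continuous_linear_Ck[OF this(2,1)] show ?thesis
      using U im by (simp add: 3(1) Cr_on_complex[OF E F 3(2)])
  qed
qed

end

lemma Cr_compose:
  fixes E :: "('k::real_or_complex_field, 'e::ab_group_add) tvs" and F :: "('k, 'f::ab_group_add) tvs"
    and G :: "('k, 'g::ab_group_add) tvs"
  assumes adm: "admissible_smoothness TYPE('k) r" and EFG: "lcs E" "lcs F" "lcs G"
    and f: "Cr_on r E F U f" and g: "Cr_on r F G V g" and fUV: "f ` U \<subseteq> V"
  shows "Cr_on r E G U (\<lambda>x. g (f x))"
proof -
  have U: "openin (top_of E) U" and V: "openin (top_of F) V" and im: "(\<lambda>x. g (f x)) ` U \<subseteq> carrier_of G"
    using Cr_on_openin[OF f] Cr_on_openin[OF g] Cr_on_in[OF g] fUV by auto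
  show ?thesis
  proof (cases rule: admissible_cases[OF adm])
    case 1
    interpret lcs_triple E F G
      using EFG by (simp add: lcs_triple_def lcs_pair_def)
    show ?thesis
      using f g U im Ck_compose[OF _ _ U V fUV] by (auto simp: Cr_on_Ck[OF 1])
  next
    case 2
    then show ?thesis
      using f g U im real_analytic_compose[OF EFG U fUV] by (simp add: Cr_on_real_analytic[OF 2(2)])
  next
    case (3 J)
    interpret scalar_isomorphism J by fact
    note C = Cr_on_complex[OF _ _ 3(2)]
    interpret lcs_triple "rescale J E" "rescale J F" "rescale J G"
      using EFG by (simp add: lcs_triple_def lcs_pair_def lcs_rescale)
    have o: "openin (top_of (rescale J E)) U" "openin (top_of (rescale J F)) V"
      using U V by simp_all
    have "\<forall>k. Ck_on k (rescale J E) (rescale J F) U f" "\<forall>k. Ck_on k (rescale J F) (rescale J G) V g"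
      using f g EFG by (simp_all add: 3(1) C)
    then show ?thesis
      using U im Ck_compose[OF _ _ o fUV] EFG by (simp add: 3(1) C)
  qed
qed

lemma Cr_pair:
  fixes E :: "('k::real_or_complex_field, 'e::ab_group_add) tvs" and F :: "('k, 'f::ab_group_add) tvs"
    and G :: "('k, 'g::ab_group_add) tvs"
  assumes adm: "admissible_smoothness TYPE('k) r" and EFG: "lcs E" "lcs F" "lcs G"
    and f: "Cr_on r E F U f" and g: "Cr_on r E G U g"
  shows "Cr_on r E (prod_tvs F G) U (\<lambda>x. (f x, g x))"
proof -
  have U: "openin (top_of E) U" and im: "(\<lambda>x. (f x, g x)) ` U \<subseteq> carrier_of (prod_tvs F G)"
    using Cr_on_openin[OF f] Cr_on_in[OF f] Cr_on_in[OF g] by auto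
  have P: "lcs (prod_tvs F G)"
    using EFG by (simp add: lcs_prod_tvs)
  show ?thesis
  proof (cases rule: admissible_cases[OF adm])
    case 1
    then show ?thesis
      using f g U im Ck_pair[OF EFG U] by (simp add: Cr_on_Ck[OF 1])
  next
    case 2
    then show ?thesis
      using f g U im real_analytic_pair[OF EFG U] by (simp add: Cr_on_real_analytic[OF 2(2)])
  next
    case (3 J)
    interpret scalar_isomorphism J by fact
    note C = Cr_on_complex[OF _ _ 3(2)]
    have o: "openin (top_of (rescale J E)) U"
      using U by simp
    have "\<forall>k. Ck_on k (rescale J E) (rescale J F) U f" "\<forall>k. Ck_on k (rescale J E) (rescale J G) U g"
      using f g EFG by (simp_all add: 3(1) C)
    then have "\<forall>k. Ck_on k (rescale J E) (rescale J (prod_tvs F G)) U (\<lambda>x. (f x, g x))"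
      using Ck_pair[OF lcs_rescale[OF EFG(1)] lcs_rescale[OF EFG(2)] lcs_rescale[OF EFG(3)] o]
      unfolding prod_tvs_rescale by blast
    then show ?thesis
      using U im EFG P by (simp add: 3(1) C)
  qed
qed

subsection \<open>Tangent maps of diffeomorphisms\<close>

text \<open>A real parameter gives one notion for both ground fields, unchanged under
  \<open>rescale\<close>. It is strong enough for its purpose, which is to see that limits of
  quotients remain in a closed subspace.\<close>

definition real_dd :: "('k::real_normed_field, 'e::ab_group_add) tvs \<Rightarrow> ('e \<Rightarrow> 'e) \<Rightarrow> 'e \<Rightarrow> 'e \<Rightarrow> 'e \<Rightarrow> bool"
  where "real_dd E f x v l \<longleftrightarrow>
    limitin (top_of E) (\<lambda>t::real. scale_of E (of_real (inverse t)) (f (x + scale_of E (of_real t) v) - f x)) l (at 0)"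

definition tangent_isomorphism ::
    "('k::real_normed_field, 'e::ab_group_add) tvs \<Rightarrow> ('e \<Rightarrow> 'e) \<Rightarrow> ('e \<Rightarrow> 'e) \<Rightarrow> 'e \<Rightarrow> ('e \<Rightarrow> 'e) \<Rightarrow> ('e \<Rightarrow> 'e) \<Rightarrow> bool"
  where "tangent_isomorphism E f g p A B \<longleftrightarrow>
    continuous_linear E E A \<and> continuous_linear E E B \<and>
    (\<forall>v\<in>carrier_of E. B (A v) = v \<and> A (B v) = v \<and> real_dd E f p v (A v) \<and> real_dd E g (f p) v (B v))"

text \<open>The last claim admits any curve tangent to \<open>v\<close> in place of a line, as
  needed to differentiate a composite.\<close>

lemma C1_derivative:
  assumes "lcs E" and U: "openin (top_of E) U" and f: "Ck_on 1 E E U f" and p: "p \<in> U"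
  defines "A \<equiv> \<lambda>v. iterated_derivative E E f 1 p (\<lambda>_. v)"
  shows "continuous_linear E E A"
    and "v \<in> carrier_of E \<Longrightarrow> has_directional_derivative E E f p v (A v)"
    and "v \<in> carrier_of E \<Longrightarrow> real_dd E f p v (A v)"
    and "limitin (top_of E) (\<lambda>t. scale_of E (inverse t) (z t - p)) v (at 0) \<Longrightarrow>
      limitin (top_of E) (\<lambda>t. scale_of E (inverse t) (f (z t) - f p)) (A v) (at 0)"
proof -
  interpret lcs_pair E E
    using assms by (simp add: lcs_pair_def)
  have upd: "it f 1 p ((\<lambda>_. w)(0 := v)) = A v" for w v
    unfolding A_def by (rule it_cong) simp
  have "A (u + v) = A u + A v" "A (scale_of E c u) = scale_of E c (A u)"
    if "u \<in> carrier_of E" "v \<in> carrier_of E" for u v c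
    using it_multilinear_upd[OF f U order_refl p, of 0 u v "\<lambda>_. u"] that unfolding upd by simp_all
  moreover have "continuous_map (top_of E) (top_of E) A"
  proof -
    have "continuous_map (top_of E) (product_topology (\<lambda>_. top_of E) {..<1::nat}) (\<lambda>v. \<lambda>i\<in>{..<1}. v)"
      unfolding continuous_map_componentwise by auto
    from continuous_map_compose[OF this it_continuous_at[OF f U order_refl p]]
    have "continuous_map (top_of E) (top_of E) (\<lambda>v. it f 1 p (\<lambda>i\<in>{..<1}. v))"
      by (simp add: o_def)
    moreover have "it f 1 p (\<lambda>i\<in>{..<1}. v) = A v" for v
      unfolding A_def by (rule it_cong) simp
    ultimately show ?thesis
      by simp
  qed
  ultimately show "continuous_linear E E A"
    unfolding continuous_linear_def by blast
  show dd: "has_dd f p v (A v)" if "v \<in> carrier_of E" for v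
    using Ck_has_dd[OF f zero_less_one p, of "\<lambda>_. v"] that by (simp add: A_def)
  show "real_dd E f p v (A v)" if "v \<in> carrier_of E"
  proof -
    have "filterlim (\<lambda>t::real. of_real t :: 'a) (at 0) (at 0)"
      by (auto simp: filterlim_at eventually_at_filter intro!: tendsto_eq_intros)
    from limitin_filterlim[OF dd[OF that, unfolded has_directional_derivative_def] this]
    show ?thesis
      by (simp add: real_dd_def)
  qed
  show "limitin (top_of E) (\<lambda>t. scale_of E (inverse t) (f (z t) - f p)) (A v) (at 0)"
    if "limitin (top_of E) (\<lambda>t. scale_of E (inverse t) (z t - p)) v (at 0)"
    using it_along_curve[OF f U zero_less_one p that, of "\<lambda>_. v" "\<lambda>_ _. v" "\<lambda>_. v"] upd[of v v] by simp
qed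

text \<open>The identity \<open>g (f x) = x\<close> is differentiated along lines: the derivative of
  \<open>g\<close> is taken along the curve \<open>f (p + t v)\<close>, whose tangent vector is the
  derivative of \<open>f\<close>.\<close>

lemma C1_tangent_isomorphism:
  assumes E: "lcs E" and U: "openin (top_of E) U" "openin (top_of E) V"
    and f: "Ck_on 1 E E U f" and g: "Ck_on 1 E E V g" and fU: "f ` U \<subseteq> V" and gV: "g ` V \<subseteq> U"
    and gf: "\<And>x. x \<in> U \<Longrightarrow> g (f x) = x" and fg: "\<And>y. y \<in> V \<Longrightarrow> f (g y) = y" and p: "p \<in> U"
  shows "\<exists>A B. tangent_isomorphism E f g p A B"
proof -
  interpret lcs_pair E E
    using E by (simp add: lcs_pair_def)
  \<comment> \<open>Stated for arbitrary maps because it is applied a second time with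
    \<open>f\<close> and \<open>g\<close> exchanged, at the point \<open>f p\<close>.\<close>
  have inv: "iterated_derivative E E g 1 (f p) (\<lambda>_. iterated_derivative E E f 1 p (\<lambda>_. v)) = v"
    if U: "openin (top_of E) U" "openin (top_of E) V" and f: "Ck_on 1 E E U f" and g: "Ck_on 1 E E V g"
      and fU: "f ` U \<subseteq> V" and gf: "\<And>x. x \<in> U \<Longrightarrow> g (f x) = x" and p: "p \<in> U" and v: "v \<in> carrier_of E"
    for U V f g p v
  proof (rule E.limitin_unique)
    have fp: "f p \<in> V"
      using fU p by blast
    show "limitin (top_of E) (\<lambda>t. scale_of E (inverse t) (g (f (p + scale_of E t v)) - g (f p)))
      (iterated_derivative E E g 1 (f p) (\<lambda>_. iterated_derivative E E f 1 p (\<lambda>_. v))) (at 0)"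
      using C1_derivative(4)[OF E U(2) g fp] C1_derivative(2)[OF E U(1) f p v] by (simp add: has_directional_derivative_def)
    have "\<forall>\<^sub>F t in at 0. v = scale_of E (inverse t) (g (f (p + scale_of E t v)) - g (f p))"
    proof -
      have "\<forall>\<^sub>F t in at (0::'a). t \<noteq> 0"
        by (simp add: eventually_at_filter)
      with eventually_line[OF U(1) p v] show ?thesis
        by eventually_elim (use gf p in simp)
    qed
    then show "limitin (top_of E) (\<lambda>t. scale_of E (inverse t) (g (f (p + scale_of E t v)) - g (f p))) v (at 0)"
      using v by (intro limitin_eventually) (auto elim: eventually_mono)
  qed simp
  let ?A = "\<lambda>v. iterated_derivative E E f 1 p (\<lambda>_. v)" and ?B = "\<lambda>v. iterated_derivative E E g 1 (f p) (\<lambda>_. v)"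
  have fp: "f p \<in> V"
    using fU p by blast
  have "?B (?A v) = v \<and> ?A (?B v) = v \<and> real_dd E f p v (?A v) \<and> real_dd E g (f p) v (?B v)"
    if v: "v \<in> carrier_of E" for v
  proof (intro conjI)
    show "?B (?A v) = v"
      by (rule inv[OF U f g fU gf p v])
    show "?A (?B v) = v"
      using inv[OF U(2,1) g f gV fg fp v] gf[OF p] by simp
    show "real_dd E f p v (?A v)"
      by (rule C1_derivative(3)[OF E U(1) f p v])
    show "real_dd E g (f p) v (?B v)"
      by (rule C1_derivative(3)[OF E U(2) g fp v])
  qed
  then have "tangent_isomorphism E f g p ?A ?B"
    unfolding tangent_isomorphism_def
    using C1_derivative(1)[OF E U(1) f p] C1_derivative(1)[OF E U(2) g fp] by (intro conjI ballI) simp_all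
  then show ?thesis
    by (intro exI)
qed

text \<open>At real points and in real directions, the first component of the derivative of an
  extension is the derivative of \<open>f\<close>, and it inherits joint continuity. Order one is
  what tangent maps call for.\<close>

lemma real_analytic_C1:
  fixes E :: "('k::real_or_complex_field, 'e::ab_group_add) tvs"
  assumes R: "(\<real> :: 'k set) = UNIV" and E: "lcs E" and F: "lcs F" and U: "openin (top_of E) U"
    and f: "real_analytic_on E F U f"
  shows "Ck_on 1 E F U f"
proof -
  interpret EF: lcs_pair E F
    using E F by (simp add: lcs_pair_def)
  let ?E = "complexification E" and ?F = "complexification F"
  interpret CC: lcs_pair ?E ?F
    using E F by (simp add: lcs_pair_def lcs_complexification)
  show ?thesis
  proof (rule EF.Ck_local[OF U])
    fix x assume x: "x \<in> U"
    obtain W g where W: "(x, 0) \<in> W" and ext: "analytic_extension E F U f W g"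
      using f x real_analytic_iff_extension[OF E F] by blast
    have Wo: "openin (top_of ?E) W" and g: "Ck_on 1 ?E ?F W g" and gf: "\<forall>u\<in>U. (u, 0) \<in> W \<longrightarrow> g (u, 0) = (f u, 0)"
      using ext by (simp_all add: analytic_extension_def del: complexification_sel)
    let ?V = "U \<inter> {u \<in> carrier_of E. (u, 0) \<in> W}"
    have V: "openin (top_of E) ?V"
      by (intro openin_Int U openin_continuous_map_preimage[OF continuous_embed_real[OF E] Wo])
    define D where "D j u y = (if j = 0 then f u else fst (CC.it g 1 (u, 0) (\<lambda>_. (y 0, 0))))"
      for j :: nat and u and y :: "nat \<Rightarrow> 'e"
    have "Ck_on 1 E F ?V f"
    proof (rule EF.CkI(1)[where D = D, OF V])
      fix j :: nat and u and y :: "nat \<Rightarrow> 'e"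
      assume j: "j < 1" and u: "u \<in> ?V" and y: "\<forall>i\<le>j. y i \<in> carrier_of E"
      have j0: "j = 0" using j by simp
      have y0: "y 0 \<in> carrier_of E"
        using y by simp
      have "CC.has_dd (\<lambda>z. CC.it g 0 z (\<lambda>_. (y 0, 0))) (u, 0) (y 0, 0) (CC.it g (Suc 0) (u, 0) (\<lambda>_. (y 0, 0)))"
        using CC.Ck_has_dd[OF g zero_less_one, of "(u, 0)" "\<lambda>_. (y 0, 0)"] u y by simp
      then have lim: "limitin (top_of ?F) (\<lambda>t. scale_of ?F (inverse t) (g ((u, 0) + scale_of ?E t (y 0, 0)) - g (u, 0)))
          (CC.it g 1 (u, 0) (\<lambda>_. (y 0, 0))) (at 0)"
        by (simp add: has_directional_derivative_def)
      \<comment> \<open>In a field with \<open>\<real> = UNIV\<close> each scalar is a real number,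
        read off by \<open>\<rho>\<close>; thus the limit over complex parameters restricts to one
        over the scalars of \<open>E\<close>.\<close>
      have "\<forall>t::'k. \<exists>a::real. t = of_real a"
        using R by (metis Reals_cases UNIV_I)
      then obtain \<rho> :: "'k \<Rightarrow> real" where \<rho>: "\<And>t. t = of_real (\<rho> t)"
        by metis
      have norm_\<rho>: "\<bar>\<rho> t\<bar> = norm t" for t
        using \<rho>[of t] by (metis norm_of_real)
      have "filterlim (\<lambda>t. complex_of_real (\<rho> t)) (at 0) (at 0)"
        unfolding filterlim_at
      proof
        have "((\<lambda>t. norm (complex_of_real (\<rho> t))) \<longlongrightarrow> 0) (at 0)"
          by (simp add: norm_\<rho> tendsto_norm_zero)
        then show "((\<lambda>t. complex_of_real (\<rho> t)) \<longlongrightarrow> 0) (at 0)"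
          by (rule tendsto_norm_zero_cancel)
        show "\<forall>\<^sub>F t in at 0. complex_of_real (\<rho> t) \<in> UNIV \<and> complex_of_real (\<rho> t) \<noteq> 0"
          unfolding eventually_at_filter
          by (rule always_eventually) (metis UNIV_I \<rho> of_real_eq_0_iff)
      qed
      from limitin_filterlim[OF lim this]
      have "limitin (top_of F) (\<lambda>t. fst (scale_of ?F (inverse (of_real (\<rho> t)))
          (g ((u, 0) + scale_of ?E (of_real (\<rho> t)) (y 0, 0)) - g (u, 0)))) (D 1 u y) (at 0)"
        by (simp add: limitin_pairwise o_def D_def)
      moreover have "\<forall>\<^sub>F t in at 0. fst (scale_of ?F (inverse (of_real (\<rho> t)))
          (g ((u, 0) + scale_of ?E (of_real (\<rho> t)) (y 0, 0)) - g (u, 0))) =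
          scale_of F (inverse t) (f (u + scale_of E t (y 0)) - f u)"
        using EF.eventually_line[OF V u y0]
      proof eventually_elim
        case (elim t)
        have t: "of_real (\<rho> t) = t" "of_real (inverse (\<rho> t)) = inverse t"
          using \<rho>[of t] by (metis, metis of_real_inverse)
        have sc: "fst (scale_of ?F (inverse (complex_of_real (\<rho> t))) (w, 0)) = scale_of F (inverse t) w"
          for w
          unfolding of_real_inverse[symmetric] by (simp add: t(2) del: of_real_inverse)
        have "(u, 0) + scale_of ?E (of_real (\<rho> t)) (y 0, 0) = (u + scale_of E t (y 0), 0)"
          by (simp add: t)
        moreover have "g (u + scale_of E t (y 0), 0) = (f (u + scale_of E t (y 0)), 0)" "g (u, 0) = (f u, 0)"
          using gf elim u by auto
        ultimately have "g ((u, 0) + scale_of ?E (of_real (\<rho> t)) (y 0, 0)) - g (u, 0) =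
            (f (u + scale_of E t (y 0)) - f u, 0)"
          by (simp only: diff_Pair diff_self)
        then show ?case
          by (simp only: sc)
      qed
      ultimately have "limitin (top_of F) (\<lambda>t. scale_of F (inverse t) (f (u + scale_of E t (y 0)) - f u)) (D 1 u y) (at 0)"
        by (rule limitin_transform_eventually[rotated])
      then show "EF.has_dd (\<lambda>u. D j u y) u (y j) (D (Suc j) u y)"
        unfolding has_directional_derivative_def j0 by (simp add: D_def)
    next
      fix j :: nat assume "j \<le> 1"
      let ?P = "product_topology (\<lambda>_. top_of E) {..<j}"
      let ?X = "prod_topology (subtopology (top_of E) ?V) ?P"
      consider "j = 0" | "j = 1" using \<open>j \<le> 1\<close> by linarith
      then show "continuous_map ?X (top_of F) (\<lambda>z. D j (fst z) (snd z))"
      proof cases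
        case 1
        have "continuous_map (subtopology (top_of E) ?V) (top_of F) f"
          using continuous_map_from_subtopology_mono[OF real_analytic_continuous[OF E F U f]] by blast
        from continuous_map_compose[OF continuous_map_fst this] show ?thesis
          using 1 by (simp add: D_def o_def)
      next
        case 2
        have c1: "continuous_map ?X (subtopology (top_of ?E) W) (\<lambda>z. (fst z, 0))"
        proof (rule continuous_map_into_subtopology)
          have "continuous_map ?X (subtopology (top_of E) ?V) fst"
            by (rule continuous_map_fst)
          then have "continuous_map ?X (top_of E) fst"
            by (rule continuous_map_into_fulltopology)
          then have "continuous_map ?X (top_of ?E) ((\<lambda>u. (u, 0)) \<circ> fst)"
            by (rule continuous_map_compose) (rule continuous_embed_real[OF E])
          then show "continuous_map ?X (top_of ?E) (\<lambda>z. (fst z, 0))"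
            unfolding o_def .
          show "(\<lambda>z. (fst z, 0)) \<in> topspace ?X \<rightarrow> W"
            by (simp add: Pi_iff)
        qed
        have "continuous_map ?X (top_of E) (\<lambda>z. snd z 0)"
          using continuous_map_compose[OF continuous_map_snd continuous_map_product_projection[of 0 "{..<j}" "\<lambda>_. top_of E"]] 2
          by (simp add: o_def)
        from continuous_map_compose[OF this continuous_embed_real[OF E]]
        have "continuous_map ?X (top_of ?E) (\<lambda>z. (snd z 0, 0))"
          by (simp add: o_def del: complexification_sel)
        then have c2: "continuous_map ?X (product_topology (\<lambda>_. top_of ?E) {..<1::nat}) (\<lambda>z. \<lambda>i\<in>{..<1}. (snd z 0, 0))"
          unfolding continuous_map_componentwise by (auto simp del: complexification_sel)
        from continuous_map_compose[OF continuous_map_pairedI[OF c1 c2] CC.Ck_continuous[OF g order_refl]]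
        have "continuous_map ?X (top_of ?F) (\<lambda>z. CC.it g 1 (fst z, 0) (\<lambda>i\<in>{..<1}. (snd z 0, 0)))"
          by (simp add: o_def del: complexification_sel)
        moreover have "CC.it g 1 w (\<lambda>i\<in>{..<1}. y) = CC.it g 1 w (\<lambda>_. y)" for w y
          by (rule CC.it_cong) simp
        ultimately have "continuous_map ?X (prod_topology (top_of F) (top_of F)) (\<lambda>z. CC.it g 1 (fst z, 0) (\<lambda>_. (snd z 0, 0)))"
          by simp
        from continuous_map_fst_comp[OF this] show ?thesis
          using 2 by (simp add: D_def)
      qed
    qed (simp add: D_def)
    then show "\<exists>V. openin (top_of E) V \<and> x \<in> V \<and> Ck_on 1 E F V f"
      using V x W openin_subset[OF U] by (intro exI[of _ ?V]) auto
  qed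
qed

lemma Cr_tangent_isomorphism:
  fixes E :: "('k::real_or_complex_field, 'e::ab_group_add) tvs"
  assumes adm: "admissible_smoothness TYPE('k) r" and E: "lcs E"
    and f: "Cr_on r E E U f" and g: "Cr_on r E E V g" and fU: "f ` U \<subseteq> V" and gV: "g ` V \<subseteq> U"
    and gf: "\<And>x. x \<in> U \<Longrightarrow> g (f x) = x" and fg: "\<And>y. y \<in> V \<Longrightarrow> f (g y) = y" and p: "p \<in> U"
  shows "\<exists>A B. tangent_isomorphism E f g p A B"
proof -
  have o: "openin (top_of E) U" "openin (top_of E) V"
    using Cr_on_openin f g by blast+
  show ?thesis
  proof (cases rule: admissible_cases[OF adm])
    case 1
    \<comment> \<open>Admissibility excludes \<open>Order 0\<close>.\<close>
    have "smoothness_le 1 r"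
      using adm by (cases r) (auto simp: smoothness_le_def admissible_smoothness_def)
    then have "Ck_on 1 E E U f" "Ck_on 1 E E V g"
      using f g by (simp_all add: Cr_on_Ck[OF 1])
    from C1_tangent_isomorphism[OF E o this fU gV gf fg p] show ?thesis .
  next
    case 2
    then have "Ck_on 1 E E U f" "Ck_on 1 E E V g"
      using f g real_analytic_C1[OF 2(2) E E] o by (simp_all add: Cr_on_real_analytic[OF 2(2)])
    from C1_tangent_isomorphism[OF E o this fU gV gf fg p] show ?thesis .
  next
    case (3 J)
    interpret scalar_isomorphism J by fact
    have o': "openin (top_of (rescale J E)) U" "openin (top_of (rescale J E)) V"
      using o by simp_all
    have "Ck_on 1 (rescale J E) (rescale J E) U f" "Ck_on 1 (rescale J E) (rescale J E) V g"
      using f g E by (simp_all add: 3(1) Cr_on_complex[OF _ _ 3(2)])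
    from C1_tangent_isomorphism[OF lcs_rescale[OF E] o' this fU gV gf fg p]
    show ?thesis
      unfolding tangent_isomorphism_def real_dd_def continuous_linear_rescale by (simp add: of_real del: of_real_inverse)
  qed
qed

section \<open>Charts and manifolds\<close>

lemma is_chart_openin: "is_chart X E (U, \<phi>) \<Longrightarrow> openin X U"
  and is_chart_image: "is_chart X E (U, \<phi>) \<Longrightarrow> openin (top_of E) (\<phi> ` U)"
  by (simp_all add: is_chart_def)

lemma is_chart_inj:
  assumes "is_chart X E (U, \<phi>)"
  shows "inj_on \<phi> U"
proof -
  have "topspace (subtopology X U) = U"
    using openin_subset[OF is_chart_openin[OF assms]] by auto
  then show ?thesis
    using assms homeomorphic_imp_injective_map unfolding is_chart_def by fastforce
qed

lemma is_chart_continuous: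
  assumes "is_chart X E (U, \<phi>)"
  shows "continuous_map (subtopology X U) (top_of E) \<phi>"
proof -
  have "homeomorphic_map (subtopology X U) (subtopology (top_of E) (\<phi> ` U)) \<phi>"
    using assms by (simp add: is_chart_def)
  from homeomorphic_imp_continuous_map[OF this] show ?thesis
    by (rule continuous_map_into_fulltopology)
qed

lemma is_chart_inverse:
  assumes "is_chart X E (U, \<phi>)"
  obtains g where "continuous_map (subtopology (top_of E) (\<phi> ` U)) X g" "\<forall>x\<in>U. g (\<phi> x) = x"
proof -
  have U: "openin X U" and "homeomorphic_map (subtopology X U) (subtopology (top_of E) (\<phi> ` U)) \<phi>"
    using assms by (simp_all add: is_chart_def)
  then obtain g where g: "homeomorphic_maps (subtopology X U) (subtopology (top_of E) (\<phi> ` U)) \<phi> g"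
    using homeomorphic_map_maps by blast
  show ?thesis
  proof (rule that)
    show "continuous_map (subtopology (top_of E) (\<phi> ` U)) X g"
      using g continuous_map_into_fulltopology unfolding homeomorphic_maps_def by blast
    show "\<forall>x\<in>U. g (\<phi> x) = x"
      using g openin_subset[OF U] unfolding homeomorphic_maps_def by auto
  qed
qed

lemma is_chartI:
  assumes U: "openin X U" and V: "openin (top_of E) (\<phi> ` U)"
    and \<phi>: "continuous_map (subtopology X U) (top_of E) \<phi>"
    and g: "continuous_map (subtopology (top_of E) (\<phi> ` U)) X g" and inv: "\<forall>x\<in>U. g (\<phi> x) = x"
  shows "is_chart X E (U, \<phi>)"
proof -
  have "homeomorphic_maps (subtopology X U) (subtopology (top_of E) (\<phi> ` U)) \<phi> g"
    unfolding homeomorphic_maps_def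
    using \<phi> g inv by (auto simp: continuous_map_in_subtopology)
  then show ?thesis
    unfolding is_chart_def using U V homeomorphic_map_maps by auto
qed

lemma is_chart_open_image:
  assumes c: "is_chart X E (U, \<phi>)" and D: "openin X D" "D \<subseteq> U"
  shows "openin (top_of E) (\<phi> ` D)"
proof -
  obtain g where g: "continuous_map (subtopology (top_of E) (\<phi> ` U)) X g" "\<forall>x\<in>U. g (\<phi> x) = x"
    using c by (rule is_chart_inverse)
  have "{e \<in> topspace (subtopology (top_of E) (\<phi> ` U)). g e \<in> D} = \<phi> ` D"
    using g(2) D(2) openin_subset[OF is_chart_image[OF c]] by auto
  with openin_continuous_map_preimage[OF g(1) D(1)] show ?thesis
    using openin_open_subtopology[OF is_chart_image[OF c]] by auto
qed

lemma is_chart_restrict: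
  assumes c: "is_chart X E (U, \<phi>)" and D: "openin X D" "D \<subseteq> U"
  shows "is_chart X E (D, \<phi>)"
proof -
  obtain g where g: "continuous_map (subtopology (top_of E) (\<phi> ` U)) X g" "\<forall>x\<in>U. g (\<phi> x) = x"
    using c by (rule is_chart_inverse)
  show ?thesis
  proof (rule is_chartI[where g = g, OF D(1) is_chart_open_image[OF c D]])
    show "continuous_map (subtopology X D) (top_of E) \<phi>"
      using continuous_map_from_subtopology_mono[OF is_chart_continuous[OF c] D(2)] .
    show "continuous_map (subtopology (top_of E) (\<phi> ` D)) X g"
      using continuous_map_from_subtopology_mono[OF g(1)] D(2) by blast
  qed (use g D in auto)
qed

text \<open>\<open>f\<close> is \<open>C^r\<close> in the coordinates \<open>\<phi>\<close>. Asking
  for some \<open>h\<close> avoids \<open>inv_into\<close>, which changes with the domain of the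
  chart and so obstructs restricting and composing.\<close>

definition Cr_factor ::
    "smoothness \<Rightarrow> ('k::real_or_complex_field, 'e::ab_group_add) tvs \<Rightarrow> ('k, 'f::ab_group_add) tvs \<Rightarrow>
      'a set \<Rightarrow> ('a \<Rightarrow> 'e) \<Rightarrow> ('a \<Rightarrow> 'f) \<Rightarrow> bool"
  where "Cr_factor r E F A \<phi> f \<longleftrightarrow> (\<exists>h. Cr_on r E F (\<phi> ` A) h \<and> (\<forall>x\<in>A. f x = h (\<phi> x)))"

lemma Cr_factor_inv_into:
  fixes E :: "('k::real_or_complex_field, 'e::ab_group_add) tvs"
  assumes adm: "admissible_smoothness TYPE('k) r" and EF: "lcs E" "lcs F"
    and "inj_on \<phi> U" "A \<subseteq> U"
  shows "Cr_factor r E F A \<phi> f \<longleftrightarrow> Cr_on r E F (\<phi> ` A) (f \<circ> inv_into U \<phi>)"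
proof
  assume "Cr_factor r E F A \<phi> f"
  then obtain h where h: "Cr_on r E F (\<phi> ` A) h" "\<forall>x\<in>A. f x = h (\<phi> x)"
    unfolding Cr_factor_def by blast
  show "Cr_on r E F (\<phi> ` A) (f \<circ> inv_into U \<phi>)"
    by (rule Cr_cong[OF adm EF h(1)]) (use assms h in \<open>auto simp: subset_iff\<close>)
next
  assume "Cr_on r E F (\<phi> ` A) (f \<circ> inv_into U \<phi>)"
  then show "Cr_factor r E F A \<phi> f"
    unfolding Cr_factor_def using assms by (intro exI[of _ "f \<circ> inv_into U \<phi>"]) (auto simp: subset_iff)
qed

lemma compatible_iff:
  fixes E :: "('k::real_or_complex_field, 'e::ab_group_add) tvs"
  assumes adm: "admissible_smoothness TYPE('k) r" and E: "lcs E"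
    and "is_chart X E (U, \<phi>)" "is_chart X E (V, \<psi>)"
  shows "compatible r E (U, \<phi>) (V, \<psi>) \<longleftrightarrow> Cr_factor r E E (U \<inter> V) \<phi> \<psi> \<and> Cr_factor r E E (U \<inter> V) \<psi> \<phi>"
  unfolding compatible_def
  using Cr_factor_inv_into[OF adm E E is_chart_inj[OF assms(3)]]
    Cr_factor_inv_into[OF adm E E is_chart_inj[OF assms(4)]] by simp

lemma Cr_factor_comp:
  fixes E :: "('k::real_or_complex_field, 'e::ab_group_add) tvs" and F :: "('k, 'f::ab_group_add) tvs"
    and G :: "('k, 'g::ab_group_add) tvs"
  assumes adm: "admissible_smoothness TYPE('k) r" and EFG: "lcs E" "lcs F" "lcs G"
    and "Cr_factor r E F A \<phi> f" "Cr_on r F G V h" "f ` A \<subseteq> V"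
  shows "Cr_factor r E G A \<phi> (\<lambda>x. h (f x))"
proof -
  obtain k where k: "Cr_on r E F (\<phi> ` A) k" "\<forall>x\<in>A. f x = k (\<phi> x)"
    using assms(5) unfolding Cr_factor_def by blast
  have "k ` \<phi> ` A \<subseteq> V"
    using assms(7) k(2) by auto
  from Cr_compose[OF adm EFG k(1) assms(6) this] show ?thesis
    unfolding Cr_factor_def using k(2) by (intro exI[of _ "\<lambda>e. h (k e)"]) auto
qed

lemma Cr_factor_trans:
  fixes E :: "('k::real_or_complex_field, 'e::ab_group_add) tvs" and F :: "('k, 'f::ab_group_add) tvs"
    and G :: "('k, 'g::ab_group_add) tvs"
  assumes adm: "admissible_smoothness TYPE('k) r" and EFG: "lcs E" "lcs F" "lcs G"
    and "Cr_factor r E F A \<phi> \<psi>" "Cr_factor r F G A \<psi> \<theta>"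
  shows "Cr_factor r E G A \<phi> \<theta>"
proof -
  obtain h where h: "Cr_on r F G (\<psi> ` A) h" "\<forall>x\<in>A. \<theta> x = h (\<psi> x)"
    using assms(6) unfolding Cr_factor_def by blast
  have "Cr_factor r E G A \<phi> (\<lambda>x. h (\<psi> x))"
    by (rule Cr_factor_comp[OF adm EFG assms(5) h(1)]) simp
  then show ?thesis
    using h(2) by (simp add: Cr_factor_def)
qed

lemma Cr_factor_subset:
  fixes E :: "('k::real_or_complex_field, 'e::ab_group_add) tvs"
  assumes adm: "admissible_smoothness TYPE('k) r" and EF: "lcs E" "lcs F"
    and "Cr_factor r E F A \<phi> f" "openin (top_of E) (\<phi> ` B)" "B \<subseteq> A"
  shows "Cr_factor r E F B \<phi> f"
proof -
  obtain h where h: "Cr_on r E F (\<phi> ` A) h" "\<forall>x\<in>A. f x = h (\<phi> x)"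
    using assms(4) unfolding Cr_factor_def by blast
  have "Cr_on r E F (\<phi> ` B) h"
    using Cr_subset[OF adm EF h(1) assms(5)] assms(6) by blast
  then show ?thesis
    unfolding Cr_factor_def using h(2) assms(6) by blast
qed

lemma Cr_factor_local:
  fixes E :: "('k::real_or_complex_field, 'e::ab_group_add) tvs"
  assumes adm: "admissible_smoothness TYPE('k) r" and EF: "lcs E" "lcs F"
    and inj: "inj_on \<phi> A" and op: "openin (top_of E) (\<phi> ` A)"
    and loc: "\<And>x. x \<in> A \<Longrightarrow> \<exists>B. x \<in> B \<and> B \<subseteq> A \<and> Cr_factor r E F B \<phi> f"
  shows "Cr_factor r E F A \<phi> f"
  unfolding Cr_factor_inv_into[OF adm EF inj subset_refl]
proof (rule Cr_local[OF adm EF op])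
  fix e assume "e \<in> \<phi> ` A"
  then obtain x where "x \<in> A" "e = \<phi> x" by blast
  with loc obtain B where "x \<in> B" "B \<subseteq> A" "Cr_factor r E F B \<phi> f" by blast
  then show "\<exists>V. e \<in> V \<and> Cr_on r E F V (f \<circ> inv_into A \<phi>)"
    using Cr_factor_inv_into[OF adm EF inj] \<open>e = \<phi> x\<close> by blast
qed

text \<open>Being \<open>C^r\<close> is a local property, so the transition map may be factored
  through a different chart \<open>\<alpha>\<close> near each common point. This is why any two
  charts compatible with an atlas are compatible with each other.\<close>

lemma compatible_via:
  fixes E :: "('k::real_or_complex_field, 'e::ab_group_add) tvs"
  assumes adm: "admissible_smoothness TYPE('k) r" and E: "lcs E"
    and c: "is_chart X E (U, \<phi>)" and d: "is_chart X E (V, \<psi>)"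
    and via: "\<And>x. x \<in> U \<inter> V \<Longrightarrow> \<exists>W \<alpha>. x \<in> W \<and> is_chart X E (W, \<alpha>) \<and>
      compatible r E (U, \<phi>) (W, \<alpha>) \<and> compatible r E (V, \<psi>) (W, \<alpha>)"
  shows "compatible r E (U, \<phi>) (V, \<psi>)"
proof -
  have *: "Cr_factor r E E (U \<inter> V) \<phi> \<psi>"
    if c: "is_chart X E (U, \<phi>)" and d: "is_chart X E (V, \<psi>)"
    and via: "\<forall>x\<in>U \<inter> V. \<exists>W \<alpha>. x \<in> W \<and> is_chart X E (W, \<alpha>) \<and>
      compatible r E (U, \<phi>) (W, \<alpha>) \<and> compatible r E (V, \<psi>) (W, \<alpha>)" for U \<phi> V \<psi>
  proof (rule Cr_factor_local[OF adm E E])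
    show "inj_on \<phi> (U \<inter> V)"
      using is_chart_inj[OF c] inj_on_subset by blast
    show "openin (top_of E) (\<phi> ` (U \<inter> V))"
      using is_chart_open_image[OF c] is_chart_openin[OF c] is_chart_openin[OF d] by blast
    fix x assume x: "x \<in> U \<inter> V"
    then obtain W \<alpha> where W: "x \<in> W" "is_chart X E (W, \<alpha>)"
      "compatible r E (U, \<phi>) (W, \<alpha>)" "compatible r E (V, \<psi>) (W, \<alpha>)"
      using via by blast
    have o: "openin X (U \<inter> V \<inter> W)"
      using is_chart_openin[OF c] is_chart_openin[OF d] is_chart_openin[OF W(2)] by blast
    have "Cr_factor r E E (U \<inter> W) \<phi> \<alpha>" "Cr_factor r E E (V \<inter> W) \<alpha> \<psi>"
      using W(3,4) compatible_iff[OF adm E c W(2)] compatible_iff[OF adm E d W(2)] by blast+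
    moreover have "openin (top_of E) (\<phi> ` (U \<inter> V \<inter> W))" "openin (top_of E) (\<alpha> ` (U \<inter> V \<inter> W))"
      using is_chart_open_image[OF c o] is_chart_open_image[OF W(2) o] by blast+
    ultimately have "Cr_factor r E E (U \<inter> V \<inter> W) \<phi> \<alpha>" "Cr_factor r E E (U \<inter> V \<inter> W) \<alpha> \<psi>"
      by (auto elim!: Cr_factor_subset[OF adm E E])
    from Cr_factor_trans[OF adm E E E this] have "Cr_factor r E E (U \<inter> V \<inter> W) \<phi> \<psi>" .
    then show "\<exists>B. x \<in> B \<and> B \<subseteq> U \<inter> V \<and> Cr_factor r E E B \<phi> \<psi>"
      using x W(1) by (intro exI[of _ "U \<inter> V \<inter> W"]) auto
  qed
  have "Cr_factor r E E (U \<inter> V) \<phi> \<psi>"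
    by (rule *[OF c d]) (use via in blast)
  moreover have "Cr_factor r E E (V \<inter> U) \<psi> \<phi>"
    by (rule *[OF d c]) (use via in blast)
  ultimately show ?thesis
    using compatible_iff[OF adm E c d] by (simp add: Int_commute)
qed

section \<open>Maximal atlases and changes of charts\<close>

lemma maximal_atlas_manifold:
  fixes E :: "('k::real_or_complex_field, 'e::ab_group_add) tvs"
  assumes adm: "admissible_smoothness TYPE('k) r" and E: "lcs E" and X: "Hausdorff_space X"
    and chart: "\<forall>c\<in>A. is_chart X E c"
    and compat: "\<forall>c\<in>A. \<forall>d\<in>A. compatible r E c d"
    and cover: "topspace X \<subseteq> (\<Union>c\<in>A. fst c)"
  shows "Cr_manifold r \<lparr>space_of = X, model_of = E, charts_of = maximal_atlas r X E A\<rparr>"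
    and "A \<subseteq> maximal_atlas r X E A"
proof -
  show sub: "A \<subseteq> maximal_atlas r X E A"
    unfolding maximal_atlas_def using chart compat by blast
  have "compatible r E c d" if c: "c \<in> maximal_atlas r X E A" and d: "d \<in> maximal_atlas r X E A" for c d
  proof -
    obtain U \<phi> V \<psi> where cd: "c = (U, \<phi>)" "d = (V, \<psi>)" by fastforce
    have ch: "is_chart X E (U, \<phi>)" "is_chart X E (V, \<psi>)"
      using c d by (simp_all add: maximal_atlas_def cd)
    show ?thesis
      unfolding cd
    proof (rule compatible_via[OF adm E ch])
      fix x assume x: "x \<in> U \<inter> V"
      then have "x \<in> topspace X"
        using openin_subset[OF is_chart_openin[OF ch(1)]] by blast
      then obtain a where a: "a \<in> A" "x \<in> fst a"
        using cover by blast
      obtain W \<alpha> where "a = (W, \<alpha>)" by fastforce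
      then show "\<exists>W \<alpha>. x \<in> W \<and> is_chart X E (W, \<alpha>) \<and>
          compatible r E (U, \<phi>) (W, \<alpha>) \<and> compatible r E (V, \<psi>) (W, \<alpha>)"
        using a c d chart by (intro exI[of _ W] exI[of _ \<alpha>]) (auto simp: maximal_atlas_def cd)
    qed
  qed
  moreover have "(\<Union>c\<in>maximal_atlas r X E A. fst c) = topspace X"
  proof
    show "(\<Union>c\<in>maximal_atlas r X E A. fst c) \<subseteq> topspace X"
    proof
      fix x assume "x \<in> (\<Union>c\<in>maximal_atlas r X E A. fst c)"
      then obtain U \<phi> where "is_chart X E (U, \<phi>)" "x \<in> U"
        unfolding maximal_atlas_def by auto
      then show "x \<in> topspace X"
        using openin_subset[OF is_chart_openin] by blast
    qed
    show "topspace X \<subseteq> (\<Union>c\<in>maximal_atlas r X E A. fst c)"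
      using cover sub by blast
  qed
  moreover have "c \<in> maximal_atlas r X E A"
    if "is_chart X E c" "\<forall>d\<in>maximal_atlas r X E A. compatible r E c d" for c
    using that sub unfolding maximal_atlas_def by blast
  moreover have "is_chart X E c" if "c \<in> maximal_atlas r X E A" for c
    using that unfolding maximal_atlas_def by blast
  ultimately show "Cr_manifold r \<lparr>space_of = X, model_of = E, charts_of = maximal_atlas r X E A\<rparr>"
    unfolding Cr_manifold_def mfd.simps using E[unfolded lcs_def] X by meson
qed

lemma Cr_manifold_lcs: "Cr_manifold r M \<Longrightarrow> lcs (model_of M)"
  and Cr_manifold_hausdorff: "Cr_manifold r M \<Longrightarrow> Hausdorff_space (space_of M)"
  and Cr_manifold_chart: "Cr_manifold r M \<Longrightarrow> c \<in> charts_of M \<Longrightarrow> is_chart (space_of M) (model_of M) c"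
  and Cr_manifold_compatible: "Cr_manifold r M \<Longrightarrow> c \<in> charts_of M \<Longrightarrow> d \<in> charts_of M \<Longrightarrow> compatible r (model_of M) c d"
  by (simp_all add: Cr_manifold_def lcs_def)

lemma Cr_manifold_cover:
  assumes "Cr_manifold r M" "x \<in> topspace (space_of M)"
  obtains U \<phi> where "(U, \<phi>) \<in> charts_of M" "x \<in> U"
proof -
  have "x \<in> (\<Union>c\<in>charts_of M. fst c)"
    using assms by (simp add: Cr_manifold_def)
  then show ?thesis
    using that by fastforce
qed

lemma Cr_manifold_factor:
  fixes M :: "('a, 'k::real_or_complex_field, 'e::ab_group_add) mfd"
  assumes adm: "admissible_smoothness TYPE('k) r" and M: "Cr_manifold r M"
    and c: "(U, \<phi>) \<in> charts_of M" and d: "(V, \<psi>) \<in> charts_of M"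
    and A: "openin (space_of M) A" "A \<subseteq> U" "A \<subseteq> V"
  shows "Cr_factor r (model_of M) (model_of M) A \<phi> \<psi>"
proof -
  note E = Cr_manifold_lcs[OF M] and ch = Cr_manifold_chart[OF M c] Cr_manifold_chart[OF M d]
  have "Cr_factor r (model_of M) (model_of M) (U \<inter> V) \<phi> \<psi>"
    using Cr_manifold_compatible[OF M c d] compatible_iff[OF adm E ch] by simp
  from Cr_factor_subset[OF adm E E this is_chart_open_image[OF ch(1) A(1,2)]] A show ?thesis
    by simp
qed

text \<open>One chart \<open>\<phi>\<close> of the atlas around \<open>A\<close> suffices for the
  comparison: the transition to any other chart passes through \<open>\<phi>\<close>.\<close>

lemma Cr_manifold_maximal:
  fixes M :: "('a, 'k::real_or_complex_field, 'e::ab_group_add) mfd"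
  assumes adm: "admissible_smoothness TYPE('k) r" and M: "Cr_manifold r M"
    and c: "(U, \<phi>) \<in> charts_of M" and d: "is_chart (space_of M) (model_of M) (A, \<psi>)" and A: "A \<subseteq> U"
    and f: "Cr_factor r (model_of M) (model_of M) A \<phi> \<psi>" "Cr_factor r (model_of M) (model_of M) A \<psi> \<phi>"
  shows "(A, \<psi>) \<in> charts_of M"
proof -
  note E = Cr_manifold_lcs[OF M] and ch = Cr_manifold_chart[OF M]
  have "compatible r (model_of M) (A, \<psi>) (V, \<alpha>)" if V: "(V, \<alpha>) \<in> charts_of M" for V \<alpha>
  proof -
    have o: "openin (space_of M) (A \<inter> V)"
      using is_chart_openin[OF d] is_chart_openin[OF ch[OF V]] by blast
    have "Cr_factor r (model_of M) (model_of M) (A \<inter> V) \<phi> \<alpha>"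
      "Cr_factor r (model_of M) (model_of M) (A \<inter> V) \<alpha> \<phi>"
      using Cr_manifold_factor[OF adm M c V o] Cr_manifold_factor[OF adm M V c o] A by blast+
    moreover have "Cr_factor r (model_of M) (model_of M) (A \<inter> V) \<phi> \<psi>"
      "Cr_factor r (model_of M) (model_of M) (A \<inter> V) \<psi> \<phi>"
      using Cr_factor_subset[OF adm E E f(1) is_chart_open_image[OF ch[OF c] o]]
        Cr_factor_subset[OF adm E E f(2) is_chart_open_image[OF d o]] A by blast+
    ultimately show ?thesis
      using Cr_factor_trans[OF adm E E E] compatible_iff[OF adm E d ch[OF V]] by blast
  qed
  then show ?thesis
    using M d unfolding Cr_manifold_def by (metis surj_pair)
qed

lemma chart_restrict:
  fixes M :: "('a, 'k::real_or_complex_field, 'e::ab_group_add) mfd"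
  assumes adm: "admissible_smoothness TYPE('k) r" and M: "Cr_manifold r M"
    and c: "(U, \<phi>) \<in> charts_of M" and A: "openin (space_of M) A" "A \<subseteq> U"
  shows "(A, \<phi>) \<in> charts_of M"
proof (rule Cr_manifold_maximal[OF adm M c _ A(2)])
  show "is_chart (space_of M) (model_of M) (A, \<phi>)"
    using is_chart_restrict[OF Cr_manifold_chart[OF M c] A] .
qed (use Cr_manifold_factor[OF adm M c c A A(2)] in blast)+

text \<open>The maps \<open>h\<close> and \<open>k\<close> are inverse to each other on an open set
  \<open>\<Omega>\<close> that may exceed the image of the chart, since a shear or a linear
  automorphism need not preserve that image.\<close>

lemma chart_transform:
  fixes M :: "('a, 'k::real_or_complex_field, 'e::ab_group_add) mfd"
  assumes adm: "admissible_smoothness TYPE('k) r" and M: "Cr_manifold r M"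
    and c: "(U, \<phi>) \<in> charts_of M" and U\<Omega>: "\<phi> ` U \<subseteq> \<Omega>"
    and h: "Cr_on r (model_of M) (model_of M) \<Omega> h" and k: "Cr_on r (model_of M) (model_of M) \<Omega> k"
    and hk: "\<forall>e\<in>\<Omega>. h e \<in> \<Omega> \<and> k e \<in> \<Omega> \<and> k (h e) = e \<and> h (k e) = e"
  shows "(U, \<lambda>x. h (\<phi> x)) \<in> charts_of M"
proof -
  let ?E = "model_of M" and ?X = "space_of M"
  note E = Cr_manifold_lcs[OF M] and ch = Cr_manifold_chart[OF M c]
  have \<Omega>: "openin (top_of ?E) \<Omega>"
    using Cr_on_openin[OF h] .
  \<comment> \<open>Written as a preimage under the inverse map \<open>k\<close>, the new image is
    seen to be open.\<close>
  have im: "(\<lambda>x. h (\<phi> x)) ` U = {e \<in> topspace (subtopology (top_of ?E) \<Omega>). k e \<in> \<phi> ` U}"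
    using hk U\<Omega> openin_subset[OF \<Omega>] by (auto simp: image_iff subset_iff) metis
  have "openin (subtopology (top_of ?E) \<Omega>) ((\<lambda>x. h (\<phi> x)) ` U)"
    unfolding im by (rule openin_continuous_map_preimage[OF Cr_continuous[OF adm E E k] is_chart_image[OF ch]])
  then have o: "openin (top_of ?E) ((\<lambda>x. h (\<phi> x)) ` U)"
    using openin_open_subtopology[OF \<Omega>] by blast
  obtain g where g: "continuous_map (subtopology (top_of ?E) (\<phi> ` U)) ?X g" "\<forall>x\<in>U. g (\<phi> x) = x"
    using ch by (rule is_chart_inverse)
  show ?thesis
  proof (rule Cr_manifold_maximal[OF adm M c _ subset_refl])
    show "is_chart ?X ?E (U, \<lambda>x. h (\<phi> x))"
    proof (rule is_chartI[where g = "\<lambda>e. g (k e)", OF is_chart_openin[OF ch] o])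
      have "continuous_map (subtopology ?X U) (subtopology (top_of ?E) \<Omega>) \<phi>"
        by (rule continuous_map_into_subtopology[OF is_chart_continuous[OF ch]]) (use U\<Omega> in auto)
      from continuous_map_compose[OF this Cr_continuous[OF adm E E h]]
      show "continuous_map (subtopology ?X U) (top_of ?E) (\<lambda>x. h (\<phi> x))"
        by (simp add: o_def)
      have "continuous_map (subtopology (top_of ?E) ((\<lambda>x. h (\<phi> x)) ` U)) (top_of ?E) k"
        by (rule continuous_map_from_subtopology_mono[OF Cr_continuous[OF adm E E k]]) (use im in auto)
      then have "continuous_map (subtopology (top_of ?E) ((\<lambda>x. h (\<phi> x)) ` U)) (subtopology (top_of ?E) (\<phi> ` U)) k"
        by (rule continuous_map_into_subtopology) (use im in auto)
      from continuous_map_compose[OF this g(1)]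
      show "continuous_map (subtopology (top_of ?E) ((\<lambda>x. h (\<phi> x)) ` U)) ?X (\<lambda>e. g (k e))"
        by (simp add: o_def)
    qed (use g hk U\<Omega> in \<open>auto simp: subset_iff\<close>)
    have "Cr_on r ?E ?E (\<phi> ` U) h"
      using Cr_subset[OF adm E E h is_chart_image[OF ch] U\<Omega>] .
    then show "Cr_factor r ?E ?E U \<phi> (\<lambda>x. h (\<phi> x))"
      unfolding Cr_factor_def by blast
    have "(\<lambda>x. h (\<phi> x)) ` U \<subseteq> \<Omega>"
      using hk U\<Omega> by (auto simp: subset_iff)
    from Cr_subset[OF adm E E k o this] show "Cr_factor r ?E ?E U (\<lambda>x. h (\<phi> x)) \<phi>"
      unfolding Cr_factor_def using hk U\<Omega> by (intro exI[of _ k]) (auto simp: subset_iff)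
  qed
qed

subsection \<open>Products and split submanifolds\<close>

lemma is_chart_prod:
  assumes c: "is_chart X E (U, \<phi>)" and d: "is_chart Y F (V, \<psi>)"
  shows "is_chart (prod_topology X Y) (prod_tvs E F) (U \<times> V, map_prod \<phi> \<psi>)"
proof -
  obtain g where g: "continuous_map (subtopology (top_of E) (\<phi> ` U)) X g" "\<forall>x\<in>U. g (\<phi> x) = x"
    using c by (rule is_chart_inverse)
  obtain h where h: "continuous_map (subtopology (top_of F) (\<psi> ` V)) Y h" "\<forall>x\<in>V. h (\<psi> x) = x"
    using d by (rule is_chart_inverse)
  have im: "map_prod \<phi> \<psi> ` (U \<times> V) = \<phi> ` U \<times> \<psi> ` V"
    by (auto simp: map_prod_def)
  have cont: "continuous_map (prod_topology X' Y') (prod_topology X'' Y'') (map_prod a b)"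
    if "continuous_map X' X'' a" "continuous_map Y' Y'' b"
    for X' :: "'x topology" and Y' :: "'y topology" and X'' :: "'u topology" and Y'' :: "'v topology" and a b
    unfolding map_prod_def case_prod_unfold
    using continuous_map_compose[OF continuous_map_fst that(1)] continuous_map_compose[OF continuous_map_snd that(2)]
    by (intro continuous_map_pairedI) (simp_all add: o_def)
  show ?thesis
  proof (rule is_chartI[where g = "map_prod g h"])
    show "openin (prod_topology X Y) (U \<times> V)"
      using is_chart_openin[OF c] is_chart_openin[OF d] by (simp add: openin_prod_Times_iff)
    show "openin (top_of (prod_tvs E F)) (map_prod \<phi> \<psi> ` (U \<times> V))"
      unfolding im using is_chart_image[OF c] is_chart_image[OF d] by (simp add: openin_prod_Times_iff)
    show "continuous_map (subtopology (prod_topology X Y) (U \<times> V)) (top_of (prod_tvs E F)) (map_prod \<phi> \<psi>)"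
      using cont[OF is_chart_continuous[OF c] is_chart_continuous[OF d]] by (simp add: subtopology_Times)
    show "continuous_map (subtopology (top_of (prod_tvs E F)) (map_prod \<phi> \<psi> ` (U \<times> V))) (prod_topology X Y) (map_prod g h)"
      unfolding im using cont[OF g(1) h(1)] by (simp add: subtopology_Times)
  qed (use g h in auto)
qed

lemma Cr_factor_prod:
  fixes E :: "('k::real_or_complex_field, 'e::ab_group_add) tvs" and F :: "('k, 'f::ab_group_add) tvs"
  assumes adm: "admissible_smoothness TYPE('k) r" and EF: "lcs E" "lcs F"
    and f: "Cr_factor r E E A \<phi> \<phi>'" and g: "Cr_factor r F F B \<psi> \<psi>'"
  shows "Cr_factor r (prod_tvs E F) (prod_tvs E F) (A \<times> B) (map_prod \<phi> \<psi>) (map_prod \<phi>' \<psi>')"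
proof -
  obtain h where h: "Cr_on r E E (\<phi> ` A) h" "\<forall>x\<in>A. \<phi>' x = h (\<phi> x)"
    using f unfolding Cr_factor_def by blast
  obtain k where k: "Cr_on r F F (\<psi> ` B) k" "\<forall>x\<in>B. \<psi>' x = k (\<psi> x)"
    using g unfolding Cr_factor_def by blast
  let ?P = "prod_tvs E F"
  have P: "lcs ?P"
    using lcs_prod_tvs[OF EF] .
  have im: "map_prod \<phi> \<psi> ` (A \<times> B) = \<phi> ` A \<times> \<psi> ` B"
    by (auto simp: map_prod_def)
  have o: "openin (top_of ?P) (\<phi> ` A \<times> \<psi> ` B)"
    using Cr_on_openin[OF h(1)] Cr_on_openin[OF k(1)] by (simp add: openin_prod_Times_iff)
  have "Cr_on r ?P E (\<phi> ` A \<times> \<psi> ` B) (\<lambda>e. h (fst e))"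
    by (rule Cr_compose[OF adm P EF(1) EF(1) Cr_linear[OF adm P EF(1) continuous_linear_fst o] h(1)]) auto
  moreover have "Cr_on r ?P F (\<phi> ` A \<times> \<psi> ` B) (\<lambda>e. k (snd e))"
    by (rule Cr_compose[OF adm P EF(2) EF(2) Cr_linear[OF adm P EF(2) continuous_linear_snd o] k(1)]) auto
  ultimately have "Cr_on r ?P ?P (\<phi> ` A \<times> \<psi> ` B) (\<lambda>e. (h (fst e), k (snd e)))"
    by (rule Cr_pair[OF adm P EF])
  then show ?thesis
    unfolding Cr_factor_def im using h(2) k(2) by (intro exI[of _ "\<lambda>e. (h (fst e), k (snd e))"]) auto
qed

lemma prod_mfd_manifold:
  fixes M :: "('a, 'k::real_or_complex_field, 'e::ab_group_add) mfd"
    and N :: "('b, 'k, 'f::ab_group_add) mfd"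
  assumes adm: "admissible_smoothness TYPE('k) r" and M: "Cr_manifold r M" and N: "Cr_manifold r N"
  shows "Cr_manifold r (prod_mfd r M N)"
    and "(U, \<phi>) \<in> charts_of M \<Longrightarrow> (V, \<psi>) \<in> charts_of N \<Longrightarrow>
      (U \<times> V, map_prod \<phi> \<psi>) \<in> charts_of (prod_mfd r M N)"
proof -
  let ?A = "{(U \<times> V, map_prod \<phi> \<psi>) | U \<phi> V \<psi>. (U, \<phi>) \<in> charts_of M \<and> (V, \<psi>) \<in> charts_of N}"
  let ?X = "prod_topology (space_of M) (space_of N)" and ?E = "prod_tvs (model_of M) (model_of N)"
  note E = Cr_manifold_lcs[OF M] Cr_manifold_lcs[OF N]
  have P: "lcs ?E"
    using lcs_prod_tvs[OF E] .
  have H: "Hausdorff_space ?X"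
    using Cr_manifold_hausdorff[OF M] Cr_manifold_hausdorff[OF N] by (simp add: Hausdorff_space_prod_topology)
  have ch: "is_chart ?X ?E (U \<times> V, map_prod \<phi> \<psi>)"
    if "(U, \<phi>) \<in> charts_of M" "(V, \<psi>) \<in> charts_of N" for U \<phi> V \<psi>
    using is_chart_prod[OF Cr_manifold_chart[OF M that(1)] Cr_manifold_chart[OF N that(2)]] .
  have fac: "Cr_factor r ?E ?E ((U \<times> V) \<inter> (U' \<times> V')) (map_prod \<phi> \<psi>) (map_prod \<phi>' \<psi>')"
    if c: "(U, \<phi>) \<in> charts_of M" "(V, \<psi>) \<in> charts_of N" "(U', \<phi>') \<in> charts_of M" "(V', \<psi>') \<in> charts_of N"
    for U V U' V' \<phi> \<psi> \<phi>' \<psi>'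
  proof -
    have o: "openin (space_of M) (U \<inter> U')" "openin (space_of N) (V \<inter> V')"
      using is_chart_openin[OF Cr_manifold_chart[OF M c(1)]] is_chart_openin[OF Cr_manifold_chart[OF M c(3)]]
        is_chart_openin[OF Cr_manifold_chart[OF N c(2)]] is_chart_openin[OF Cr_manifold_chart[OF N c(4)]]
      by (simp_all add: openin_Int)
    have "Cr_factor r (model_of M) (model_of M) (U \<inter> U') \<phi> \<phi>'"
      by (rule Cr_manifold_factor[OF adm M c(1,3) o(1)]) auto
    moreover have "Cr_factor r (model_of N) (model_of N) (V \<inter> V') \<psi> \<psi>'"
      by (rule Cr_manifold_factor[OF adm N c(2,4) o(2)]) auto
    ultimately have "Cr_factor r (prod_tvs (model_of M) (model_of N)) (prod_tvs (model_of M) (model_of N))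
        ((U \<inter> U') \<times> (V \<inter> V')) (map_prod \<phi> \<psi>) (map_prod \<phi>' \<psi>')"
      by (rule Cr_factor_prod[OF adm E])
    then show ?thesis
      by (simp add: Times_Int_Times)
  qed
  have compat: "\<forall>c\<in>?A. \<forall>d\<in>?A. compatible r ?E c d"
  proof (intro ballI)
    fix c d assume cd: "c \<in> ?A" "d \<in> ?A"
    obtain U \<phi> V \<psi> where c: "c = (U \<times> V, map_prod \<phi> \<psi>)" "(U, \<phi>) \<in> charts_of M" "(V, \<psi>) \<in> charts_of N"
      using cd(1) by blast
    obtain U' \<phi>' V' \<psi>' where d: "d = (U' \<times> V', map_prod \<phi>' \<psi>')" "(U', \<phi>') \<in> charts_of M" "(V', \<psi>') \<in> charts_of N"
      using cd(2) by blast
    show "compatible r ?E c d"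
      unfolding c(1) d(1) compatible_iff[OF adm P ch[OF c(2,3)] ch[OF d(2,3)]]
      using fac[OF c(2,3) d(2,3)] fac[OF d(2,3) c(2,3)] by (simp add: Int_commute)
  qed
  have cover: "topspace ?X \<subseteq> (\<Union>c\<in>?A. fst c)"
  proof
    fix z assume "z \<in> topspace ?X"
    then have z: "fst z \<in> topspace (space_of M)" "snd z \<in> topspace (space_of N)"
      by auto
    obtain U \<phi> where U: "(U, \<phi>) \<in> charts_of M" "fst z \<in> U"
      using M z(1) by (rule Cr_manifold_cover)
    obtain V \<psi> where V: "(V, \<psi>) \<in> charts_of N" "snd z \<in> V"
      using N z(2) by (rule Cr_manifold_cover)
    show "z \<in> (\<Union>c\<in>?A. fst c)"
    proof (rule UN_I)
      show "(U \<times> V, map_prod \<phi> \<psi>) \<in> ?A"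
        using U(1) V(1) by blast
      show "z \<in> fst (U \<times> V, map_prod \<phi> \<psi>)"
        using U(2) V(2) by (simp add: mem_Times_iff)
    qed
  qed
  have charts: "\<forall>c\<in>?A. is_chart ?X ?E c"
    using ch by auto
  note mfd = maximal_atlas_manifold[OF adm P H charts compat cover]
  show "Cr_manifold r (prod_mfd r M N)"
    using mfd(1) by (simp add: prod_mfd_def Let_def)
  show "(U \<times> V, map_prod \<phi> \<psi>) \<in> charts_of (prod_mfd r M N)"
    if "(U, \<phi>) \<in> charts_of M" "(V, \<psi>) \<in> charts_of N"
    unfolding prod_mfd_def Let_def mfd.simps by (rule subsetD[OF mfd(2)], intro CollectI exI[of _ U] exI[of _ \<phi>] exI[of _ V] exI[of _ \<psi>] conjI refl that)
qed

lemma prod_mfd_sel [simp]: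
  "space_of (prod_mfd r M N) = prod_topology (space_of M) (space_of N)"
  "model_of (prod_mfd r M N) = prod_tvs (model_of M) (model_of N)"
  by (simp_all add: prod_mfd_def Let_def)

text \<open>The projection is the first component of the inverse of addition. It is used to regard
  maps with values in \<open>F\<close> as \<open>C^r\<close> maps into the subspace.\<close>

lemma complemented_projection:
  assumes "lcs E" and F: "closed_vector_subspace E F" and c: "complemented E F"
  obtains P where "continuous_linear E (sub_tvs E F) P" "\<forall>x\<in>F. P x = x"
proof -
  interpret lcs E by fact
  have Fs: "subspace F" and Fc: "F \<subseteq> carrier_of E"
    using F closedin_subset unfolding closed_vector_subspace_def by blast+
  obtain C where C: "subspace C" "C \<subseteq> carrier_of E"
    and hom: "homeomorphic_map (prod_topology (subtopology (top_of E) F) (subtopology (top_of E) C))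
        (top_of E) (\<lambda>(x, y). x + y)"
    using c unfolding complemented_def by blast
  let ?FC = "prod_topology (subtopology (top_of E) F) (subtopology (top_of E) C)"
  obtain i where i: "homeomorphic_maps ?FC (top_of E) (\<lambda>(x, y). x + y) i"
    using hom homeomorphic_map_maps by blast
  have cont: "continuous_map (top_of E) ?FC i"
    and inv: "\<And>x y. x \<in> F \<Longrightarrow> y \<in> C \<Longrightarrow> i (x + y) = (x, y)" "\<And>e. e \<in> carrier_of E \<Longrightarrow> fst (i e) + snd (i e) = e"
    using i Fc C(2) by (auto simp: homeomorphic_maps_def case_prod_unfold subset_iff)
  have iFC: "fst (i e) \<in> F" "snd (i e) \<in> C" if "e \<in> carrier_of E" for e
    using continuous_map_in[OF cont that] by auto
  have i_add: "i (x + y) = i x + i y" if "x \<in> carrier_of E" "y \<in> carrier_of E" for x y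
  proof -
    have "i ((fst (i x) + fst (i y)) + (snd (i x) + snd (i y))) = (fst (i x) + fst (i y), snd (i x) + snd (i y))"
      using iFC that by (intro inv(1) subspace_add Fs C(1)) auto
    moreover have "(fst (i x) + fst (i y)) + (snd (i x) + snd (i y)) = x + y"
      using inv(2)[OF that(1)] inv(2)[OF that(2)] by (metis add.assoc add.left_commute)
    ultimately show ?thesis
      by (simp add: plus_prod_def)
  qed
  have i_scale: "fst (i (scale_of E c x)) = scale_of E c (fst (i x))" if "x \<in> carrier_of E" for c x
  proof -
    have "i (scale_of E c (fst (i x)) + scale_of E c (snd (i x))) = (scale_of E c (fst (i x)), scale_of E c (snd (i x)))"
      using iFC that by (intro inv(1) subspace_scale Fs C(1)) auto
    moreover have "scale_of E c (fst (i x)) + scale_of E c (snd (i x)) = scale_of E c x"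
      using inv(2)[OF that] by (metis scale_right_distrib)
    ultimately show ?thesis
      by simp
  qed
  show ?thesis
  proof (rule that)
    show "continuous_linear E (sub_tvs E F) (\<lambda>e. fst (i e))"
      using i_add i_scale continuous_map_fst_comp[OF cont] by (simp add: continuous_linear_def)
    show "\<forall>x\<in>F. fst (i x) = x"
      using inv(1)[of _ 0] subspace_0[OF C(1)] by auto
  qed
qed

lemma is_chart_sub:
  assumes c: "is_chart X E (U, \<phi>)" and flat: "\<phi> ` (U \<inter> S) = \<phi> ` U \<inter> F"
  shows "is_chart (subtopology X S) (sub_tvs E F) (U \<inter> S, \<phi>)"
proof -
  obtain g where g: "continuous_map (subtopology (top_of E) (\<phi> ` U)) X g" "\<forall>x\<in>U. g (\<phi> x) = x"
    using c by (rule is_chart_inverse)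
  show ?thesis
  proof (rule is_chartI[where g = g])
    show "openin (subtopology X S) (U \<inter> S)"
      using is_chart_openin[OF c] by (rule openin_subtopology_Int)
    show "openin (top_of (sub_tvs E F)) (\<phi> ` (U \<inter> S))"
      using is_chart_image[OF c] by (simp add: flat openin_subtopology_Int)
    have "continuous_map (subtopology (subtopology X S) (U \<inter> S)) (top_of E) \<phi>"
      unfolding subtopology_subtopology
      by (rule continuous_map_from_subtopology_mono[OF is_chart_continuous[OF c]]) auto
    moreover have "\<phi> x \<in> F" if "x \<in> U" "x \<in> S" for x
      using flat that by blast
    ultimately show "continuous_map (subtopology (subtopology X S) (U \<inter> S)) (top_of (sub_tvs E F)) \<phi>"
      unfolding sub_tvs_sel by (intro continuous_map_into_subtopology) auto
    have "continuous_map (subtopology (subtopology (top_of E) F) (\<phi> ` (U \<inter> S))) X g"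
      unfolding subtopology_subtopology
      by (rule continuous_map_from_subtopology_mono[OF g(1)]) auto
    then show "continuous_map (subtopology (top_of (sub_tvs E F)) (\<phi> ` (U \<inter> S))) (subtopology X S) g"
      unfolding sub_tvs_sel by (rule continuous_map_into_subtopology) (use g(2) in auto)
  qed (use g in auto)
qed

lemma sub_mfd_sel [simp]:
  "space_of (sub_mfd r M S F) = subtopology (space_of M) S"
  "model_of (sub_mfd r M S F) = sub_tvs (model_of M) F"
  by (simp_all add: sub_mfd_def Let_def)

text \<open>The transition map between two flat charts is \<open>C^r\<close> into the ambient space
  and takes values in \<open>F\<close> on \<open>S\<close>. Composing it with the continuous
  projection onto \<open>F\<close> does not alter it there and makes it \<open>C^r\<close> into
  \<open>F\<close> as a space of its own.\<close>

lemma sub_mfd_manifold: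
  fixes M :: "('a, 'k::real_or_complex_field, 'e::ab_group_add) mfd"
  assumes adm: "admissible_smoothness TYPE('k) r" and M: "Cr_manifold r M" and S: "is_split_submanifold M S F"
  shows "Cr_manifold r (sub_mfd r M S F)"
    and "(U, \<phi>) \<in> charts_of M \<Longrightarrow> \<phi> ` (U \<inter> S) = \<phi> ` U \<inter> F \<Longrightarrow> (U \<inter> S, \<phi>) \<in> charts_of (sub_mfd r M S F)"
proof -
  let ?E = "model_of M" and ?X = "subtopology (space_of M) S"
  let ?F = "sub_tvs ?E F"
  let ?A = "{(U \<inter> S, \<phi>) | U \<phi>. (U, \<phi>) \<in> charts_of M \<and> \<phi> ` (U \<inter> S) = \<phi> ` U \<inter> F}"
  note E = Cr_manifold_lcs[OF M]
  have F: "closed_vector_subspace ?E F" "complemented ?E F"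
    using S by (simp_all add: is_split_submanifold_def is_submanifold_def)
  have Fl: "lcs ?F"
    using lcs_sub_tvs[OF E] F(1) unfolding closed_vector_subspace_def by blast
  obtain P where P: "continuous_linear ?E ?F P" "\<forall>x\<in>F. P x = x"
    using E F by (rule complemented_projection)
  have H: "Hausdorff_space ?X"
    using Cr_manifold_hausdorff[OF M] by (simp add: Hausdorff_space_subtopology)
  have ch: "is_chart ?X ?F (U \<inter> S, \<phi>)"
    if "(U, \<phi>) \<in> charts_of M" "\<phi> ` (U \<inter> S) = \<phi> ` U \<inter> F" for U \<phi>
    using is_chart_sub[OF Cr_manifold_chart[OF M that(1)] that(2)] .
  have fac: "Cr_factor r ?F ?F ((U \<inter> S) \<inter> (V \<inter> S)) \<phi> \<psi>"
    if c: "(U, \<phi>) \<in> charts_of M" "\<phi> ` (U \<inter> S) = \<phi> ` U \<inter> F"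
    and d: "(V, \<psi>) \<in> charts_of M" "\<psi> ` (V \<inter> S) = \<psi> ` V \<inter> F" for U V \<phi> \<psi>
  proof -
    let ?D = "(U \<inter> S) \<inter> (V \<inter> S)"
    have "openin (space_of M) (U \<inter> V)"
      using is_chart_openin[OF Cr_manifold_chart[OF M c(1)]] is_chart_openin[OF Cr_manifold_chart[OF M d(1)]]
      by (rule openin_Int)
    then have "Cr_factor r ?E ?E (U \<inter> V) \<phi> \<psi>"
      by (rule Cr_manifold_factor[OF adm M c(1) d(1)]) auto
    then obtain h where h: "Cr_on r ?E ?E (\<phi> ` (U \<inter> V)) h" "\<forall>x\<in>U \<inter> V. \<psi> x = h (\<phi> x)"
      unfolding Cr_factor_def by blast
    have o: "openin (top_of ?F) (\<phi> ` ?D)"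
    proof (rule is_chart_open_image[OF ch[OF c]])
      show "openin ?X ?D"
        using is_chart_openin[OF ch[OF c]] is_chart_openin[OF ch[OF d]] by (rule openin_Int)
    qed blast
    have 1: "Cr_on r ?F ?E (\<phi> ` ?D) (\<lambda>x. x)"
      by (rule Cr_linear[OF adm Fl E _ o]) (rule continuous_linear_from_sub[OF continuous_linear_id])
    have 2: "Cr_on r ?F ?E (\<phi> ` ?D) h"
      using Cr_compose[OF adm Fl E E 1 h(1)] by auto
    have 3: "Cr_on r ?E ?F (carrier_of ?E) P"
      by (rule Cr_linear[OF adm E Fl P(1)]) simp
    have "Cr_on r ?F ?F (\<phi> ` ?D) (\<lambda>x. P (h x))"
      by (rule Cr_compose[OF adm Fl E Fl 2 3 Cr_on_in[OF 2]])
    moreover have "\<psi> x = P (h (\<phi> x))" if "x \<in> ?D" for x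
      using that d(2) P(2) h(2) by (metis IntD1 IntD2 IntI image_eqI)
    ultimately show ?thesis
      unfolding Cr_factor_def by blast
  qed
  have compat: "\<forall>c\<in>?A. \<forall>d\<in>?A. compatible r ?F c d"
  proof (intro ballI)
    fix c d assume cd: "c \<in> ?A" "d \<in> ?A"
    obtain U \<phi> where c: "c = (U \<inter> S, \<phi>)" "(U, \<phi>) \<in> charts_of M" "\<phi> ` (U \<inter> S) = \<phi> ` U \<inter> F"
      using cd(1) by blast
    obtain V \<psi> where d: "d = (V \<inter> S, \<psi>)" "(V, \<psi>) \<in> charts_of M" "\<psi> ` (V \<inter> S) = \<psi> ` V \<inter> F"
      using cd(2) by blast
    show "compatible r ?F c d"
      unfolding c(1) d(1) compatible_iff[OF adm Fl ch[OF c(2,3)] ch[OF d(2,3)]]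
      using fac[OF c(2,3) d(2,3)] fac[OF d(2,3) c(2,3)] by (simp add: Int_commute)
  qed
  have cover: "topspace ?X \<subseteq> (\<Union>c\<in>?A. fst c)"
  proof
    fix x assume "x \<in> topspace ?X"
    then have "x \<in> S" by simp
    then obtain U \<phi> where "(U, \<phi>) \<in> charts_of M" "x \<in> U" "\<phi> ` (U \<inter> S) = \<phi> ` U \<inter> F"
      using S unfolding is_split_submanifold_def is_submanifold_def by blast
    then have "(U \<inter> S, \<phi>) \<in> ?A" "x \<in> fst (U \<inter> S, \<phi>)"
      using \<open>x \<in> S\<close> by auto
    then show "x \<in> (\<Union>c\<in>?A. fst c)"
      by (rule UN_I)
  qed
  have charts: "\<forall>c\<in>?A. is_chart ?X ?F c"
    using ch by auto
  note mfd = maximal_atlas_manifold[OF adm Fl H charts compat cover]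
  show "Cr_manifold r (sub_mfd r M S F)"
    using mfd(1) by (simp add: sub_mfd_def Let_def)
  show "(U \<inter> S, \<phi>) \<in> charts_of (sub_mfd r M S F)"
    if "(U, \<phi>) \<in> charts_of M" "\<phi> ` (U \<inter> S) = \<phi> ` U \<inter> F"
    unfolding sub_mfd_def Let_def mfd.simps by (rule subsetD[OF mfd(2)], intro CollectI exI[of _ U] exI[of _ \<phi>] conjI refl that)
qed

subsection \<open>Flat charts\<close>

definition flat_chart :: "('a, 'k, 'e) mfd \<Rightarrow> 'a set \<Rightarrow> 'e set \<Rightarrow> 'a set \<Rightarrow> ('a \<Rightarrow> 'e) \<Rightarrow> bool"
  where "flat_chart M S F U \<phi> \<longleftrightarrow> (U, \<phi>) \<in> charts_of M \<and> (\<forall>u\<in>U. u \<in> S \<longleftrightarrow> \<phi> u \<in> F)"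

lemma flat_chart_iff:
  assumes M: "Cr_manifold r M"
  shows "flat_chart M S F U \<phi> \<longleftrightarrow> (U, \<phi>) \<in> charts_of M \<and> \<phi> ` (U \<inter> S) = \<phi> ` U \<inter> F"
proof (cases "(U, \<phi>) \<in> charts_of M")
  case True
  have "inj_on \<phi> U"
    using is_chart_inj[OF Cr_manifold_chart[OF M True]] .
  then have "\<phi> u \<in> \<phi> ` (U \<inter> S) \<longleftrightarrow> u \<in> S" if "u \<in> U" for u
    using that by (simp add: inj_on_image_mem_iff)
  then have "(\<forall>u\<in>U. u \<in> S \<longleftrightarrow> \<phi> u \<in> F) \<longleftrightarrow> \<phi> ` (U \<inter> S) = \<phi> ` U \<inter> F"
    by blast
  with True show ?thesis
    by (simp add: flat_chart_def)
qed (simp add: flat_chart_def)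

text \<open>The change from \<open>S\<close> to \<open>S'\<close> is meant for a component of
  \<open>S\<close>, which agrees with \<open>S\<close> on an open set.\<close>

lemma flat_chart_restrict:
  fixes M :: "('a, 'k::real_or_complex_field, 'e::ab_group_add) mfd"
  assumes "admissible_smoothness TYPE('k) r" "Cr_manifold r M" "flat_chart M S F U \<phi>"
    and "openin (space_of M) D" "D \<subseteq> U" "D \<inter> S = D \<inter> S'"
  shows "flat_chart M S' F D \<phi>"
  using chart_restrict[OF assms(1,2) _ assms(4,5)] assms(3,5,6) unfolding flat_chart_def by blast

text \<open>For small real \<open>t\<close> the points \<open>p + t v\<close> stay in
  \<open>W\<close> and in \<open>F\<close>, so the difference quotients of \<open>h\<close> lie in
  the subspace \<open>F'\<close>; since \<open>F'\<close> is closed, so does their limit.\<close>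

lemma real_dd_maps_flat:
  assumes E: "lcs E" and F: "closed_vector_subspace E F" and F': "closed_vector_subspace E F'"
    and W: "openin (top_of E) W" and hF: "h ` (W \<inter> F) \<subseteq> F'" and p: "p \<in> W" "p \<in> F" and v: "v \<in> F"
    and dd: "real_dd E h p v l"
  shows "l \<in> F'"
proof -
  interpret lcs E by fact
  have Fs: "subspace F" "subspace F'" and Fc: "closedin (top_of E) F" "closedin (top_of E) F'"
    using F F' by (simp_all add: closed_vector_subspace_def)
  have vE: "v \<in> carrier_of E" and pE: "p \<in> carrier_of E"
    using v p closedin_subset[OF Fc(1)] by blast+
  have "continuous_map euclideanreal (top_of E) (\<lambda>t. p + scale_of E (of_real t) v)"
    by (intro continuous_add continuous_scale) (use vE pE in \<open>auto intro: continuous_intros\<close>)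
  from openin_continuous_map_preimage[OF this W]
  have "open {t::real. p + scale_of E (of_real t) v \<in> W}"
    by simp
  then have "\<forall>\<^sub>F t in at (0::real). p + scale_of E (of_real t) v \<in> W"
    using p(1) by (intro eventually_at_in_open'[of "{t. p + scale_of E (of_real t) v \<in> W}" 0, simplified]) auto
  then have "\<forall>\<^sub>F t in at (0::real). scale_of E (of_real (inverse t)) (h (p + scale_of E (of_real t) v) - h p) \<in> F'"
  proof eventually_elim
    case (elim t)
    have "p + scale_of E (of_real t) v \<in> F"
      by (intro subspace_add subspace_scale Fs p v)
    then have "h (p + scale_of E (of_real t) v) \<in> F'" "h p \<in> F'"
      using hF elim p by blast+
    then show ?case
      by (intro subspace_scale subspace_diff Fs)
  qed
  then show ?thesis
    by (rule limitin_closedin[OF dd[unfolded real_dd_def] Fc(2)]) simp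
qed

text \<open>Both charts describe \<open>S\<close>, so the transition map takes the part of
  \<open>F\<close> in its domain into \<open>F'\<close>, and its inverse does the converse. The same
  inclusions pass to the tangent maps \<open>A\<close> and \<open>B\<close> at the common point, and
  as these are inverse to each other, \<open>A\<close> carries \<open>F\<close> onto
  \<open>F'\<close>.\<close>

lemma flat_chart_transfer:
  fixes M :: "('a, 'k::real_or_complex_field, 'e::ab_group_add) mfd"
  assumes adm: "admissible_smoothness TYPE('k) r" and M: "Cr_manifold r M"
    and F: "closed_vector_subspace (model_of M) F" and F': "closed_vector_subspace (model_of M) F'"
    and c: "flat_chart M S F U \<phi>" and d: "flat_chart M S F' V \<psi>" and x: "x \<in> U" "x \<in> V" "x \<in> S"
  shows "\<exists>A B. continuous_linear (model_of M) (model_of M) A \<and> continuous_linear (model_of M) (model_of M) B \<and>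
    (\<forall>v\<in>carrier_of (model_of M). B (A v) = v \<and> A (B v) = v) \<and> A ` F \<subseteq> F' \<and> B ` F' \<subseteq> F"
proof -
  let ?E = "model_of M"
  note E = Cr_manifold_lcs[OF M]
  have cc: "(U, \<phi>) \<in> charts_of M" and cS: "\<forall>u\<in>U. u \<in> S \<longleftrightarrow> \<phi> u \<in> F"
    using c by (simp_all add: flat_chart_def)
  have dc: "(V, \<psi>) \<in> charts_of M" and dS: "\<forall>u\<in>V. u \<in> S \<longleftrightarrow> \<psi> u \<in> F'"
    using d by (simp_all add: flat_chart_def)
  have o: "openin (space_of M) (U \<inter> V)"
    using is_chart_openin[OF Cr_manifold_chart[OF M cc]] is_chart_openin[OF Cr_manifold_chart[OF M dc]]
    by (rule openin_Int)
  have "Cr_factor r ?E ?E (U \<inter> V) \<phi> \<psi>" "Cr_factor r ?E ?E (U \<inter> V) \<psi> \<phi>"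
    using Cr_manifold_factor[OF adm M cc dc o] Cr_manifold_factor[OF adm M dc cc o] by simp_all
  then obtain h k where h: "Cr_on r ?E ?E (\<phi> ` (U \<inter> V)) h" "\<forall>x\<in>U \<inter> V. \<psi> x = h (\<phi> x)"
    and k: "Cr_on r ?E ?E (\<psi> ` (U \<inter> V)) k" "\<forall>x\<in>U \<inter> V. \<phi> x = k (\<psi> x)"
    unfolding Cr_factor_def by blast
  have im: "h ` \<phi> ` (U \<inter> V) \<subseteq> \<psi> ` (U \<inter> V)" "k ` \<psi> ` (U \<inter> V) \<subseteq> \<phi> ` (U \<inter> V)"
    using h(2) k(2) by (metis (no_types, lifting) image_image image_cong subset_refl)+
  have inv: "k (h e) = e" if "e \<in> \<phi> ` (U \<inter> V)" for e
    using that h(2) k(2) by (elim imageE) metis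
  have inv': "h (k e) = e" if "e \<in> \<psi> ` (U \<inter> V)" for e
    using that h(2) k(2) by (elim imageE) metis
  have px: "\<phi> x \<in> \<phi> ` (U \<inter> V)" and qx: "\<psi> x \<in> \<psi> ` (U \<inter> V)" and hx: "h (\<phi> x) = \<psi> x"
    using x h(2) by auto
  have xF: "\<phi> x \<in> F" "\<psi> x \<in> F'"
    using x cS dS by auto
  obtain A B where T: "tangent_isomorphism ?E h k (\<phi> x) A B"
    using Cr_tangent_isomorphism[OF adm E h(1) k(1) im inv inv' px] by blast
  have FE: "F \<subseteq> carrier_of ?E" "F' \<subseteq> carrier_of ?E"
    using F F' closedin_subset unfolding closed_vector_subspace_def by blast+
  have dd: "real_dd ?E h (\<phi> x) v (A v)" "real_dd ?E k (\<psi> x) v (B v)" if "v \<in> carrier_of ?E" for v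
    using T that unfolding tangent_isomorphism_def hx by blast+
  have hF: "h ` (\<phi> ` (U \<inter> V) \<inter> F) \<subseteq> F'"
  proof clarsimp
    fix u assume "u \<in> U" "u \<in> V" "\<phi> u \<in> F"
    then show "h (\<phi> u) \<in> F'"
      using cS dS h(2) by (metis IntI)
  qed
  have kF: "k ` (\<psi> ` (U \<inter> V) \<inter> F') \<subseteq> F"
  proof clarsimp
    fix u assume "u \<in> U" "u \<in> V" "\<psi> u \<in> F'"
    then show "k (\<psi> u) \<in> F"
      using cS dS k(2) by (metis IntI)
  qed
  have "A v \<in> F'" if "v \<in> F" for v
    using real_dd_maps_flat[OF E F F' Cr_on_openin[OF h(1)] hF px xF(1) that dd(1)] FE that by blast
  moreover have "B v \<in> F" if "v \<in> F'" for v
    using real_dd_maps_flat[OF E F' F Cr_on_openin[OF k(1)] kF qx xF(2) that dd(2)] FE that by blast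
  ultimately show ?thesis
    using T unfolding tangent_isomorphism_def by (intro exI[of _ A] exI[of _ B]) auto
qed

text \<open>The automorphism is found at a single point, but being linear and defined everywhere it
  can be composed with flat charts far away from that point.\<close>

lemma flat_chart_linear:
  fixes M :: "('a, 'k::real_or_complex_field, 'e::ab_group_add) mfd"
  assumes adm: "admissible_smoothness TYPE('k) r" and M: "Cr_manifold r M"
    and c: "flat_chart M S F U \<phi>"
    and A: "continuous_linear (model_of M) (model_of M) A" and B: "continuous_linear (model_of M) (model_of M) B"
    and AB: "\<forall>v\<in>carrier_of (model_of M). B (A v) = v \<and> A (B v) = v" and AF: "A ` F \<subseteq> F'" "B ` F' \<subseteq> F"
  shows "flat_chart M S F' U (\<lambda>x. A (\<phi> x))"
proof -
  let ?E = "model_of M"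
  note E = Cr_manifold_lcs[OF M]
  have cc: "(U, \<phi>) \<in> charts_of M" and cS: "\<forall>u\<in>U. u \<in> S \<longleftrightarrow> \<phi> u \<in> F"
    using c by (simp_all add: flat_chart_def)
  have im: "\<phi> ` U \<subseteq> carrier_of ?E"
    using openin_subset[OF is_chart_image[OF Cr_manifold_chart[OF M cc]]] .
  have "(U, \<lambda>x. A (\<phi> x)) \<in> charts_of M"
    by (rule chart_transform[OF adm M cc im Cr_linear[OF adm E E A openin_topspace] Cr_linear[OF adm E E B openin_topspace]])
      (use AB continuous_linear_in[OF A] continuous_linear_in[OF B] in blast)
  moreover have "u \<in> S \<longleftrightarrow> A (\<phi> u) \<in> F'" if "u \<in> U" for u
  proof -
    have "B (A (\<phi> u)) = \<phi> u"
      using that im AB by blast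
    then show ?thesis
      using cS that AF by (metis image_subset_iff)
  qed
  ultimately show ?thesis
    by (simp add: flat_chart_def)
qed

text \<open>A convex neighbourhood intersected with \<open>F\<close> is a union of segments issuing
  from its centre, hence connected, and the inverse of the chart carries it into \<open>S\<close>.
  It follows that the components of \<open>S\<close> are open.\<close>

lemma flat_chart_connected_nbhd:
  assumes M: "Cr_manifold r M" and F: "closed_vector_subspace (model_of M) F"
    and c: "flat_chart M S F U \<phi>" and x: "x \<in> U" "x \<in> S"
  shows "\<exists>T. openin (subtopology (space_of M) S) T \<and> connectedin (subtopology (space_of M) S) T \<and> x \<in> T"
proof -
  let ?E = "model_of M"
  interpret lcs ?E
    using Cr_manifold_lcs[OF M] .
  have cc: "(U, \<phi>) \<in> charts_of M" and cS: "\<forall>u\<in>U. u \<in> S \<longleftrightarrow> \<phi> u \<in> F"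
    using c by (simp_all add: flat_chart_def)
  note ch = Cr_manifold_chart[OF M cc]
  have Fs: "subspace F" and Fc: "F \<subseteq> carrier_of ?E"
    using F closedin_subset unfolding closed_vector_subspace_def by blast+
  have o: "openin (top_of ?E) (\<phi> ` U)"
    using is_chart_image[OF ch] .
  define w where "w = \<phi> x"
  have w: "w \<in> \<phi> ` U" "w \<in> F" "w \<in> carrier_of ?E"
    using x cS openin_subset[OF o] by (auto simp: w_def)
  have "continuous_map (top_of ?E) (top_of ?E) (\<lambda>v. w + v)"
    using w(3) by (intro continuous_add) auto
  from openin_continuous_map_preimage[OF this o]
  have "openin (top_of ?E) {v \<in> carrier_of ?E. w + v \<in> \<phi> ` U}" .
  moreover have "0 \<in> {v \<in> carrier_of ?E. w + v \<in> \<phi> ` U}"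
    using w by simp
  ultimately obtain C where C: "openin (top_of ?E) C" "0 \<in> C" "C \<subseteq> {v \<in> carrier_of ?E. w + v \<in> \<phi> ` U}"
    and conv: "\<forall>x\<in>C. \<forall>y\<in>C. \<forall>t. 0 \<le> t \<and> t \<le> 1 \<longrightarrow>
        scale_of ?E (of_real (1 - t)) x + scale_of ?E (of_real t) y \<in> C"
    by (rule convex_nbhd)
  define segment where "segment v = (\<lambda>t::real. w + scale_of ?E (of_real t) v) ` {0..1}" for v
  let ?K = "\<Union>v\<in>C \<inter> F. segment v"
  have seg: "w + scale_of ?E (of_real t) v \<in> (\<lambda>v. w + v) ` (C \<inter> F)" if "v \<in> C \<inter> F" "0 \<le> t" "t \<le> 1" for v t
  proof -
    have "scale_of ?E (of_real (1 - t)) 0 + scale_of ?E (of_real t) v \<in> C"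
      using conv C(2) that by blast
    moreover have "scale_of ?E (of_real t) v \<in> F"
      using that by (intro subspace_scale Fs) auto
    ultimately show ?thesis
      by simp
  qed
  have "segment v \<subseteq> (\<lambda>v. w + v) ` (C \<inter> F)" if "v \<in> C \<inter> F" for v
    unfolding segment_def using seg[OF that] by (intro image_subsetI) simp
  moreover have "w + v \<in> segment v" for v
    unfolding segment_def by (rule image_eqI[of _ _ 1]) simp_all
  ultimately have K: "?K = (\<lambda>v. w + v) ` (C \<inter> F)"
    by (intro equalityI UN_least image_subsetI UN_I)
  have "connectedin (top_of ?E) ?K"
  proof (rule connectedin_Union)
    show "connectedin (top_of ?E) T" if T: "T \<in> segment ` (C \<inter> F)" for T
    proof -
      obtain v where v: "v \<in> C \<inter> F" "T = segment v"
        using T by blast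
      have "continuous_map euclideanreal (top_of ?E) (\<lambda>t. w + scale_of ?E (of_real t) v)"
        by (intro continuous_add continuous_scale) (use w v Fc in \<open>auto intro: continuous_intros\<close>)
      from connectedin_continuous_map_image[OF this] show ?thesis
        unfolding v(2) segment_def by simp
    qed
    have "w \<in> segment v" for v
      unfolding segment_def by (rule image_eqI[of _ _ 0]) simp_all
    then show "\<Inter> (segment ` (C \<inter> F)) \<noteq> {}"
      by auto
  qed
  then have conK: "connectedin (subtopology (top_of ?E) (\<phi> ` U)) ?K"
    unfolding connectedin_subtopology using C(3) K by auto
  obtain g where g: "continuous_map (subtopology (top_of ?E) (\<phi> ` U)) (space_of M) g" "\<forall>x\<in>U. g (\<phi> x) = x"
    using ch by (rule is_chart_inverse)
  let ?T = "g ` ?K"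
  \<comment> \<open>The image of the segments is rewritten as a preimage, from which it is seen to
    be open in \<open>S\<close>.\<close>
  have T: "?T = {u \<in> U. \<phi> u - w \<in> C} \<inter> S"
  proof (intro equalityI subsetI)
    fix u assume "u \<in> ?T"
    then obtain v where v: "v \<in> C" "v \<in> F" "u = g (w + v)"
      unfolding K by blast
    then obtain u' where u': "u' \<in> U" "w + v = \<phi> u'"
      using C(3) by auto
    have "w + v \<in> F"
      by (intro subspace_add Fs w v)
    moreover have "\<phi> u' - w = v"
      unfolding u'(2)[symmetric] by simp
    ultimately show "u \<in> {u \<in> U. \<phi> u - w \<in> C} \<inter> S"
      using u' v g(2) cS by auto
  next
    fix u assume u: "u \<in> {u \<in> U. \<phi> u - w \<in> C} \<inter> S"
    then have "\<phi> u - w \<in> F"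
      using cS w by (intro subspace_diff Fs) auto
    then have "w + (\<phi> u - w) \<in> ?K"
      using u unfolding K by blast
    then have "\<phi> u \<in> ?K"
      by (metis add.commute diff_add_cancel)
    moreover have "u = g (\<phi> u)"
      using u g(2) by simp
    ultimately show "u \<in> ?T"
      by blast
  qed
  have "connectedin (subtopology (space_of M) S) ?T"
    unfolding connectedin_subtopology
  proof
    show "connectedin (space_of M) ?T"
      by (rule connectedin_continuous_map_image[OF g(1) conK])
    show "?T \<subseteq> S"
      unfolding T by blast
  qed
  moreover have "openin (subtopology (space_of M) S) ?T"
    unfolding T
  proof (rule openin_subtopology_Int)
    have "continuous_map (subtopology (space_of M) U) (top_of ?E) (\<lambda>u. \<phi> u - w)"
      using w is_chart_continuous[OF ch] by (intro continuous_diff) auto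
    from openin_continuous_map_preimage[OF this C(1)]
    have "openin (space_of M) {u \<in> topspace (subtopology (space_of M) U). \<phi> u - w \<in> C}"
      unfolding openin_open_subtopology[OF is_chart_openin[OF ch]] by blast
    moreover have "topspace (subtopology (space_of M) U) = U"
      using openin_subset[OF is_chart_openin[OF ch]] by auto
    ultimately show "openin (space_of M) {u \<in> U. \<phi> u - w \<in> C}"
      by (simp only:)
  qed
  moreover have "x \<in> ?T"
    unfolding T using x C(2) by (simp add: w_def)
  ultimately show ?thesis
    by blast
qed

lemma nonpure_split_submanifoldI:
  fixes M :: "('a, 'k::real_or_complex_field, 'e::ab_group_add) mfd"
  assumes adm: "admissible_smoothness TYPE('k) r" and M: "Cr_manifold r M" and S: "S \<subseteq> topspace (space_of M)"
    and flat: "\<forall>x\<in>S. \<exists>U \<phi> F. x \<in> U \<and> flat_chart M S F U \<phi> \<and>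
      closed_vector_subspace (model_of M) F \<and> complemented (model_of M) F"
  shows "\<exists>F. is_nonpure_split_submanifold M S F"
proof -
  let ?E = "model_of M" and ?X = "subtopology (space_of M) S"
  define T where "T F = {x \<in> S. \<exists>U \<phi>. x \<in> U \<and> flat_chart M S F U \<phi>}" for F
  have opT: "openin ?X (T F)" for F
  proof (subst openin_subopen, intro ballI)
    fix x assume "x \<in> T F"
    then obtain U \<phi> where U: "x \<in> S" "x \<in> U" "flat_chart M S F U \<phi>"
      unfolding T_def by blast
    then have "openin (space_of M) U"
      using is_chart_openin[OF Cr_manifold_chart[OF M]] unfolding flat_chart_def by blast
    then have "openin ?X (U \<inter> S)"
      by (rule openin_subtopology_Int)
    moreover have "U \<inter> S \<subseteq> T F"
      using U(3) unfolding T_def by blast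
    ultimately show "\<exists>V. openin ?X V \<and> x \<in> V \<and> V \<subseteq> T F"
      using U by blast
  qed
  \<comment> \<open>A single common point is enough: the automorphism obtained there converts all
    charts with model \<open>F\<close>.\<close>
  have TT: "T F \<subseteq> T F'"
    if F: "closed_vector_subspace ?E F" "closed_vector_subspace ?E F'" and x: "x \<in> T F" "x \<in> T F'" for F F' x
  proof -
    obtain U \<phi> V \<psi> where U: "x \<in> S" "x \<in> U" "flat_chart M S F U \<phi>" and V: "x \<in> V" "flat_chart M S F' V \<psi>"
      using x unfolding T_def by blast
    obtain A B where AB: "continuous_linear ?E ?E A" "continuous_linear ?E ?E B"
      "\<forall>v\<in>carrier_of ?E. B (A v) = v \<and> A (B v) = v" "A ` F \<subseteq> F'" "B ` F' \<subseteq> F"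
      using flat_chart_transfer[OF adm M F U(3) V(2) U(2) V(1) U(1)] by (elim exE conjE)
    show ?thesis
      unfolding T_def using flat_chart_linear[OF adm M _ AB] by blast
  qed
  have "\<exists>F. openin ?X C \<and> is_split_submanifold M C F" if C: "C \<in> connected_components_of ?X" for C
  proof -
    have CS: "C \<subseteq> S"
      using connected_components_of_subset[OF C] by auto
    have opC: "openin ?X C"
    proof (subst openin_subopen, intro ballI)
      fix x assume x: "x \<in> C"
      then obtain U \<phi> F where U: "x \<in> U" "flat_chart M S F U \<phi>" "closed_vector_subspace ?E F"
        using flat CS by (meson subsetD)
      have "x \<in> S"
        using x CS by blast
      from flat_chart_connected_nbhd[OF M U(3,2,1) this]
      obtain V where V: "openin ?X V" "connectedin ?X V" "x \<in> V"
        by (elim exE conjE)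
      have "\<not> disjnt C V"
        using x V(3) unfolding disjnt_iff by blast
      with C V(2) have "V \<subseteq> C"
        by (rule connected_components_of_maximal)
      then show "\<exists>V. openin ?X V \<and> x \<in> V \<and> V \<subseteq> C"
        using V by blast
    qed
    obtain x where x: "x \<in> C"
      using nonempty_connected_components_of[OF C] by blast
    then obtain U \<phi> F where U: "x \<in> U" "flat_chart M S F U \<phi>" "closed_vector_subspace ?E F" "complemented ?E F"
      using flat CS by (meson subsetD)
    have xT: "x \<in> T F"
      using U x CS unfolding T_def by blast
    \<comment> \<open>Sets \<open>T F\<close> that meet coincide, so the complement of one of them
      is a union of others, which are open.\<close>
    have "openin ?X (S - T F)"
    proof (subst openin_subopen, intro ballI)
      fix y assume y: "y \<in> S - T F"
      then obtain U' \<phi>' F' where U': "y \<in> U'" "flat_chart M S F' U' \<phi>'" "closed_vector_subspace ?E F'"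
        using flat by (meson DiffD1)
      have yT: "y \<in> T F'"
        using U' y unfolding T_def by blast
      have "T F' \<subseteq> S - T F"
      proof
        fix z assume z: "z \<in> T F'"
        then have "z \<notin> T F"
          using TT[OF U'(3) U(3) z] yT y by blast
        then show "z \<in> S - T F"
          using z unfolding T_def by blast
      qed
      then show "\<exists>V. openin ?X V \<and> y \<in> V \<and> V \<subseteq> S - T F"
        using opT yT by blast
    qed
    moreover have "connectedin ?X C"
      using connectedin_connected_components_of[OF C] .
    ultimately have CT: "C \<subseteq> T F"
      using opT[of F] x xT CS unfolding connectedin by blast
    obtain D where D: "openin (space_of M) D" "C = D \<inter> S"
      using opC unfolding openin_subtopology by blast
    have "\<exists>c\<in>charts_of M. case c of (U, \<phi>) \<Rightarrow> y \<in> U \<and> \<phi> ` (U \<inter> C) = \<phi> ` U \<inter> F" if y: "y \<in> C" for y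
    proof -
      obtain V \<psi> where V: "y \<in> V" "flat_chart M S F V \<psi>"
        using y CT unfolding T_def by blast
      have "(V, \<psi>) \<in> charts_of M"
        using V(2) by (simp add: flat_chart_def)
      then have "openin (space_of M) V"
        by (rule is_chart_openin[OF Cr_manifold_chart[OF M]])
      then have o: "openin (space_of M) (V \<inter> D)"
        using D(1) by (rule openin_Int)
      have "flat_chart M C F (V \<inter> D) \<psi>"
        by (rule flat_chart_restrict[OF adm M V(2) o]) (use D(2) in auto)
      then have *: "(V \<inter> D, \<psi>) \<in> charts_of M" "\<psi> ` (V \<inter> D \<inter> C) = \<psi> ` (V \<inter> D) \<inter> F"
        by (simp_all add: flat_chart_iff[OF M])
      show ?thesis
      proof (rule bexI[OF _ *(1)], unfold prod.case, intro conjI)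
        show "y \<in> V \<inter> D"
          using V(1) y D(2) by blast
      qed (rule *(2))
    qed
    then have "is_split_submanifold M C F"
      unfolding is_split_submanifold_def is_submanifold_def using U(3,4) CS S by (intro conjI ballI) simp_all
    with opC show ?thesis
      by blast
  qed
  then have "\<forall>C\<in>connected_components_of ?X. \<exists>F. openin ?X C \<and> is_split_submanifold M C F"
    by blast
  then obtain F where "\<forall>C\<in>connected_components_of ?X. openin ?X C \<and> is_split_submanifold M C (F C)"
    by (rule bchoice[THEN exE])
  then have "is_nonpure_split_submanifold M S F"
    unfolding is_nonpure_split_submanifold_def using S by blast
  then show ?thesis
    by blast
qed

lemma Cr_map_factor:
  fixes M :: "('a, 'k::real_or_complex_field, 'e::ab_group_add) mfd" and N :: "('b, 'k, 'f::ab_group_add) mfd"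
  assumes adm: "admissible_smoothness TYPE('k) r" and M: "Cr_manifold r M" and N: "Cr_manifold r N"
  shows "Cr_map r M N f \<longleftrightarrow> continuous_map (space_of M) (space_of N) f \<and>
    (\<forall>U \<phi> V \<psi>. (U, \<phi>) \<in> charts_of M \<longrightarrow> (V, \<psi>) \<in> charts_of N \<longrightarrow>
      Cr_factor r (model_of M) (model_of N) (U \<inter> f -` V) \<phi> (\<lambda>x. \<psi> (f x)))"
proof -
  have "Cr_factor r (model_of M) (model_of N) (U \<inter> f -` V) \<phi> (\<lambda>x. \<psi> (f x)) \<longleftrightarrow>
      Cr_on r (model_of M) (model_of N) (\<phi> ` (U \<inter> f -` V)) (\<psi> \<circ> f \<circ> inv_into U \<phi>)"
    if "(U, \<phi>) \<in> charts_of M" for U \<phi> V \<psi>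
    using Cr_factor_inv_into[OF adm Cr_manifold_lcs[OF M] Cr_manifold_lcs[OF N]
      is_chart_inj[OF Cr_manifold_chart[OF M that]] Int_lower1] by (simp add: o_def)
  then show ?thesis
    unfolding Cr_map_def by auto
qed

subsection \<open>Submersions on split submanifolds\<close>

text \<open>A submersion chart for the restriction of \<open>p\<close> to \<open>S\<close>, phrased
  in the ambient manifold: \<open>\<pi>\<close> lives on the whole model space, while the right
  inverse takes its values in \<open>F\<close>, so that both restrict to \<open>F\<close>. In this
  form the data can be moved by ambient automorphisms.\<close>

definition submersive_at ::
    "('a, 'k::field, 'e::ab_group_add) mfd \<Rightarrow> ('b, 'k, 'f::ab_group_add) mfd \<Rightarrow> ('a \<Rightarrow> 'b) \<Rightarrow> 'a set \<Rightarrow> 'e set \<Rightarrow> 'a \<Rightarrow> bool"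
  where "submersive_at M B p S F x \<longleftrightarrow>
    (\<exists>U \<phi> W \<kappa> \<pi> \<sigma>. x \<in> U \<and> flat_chart M S F U \<phi> \<and> (W, \<kappa>) \<in> charts_of B \<and> p ` U \<subseteq> W \<and>
      continuous_linear (model_of M) (model_of B) \<pi> \<and> continuous_linear (model_of B) (model_of M) \<sigma> \<and>
      \<sigma> ` carrier_of (model_of B) \<subseteq> F \<and> (\<forall>y\<in>carrier_of (model_of B). \<pi> (\<sigma> y) = y) \<and>
      (\<forall>z\<in>U. \<kappa> (p z) = \<pi> (\<phi> z)))"

lemma submersive_at_subset:
  fixes M :: "('a, 'k::real_or_complex_field, 'e::ab_group_add) mfd" and B :: "('b, 'k, 'f::ab_group_add) mfd"
  assumes adm: "admissible_smoothness TYPE('k) r" and M: "Cr_manifold r M"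
    and s: "submersive_at M B p S F x" and D: "openin (space_of M) D" "x \<in> D" "D \<inter> S = D \<inter> S'"
  shows "submersive_at M B p S' F x"
proof -
  obtain U \<phi> W \<kappa> \<pi> \<sigma> where U: "x \<in> U" "flat_chart M S F U \<phi>" and W: "(W, \<kappa>) \<in> charts_of B" "p ` U \<subseteq> W"
    and lin: "continuous_linear (model_of M) (model_of B) \<pi>" "continuous_linear (model_of B) (model_of M) \<sigma>"
      "\<sigma> ` carrier_of (model_of B) \<subseteq> F" "\<forall>y\<in>carrier_of (model_of B). \<pi> (\<sigma> y) = y"
    and \<kappa>: "\<forall>z\<in>U. \<kappa> (p z) = \<pi> (\<phi> z)"
    using s unfolding submersive_at_def by (elim exE conjE)
  have "(U, \<phi>) \<in> charts_of M"
    using U(2) by (simp add: flat_chart_def)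
  then have "openin (space_of M) U"
    by (rule is_chart_openin[OF Cr_manifold_chart[OF M]])
  then have o: "openin (space_of M) (U \<inter> D)"
    using D(1) by (rule openin_Int)
  have "flat_chart M S' F (U \<inter> D) \<phi>"
    by (rule flat_chart_restrict[OF adm M U(2) o]) (use D(3) in auto)
  then show ?thesis
    unfolding submersive_at_def using U(1) D(2) W lin \<kappa>
    by (intro exI[of _ "U \<inter> D"] exI[of _ \<phi>] exI[of _ W] exI[of _ \<kappa>] exI[of _ \<pi>] exI[of _ \<sigma>]) auto
qed

text \<open>The model of a component is prescribed, whereas a local construction yields some other
  subspace \<open>F\<close>. The automorphism \<open>A\<close> from \<open>F\<close> to
  \<open>F'\<close>, with inverse \<open>C\<close>, conjugates all data: the chart is followed by
  \<open>A\<close>, \<open>\<pi>\<close> is preceded by \<open>C\<close>, and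
  \<open>\<sigma>\<close> is followed by \<open>A\<close>.\<close>

lemma submersive_at_transfer:
  fixes M :: "('a, 'k::real_or_complex_field, 'e::ab_group_add) mfd" and B :: "('b, 'k, 'f::ab_group_add) mfd"
  assumes adm: "admissible_smoothness TYPE('k) r" and M: "Cr_manifold r M"
    and s: "submersive_at M B p S F x" and F: "closed_vector_subspace (model_of M) F"
    and S: "is_submanifold M S F'" and x: "x \<in> S"
  shows "submersive_at M B p S F' x"
proof -
  let ?E = "model_of M" and ?G = "model_of B"
  obtain U \<phi> W \<kappa> \<pi> \<sigma> where U: "x \<in> U" "flat_chart M S F U \<phi>" and W: "(W, \<kappa>) \<in> charts_of B" "p ` U \<subseteq> W"
    and \<pi>: "continuous_linear ?E ?G \<pi>" and \<sigma>: "continuous_linear ?G ?E \<sigma>"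
      "\<sigma> ` carrier_of ?G \<subseteq> F" and \<pi>\<sigma>: "\<forall>y\<in>carrier_of ?G. \<pi> (\<sigma> y) = y"
    and \<kappa>: "\<forall>z\<in>U. \<kappa> (p z) = \<pi> (\<phi> z)"
    using s unfolding submersive_at_def by (elim exE conjE)
  have F': "closed_vector_subspace ?E F'"
    using S by (simp add: is_submanifold_def)
  obtain V \<psi> where V: "(V, \<psi>) \<in> charts_of M" "x \<in> V" "\<psi> ` (V \<inter> S) = \<psi> ` V \<inter> F'"
    using S x unfolding is_submanifold_def by blast
  then have "flat_chart M S F' V \<psi>"
    by (simp add: flat_chart_iff[OF M])
  from flat_chart_transfer[OF adm M F F' U(2) this U(1) V(2) x]
  obtain A C where A: "continuous_linear ?E ?E A" and C: "continuous_linear ?E ?E C"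
    and AC: "\<forall>v\<in>carrier_of ?E. C (A v) = v \<and> A (C v) = v" and AF: "A ` F \<subseteq> F'" "C ` F' \<subseteq> F"
    by (elim exE conjE)
  have "flat_chart M S F' U (\<lambda>x. A (\<phi> x))"
    by (rule flat_chart_linear[OF adm M U(2) A C AC AF])
  moreover have "C (A (\<phi> z)) = \<phi> z" if "z \<in> U" for z
  proof -
    have "\<phi> z \<in> carrier_of ?E"
      using U(2) that openin_subset[OF is_chart_image[OF Cr_manifold_chart[OF M]]] unfolding flat_chart_def by blast
    then show ?thesis
      using AC by blast
  qed
  moreover have "C (A (\<sigma> y)) = \<sigma> y" if "y \<in> carrier_of ?G" for y
    using AC continuous_linear_in[OF \<sigma>(1) that] by blast
  ultimately show ?thesis
    unfolding submersive_at_def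
    using U(1) W continuous_linear_compose[OF C \<pi>] continuous_linear_compose[OF \<sigma>(1) A] \<sigma>(2) AF(1) \<pi>\<sigma> \<kappa>
    by (intro exI[of _ U] exI[of _ "\<lambda>x. A (\<phi> x)"] exI[of _ W] exI[of _ \<kappa>] exI[of _ "\<lambda>v. \<pi> (C v)"]
        exI[of _ "\<lambda>y. A (\<sigma> y)"] conjI) (simp_all add: image_subset_iff)
qed

text \<open>Near each point there are charts in which \<open>p\<close> is linear and split.
  Smoothness in all other charts follows by composing with transition maps on both sides, and the
  submersion condition is read off from the same charts.\<close>

lemma submersion_sub_mfd:
  fixes M :: "('a, 'k::real_or_complex_field, 'e::ab_group_add) mfd" and B :: "('b, 'k, 'f::ab_group_add) mfd"
  assumes adm: "admissible_smoothness TYPE('k) r" and M: "Cr_manifold r M" and B: "Cr_manifold r B"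
    and S: "is_split_submanifold M S F" and p: "continuous_map (space_of M) (space_of B) p"
    and s: "\<forall>x\<in>S. submersive_at M B p S F x"
  shows "Cr_submersion r (sub_mfd r M S F) B p"
proof -
  let ?P = "sub_mfd r M S F" and ?E = "sub_tvs (model_of M) F" and ?G = "model_of B"
  have P: "Cr_manifold r ?P"
    by (rule sub_mfd_manifold(1)[OF adm M S])
  have E: "lcs ?E"
    using Cr_manifold_lcs[OF P] by simp
  note G = Cr_manifold_lcs[OF B]
  have local: "\<exists>U \<phi> W \<kappa> \<pi> \<sigma>. x \<in> U \<and> (U, \<phi>) \<in> charts_of ?P \<and> (W, \<kappa>) \<in> charts_of B \<and> p ` U \<subseteq> W \<and>
      continuous_linear ?E ?G \<pi> \<and> continuous_linear ?G ?E \<sigma> \<and>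
      (\<forall>y\<in>carrier_of ?G. \<pi> (\<sigma> y) = y) \<and> (\<forall>z\<in>U. \<kappa> (p z) = \<pi> (\<phi> z))" if x: "x \<in> S" for x
  proof -
    have "submersive_at M B p S F x"
      using s x by blast
    then obtain U \<phi> W \<kappa> \<pi> \<sigma> where U: "x \<in> U" "flat_chart M S F U \<phi>" and W: "(W, \<kappa>) \<in> charts_of B" "p ` U \<subseteq> W"
      and \<pi>: "continuous_linear (model_of M) ?G \<pi>" and \<sigma>: "continuous_linear ?G (model_of M) \<sigma>"
        "\<sigma> ` carrier_of ?G \<subseteq> F" and \<pi>\<sigma>: "\<forall>y\<in>carrier_of ?G. \<pi> (\<sigma> y) = y"
      and \<kappa>: "\<forall>z\<in>U. \<kappa> (p z) = \<pi> (\<phi> z)"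
      unfolding submersive_at_def by (elim exE conjE)
    have "(U \<inter> S, \<phi>) \<in> charts_of ?P"
      using sub_mfd_manifold(2)[OF adm M S] U(2) by (simp add: flat_chart_iff[OF M])
    then show ?thesis
      using U(1) x W continuous_linear_from_sub[OF \<pi>] continuous_linear_into_sub[OF \<sigma>] \<pi>\<sigma> \<kappa>
      by (intro exI[of _ "U \<inter> S"] exI[of _ \<phi>] exI[of _ W] exI[of _ \<kappa>] exI[of _ \<pi>] exI[of _ \<sigma>] conjI) auto
  qed
  have p': "continuous_map (space_of ?P) (space_of B) p"
    using continuous_map_from_subtopology[OF p] by simp
  have "Cr_factor r ?E ?G (V \<inter> p -` W') \<psi> (\<lambda>x. \<kappa>' (p x))"
    if c: "(V, \<psi>) \<in> charts_of ?P" and d: "(W', \<kappa>') \<in> charts_of B" for V \<psi> W' \<kappa>'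
  proof -
    have cc: "is_chart (subtopology (space_of M) S) ?E (V, \<psi>)"
      using Cr_manifold_chart[OF P c] by simp
    let ?D = "V \<inter> p -` W'"
    have VS: "V \<subseteq> topspace (subtopology (space_of M) S)"
      using openin_subset[OF is_chart_openin[OF cc]] .
    have "?D = V \<inter> {x \<in> topspace (space_of ?P). p x \<in> W'}"
      using VS by auto
    then have D: "openin (subtopology (space_of M) S) ?D"
      using openin_Int[OF is_chart_openin[OF cc]
        openin_continuous_map_preimage[OF p' is_chart_openin[OF Cr_manifold_chart[OF B d]], simplified]] by simp
    show ?thesis
    proof (rule Cr_factor_local[OF adm E G])
      show "inj_on \<psi> ?D"
        using is_chart_inj[OF cc] inj_on_subset by blast
      show "openin (top_of ?E) (\<psi> ` ?D)"
        by (rule is_chart_open_image[OF cc D]) blast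
      fix x assume x: "x \<in> ?D"
      then have "x \<in> S"
        using VS by auto
      from local[OF this] obtain U \<phi> W \<kappa> \<pi> \<sigma> where U: "x \<in> U" "(U, \<phi>) \<in> charts_of ?P"
        and W: "(W, \<kappa>) \<in> charts_of B" "p ` U \<subseteq> W" and \<pi>: "continuous_linear ?E ?G \<pi>"
        and \<kappa>: "\<forall>z\<in>U. \<kappa> (p z) = \<pi> (\<phi> z)"
        by (elim exE conjE)
      have cu: "is_chart (subtopology (space_of M) S) ?E (U, \<phi>)"
        using Cr_manifold_chart[OF P U(2)] by simp
      let ?A = "?D \<inter> U"
      have o: "openin (subtopology (space_of M) S) ?A"
        using D is_chart_openin[OF cu] by (rule openin_Int)
      have oim: "openin (top_of ?E) (\<phi> ` ?A)"
        by (rule is_chart_open_image[OF cu o]) blast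
      have 1: "Cr_factor r ?E ?E ?A \<psi> \<phi>"
        using Cr_manifold_factor[OF adm P c U(2), of ?A] o by auto
      have 2: "Cr_factor r ?E ?G ?A \<phi> (\<lambda>x. \<kappa> (p x))"
        unfolding Cr_factor_def using Cr_linear[OF adm E G \<pi> oim] \<kappa> by (intro exI[of _ \<pi>]) auto
      have "openin (space_of B) (W \<inter> W')"
        using is_chart_openin[OF Cr_manifold_chart[OF B W(1)]] is_chart_openin[OF Cr_manifold_chart[OF B d]]
        by (rule openin_Int)
      from Cr_manifold_factor[OF adm B W(1) d this] obtain h where
        h: "Cr_on r ?G ?G (\<kappa> ` (W \<inter> W')) h" "\<forall>y\<in>W \<inter> W'. \<kappa>' y = h (\<kappa> y)"
        unfolding Cr_factor_def by auto
      have pO: "p z \<in> W \<inter> W'" if "z \<in> ?A" for z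
        using that W(2) by blast
      have "Cr_factor r ?E ?G ?A \<psi> (\<lambda>x. h (\<kappa> (p x)))"
        by (rule Cr_factor_comp[OF adm E G G Cr_factor_trans[OF adm E E G 1 2] h(1)]) (use pO in blast)
      then have "Cr_factor r ?E ?G ?A \<psi> (\<lambda>x. \<kappa>' (p x))"
        unfolding Cr_factor_def using h(2) pO by (metis (no_types, lifting))
      then show "\<exists>B. x \<in> B \<and> B \<subseteq> ?D \<and> Cr_factor r ?E ?G B \<psi> (\<lambda>x. \<kappa>' (p x))"
        using x U(1) by (intro exI[of _ ?A]) blast
    qed
  qed
  then have map: "Cr_map r ?P B p"
    unfolding Cr_map_factor[OF adm P B] using p' by simp
  show ?thesis
    unfolding Cr_submersion_def
  proof (intro conjI map ballI)
    fix x assume "x \<in> topspace (space_of ?P)"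
    then have "x \<in> S" by simp
    from local[OF this] obtain U \<phi> W \<kappa> \<pi> \<sigma> where U: "x \<in> U" "(U, \<phi>) \<in> charts_of ?P"
      and W: "(W, \<kappa>) \<in> charts_of B" "p ` U \<subseteq> W" and lin: "continuous_linear ?E ?G \<pi>" "continuous_linear ?G ?E \<sigma>"
        "\<forall>y\<in>carrier_of ?G. \<pi> (\<sigma> y) = y"
      and \<kappa>: "\<forall>z\<in>U. \<kappa> (p z) = \<pi> (\<phi> z)"
      by (elim exE conjE)
    have inj: "inj_on \<phi> U"
      using is_chart_inj[OF Cr_manifold_chart[OF P U(2)]] .
    show "\<exists>(U, \<phi>)\<in>charts_of ?P. \<exists>(V, \<psi>)\<in>charts_of B. \<exists>\<pi> \<sigma>.
        x \<in> U \<and> p x \<in> V \<and> p ` U \<subseteq> V \<and>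
        continuous_linear (model_of ?P) (model_of B) \<pi> \<and>
        continuous_linear (model_of B) (model_of ?P) \<sigma> \<and>
        (\<forall>y\<in>carrier_of (model_of B). \<pi> (\<sigma> y) = y) \<and>
        (\<forall>v\<in>\<phi> ` U. (\<psi> \<circ> p \<circ> inv_into U \<phi>) v = \<pi> v)"
    proof (rule bexI[OF _ U(2)], unfold prod.case, rule bexI[OF _ W(1)], unfold prod.case,
        rule exI[of _ \<pi>], rule exI[of _ \<sigma>], intro conjI)
      show "\<forall>v\<in>\<phi> ` U. (\<kappa> \<circ> p \<circ> inv_into U \<phi>) v = \<pi> v"
        using \<kappa> inj by simp
    qed (use U W lin in \<open>simp_all add: image_subset_iff\<close>)
  qed
qed

text \<open>All that is global about the theorem is contained here. The local data are passed from
  \<open>S\<close> to the component, and then from the subspace found at the point to the model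
  \<open>F C\<close> that an arbitrary admissible family prescribes.\<close>

lemma nonpure_submersionI:
  fixes M :: "('a, 'k::real_or_complex_field, 'e::ab_group_add) mfd" and B :: "('b, 'k, 'f::ab_group_add) mfd"
  assumes adm: "admissible_smoothness TYPE('k) r" and M: "Cr_manifold r M" and B: "Cr_manifold r B"
    and S: "S \<subseteq> topspace (space_of M)" and p: "continuous_map (space_of M) (space_of B) p"
    and s: "\<forall>x\<in>S. \<exists>F. closed_vector_subspace (model_of M) F \<and> complemented (model_of M) F \<and> submersive_at M B p S F x"
  shows "(\<exists>F. is_nonpure_split_submanifold M S F) \<and>
    (\<forall>F. is_nonpure_split_submanifold M S F \<longrightarrow>
      nonpure_Cr_submersion r (subtopology (space_of M) S) (\<lambda>C. sub_mfd r M C (F C)) B p)"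
proof (intro conjI allI impI)
  have "\<forall>x\<in>S. \<exists>U \<phi> F. x \<in> U \<and> flat_chart M S F U \<phi> \<and>
      closed_vector_subspace (model_of M) F \<and> complemented (model_of M) F"
  proof
    fix x assume "x \<in> S"
    with s obtain F where F: "closed_vector_subspace (model_of M) F" "complemented (model_of M) F" "submersive_at M B p S F x"
      by blast
    from F(3) obtain U \<phi> where "x \<in> U" "flat_chart M S F U \<phi>"
      unfolding submersive_at_def by (elim exE conjE)
    with F show "\<exists>U \<phi> F. x \<in> U \<and> flat_chart M S F U \<phi> \<and>
        closed_vector_subspace (model_of M) F \<and> complemented (model_of M) F"
      by (intro exI conjI)
  qed
  from nonpure_split_submanifoldI[OF adm M S this] show "\<exists>F. is_nonpure_split_submanifold M S F" .
next
  fix F assume F: "is_nonpure_split_submanifold M S F"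
  let ?X = "subtopology (space_of M) S"
  have "openin ?X C \<and> space_of (sub_mfd r M C (F C)) = subtopology ?X C \<and> Cr_manifold r (sub_mfd r M C (F C)) \<and>
      Cr_submersion r (sub_mfd r M C (F C)) B p" if C: "C \<in> connected_components_of ?X" for C
  proof -
    have opC: "openin ?X C" and spl: "is_split_submanifold M C (F C)"
      using F C unfolding is_nonpure_split_submanifold_def by blast+
    have CS: "C \<subseteq> S"
      using openin_subset[OF opC] by simp
    obtain D where D: "openin (space_of M) D" "C = D \<inter> S"
      using opC unfolding openin_subtopology by blast
    have "submersive_at M B p C (F C) x" if x: "x \<in> C" for x
    proof -
      obtain F0 where F0: "closed_vector_subspace (model_of M) F0" "submersive_at M B p S F0 x"
        using s x CS by blast
      have "submersive_at M B p C F0 x"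
        by (rule submersive_at_subset[OF adm M F0(2) D(1)]) (use x D(2) in auto)
      then show ?thesis
        by (rule submersive_at_transfer[OF adm M _ F0(1) _ x]) (use spl in \<open>simp add: is_split_submanifold_def\<close>)
    qed
    then have "Cr_submersion r (sub_mfd r M C (F C)) B p"
      by (intro submersion_sub_mfd[OF adm M B spl p] ballI)
    moreover have "S \<inter> C = C"
      using CS by blast
    ultimately show ?thesis
      using opC sub_mfd_manifold(1)[OF adm M spl] by (simp add: subtopology_subtopology)
  qed
  then show "nonpure_Cr_submersion r ?X (\<lambda>C. sub_mfd r M C (F C)) B p"
    unfolding nonpure_Cr_submersion_def nonpure_Cr_manifold_def by blast
qed

subsection \<open>Fibre products\<close>

lemma continuous_linear_minus:
  assumes "lcs E" and h: "continuous_linear E F h" and xy: "x \<in> carrier_of E" "y \<in> carrier_of E"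
  shows "h (x - y) = h x - h y"
proof -
  interpret lcs E by fact
  have "h ((x - y) + y) = h (x - y) + h y"
    using h xy unfolding continuous_linear_def by (metis diff_in)
  then show ?thesis
    by (simp add: eq_diff_eq)
qed

lemma continuous_linear_uminus:
  assumes "lcs E" and h: "continuous_linear E F h" and x: "x \<in> carrier_of E"
  shows "h 0 = 0" and "h (- x) = - h x"
proof -
  interpret lcs E by fact
  show "h 0 = 0"
    using continuous_linear_minus[OF assms(1) h x x] by simp
  then show "h (- x) = - h x"
    using continuous_linear_minus[OF assms(1) h zero_in x] by simp
qed

text \<open>Since \<open>L\<close> has the right inverse \<open>s\<close>, the map
  \<open>s (L e)\<close> is a continuous projection along the kernel of \<open>L\<close>. Splitting
  \<open>e\<close> into \<open>e - s (L e)\<close> and \<open>s (L e)\<close> therefore inverts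
  addition, and the range of \<open>s\<close> is a complement.\<close>

lemma split_kernel:
  fixes E :: "('k::real_normed_field, 'e::ab_group_add) tvs" and G :: "('k, 'g::ab_group_add) tvs"
  assumes E: "lcs E" and G: "lcs G" and L: "continuous_linear E G L" and s: "continuous_linear G E s"
    and Ls: "\<forall>z\<in>carrier_of G. L (s z) = z"
  shows "closed_vector_subspace E {e \<in> carrier_of E. L e = 0}"
    and "complemented E {e \<in> carrier_of E. L e = 0}"
proof -
  interpret E: lcs E by fact
  interpret G: lcs G by fact
  let ?K = "{e \<in> carrier_of E. L e = 0}" and ?C = "s ` carrier_of G"
  have L_add: "L (x + y) = L x + L y" if "x \<in> carrier_of E" "y \<in> carrier_of E" for x y
    using L that by (simp add: continuous_linear_def)
  have L_scale: "L (scale_of E c x) = scale_of G c (L x)" if "x \<in> carrier_of E" for x c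
    using L that by (simp add: continuous_linear_def)
  have s_add: "s (x + y) = s x + s y" if "x \<in> carrier_of G" "y \<in> carrier_of G" for x y
    using s that by (simp add: continuous_linear_def)
  have s_scale: "s (scale_of G c x) = scale_of E c (s x)" if "x \<in> carrier_of G" for x c
    using s that by (simp add: continuous_linear_def)
  have L0: "L 0 = 0" and s0: "s 0 = 0"
    using continuous_linear_uminus(1)[OF E L E.zero_in] continuous_linear_uminus(1)[OF G s G.zero_in] by simp_all
  have cL: "continuous_map (top_of E) (top_of G) L" and cs: "continuous_map (top_of G) (top_of E) s"
    using L s by (simp_all add: continuous_linear_def)
  have Lin: "L e \<in> carrier_of G" if "e \<in> carrier_of E" for e
    using continuous_linear_in[OF L that] .
  have sin: "s z \<in> carrier_of E" if "z \<in> carrier_of G" for z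
    using continuous_linear_in[OF s that] .
  have K: "E.subspace ?K"
    by (rule E.subspaceI) (use L_add L_scale L0 in auto)
  have C: "E.subspace ?C"
  proof (rule E.subspaceI)
    show "0 \<in> ?C"
      using s0 G.zero_in by (metis image_eqI)
    show "x + y \<in> ?C" if "x \<in> ?C" "y \<in> ?C" for x y
      using that s_add G.add_in by (elim imageE) (metis image_eqI)
    show "scale_of E c x \<in> ?C" if "x \<in> ?C" for c x
      using that s_scale G.scale_in by (elim imageE) (metis image_eqI)
  qed
  have "closedin (top_of G) {0}"
    using closedin_t1_singleton[OF Hausdorff_imp_t1_space[OF G.hausdorff]] by simp
  from closedin_continuous_map_preimage[OF cL this] show "closed_vector_subspace E ?K"
    unfolding closed_vector_subspace_def using K by simp
  let ?KC = "prod_topology (subtopology (top_of E) ?K) (subtopology (top_of E) ?C)"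
  have csL: "continuous_map (top_of E) (top_of E) (\<lambda>e. s (L e))"
    using continuous_map_compose[OF cL cs] by (simp add: o_def)
  have c1: "continuous_map (top_of E) (subtopology (top_of E) ?K) (\<lambda>e. e - s (L e))"
  proof (rule continuous_map_into_subtopology)
    show "continuous_map (top_of E) (top_of E) (\<lambda>e. e - s (L e))"
      using csL by (intro E.continuous_diff) auto
    have "L (e - s (L e)) = 0" if "e \<in> carrier_of E" for e
      using continuous_linear_minus[OF E L that sin[OF Lin[OF that]]] Ls Lin[OF that] by simp
    then show "(\<lambda>e. e - s (L e)) \<in> carrier_of E \<rightarrow> ?K"
      using Lin sin by (auto intro!: E.diff_in)
  qed
  have c2: "continuous_map (top_of E) (subtopology (top_of E) ?C) (\<lambda>e. s (L e))"
    using csL Lin by (auto intro!: continuous_map_into_subtopology)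
  have c3: "continuous_map ?KC (top_of E) (\<lambda>(x, y). x + y)"
    unfolding case_prod_unfold
    by (intro E.continuous_add; rule continuous_map_into_fulltopology)
      (rule continuous_map_fst continuous_map_snd)+
  have "homeomorphic_maps ?KC (top_of E) (\<lambda>(x, y). x + y) (\<lambda>e. (e - s (L e), s (L e)))"
    unfolding homeomorphic_maps_def
  proof (intro conjI c3 continuous_map_pairedI c1 c2 ballI)
    fix z assume "z \<in> topspace ?KC"
    then obtain e y where z: "z = (e, s y)" "e \<in> carrier_of E" "L e = 0" "y \<in> carrier_of G"
      by auto
    then have "L (e + s y) = y"
      using L_add[OF z(2) sin[OF z(4)]] Ls by simp
    then show "((case z of (x, y) \<Rightarrow> x + y) - s (L (case z of (x, y) \<Rightarrow> x + y)), s (L (case z of (x, y) \<Rightarrow> x + y))) = z"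
      by (simp add: z(1))
  qed simp
  then show "complemented E ?K"
    unfolding complemented_def using C sin
    by (intro exI[of _ ?C] conjI) (auto simp: homeomorphic_map_maps)
qed

text \<open>The shear subtracts \<open>s (k e)\<close> and turns the equation
  \<open>L e = k e\<close> into \<open>L e = 0\<close>. Adding \<open>s (k e)\<close> is its inverse
  because \<open>k\<close> is invariant under translation by values of \<open>s\<close>. Hypothesis
  \<open>inv\<close> is the abstract form of \<open>k\<close> depending on the other factor only, so
  the lemma serves both projections.\<close>

lemma flat_chart_graph:
  fixes M :: "('a, 'k::real_or_complex_field, 'e::ab_group_add) mfd" and G :: "('k, 'g::ab_group_add) tvs"
  assumes adm: "admissible_smoothness TYPE('k) r" and M: "Cr_manifold r M" and G: "lcs G"
    and c: "(U, \<phi>) \<in> charts_of M" and U\<Omega>: "\<phi> ` U \<subseteq> \<Omega>" and k: "Cr_on r (model_of M) G \<Omega> k"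
    and L: "continuous_linear (model_of M) G L" and s: "continuous_linear G (model_of M) s"
    and Ls: "\<forall>z\<in>carrier_of G. L (s z) = z"
    and inv: "\<forall>e\<in>\<Omega>. \<forall>z\<in>carrier_of G. e + s z \<in> \<Omega> \<and> k (e + s z) = k e"
    and S: "\<forall>x\<in>U. x \<in> S \<longleftrightarrow> L (\<phi> x) = k (\<phi> x)"
  shows "flat_chart M S {e \<in> carrier_of (model_of M). L e = 0} U (\<lambda>x. \<phi> x - s (k (\<phi> x)))"
proof -
  let ?E = "model_of M"
  note E = Cr_manifold_lcs[OF M]
  interpret E: lcs ?E by (rule E)
  interpret G: lcs G by (rule G)
  have EE: "lcs (prod_tvs ?E ?E)"
    using lcs_prod_tvs[OF E E] .
  have \<Omega>: "openin (top_of ?E) \<Omega>"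
    using Cr_on_openin[OF k] .
  have kG: "k e \<in> carrier_of G" if "e \<in> \<Omega>" for e
    using Cr_on_in[OF k] that by blast
  have \<Omega>E: "e \<in> carrier_of ?E" if "e \<in> \<Omega>" for e
    using openin_subset[OF \<Omega>] that by blast
  have sE: "s z \<in> carrier_of ?E" if "z \<in> carrier_of G" for z
    using continuous_linear_in[OF s that] .
  have id: "Cr_on r ?E ?E \<Omega> (\<lambda>e. e)"
    by (rule Cr_linear[OF adm E E continuous_linear_id \<Omega>])
  have "Cr_on r ?E ?E \<Omega> (\<lambda>e. s (k e))"
    by (rule Cr_compose[OF adm E G E k Cr_linear[OF adm G E s openin_topspace] Cr_on_in[OF k]])
  from Cr_pair[OF adm E E E id this]
  have pair: "Cr_on r ?E (prod_tvs ?E ?E) \<Omega> (\<lambda>e. (e, s (k e)))" .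
  \<comment> \<open>As linear maps on the product, sum and difference make the shear and its inverse
    composites of maps already known to be \<open>C^r\<close>.\<close>
  have "continuous_linear (prod_tvs ?E ?E) ?E (\<lambda>z. fst z - snd z)"
    "continuous_linear (prod_tvs ?E ?E) ?E (\<lambda>z. fst z + snd z)"
    using continuous_linear_diff[OF E continuous_linear_fst continuous_linear_snd]
      continuous_linear_add[OF E continuous_linear_fst continuous_linear_snd] by auto
  note lin = this[THEN Cr_linear[OF adm EE E _ openin_topspace]]
  have h: "Cr_on r ?E ?E \<Omega> (\<lambda>e. e - s (k e))" and h': "Cr_on r ?E ?E \<Omega> (\<lambda>e. e + s (k e))"
    using Cr_compose[OF adm E EE E pair lin(1) Cr_on_in[OF pair]]
      Cr_compose[OF adm E EE E pair lin(2) Cr_on_in[OF pair]] by simp_all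
  \<comment> \<open>\<open>inv\<close> speaks of adding values of \<open>s\<close>, so the
    subtraction is expressed as adding \<open>s (- k e)\<close>.\<close>
  have neg: "e - s (k e) = e + s (- k e)" if "e \<in> \<Omega>" for e
    using continuous_linear_uminus(2)[OF G s kG[OF that]] by simp
  have hk: "\<forall>e\<in>\<Omega>. e - s (k e) \<in> \<Omega> \<and> e + s (k e) \<in> \<Omega> \<and>
      (e - s (k e)) + s (k (e - s (k e))) = e \<and> (e + s (k e)) - s (k (e + s (k e))) = e"
  proof
    fix e assume e: "e \<in> \<Omega>"
    have 1: "e - s (k e) \<in> \<Omega>" "k (e - s (k e)) = k e"
      unfolding neg[OF e] using inv e kG[OF e] by simp_all
    have 2: "e + s (k e) \<in> \<Omega>" "k (e + s (k e)) = k e"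
      using inv e kG[OF e] by simp_all
    show "e - s (k e) \<in> \<Omega> \<and> e + s (k e) \<in> \<Omega> \<and>
      (e - s (k e)) + s (k (e - s (k e))) = e \<and> (e + s (k e)) - s (k (e + s (k e))) = e"
      using 1 2 by simp
  qed
  have "(U, \<lambda>x. \<phi> x - s (k (\<phi> x))) \<in> charts_of M"
    by (rule chart_transform[OF adm M c U\<Omega> h h' hk])
  moreover have "x \<in> S \<longleftrightarrow> \<phi> x - s (k (\<phi> x)) \<in> {e \<in> carrier_of ?E. L e = 0}" if x: "x \<in> U" for x
  proof -
    have e: "\<phi> x \<in> \<Omega>"
      using x U\<Omega> by blast
    have "L (\<phi> x - s (k (\<phi> x))) = L (\<phi> x) - k (\<phi> x)"
      using continuous_linear_minus[OF E L \<Omega>E[OF e] sE[OF kG[OF e]]] Ls kG[OF e] by simp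
    moreover have "\<phi> x - s (k (\<phi> x)) \<in> carrier_of ?E"
      using \<Omega>E[OF e] sE[OF kG[OF e]] by simp
    ultimately show ?thesis
      using S x by simp
  qed
  ultimately show ?thesis
    by (simp add: flat_chart_def)
qed

text \<open>The definition of a submersion takes care of \<open>f\<close>; for \<open>g\<close> the
  chart around \<open>y\<close> is cut down to the preimage of \<open>V\<close>. Then both
  \<open>f u\<close> and \<open>g w\<close> lie in the domain of the injective chart
  \<open>\<psi>\<close>, and their equality can be read in coordinates.\<close>

lemma submersion_chart:
  fixes M :: "('a, 'k::real_or_complex_field, 'e::ab_group_add) mfd" and B :: "('b, 'k, 'f::ab_group_add) mfd"
    and N :: "('c, 'k, 'g::ab_group_add) mfd"
  assumes adm: "admissible_smoothness TYPE('k) r" and M: "Cr_manifold r M" and B: "Cr_manifold r B" and N: "Cr_manifold r N"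
    and f: "Cr_submersion r M N f" and g: "Cr_map r B N g"
    and x: "x \<in> topspace (space_of M)" and y: "y \<in> topspace (space_of B)" and xy: "f x = g y"
  shows "\<exists>U \<phi> W \<kappa> \<pi> \<sigma> h. (U, \<phi>) \<in> charts_of M \<and> x \<in> U \<and> (W, \<kappa>) \<in> charts_of B \<and> y \<in> W \<and>
    continuous_linear (model_of M) (model_of N) \<pi> \<and> continuous_linear (model_of N) (model_of M) \<sigma> \<and>
    (\<forall>z\<in>carrier_of (model_of N). \<pi> (\<sigma> z) = z) \<and> Cr_on r (model_of B) (model_of N) (\<kappa> ` W) h \<and>
    (\<forall>u\<in>U. \<forall>w\<in>W. f u = g w \<longleftrightarrow> \<pi> (\<phi> u) = h (\<kappa> w))"
proof -
  obtain U \<phi> V \<psi> \<pi> \<sigma> where U: "(U, \<phi>) \<in> charts_of M" "x \<in> U" and V: "(V, \<psi>) \<in> charts_of N" "f ` U \<subseteq> V"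
    and lin: "continuous_linear (model_of M) (model_of N) \<pi>" "continuous_linear (model_of N) (model_of M) \<sigma>"
      "\<forall>z\<in>carrier_of (model_of N). \<pi> (\<sigma> z) = z"
    and \<pi>: "\<forall>v\<in>\<phi> ` U. (\<psi> \<circ> f \<circ> inv_into U \<phi>) v = \<pi> v"
    using f x unfolding Cr_submersion_def by blast
  obtain W0 \<kappa> where W0: "(W0, \<kappa>) \<in> charts_of B" "y \<in> W0"
    using B y by (rule Cr_manifold_cover)
  note chW = Cr_manifold_chart[OF B W0(1)]
  have gc: "continuous_map (space_of B) (space_of N) g"
    and gf: "Cr_factor r (model_of B) (model_of N) (W0 \<inter> g -` V) \<kappa> (\<lambda>x. \<psi> (g x))"
    using g W0(1) V(1) unfolding Cr_map_factor[OF adm B N] by blast+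
  let ?W = "W0 \<inter> g -` V"
  have "?W = W0 \<inter> {w \<in> topspace (space_of B). g w \<in> V}"
    using openin_subset[OF is_chart_openin[OF chW]] by blast
  then have oW: "openin (space_of B) ?W"
    using openin_Int[OF is_chart_openin[OF chW]
      openin_continuous_map_preimage[OF gc is_chart_openin[OF Cr_manifold_chart[OF N V(1)]]]] by simp
  have W: "(?W, \<kappa>) \<in> charts_of B"
    by (rule chart_restrict[OF adm B W0(1) oW]) blast
  have yW: "y \<in> ?W"
    using W0(2) V(2) U(2) xy by auto
  obtain h where h: "Cr_on r (model_of B) (model_of N) (\<kappa> ` ?W) h" "\<forall>w\<in>?W. \<psi> (g w) = h (\<kappa> w)"
    using gf unfolding Cr_factor_def by blast
  have "f u = g w \<longleftrightarrow> \<pi> (\<phi> u) = h (\<kappa> w)" if u: "u \<in> U" and w: "w \<in> ?W" for u w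
  proof -
    have "f u \<in> V" "g w \<in> V"
      using u w V(2) by auto
    then have "f u = g w \<longleftrightarrow> \<psi> (f u) = \<psi> (g w)"
      using inj_on_eq_iff[OF is_chart_inj[OF Cr_manifold_chart[OF N V(1)]]] by blast
    moreover have "\<psi> (f u) = \<pi> (\<phi> u)"
      using \<pi> u is_chart_inj[OF Cr_manifold_chart[OF M U(1)]] by simp
    ultimately show ?thesis
      using h(2) w by simp
  qed
  then have "\<forall>u\<in>U. \<forall>w\<in>?W. f u = g w \<longleftrightarrow> \<pi> (\<phi> u) = h (\<kappa> w)"
    by simp
  with U W yW lin h(1) show ?thesis
    by (intro exI conjI)
qed

text \<open>The shear changes the first coordinate only. Hence \<open>snd\<close> remains linear in
  the sheared chart, and \<open>w \<mapsto> (0, w)\<close> is a right inverse with values in the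
  kernel because \<open>\<pi> 0 = 0\<close>.\<close>

lemma fibre_product_left:
  fixes M\<^sub>1 :: "('a, 'k::real_or_complex_field, 'e1::ab_group_add) mfd"
    and M\<^sub>2 :: "('b, 'k, 'e2::ab_group_add) mfd" and N :: "('c, 'k, 'e3::ab_group_add) mfd"
  assumes adm: "admissible_smoothness TYPE('k) r"
    and M1: "Cr_manifold r M\<^sub>1" and M2: "Cr_manifold r M\<^sub>2" and N: "Cr_manifold r N"
    and f: "Cr_submersion r M\<^sub>1 N f" and g: "Cr_map r M\<^sub>2 N g"
    and z: "z \<in> fibre_product M\<^sub>1 M\<^sub>2 f g"
  defines "M \<equiv> prod_mfd r M\<^sub>1 M\<^sub>2"
  shows "\<exists>F. closed_vector_subspace (model_of M) F \<and> complemented (model_of M) F \<and>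
    submersive_at M M\<^sub>2 snd (fibre_product M\<^sub>1 M\<^sub>2 f g) F z"
proof -
  obtain x y where xy: "z = (x, y)" "x \<in> topspace (space_of M\<^sub>1)" "y \<in> topspace (space_of M\<^sub>2)" "f x = g y"
    using z unfolding fibre_product_def by blast
  let ?E1 = "model_of M\<^sub>1" and ?E2 = "model_of M\<^sub>2" and ?G = "model_of N" and ?S = "fibre_product M\<^sub>1 M\<^sub>2 f g"
  let ?E = "prod_tvs ?E1 ?E2"
  have M: "Cr_manifold r M" and E: "model_of M = ?E"
    using prod_mfd_manifold(1)[OF adm M1 M2] by (simp_all add: M_def)
  note l1 = Cr_manifold_lcs[OF M1] and l2 = Cr_manifold_lcs[OF M2] and G = Cr_manifold_lcs[OF N]
  have lE: "lcs ?E"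
    using lcs_prod_tvs[OF l1 l2] .
  interpret E1: lcs ?E1 by (rule l1)
  interpret E2: lcs ?E2 by (rule l2)
  obtain U \<phi> W \<kappa> \<pi> \<sigma> h where U: "(U, \<phi>) \<in> charts_of M\<^sub>1" "x \<in> U" and W: "(W, \<kappa>) \<in> charts_of M\<^sub>2" "y \<in> W"
    and \<pi>: "continuous_linear ?E1 ?G \<pi>" and \<sigma>: "continuous_linear ?G ?E1 \<sigma>"
    and \<pi>\<sigma>: "\<forall>z\<in>carrier_of ?G. \<pi> (\<sigma> z) = z" and h: "Cr_on r ?E2 ?G (\<kappa> ` W) h"
    and fg: "\<forall>u\<in>U. \<forall>w\<in>W. f u = g w \<longleftrightarrow> \<pi> (\<phi> u) = h (\<kappa> w)"
    using submersion_chart[OF adm M1 M2 N f g xy(2,3,4)] by (elim exE conjE)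
  have UW: "(U \<times> W, map_prod \<phi> \<kappa>) \<in> charts_of M"
    unfolding M_def by (rule prod_mfd_manifold(2)[OF adm M1 M2 U(1) W(1)])
  note ch = Cr_manifold_chart[OF M1 U(1)] Cr_manifold_chart[OF M2 W(1)]
  have sub: "U \<subseteq> topspace (space_of M\<^sub>1)" "W \<subseteq> topspace (space_of M\<^sub>2)" "\<phi> ` U \<subseteq> carrier_of ?E1"
    using ch[THEN is_chart_openin, THEN openin_subset] openin_subset[OF is_chart_image[OF ch(1)]] by simp_all
  \<comment> \<open>The first factor is the whole model space, since the shear may leave the image
    of \<open>\<phi>\<close>; the second is the domain of \<open>h\<close> and is left
    unchanged.\<close>
  let ?\<Omega> = "carrier_of ?E1 \<times> \<kappa> ` W"
  let ?L = "\<lambda>e. \<pi> (fst e)" and ?s = "\<lambda>z. (\<sigma> z, 0 :: 'e2)" and ?k = "\<lambda>e :: 'e1 \<times> 'e2. h (snd e)"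
  let ?K = "{e \<in> carrier_of (model_of M). ?L e = 0}"
  have \<Omega>: "openin (top_of ?E) ?\<Omega>"
    using is_chart_image[OF ch(2)] by (simp add: openin_prod_Times_iff)
  have L: "continuous_linear (model_of M) ?G ?L" and s: "continuous_linear ?G (model_of M) ?s"
    unfolding E using continuous_linear_compose[OF continuous_linear_fst \<pi>]
      continuous_linear_pair[OF \<sigma> continuous_linear_zero[OF l2]] by simp_all
  have k: "Cr_on r (model_of M) ?G ?\<Omega> ?k"
    unfolding E by (rule Cr_compose[OF adm lE l2 G Cr_linear[OF adm lE l2 continuous_linear_snd \<Omega>] h]) auto
  have Ls: "\<forall>z\<in>carrier_of ?G. ?L (?s z) = z"
    using \<pi>\<sigma> by simp
  have inv: "\<forall>e\<in>?\<Omega>. \<forall>z\<in>carrier_of ?G. e + ?s z \<in> ?\<Omega> \<and> ?k (e + ?s z) = ?k e"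
    using continuous_linear_in[OF \<sigma>] by auto
  have S: "\<forall>p\<in>U \<times> W. p \<in> ?S \<longleftrightarrow> ?L (map_prod \<phi> \<kappa> p) = ?k (map_prod \<phi> \<kappa> p)"
    using fg sub unfolding fibre_product_def by auto
  have im: "map_prod \<phi> \<kappa> ` (U \<times> W) \<subseteq> ?\<Omega>"
    using sub(3) by auto
  note flat = flat_chart_graph[OF adm M G UW im k L s Ls inv S]
  have "submersive_at M M\<^sub>2 snd ?S ?K z"
    unfolding submersive_at_def
  proof (intro exI conjI)
    show "flat_chart M ?S ?K (U \<times> W) (\<lambda>p. map_prod \<phi> \<kappa> p - ?s (?k (map_prod \<phi> \<kappa> p)))"
      by (rule flat)
    show "z \<in> U \<times> W" "(W, \<kappa>) \<in> charts_of M\<^sub>2" "snd ` (U \<times> W) \<subseteq> W"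
      using xy U W by auto
    show "continuous_linear (model_of M) ?E2 snd" "continuous_linear ?E2 (model_of M) (\<lambda>w. (0, w))"
      unfolding E by (rule continuous_linear_snd, rule continuous_linear_pair[OF continuous_linear_zero[OF l1] continuous_linear_id])
    show "(\<lambda>w. (0, w)) ` carrier_of ?E2 \<subseteq> ?K"
      unfolding E using continuous_linear_uminus(1)[OF l1 \<pi> E1.zero_in] by auto
    show "\<forall>y\<in>carrier_of ?E2. snd (0, y) = y"
      by simp
    show "\<forall>p\<in>U \<times> W. \<kappa> (snd p) = snd (map_prod \<phi> \<kappa> p - ?s (?k (map_prod \<phi> \<kappa> p)))"
      by auto
  qed
  moreover have "closed_vector_subspace (model_of M) ?K" "complemented (model_of M) ?K"
    using split_kernel[OF Cr_manifold_lcs[OF M] G L s Ls] by simp_all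
  ultimately show ?thesis
    by blast
qed

text \<open>The mirror image of the preceding argument: now \<open>g\<close> supplies the linear
  chart, \<open>h\<close> depends on the first coordinate and the second one is sheared. Only this
  local part is carried out twice; the global part is shared through
  \<open>nonpure_submersionI\<close>.\<close>

lemma fibre_product_right:
  fixes M\<^sub>1 :: "('a, 'k::real_or_complex_field, 'e1::ab_group_add) mfd"
    and M\<^sub>2 :: "('b, 'k, 'e2::ab_group_add) mfd" and N :: "('c, 'k, 'e3::ab_group_add) mfd"
  assumes adm: "admissible_smoothness TYPE('k) r"
    and M1: "Cr_manifold r M\<^sub>1" and M2: "Cr_manifold r M\<^sub>2" and N: "Cr_manifold r N"
    and f: "Cr_map r M\<^sub>1 N f" and g: "Cr_submersion r M\<^sub>2 N g"
    and z: "z \<in> fibre_product M\<^sub>1 M\<^sub>2 f g"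
  defines "M \<equiv> prod_mfd r M\<^sub>1 M\<^sub>2"
  shows "\<exists>F. closed_vector_subspace (model_of M) F \<and> complemented (model_of M) F \<and>
    submersive_at M M\<^sub>1 fst (fibre_product M\<^sub>1 M\<^sub>2 f g) F z"
proof -
  obtain x y where xy: "z = (x, y)" "x \<in> topspace (space_of M\<^sub>1)" "y \<in> topspace (space_of M\<^sub>2)" "f x = g y"
    using z unfolding fibre_product_def by blast
  let ?E1 = "model_of M\<^sub>1" and ?E2 = "model_of M\<^sub>2" and ?G = "model_of N" and ?S = "fibre_product M\<^sub>1 M\<^sub>2 f g"
  let ?E = "prod_tvs ?E1 ?E2"
  have M: "Cr_manifold r M" and E: "model_of M = ?E"
    using prod_mfd_manifold(1)[OF adm M1 M2] by (simp_all add: M_def)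
  note l1 = Cr_manifold_lcs[OF M1] and l2 = Cr_manifold_lcs[OF M2] and G = Cr_manifold_lcs[OF N]
  have lE: "lcs ?E"
    using lcs_prod_tvs[OF l1 l2] .
  interpret E1: lcs ?E1 by (rule l1)
  interpret E2: lcs ?E2 by (rule l2)
  obtain U \<phi> W \<kappa> \<pi> \<sigma> h where U: "(U, \<phi>) \<in> charts_of M\<^sub>2" "y \<in> U" and W: "(W, \<kappa>) \<in> charts_of M\<^sub>1" "x \<in> W"
    and \<pi>: "continuous_linear ?E2 ?G \<pi>" and \<sigma>: "continuous_linear ?G ?E2 \<sigma>"
    and \<pi>\<sigma>: "\<forall>z\<in>carrier_of ?G. \<pi> (\<sigma> z) = z" and h: "Cr_on r ?E1 ?G (\<kappa> ` W) h"
    and fg: "\<forall>u\<in>U. \<forall>w\<in>W. g u = f w \<longleftrightarrow> \<pi> (\<phi> u) = h (\<kappa> w)"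
    using submersion_chart[OF adm M2 M1 N g f xy(3,2) xy(4)[symmetric]] by (elim exE conjE)
  have UW: "(W \<times> U, map_prod \<kappa> \<phi>) \<in> charts_of M"
    unfolding M_def by (rule prod_mfd_manifold(2)[OF adm M1 M2 W(1) U(1)])
  note ch = Cr_manifold_chart[OF M2 U(1)] Cr_manifold_chart[OF M1 W(1)]
  have sub: "U \<subseteq> topspace (space_of M\<^sub>2)" "W \<subseteq> topspace (space_of M\<^sub>1)" "\<phi> ` U \<subseteq> carrier_of ?E2"
    using ch[THEN is_chart_openin, THEN openin_subset] openin_subset[OF is_chart_image[OF ch(1)]] by simp_all
  let ?\<Omega> = "\<kappa> ` W \<times> carrier_of ?E2"
  let ?L = "\<lambda>e. \<pi> (snd e)" and ?s = "\<lambda>z. (0 :: 'e1, \<sigma> z)" and ?k = "\<lambda>e :: 'e1 \<times> 'e2. h (fst e)"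
  let ?K = "{e \<in> carrier_of (model_of M). ?L e = 0}"
  have \<Omega>: "openin (top_of ?E) ?\<Omega>"
    using is_chart_image[OF ch(2)] by (simp add: openin_prod_Times_iff)
  have L: "continuous_linear (model_of M) ?G ?L" and s: "continuous_linear ?G (model_of M) ?s"
    unfolding E using continuous_linear_compose[OF continuous_linear_snd \<pi>]
      continuous_linear_pair[OF continuous_linear_zero[OF l1] \<sigma>] by simp_all
  have k: "Cr_on r (model_of M) ?G ?\<Omega> ?k"
    unfolding E by (rule Cr_compose[OF adm lE l1 G Cr_linear[OF adm lE l1 continuous_linear_fst \<Omega>] h]) auto
  have Ls: "\<forall>z\<in>carrier_of ?G. ?L (?s z) = z"
    using \<pi>\<sigma> by simp
  have inv: "\<forall>e\<in>?\<Omega>. \<forall>z\<in>carrier_of ?G. e + ?s z \<in> ?\<Omega> \<and> ?k (e + ?s z) = ?k e"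
    using continuous_linear_in[OF \<sigma>] by auto
  have S: "\<forall>p\<in>W \<times> U. p \<in> ?S \<longleftrightarrow> ?L (map_prod \<kappa> \<phi> p) = ?k (map_prod \<kappa> \<phi> p)"
    using fg sub unfolding fibre_product_def by (auto simp: eq_commute[of "f _"])
  have im: "map_prod \<kappa> \<phi> ` (W \<times> U) \<subseteq> ?\<Omega>"
    using sub(3) by auto
  note flat = flat_chart_graph[OF adm M G UW im k L s Ls inv S]
  have "submersive_at M M\<^sub>1 fst ?S ?K z"
    unfolding submersive_at_def
  proof (intro exI conjI)
    show "flat_chart M ?S ?K (W \<times> U) (\<lambda>p. map_prod \<kappa> \<phi> p - ?s (?k (map_prod \<kappa> \<phi> p)))"
      by (rule flat)
    show "z \<in> W \<times> U" "(W, \<kappa>) \<in> charts_of M\<^sub>1" "fst ` (W \<times> U) \<subseteq> W"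
      using xy U W by auto
    show "continuous_linear (model_of M) ?E1 fst" "continuous_linear ?E1 (model_of M) (\<lambda>w. (w, 0))"
      unfolding E by (rule continuous_linear_fst, rule continuous_linear_pair[OF continuous_linear_id continuous_linear_zero[OF l2]])
    show "(\<lambda>w. (w, 0)) ` carrier_of ?E1 \<subseteq> ?K"
      unfolding E using continuous_linear_uminus(1)[OF l2 \<pi> E2.zero_in] by auto
    show "\<forall>y\<in>carrier_of ?E1. fst (y, 0) = y"
      by simp
    show "\<forall>p\<in>W \<times> U. \<kappa> (fst p) = fst (map_prod \<kappa> \<phi> p - ?s (?k (map_prod \<kappa> \<phi> p)))"
      by auto
  qed
  moreover have "closed_vector_subspace (model_of M) ?K" "complemented (model_of M) ?K"
    using split_kernel[OF Cr_manifold_lcs[OF M] G L s Ls] by simp_all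
  ultimately show ?thesis
    by blast
qed

theorem theoremB:
  fixes r :: smoothness
    and M\<^sub>1 :: "('a, 'k::real_or_complex_field, 'e1::ab_group_add) mfd"
    and M\<^sub>2 :: "('b, 'k, 'e2::ab_group_add) mfd"
    and N :: "('c, 'k, 'e3::ab_group_add) mfd"
    and f :: "'a \<Rightarrow> 'c" and g :: "'b \<Rightarrow> 'c"
  defines "M \<equiv> prod_mfd r M\<^sub>1 M\<^sub>2"
    and "S \<equiv> fibre_product M\<^sub>1 M\<^sub>2 f g"
  assumes "admissible_smoothness TYPE('k) r"
    and "Cr_manifold r M\<^sub>1" and "Cr_manifold r M\<^sub>2" and "Cr_manifold r N"
    and "Cr_map r M\<^sub>1 N f" and "Cr_map r M\<^sub>2 N g"
  shows "(Cr_submersion r M\<^sub>1 N f \<longrightarrow>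
           (\<exists>F. is_nonpure_split_submanifold M S F) \<and>
           (\<forall>F. is_nonpure_split_submanifold M S F \<longrightarrow>
             nonpure_Cr_submersion r (subtopology (space_of M) S) (\<lambda>C. sub_mfd r M C (F C)) M\<^sub>2 snd)) \<and>
         (Cr_submersion r M\<^sub>2 N g \<longrightarrow>
           (\<exists>F. is_nonpure_split_submanifold M S F) \<and>
           (\<forall>F. is_nonpure_split_submanifold M S F \<longrightarrow>
             nonpure_Cr_submersion r (subtopology (space_of M) S) (\<lambda>C. sub_mfd r M C (F C)) M\<^sub>1 fst))"
proof -
  note adm = assms(3) and M1 = assms(4) and M2 = assms(5) and N = assms(6) and f = assms(7) and g = assms(8)
  have M: "Cr_manifold r M"
    unfolding M_def by (rule prod_mfd_manifold(1)[OF adm M1 M2])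
  have S: "S \<subseteq> topspace (space_of M)"
    unfolding S_def M_def fibre_product_def by auto
  have p: "continuous_map (space_of M) (space_of M\<^sub>2) snd" "continuous_map (space_of M) (space_of M\<^sub>1) fst"
    unfolding M_def prod_mfd_sel by (rule continuous_map_snd, rule continuous_map_fst)
  show ?thesis
  proof (intro conjI[of "_ \<longrightarrow> _" "_ \<longrightarrow> _"] impI)
    assume f': "Cr_submersion r M\<^sub>1 N f"
    have "\<forall>x\<in>S. \<exists>F. closed_vector_subspace (model_of M) F \<and> complemented (model_of M) F \<and> submersive_at M M\<^sub>2 snd S F x"
      unfolding M_def S_def using fibre_product_left[OF adm M1 M2 N f' g] by blast
    from nonpure_submersionI[OF adm M M2 S p(1) this]
    show "(\<exists>F. is_nonpure_split_submanifold M S F) \<and>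
      (\<forall>F. is_nonpure_split_submanifold M S F \<longrightarrow>
        nonpure_Cr_submersion r (subtopology (space_of M) S) (\<lambda>C. sub_mfd r M C (F C)) M\<^sub>2 snd)" .
  next
    assume g': "Cr_submersion r M\<^sub>2 N g"
    have "\<forall>x\<in>S. \<exists>F. closed_vector_subspace (model_of M) F \<and> complemented (model_of M) F \<and> submersive_at M M\<^sub>1 fst S F x"
      unfolding M_def S_def using fibre_product_right[OF adm M1 M2 N f g'] by blast
    from nonpure_submersionI[OF adm M M1 S p(2) this]
    show "(\<exists>F. is_nonpure_split_submanifold M S F) \<and>
      (\<forall>F. is_nonpure_split_submanifold M S F \<longrightarrow>
        nonpure_Cr_submersion r (subtopology (space_of M) S) (\<lambda>C. sub_mfd r M C (F C)) M\<^sub>1 fst)" .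
  qed
qed

end
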